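(* Let $n\ge 2$, let $\Gamma$ be a totally ordered abelian group, and let $a,b\in\Gamma$ with $b>(n-1)a>0$. Let $W_n$ be the Coxeter group of type $B_n$ with generators $t,s_1,\dots,s_{n-1}$ and weight function $L\colon W_n\to\Gamma$ given by $L(t)=b$, $L(s_i)=a$ for $1\le i\le n-1$, and let $\mathbf a\colon W_n\to\Gamma$ be Lusztig's $\mathbf a$-function with respect to $L$. Let $w\in W_n$ and assume that $w$ corresponds, under the generalized Robinson--Schensted correspondence, to a pair of standard bitableaux of shape $(\lambda_1,\lambda_2)$, where $\lambda_1,\lambda_2$ are partitions with $|\lambda_1|+|\lambda_2|=n$. Then $$\mathbf a(w)=b\,|\lambda_2|+a\,\bigl(n(\lambda_1)+2n(\lambda_2^* )-n(\lambda_2)\bigr).$$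
   Context: **Type $B_n$.** $W_n$ has generators $S=\{t,s_1,\dots,s_{n-1}\}$, all of order $2$, with $(ts_1)^4=1$, $(s_is_{i+1})^3=1$, and all other pairs of generators commuting. It is identified with the group of permutations $w$ of $\{\pm1,\dots,\pm n\}$ with $w(-i)=-w(i)$, where $t$ interchanges $1$ and $-1$ and $s_i$ interchanges $i,i+1$ (and $-i,-(i+1)$). **Hecke algebra.** $\Gamma$ is an abelian group (written additively) with a total order compatible with the group structure. $A=\mathbb Z[\Gamma]$ is the free abelian group with basis $\{e^\gamma\mid\gamma\in\Gamma\}$ and product $e^\gamma e^{\gamma'}=e^{\gamma+\gamma'}$; $A_{\ge0}$, $A_{<0}$ denote the $\mathbb Z$-spans of the $e^\gamma$ with $\gamma\ge0$, resp. $\gamma<0$. A weight function is a map $L\colon W_n\to\Gamma$ with $L(ww')=L(w)+L(w')$ whenever $\ell(ww')=\ell(w)+\ell(w')$, $\ell$ being the length function. Put $v_s=e^{L(s)}$ for $s\in S$. $\mathcal H_n$ is the associative $A$-algebra with $A$-basis $\{T_w\mid w\in W_n\}$ and multiplication $T_sT_w=T_{sw}$ if $\ell(sw)>\ell(w)$, $T_sT_w=T_{sw}+(v_s-v_s^{-1})T_w$ if $\ell(sw)<\ell(w)$ ($s\in S$). The bar involution is the ring involution of $\mathcal H_n$ with $\overline{e^\gamma}=e^{-\gamma}$, $\overline{T_w}=T_{w^{-1}}^{-1}$. The Kazhdan--Lusztig basis $\{C'_w\}$ is determined by $\overline{C'_w}=C'_w$ and $C'_w=T_w+\sum_{y<w}P^*_{y,w}T_y$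 with $P^*_{y,w}\in A_{<0}$ ($<$ is the Bruhat--Chevalley order). Write $C'_xC'_y=\sum_z h_{x,y,z}C'_z$ with $h_{x,y,z}\in A$. **$\mathbf a$-function.** $\mathbf a(z)=\min\{\gamma\ge0\mid e^\gamma h_{x,y,z}\in A_{\ge0}\text{ for all }x,y\in W_n\}$. **Generalized Robinson--Schensted correspondence.** For $w\in W_n$ let $i_1<\dots<i_k$ be the indices $i\in\{1,\dots,n\}$ with $w(i)>0$ and $j_1<\dots<j_l$ those with $w(j)<0$. Let $A^+(w)$ be the tableau obtained by row-inserting $w(i_1),\dots,w(i_k)$ (in this order) into the empty tableau, $A^-(w)$ the one obtained by row-inserting $|w(j_1)|,\dots,|w(j_l)|$, and $B^+(w)$, $B^-(w)$ the corresponding recording tableaux, with entries $i_1,\dots,i_k$, resp. $j_1,\dots,j_l$. Then $w\mapsto\bigl((A^+(w),A^-(w)),(B^+(w),B^-(w))\bigr)$ is a bijection from $W_n$ onto pairs of standard bitableaux (ordered pairs of tableaux, with total entries $1,\dots,n$) of the same shape and total size $n$; the shape is the bipartition (shape of $A^+(w)$, shape of $A^-(w)$). **Partitions.** For a partition $\mu=(\mu^{(1)}\ge\mu^{(2)}\ge\dots\ge0)$, $n(\mu)=\sum_i(i-1)\mu^{(i)}$, and $\mu^*$ is the conjugate partition. *)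

theory Defs
  imports Complex_Main "HOL-Library.Poly_Mapping" "HOL-Combinatorics.Permutations"
begin

section \<open>The Coxeter group of type B\<close>

text \<open>Elements are maps on the integers fixing everything outside
  \<open>{\<plusminus>1, \<dots>, \<plusminus>n}\<close>; the product of the group is composition of maps.\<close>

definition W :: "nat \<Rightarrow> (int \<Rightarrow> int) set" where
  "W n = {w. w permutes ({- int n..int n} - {0}) \<and> (\<forall>i. w (- i) = - w i)}"

definition t_gen :: "int \<Rightarrow> int" where
  "t_gen = transpose 1 (- 1)"

definition s_gen :: "nat \<Rightarrow> int \<Rightarrow> int" where
  "s_gen i = transpose (int i) (int i + 1) \<circ> transpose (- int i) (- (int i + 1))"

definition gens :: "nat \<Rightarrow> (int \<Rightarrow> int) set" where
  "gens n = insert t_gen (s_gen ` {1..n - 1})"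

definition len :: "nat \<Rightarrow> (int \<Rightarrow> int) \<Rightarrow> nat" where
  "len n w = (LEAST k. \<exists>ss. set ss \<subseteq> gens n \<and> length ss = k \<and> foldr (\<circ>) ss id = w)"

definition reflections :: "nat \<Rightarrow> (int \<Rightarrow> int) set" where
  "reflections n = {x \<circ> s \<circ> inv x | x s. x \<in> W n \<and> s \<in> gens n}"

definition bruhat_less :: "nat \<Rightarrow> (int \<Rightarrow> int) \<Rightarrow> (int \<Rightarrow> int) \<Rightarrow> bool" where
  "bruhat_less n y w \<longleftrightarrow>
     (y, w) \<in> {(u, u \<circ> r) | u r. u \<in> W n \<and> r \<in> reflections n \<and> len n u < len n (u \<circ> r)}\<^sup>+"

definition weight_function ::
    "nat \<Rightarrow> ((int \<Rightarrow> int) \<Rightarrow> 'g::linordered_ab_group_add) \<Rightarrow> bool" where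
  "weight_function n L \<longleftrightarrow>
     (\<forall>w\<in>W n. \<forall>w'\<in>W n. len n (w \<circ> w') = len n w + len n w' \<longrightarrow> L (w \<circ> w') = L w + L w')"


section \<open>The group ring of \<open>\<Gamma>\<close>\<close>

text \<open>\<open>'g \<Rightarrow>\<^sub>0 int\<close> with its convolution product is the group ring
  \<open>\<int>[\<Gamma>]\<close> of \<open>\<Gamma> = 'g\<close>.\<close>

definition ex :: "'g \<Rightarrow> ('g::linordered_ab_group_add \<Rightarrow>\<^sub>0 int)" where
  "ex \<gamma> = Poly_Mapping.single \<gamma> 1"

definition A_nonneg :: "('g::linordered_ab_group_add \<Rightarrow>\<^sub>0 int) set" where
  "A_nonneg = {p. \<forall>\<gamma>\<in>Poly_Mapping.keys p. 0 \<le> \<gamma>}"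

definition A_neg :: "('g::linordered_ab_group_add \<Rightarrow>\<^sub>0 int) set" where
  "A_neg = {p. \<forall>\<gamma>\<in>Poly_Mapping.keys p. \<gamma> < 0}"

definition A_bar :: "('g::linordered_ab_group_add \<Rightarrow>\<^sub>0 int) \<Rightarrow> ('g \<Rightarrow>\<^sub>0 int)" where
  "A_bar p = (\<Sum>\<gamma>\<in>Poly_Mapping.keys p. Poly_Mapping.single (- \<gamma>) (Poly_Mapping.lookup p \<gamma>))"


section \<open>The Iwahori--Hecke algebra\<close>

text \<open>The underlying module \<open>H n\<close> is the free module over \<open>\<int>[\<Gamma>]\<close>
  with basis \<open>W n\<close>, realised inside the formal linear combinations of arbitrary maps on
  the integers.\<close>

type_synonym 'g hecke = "(int \<Rightarrow> int) \<Rightarrow>\<^sub>0 ('g \<Rightarrow>\<^sub>0 int)"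

definition H :: "nat \<Rightarrow> 'g::linordered_ab_group_add hecke set" where
  "H n = {h. Poly_Mapping.keys h \<subseteq> W n}"

definition scale :: "('g \<Rightarrow>\<^sub>0 int) \<Rightarrow> 'g::linordered_ab_group_add hecke \<Rightarrow> 'g hecke" where
  "scale p h = Poly_Mapping.map (\<lambda>q. p * q) h"

definition T :: "(int \<Rightarrow> int) \<Rightarrow> 'g::linordered_ab_group_add hecke" where
  "T w = Poly_Mapping.single w 1"

definition is_hecke_mult ::
    "nat \<Rightarrow> ((int \<Rightarrow> int) \<Rightarrow> 'g::linordered_ab_group_add)
      \<Rightarrow> ('g hecke \<Rightarrow> 'g hecke \<Rightarrow> 'g hecke) \<Rightarrow> bool" where
  "is_hecke_mult n L m \<longleftrightarrow>
     (\<forall>x\<in>H n. \<forall>y\<in>H n. m x y \<in> H n) \<and>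
     (\<forall>x\<in>H n. \<forall>y\<in>H n. \<forall>z\<in>H n. m (m x y) z = m x (m y z)) \<and>
     (\<forall>x\<in>H n. \<forall>y\<in>H n. \<forall>z\<in>H n. m (x + y) z = m x z + m y z \<and> m x (y + z) = m x y + m x z) \<and>
     (\<forall>p. \<forall>x\<in>H n. \<forall>y\<in>H n. m (scale p x) y = scale p (m x y) \<and> m x (scale p y) = scale p (m x y)) \<and>
     (\<forall>x\<in>H n. m (T id) x = x \<and> m x (T id) = x) \<and>
     (\<forall>s\<in>gens n. \<forall>w\<in>W n.
        (len n (s \<circ> w) > len n w \<longrightarrow> m (T s) (T w) = T (s \<circ> w)) \<and>
        (len n (s \<circ> w) < len n w \<longrightarrow>
           m (T s) (T w) = T (s \<circ> w) + scale (ex (L s) - ex (- L s)) (T w)))"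

text \<open>For a weight function \<open>L\<close>, such a multiplication exists and is uniquely determined
  on \<open>H n \<times> H n\<close>, which is all that is used; its values elsewhere are irrelevant
  (hence \<open>SOME\<close> rather than \<open>THE\<close>).\<close>

definition hecke_mult ::
    "nat \<Rightarrow> ((int \<Rightarrow> int) \<Rightarrow> 'g::linordered_ab_group_add) \<Rightarrow> 'g hecke \<Rightarrow> 'g hecke \<Rightarrow> 'g hecke" where
  "hecke_mult n L = (SOME m. is_hecke_mult n L m)"

definition hecke_inv ::
    "nat \<Rightarrow> ((int \<Rightarrow> int) \<Rightarrow> 'g::linordered_ab_group_add) \<Rightarrow> 'g hecke \<Rightarrow> 'g hecke" where
  "hecke_inv n L h =
     (THE g. g \<in> H n \<and> hecke_mult n L g h = T id \<and> hecke_mult n L h g = T id)"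

text \<open>The values prescribed on the \<open>ex \<gamma>\<close> and the \<open>T w\<close> leave only the
  following semilinear map.\<close>

definition hecke_bar ::
    "nat \<Rightarrow> ((int \<Rightarrow> int) \<Rightarrow> 'g::linordered_ab_group_add) \<Rightarrow> 'g hecke \<Rightarrow> 'g hecke" where
  "hecke_bar n L h =
     (\<Sum>w\<in>Poly_Mapping.keys h. scale (A_bar (Poly_Mapping.lookup h w)) (hecke_inv n L (T (inv w))))"

definition KL_basis ::
    "nat \<Rightarrow> ((int \<Rightarrow> int) \<Rightarrow> 'g::linordered_ab_group_add) \<Rightarrow> (int \<Rightarrow> int) \<Rightarrow> 'g hecke" where
  "KL_basis n L w =
     (THE c. hecke_bar n L c = c \<and>
        (\<exists>P. (\<forall>y. bruhat_less n y w \<longrightarrow> P y \<in> A_neg) \<and>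
             c = T w + (\<Sum>y\<in>{y\<in>W n. bruhat_less n y w}. scale (P y) (T y))))"

definition h_coeff ::
    "nat \<Rightarrow> ((int \<Rightarrow> int) \<Rightarrow> 'g::linordered_ab_group_add)
      \<Rightarrow> (int \<Rightarrow> int) \<Rightarrow> (int \<Rightarrow> int) \<Rightarrow> (int \<Rightarrow> int) \<Rightarrow> ('g \<Rightarrow>\<^sub>0 int)" where
  "h_coeff n L x y =
     (THE f. (\<forall>z. z \<notin> W n \<longrightarrow> f z = 0) \<and>
        hecke_mult n L (KL_basis n L x) (KL_basis n L y) =
          (\<Sum>z\<in>W n. scale (f z) (KL_basis n L z)))"

definition a_fun ::
    "nat \<Rightarrow> ((int \<Rightarrow> int) \<Rightarrow> 'g::linordered_ab_group_add) \<Rightarrow> (int \<Rightarrow> int) \<Rightarrow> 'g" where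
  "a_fun n L z =
     (LEAST \<gamma>. 0 \<le> \<gamma> \<and> (\<forall>x\<in>W n. \<forall>y\<in>W n. ex \<gamma> * h_coeff n L x y z \<in> A_nonneg))"


section \<open>The generalized Robinson--Schensted correspondence\<close>

type_synonym tableau = "int list list"

fun row_insert :: "int \<Rightarrow> int list \<Rightarrow> int list \<times> int option" where
  "row_insert x [] = ([x], None)"
| "row_insert x (y # ys) =
     (if x < y then (x # ys, Some y)
      else let (zs, bumped) = row_insert x ys in (y # zs, bumped))"

text \<open>\<open>rs_insert x i A B\<close> inserts \<open>x\<close> into \<open>A\<close> and puts the label
  \<open>i\<close> into \<open>B\<close> (a tableau of the same shape as \<open>A\<close>) at the position of the
  box that is new in \<open>A\<close>.\<close>

fun rs_insert :: "int \<Rightarrow> int \<Rightarrow> tableau \<Rightarrow> tableau \<Rightarrow> tableau \<times> tableau" where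
  "rs_insert x i [] B = ([[x]], [[i]])"
| "rs_insert x i (r # A) B =
     (case row_insert x r of
        (r', None) \<Rightarrow> (r' # A, (hd B @ [i]) # tl B)
      | (r', Some y) \<Rightarrow> (let (A', B') = rs_insert y i A (tl B) in (r' # A', hd B # B')))"

text \<open>The argument is the word as a list of pairs (label, inserted letter).\<close>

definition rs :: "(int \<times> int) list \<Rightarrow> tableau \<times> tableau" where
  "rs word = foldl (\<lambda>(A, B) (i, x). rs_insert x i A B) ([], []) word"

type_synonym bitableau = "tableau \<times> tableau"

definition gen_RS :: "nat \<Rightarrow> (int \<Rightarrow> int) \<Rightarrow> bitableau \<times> bitableau" where
  "gen_RS n w =
     (let (A1, B1) = rs (map (\<lambda>i. (i, w i)) (filter (\<lambda>i. w i > 0) [1..int n]));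
          (A2, B2) = rs (map (\<lambda>j. (j, \<bar>w j\<bar>)) (filter (\<lambda>j. w j < 0) [1..int n]))
      in ((A1, A2), (B1, B2)))"

definition is_partition :: "nat list \<Rightarrow> bool" where
  "is_partition \<mu> \<longleftrightarrow> sorted_wrt (\<ge>) \<mu> \<and> (\<forall>k\<in>set \<mu>. k > 0)"

definition shape :: "tableau \<Rightarrow> nat list" where
  "shape X = map length X"

definition standard_tableau :: "tableau \<Rightarrow> bool" where
  "standard_tableau X \<longleftrightarrow> is_partition (shape X) \<and> distinct (concat X) \<and>
     (\<forall>r\<in>set X. sorted_wrt (<) r) \<and>
     (\<forall>i j. Suc i < length X \<and> j < length (X ! Suc i) \<longrightarrow> X ! i ! j < X ! Suc i ! j)"

definition standard_bitableau :: "nat \<Rightarrow> bitableau \<Rightarrow> bool" where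
  "standard_bitableau n X \<longleftrightarrow>
     standard_tableau (fst X) \<and> standard_tableau (snd X) \<and>
     distinct (concat (fst X) @ concat (snd X)) \<and>
     set (concat (fst X) @ concat (snd X)) = {1..int n}"

definition bishape :: "bitableau \<Rightarrow> nat list \<times> nat list" where
  "bishape X = (shape (fst X), shape (snd X))"


section \<open>Partition statistics\<close>

text \<open>Lists are indexed from 0, so the weight of part \<open>i\<close> is \<open>i\<close> here.\<close>

definition n_stat :: "nat list \<Rightarrow> nat" where
  "n_stat \<mu> = (\<Sum>i<length \<mu>. i * \<mu> ! i)"

definition conjugate :: "nat list \<Rightarrow> nat list" where
  "conjugate \<mu> = map (\<lambda>j. length (filter (\<lambda>k. j < k) \<mu>)) [0..<foldr max \<mu> 0]"

text \<open>Integer multiples in an additive group.\<close>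

definition zmul :: "int \<Rightarrow> 'g::ab_group_add \<Rightarrow> 'g" where
  "zmul k x = (if 0 \<le> k then (\<Sum>i<nat k. x) else - (\<Sum>i<nat (- k). x))"

end

(* All irreducible representations of the Hecke algebra act at once on functions on standard
   bitableaux, by a version of Young's seminormal form. The exponent alpha(S), the sum of the
   contributions of the boxes of a shape S, is the right-hand side of the theorem. Near infinity in
   the group ring, the matrix entries of T_w divided by e^alpha of their shape tend, up to sign, to
   the matrix unit indexed by the Robinson-Schensted tableaux of w; this comes from following the
   bumping paths. Consequently the coefficients of an element of the algebra with respect to the
   basis T_w, or to the Kazhdan-Lusztig basis, can be read off, to leading order, from matrix entries.
   For every matrix unit in the block of a shape S there is a bar-invariant element of the algebra
   with this leading term in the block of S that acts as zero on all other blocks, except those of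
   shapes higher than S (larger or equal alpha, and larger in a second statistic). Therefore C'_w is
   supported on the shape of w and higher shapes, and comparing C'_x C'_y with its expansion block
   by block bounds the degree of h_{x,y,z} by alpha(shape of z), with equality for suitable x, y. *)
theory Submission
 imports Defs "HOL-Computational_Algebra.Polynomial_Factorial"
begin

section \<open>The fraction field of the group ring and limits at infinity\<close>

subsection \<open>The bar involution\<close>

text \<open>Estimates become equations because a bar-invariant element of the group ring with an
  integer limit is that integer. Limits are taken in the fraction field, which lacks the square
  roots of Young's orthogonal form; hence the rescaling by factors \<open>theta\<close>, each 0 or
  tending to 1. The hypothesis on \<open>b\<close> enters through hooks: a box in row r and column c
  of a filling has r + c < n, so powers of e^b dominate the powers of e^a produced by contents. The
  obstacle is that limits say nothing about blocks in which an element is merely small, whereas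
  \<open>C'_w\<close> has to vanish there exactly. The bar-invariant element used for this is F C0 G
  plus its conjugate. Here C0 is a parabolic symmetriser times a product in Jucys-Murphy elements;
  it has rank one on the block, through the vector of a filling for which contents and the length of
  the longest parabolic element add up to the exponent. F and the adjoint of G move this vector to
  bar-invariant vectors close to basis vectors. As exponents of different shapes may coincide, the
  inductions over shapes run on the second, strict statistic.\<close>

type_synonym 'g gring = "'g \<Rightarrow>\<^sub>0 int"

abbreviation coef :: "'g gring => 'g => int" where
 "coef \<equiv> Poly_Mapping.lookup"

lemma gring_induct [case_names single add]:
 fixes p :: "'g::linordered_ab_group_add gring"
 assumes s: "\<And>\<gamma> k. Q (Poly_Mapping.single \<gamma> k)"
  and a: "\<And>p q. Q p ==> Q q ==> Q (p + q)"
 shows "Q p"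
proof (induction p rule: update_induct)
 case const
 show ?case using s[of 0 0] by simp
next
 case (update f x y)
 have "Poly_Mapping.update x y f = f + Poly_Mapping.single x y"
  by (rule poly_mapping_eqI)
   (use update(1) in \<open>auto simp: lookup_update lookup_add lookup_single when_def in_keys_iff\<close>)
 then show ?case using a[OF update(3) s] by simp
qed

lemma coef_A_bar: "coef (A_bar p) \<gamma> = coef p (- \<gamma>)"
proof -
 have "coef (A_bar p) \<gamma> = (\<Sum>\<delta>\<in>Poly_Mapping.keys p. if - \<delta> = \<gamma> then coef p \<delta> else 0)"
  unfolding A_bar_def by (simp add: lookup_sum lookup_single when_def)
 also have "\<dots> = (\<Sum>\<delta>\<in>Poly_Mapping.keys p. if - \<gamma> = \<delta> then coef p \<delta> else 0)"
  by (intro sum.cong) auto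
 also have "\<dots> = coef p (- \<gamma>)"
  by (simp add: sum.delta' in_keys_iff)
 finally show ?thesis .
qed

lemma A_bar_add: "A_bar (p + q) = A_bar p + A_bar q"
 by (rule poly_mapping_eqI) (simp add: coef_A_bar lookup_add)

lemma A_bar_single: "A_bar (Poly_Mapping.single \<gamma> k) = Poly_Mapping.single (- \<gamma>) k"
 by (rule poly_mapping_eqI) (auto simp: coef_A_bar lookup_single when_def)

lemma A_bar_0 [simp]: "A_bar 0 = 0"
 using A_bar_single[of 0 0] by simp

lemma A_bar_1 [simp]: "A_bar 1 = 1"
 using A_bar_single[of 0 1] by simp

lemma A_bar_bar [simp]: "A_bar (A_bar p) = p"
 by (rule poly_mapping_eqI) (simp add: coef_A_bar)

lemma A_bar_mult: "A_bar (p * q) = A_bar p * A_bar q"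
proof (induction p rule: gring_induct)
 case (single \<gamma> k)
 show ?case
  by (induction q rule: gring_induct)
   (simp_all add: mult_single A_bar_single A_bar_add distrib_left)
next
 case (add p q)
 then show ?case by (simp add: A_bar_add distrib_right)
qed

lemma A_bar_eq_0_iff [simp]: "A_bar p = 0 \<longleftrightarrow> p = 0"
 by (metis A_bar_0 A_bar_bar)

lemma A_bar_uminus: "A_bar (- p) = - A_bar p"
 by (rule poly_mapping_eqI) (simp add: coef_A_bar)

lemma of_int_eq_single: "(of_int k :: 'g::linordered_ab_group_add gring) = Poly_Mapping.single 0 k"
 using single_of_int[of k, where 'a = 'g and 'b = int] by (simp del: single_of_int)

lemma A_bar_of_int [simp]: "A_bar (of_int k) = of_int k"
 by (simp add: of_int_eq_single A_bar_single del: single_of_int)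

lemma A_bar_ex [simp]: "A_bar (ex \<gamma>) = ex (- \<gamma>)"
 by (simp add: ex_def A_bar_single)

type_synonym 'g K = "'g gring fract"

text \<open>\<open>THE\<close> is legitimate because \<open>A_bar\<close> is an injective ring
  homomorphism: equal fractions have equal images, which \<open>kbar_Fract\<close> checks.\<close>

definition kbar :: "'g::linordered_ab_group_add K => 'g K" where
 "kbar x = (THE y. \<exists>p q. q ~= 0 \<and> x = Fraction_Field.Fract p q \<and>
   y = Fraction_Field.Fract (A_bar p) (A_bar q))"

lemma kbar_Fract:
 assumes "q ~= 0"
 shows "kbar (Fraction_Field.Fract p q) = Fraction_Field.Fract (A_bar p) (A_bar q)"
 unfolding kbar_def
proof (rule the_equality)
 show "\<exists>p' q'. q' ~= 0 \<and> Fraction_Field.Fract p q = Fraction_Field.Fract p' q' \<and>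
   Fraction_Field.Fract (A_bar p) (A_bar q) = Fraction_Field.Fract (A_bar p') (A_bar q')"
  using assms by blast
next
 fix y
 assume "\<exists>p' q'. q' ~= 0 \<and> Fraction_Field.Fract p q = Fraction_Field.Fract p' q' \<and>
   y = Fraction_Field.Fract (A_bar p') (A_bar q')"
 then obtain p' q' where *: "q' ~= 0" "Fraction_Field.Fract p q = Fraction_Field.Fract p' q'"
  "y = Fraction_Field.Fract (A_bar p') (A_bar q')" by blast
 then have "p * q' = p' * q" using assms by (simp add: eq_fract)
 then have "A_bar p * A_bar q' = A_bar p' * A_bar q" by (metis A_bar_mult)
 then show "y = Fraction_Field.Fract (A_bar p) (A_bar q)"
  using * assms by (simp add: eq_fract)
qed

lemma kbar_to_fract [simp]: "kbar (to_fract p) = to_fract (A_bar p)"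
 by (simp add: to_fract_def kbar_Fract)

lemma kbar_0 [simp]: "kbar 0 = 0" and kbar_1 [simp]: "kbar 1 = 1"
 using kbar_to_fract[of 0] kbar_to_fract[of 1] by simp_all

lemma kbar_add: "kbar (x + y) = kbar x + kbar y"
 by (cases x; cases y) (simp add: kbar_Fract A_bar_add A_bar_mult)

lemma kbar_mult: "kbar (x * y) = kbar x * kbar y"
 by (cases x; cases y) (simp add: kbar_Fract A_bar_mult)

lemma kbar_bar [simp]: "kbar (kbar x) = x"
 by (cases x) (simp add: kbar_Fract)

lemma kbar_eq_0_iff [simp]: "kbar x = 0 \<longleftrightarrow> x = 0"
 by (metis kbar_0 kbar_bar)

lemma kbar_uminus: "kbar (- x) = - kbar x"
 by (metis add.right_inverse add_eq_0_iff kbar_0 kbar_add)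

lemma kbar_diff: "kbar (x - y) = kbar x - kbar y"
 by (metis add_uminus_conv_diff kbar_add kbar_uminus)

lemma kbar_inverse: "kbar (inverse x) = inverse (kbar x)"
proof (cases "x = 0")
 case False
 then have "kbar x * kbar (inverse x) = 1"
  by (simp flip: kbar_mult)
 then show ?thesis by (metis inverse_unique)
qed simp

lemma kbar_divide: "kbar (x / y) = kbar x / kbar y"
 by (simp add: divide_inverse kbar_mult kbar_inverse)

lemma kbar_sum: "kbar (sum f S) = (\<Sum>i\<in>S. kbar (f i))"
 by (induction S rule: infinite_finite_induct) (simp_all add: kbar_add)

lemma kbar_prod: "kbar (prod f S) = (\<Prod>i\<in>S. kbar (f i))"
 by (induction S rule: infinite_finite_induct) (simp_all add: kbar_mult)

lemma to_fract_of_int [simp]: "to_fract (of_int k) = of_int k"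
 by (induction k rule: int_induct[where k = 0]) simp_all

lemma kbar_of_int [simp]: "kbar (of_int k) = of_int k"
 by (metis A_bar_of_int kbar_to_fract to_fract_of_int)

subsection \<open>Exponentials\<close>

definition eps :: "'g::linordered_ab_group_add => 'g K" where
 "eps \<gamma> = to_fract (ex \<gamma>)"

lemma ex_add: "ex (\<gamma> + \<delta>) = ex \<gamma> * ex \<delta>"
 by (simp add: ex_def mult_single)

lemma ex_0 [simp]: "ex 0 = 1"
 by (simp add: ex_def)

lemma coef_ex_mult: "coef (ex \<gamma> * p) \<delta> = coef p (\<delta> - \<gamma>)"
proof (induction p rule: gring_induct)
 case (single \<epsilon> k)
 then show ?case by (auto simp: ex_def mult_single lookup_single when_def algebra_simps)
next
 case (add p q)
 then show ?case by (simp add: distrib_left lookup_add)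
qed

lemma eps_add: "eps (\<gamma> + \<delta>) = eps \<gamma> * eps \<delta>"
 by (simp add: eps_def ex_add)

lemma eps_0 [simp]: "eps 0 = 1"
 by (simp add: eps_def)

lemma eps_neq_0 [simp]: "eps \<gamma> ~= 0"
 by (metis add.right_inverse eps_0 eps_add mult_zero_left zero_neq_one)

lemma eps_minus: "eps (- \<gamma>) = inverse (eps \<gamma>)"
 by (metis add.right_inverse eps_0 eps_add inverse_unique)

lemma kbar_eps [simp]: "kbar (eps \<gamma>) = eps (- \<gamma>)"
 by (simp add: eps_def)

lemma eps_sum: "eps (sum f S) = (\<Prod>i\<in>S. eps (f i))"
 by (induction S rule: infinite_finite_induct) (simp_all add: eps_add)

text \<open>Comparing coefficients at \<gamma> would give 1 = -1 or 1 = 0. Used to separate the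
  eigenvalues \<open>x\<close> of the two components, which carry opposite signs.\<close>

lemma eps_neq_minus_eps: "eps \<gamma> ~= - eps \<delta>"
proof
 assume "eps \<gamma> = - eps \<delta>"
 then have "to_fract (ex \<gamma>) = to_fract (- ex \<delta>)" by (simp add: eps_def)
 then have "ex \<gamma> = - ex \<delta>" unfolding to_fract_eq_iff .
 then have "coef (ex \<gamma>) \<gamma> = - coef (ex \<delta>) \<gamma>" by simp
 then show False by (auto simp: ex_def lookup_single when_def split: if_splits)
qed

subsection \<open>Limits\<close>

lemma A_neg_coef: "p \<in> A_neg \<longleftrightarrow> (\<forall>\<gamma>\<ge>0. coef p \<gamma> = 0)"
proof
 assume "p \<in> A_neg"
 then have "\<gamma> < 0" if "\<gamma> \<in> Poly_Mapping.keys p" for \<gamma>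
  using that unfolding A_neg_def by blast
 then show "\<forall>\<gamma>\<ge>0. coef p \<gamma> = 0" unfolding in_keys_iff by (meson not_le)
next
 assume "\<forall>\<gamma>\<ge>0. coef p \<gamma> = 0"
 then have "\<not> 0 \<le> \<gamma>" if "\<gamma> \<in> Poly_Mapping.keys p" for \<gamma>
  using that unfolding in_keys_iff by blast
 then show "p \<in> A_neg" unfolding A_neg_def by (simp add: not_le)
qed

lemma A_nonneg_coef: "p \<in> A_nonneg \<longleftrightarrow> (\<forall>\<gamma><0. coef p \<gamma> = 0)"
proof
 assume "p \<in> A_nonneg"
 then have "0 \<le> \<gamma>" if "\<gamma> \<in> Poly_Mapping.keys p" for \<gamma>
  using that unfolding A_nonneg_def by blast
 then show "\<forall>\<gamma><0. coef p \<gamma> = 0" unfolding in_keys_iff by (meson not_le)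
next
 assume "\<forall>\<gamma><0. coef p \<gamma> = 0"
 then have "\<not> \<gamma> < 0" if "\<gamma> \<in> Poly_Mapping.keys p" for \<gamma>
  using that unfolding in_keys_iff by blast
 then show "p \<in> A_nonneg" unfolding A_nonneg_def by (simp add: not_less)
qed

lemma A_neg_0 [simp]: "0 \<in> A_neg"
 by (simp add: A_neg_def)

lemma A_neg_add: "p \<in> A_neg ==> q \<in> A_neg ==> p + q \<in> A_neg"
 by (simp add: A_neg_coef lookup_add)

lemma A_neg_uminus: "p \<in> A_neg ==> - p \<in> A_neg"
 by (simp add: A_neg_coef)

lemma A_neg_mult: assumes "p \<in> A_neg" "q \<in> A_neg" shows "p * q \<in> A_neg"
proof -
 have "Poly_Mapping.keys (p * q) \<subseteq> {x + y |x y. x \<in> Poly_Mapping.keys p \<and> y \<in> Poly_Mapping.keys q}"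
  by (rule keys_mult)
 moreover have "x + y < 0" if "x \<in> Poly_Mapping.keys p" "y \<in> Poly_Mapping.keys q" for x y
  using assms that by (simp add: A_neg_def add_neg_neg)
 ultimately show ?thesis unfolding A_neg_def by blast
qed

lemma A_neg_mult_of_int: assumes "p \<in> A_neg" shows "of_int k * p \<in> A_neg"
proof -
 have "of_int k * p = Poly_Mapping.single 0 k * p" by (simp only: of_int_eq_single)
 also have "\<dots> = Poly_Mapping.map ((*) k) p" by (rule mult_map_scale_conv_mult[symmetric])
 finally show ?thesis using assms by (simp add: A_neg_coef map.rep_eq when_def)
qed

lemma A_neg_ex: "\<gamma> < 0 ==> ex \<gamma> \<in> A_neg"
 by (simp add: A_neg_def ex_def)

text \<open>The subring of elements with a limit is a local ring dominating the monomials of negative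
 degree; it plays the role of a valuation ring with residue ring \<open>\<int>\<close>.\<close>

definition tends :: "'g::linordered_ab_group_add K => int => bool" where
 "tends x c \<longleftrightarrow> (\<exists>p\<in>A_neg. \<exists>q\<in>A_neg. x * to_fract (1 + q) = to_fract (of_int c + p))"

lemma coef_of_int: "coef (of_int k :: 'g::linordered_ab_group_add gring) \<gamma> = (if \<gamma> = 0 then k else 0)"
 by (simp add: of_int_eq_single lookup_single when_def del: single_of_int)

lemma one_plus_A_neg_neq_0: assumes "q \<in> A_neg" shows "1 + q ~= 0"
proof
 assume "1 + q = 0"
 then have "coef (of_int 1 + q) 0 = 0" by simp
 moreover have "coef q 0 = 0" using assms by (simp add: A_neg_coef)
 ultimately show False unfolding lookup_add coef_of_int by simp
qed

lemma limI: "p \<in> A_neg ==> q \<in> A_neg ==> x * to_fract (1 + q) = to_fract (of_int c + p) ==> tends x c"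
 unfolding tends_def by blast

lemma lim_add: assumes "tends x c" "tends y d" shows "tends (x + y) (c + d)"
proof -
 obtain p q where 1: "p \<in> A_neg" "q \<in> A_neg" "x * to_fract (1 + q) = to_fract (of_int c + p)"
  using assms(1) unfolding tends_def by blast
 obtain r s where 2: "r \<in> A_neg" "s \<in> A_neg" "y * to_fract (1 + s) = to_fract (of_int d + r)"
  using assms(2) unfolding tends_def by blast
 have "(x + y) * to_fract ((1 + q) * (1 + s))
   = (x * to_fract (1 + q)) * to_fract (1 + s) + (y * to_fract (1 + s)) * to_fract (1 + q)"
  unfolding to_fract_mult by (simp only: algebra_simps)
 also have "\<dots> = to_fract ((of_int c + p) * (1 + s) + (of_int d + r) * (1 + q))"
  unfolding 1 2 by (simp only: to_fract_mult to_fract_add)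
 finally have *: "(x + y) * to_fract ((1 + q) * (1 + s)) = to_fract ((of_int c + p) * (1 + s) + (of_int d + r) * (1 + q))" .
 show ?thesis
 proof (rule limI)
  show "of_int c * s + p + p * s + of_int d * q + r + r * q \<in> A_neg" "q + s + q * s \<in> A_neg"
   using 1 2 by (auto intro!: A_neg_add A_neg_mult A_neg_mult_of_int)
  show "(x + y) * to_fract (1 + (q + s + q * s)) = to_fract (of_int (c + d) + (of_int c * s + p + p * s + of_int d * q + r + r * q))"
   using * by (simp add: algebra_simps)
 qed
qed

lemma lim_mult: assumes "tends x c" "tends y d" shows "tends (x * y) (c * d)"
proof -
 obtain p q where 1: "p \<in> A_neg" "q \<in> A_neg" "x * to_fract (1 + q) = to_fract (of_int c + p)"
  using assms(1) unfolding tends_def by blast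
 obtain r s where 2: "r \<in> A_neg" "s \<in> A_neg" "y * to_fract (1 + s) = to_fract (of_int d + r)"
  using assms(2) unfolding tends_def by blast
 have "(x * y) * to_fract ((1 + q) * (1 + s)) = (x * to_fract (1 + q)) * (y * to_fract (1 + s))"
  unfolding to_fract_mult by (simp only: algebra_simps)
 also have "\<dots> = to_fract ((of_int c + p) * (of_int d + r))"
  unfolding 1 2 by (simp only: to_fract_mult)
 finally have *: "(x * y) * to_fract ((1 + q) * (1 + s)) = to_fract ((of_int c + p) * (of_int d + r))" .
 show ?thesis
 proof (rule limI)
  show "of_int c * r + of_int d * p + p * r \<in> A_neg" "q + s + q * s \<in> A_neg"
   using 1 2 by (auto intro!: A_neg_add A_neg_mult A_neg_mult_of_int)
  show "(x * y) * to_fract (1 + (q + s + q * s)) = to_fract (of_int (c * d) + (of_int c * r + of_int d * p + p * r))"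
   using * by (simp add: algebra_simps)
 qed
qed

lemma lim_to_fract: assumes "p - of_int c \<in> A_neg" shows "tends (to_fract p) c"
 by (rule limI[OF assms A_neg_0]) simp

lemma lim_of_int [simp]: "tends (of_int c) c"
 using lim_to_fract[of "of_int c" c] by simp

lemma lim_0 [simp]: "tends 0 0" and lim_1 [simp]: "tends 1 1"
 using lim_of_int[of 0] lim_of_int[of 1] by simp_all

lemma lim_uminus: "tends x c ==> tends (- x) (- c)"
 using lim_mult[OF lim_of_int[of "-1"], of x c] by simp

lemma lim_diff: "tends x c ==> tends y d ==> tends (x - y) (c - d)"
 using lim_add[OF _ lim_uminus, of x c y d] by simp

lemma lim_sum: "(\<And>i. i \<in> S ==> tends (f i) (c i)) ==> tends (sum f S) (sum c S)"
 by (induction S rule: infinite_finite_induct) (simp_all add: lim_add)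

lemma lim_prod: "(\<And>i. i \<in> S ==> tends (f i) (c i)) ==> tends (prod f S) (prod c S)"
 by (induction S rule: infinite_finite_induct) (simp_all add: lim_mult)

lemma lim_eps: "\<gamma> < 0 ==> tends (eps \<gamma>) 0"
 unfolding eps_def by (rule lim_to_fract) (simp add: A_neg_ex)

lemma lim_eps_le: "\<gamma> \<le> 0 ==> tends (eps \<gamma>) (if \<gamma> = 0 then 1 else 0)"
 using lim_eps[of \<gamma>] by auto

text \<open>The largest exponent of \<open>p - of_int c\<close> survives multiplication by
  \<open>1 + q\<close>. Were it nonnegative, it would be an exponent of an element of
  \<open>A_neg\<close>.\<close>

lemma to_fract_eq_lim:
 assumes "tends (to_fract p) c" shows "p - of_int c \<in> A_neg"
proof -
 obtain r q where 1: "r \<in> A_neg" "q \<in> A_neg" "to_fract p * to_fract (1 + q) = to_fract (of_int c + r)"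
  using assms unfolding tends_def by blast
 then have eq: "p * (1 + q) = of_int c + r"
  by (simp only: to_fract_mult[symmetric] to_fract_eq_iff)
 define d where "d = p - of_int c"
 have eq': "d * (1 + q) = r - of_int c * q"
  using eq by (simp add: d_def algebra_simps)
 have neg: "d * (1 + q) \<in> A_neg"
  unfolding eq' using 1 by (metis A_neg_add A_neg_mult_of_int A_neg_uminus add_uminus_conv_diff)
 show ?thesis
 proof (rule ccontr)
  assume "p - of_int c \<notin> A_neg"
  then obtain \<gamma> where g: "\<gamma> \<in> Poly_Mapping.keys d" "0 \<le> \<gamma>"
   unfolding A_neg_def d_def by force
  define \<mu> where "\<mu> = Max (Poly_Mapping.keys d)"
  have mu: "\<mu> \<in> Poly_Mapping.keys d" "\<And>\<delta>. \<delta> \<in> Poly_Mapping.keys d ==> \<delta> \<le> \<mu>"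
   unfolding \<mu>_def using g by (auto intro: Max_in)
  have "0 \<le> \<mu>" using mu(2)[OF g(1)] g(2) by simp
  have "\<mu> \<notin> Poly_Mapping.keys (d * q)"
  proof
   assume "\<mu> \<in> Poly_Mapping.keys (d * q)"
   then obtain x y where "x \<in> Poly_Mapping.keys d" "y \<in> Poly_Mapping.keys q" "\<mu> = x + y"
    using keys_mult[of d q] by auto
   moreover have "y < 0" using 1(2) \<open>y \<in> _\<close> unfolding A_neg_def by auto
   ultimately show False using mu(2)[of x] by (metis add_less_same_cancel1 leD)
  qed
  then have "coef (d * (1 + q)) \<mu> = coef d \<mu>"
   by (simp add: distrib_left lookup_add in_keys_iff)
  moreover have "coef (d * (1 + q)) \<mu> = 0" using neg \<open>0 \<le> \<mu>\<close> by (simp add: A_neg_coef)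
  ultimately show False using mu(1) by (simp add: in_keys_iff)
 qed
qed

lemma lim_to_fract_iff: "tends (to_fract p) c \<longleftrightarrow> p - of_int c \<in> A_neg"
 using lim_to_fract to_fract_eq_lim by blast

lemma lim_unique: assumes "tends x c" "tends x d" shows "c = d"
proof -
 have "tends (to_fract (0 :: 'a gring)) (c - d)" using lim_diff[OF assms] by simp
 then have "0 - of_int (c - d) \<in> (A_neg :: 'a gring set)" by (rule to_fract_eq_lim)
 then have "coef (0 - of_int (c - d) :: 'a gring) 0 = 0" unfolding A_neg_coef by blast
 then have "coef (of_int (c - d) :: 'a gring) 0 = 0" by (simp only: lookup_minus lookup_zero)
 then show ?thesis unfolding coef_of_int by simp
qed

text \<open>Limits are integers, so inverses can be controlled only at units. Limit 1 is the case
  met by the geometric factors \<open>1 - u\<close> and by \<open>Dg\<close>.\<close>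

lemma lim_inverse_1: assumes "tends x 1" shows "tends (inverse x) 1"
proof -
 obtain p q where 1: "p \<in> A_neg" "q \<in> A_neg" "x * to_fract (1 + q) = to_fract (1 + p)"
  using assms unfolding tends_def by auto
 have "to_fract (1 + q) ~= 0" "to_fract (1 + p) ~= 0"
  using one_plus_A_neg_neq_0[OF 1(1)] one_plus_A_neg_neq_0[OF 1(2)]
  by (simp_all only: to_fract_eq_0_iff not_False_eq_True)
 then have "x ~= 0" using 1(3) by auto
 have "inverse x * to_fract (1 + p) = to_fract (1 + q)"
  unfolding 1(3)[symmetric] using \<open>x ~= 0\<close> by (simp del: to_fract_add)
 then show ?thesis using 1 by (intro limI[of q p]) simp_all
qed

lemma lim_1_neq_0: "tends x c ==> c ~= 0 ==> x ~= 0"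
 using lim_unique[of x c 0] by auto

text \<open>The limit forbids exponents \<ge> 0 apart from the constant term, and bar symmetry
  carries this over to negative exponents.\<close>

lemma bar_invariant_limit:
 assumes "A_bar p = p" "tends (to_fract p) c" shows "p = of_int c"
proof -
 have *: "p - of_int c \<in> A_neg" using assms(2) lim_to_fract_iff by blast
 have "p - of_int c = 0"
 proof (rule poly_mapping_eqI)
  fix \<gamma>
  show "coef (p - of_int c) \<gamma> = coef 0 \<gamma>"
  proof (cases "0 \<le> \<gamma>")
   case True
   then show ?thesis using * by (simp add: A_neg_coef)
  next
   case False
   have "coef (p - of_int c) \<gamma> = coef (A_bar (p - of_int c)) \<gamma>"
    by (simp only: diff_conv_add_uminus A_bar_add A_bar_uminus A_bar_of_int assms(1))
   also have "\<dots> = coef (p - of_int c) (- \<gamma>)" by (rule coef_A_bar)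
   also have "\<dots> = 0" using * False by (simp add: A_neg_coef)
   finally show ?thesis by simp
  qed
 qed
 then show ?thesis by simp
qed

section \<open>Combinatorics of the Coxeter group\<close>

lemma W_odd: "w \<in> W n ==> w (- i) = - w i"
 by (simp add: W_def)

lemma W_permutes: "w \<in> W n ==> w permutes ({- int n..int n} - {0})"
 by (simp add: W_def)

lemma W_0: "w \<in> W n ==> w 0 = 0"
 using W_odd[of w n 0] by simp

lemma W_inj: "w \<in> W n ==> w i = w j \<longleftrightarrow> i = j"
 using W_permutes by (metis permutes_inj inj_eq)

lemma W_eq_0_iff: "w \<in> W n ==> w i = 0 \<longleftrightarrow> i = 0"
 using W_inj[of w n i 0] W_0[of w n] by simp

lemma W_outside: "w \<in> W n ==> \<bar>i\<bar> > int n ==> w i = i"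
 by (rule permutes_not_in[OF W_permutes]) auto

lemma W_bound: assumes "w \<in> W n" "\<bar>i\<bar> \<le> int n" shows "\<bar>w i\<bar> \<le> int n"
proof (cases "i = 0")
 case False
 then have "i \<in> {- int n..int n} - {0}" using assms by auto
 then have "w i \<in> {- int n..int n} - {0}"
  using permutes_in_image[OF W_permutes[OF assms(1)]] by blast
 then show ?thesis by auto
qed (use W_0[OF assms(1)] in simp)

lemma W_id [simp]: "id \<in> W n"
 by (simp add: W_def permutes_id)

lemma W_comp: "x \<in> W n ==> y \<in> W n ==> x \<circ> y \<in> W n"
 by (simp add: W_def permutes_compose)

lemma W_bij: "w \<in> W n ==> bij w"
 using W_permutes permutes_bij by blast

lemma W_inv_inverses:
 assumes "w \<in> W n"
 shows "inv w \<circ> w = id" "w \<circ> inv w = id" "inv w (w i) = i" "w (inv w i) = i"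
 using permutes_inv_o[OF W_permutes[OF assms]] permutes_inverses[OF W_permutes[OF assms]] by auto

lemma W_inv: assumes "w \<in> W n" shows "inv w \<in> W n"
proof -
 have "inv w (- i) = - inv w i" for i
 proof -
  have "w (- inv w i) = - i" using assms by (simp add: W_odd W_inv_inverses)
  then show ?thesis using W_inv_inverses(3)[OF assms, of "- inv w i"] by simp
 qed
 then show ?thesis using assms by (simp add: W_def permutes_inv)
qed

lemma W_inv_comp: "x \<in> W n ==> y \<in> W n ==> inv (x \<circ> y) = inv y \<circ> inv x"
 by (simp add: W_bij o_inv_distrib)

lemma W_inv_inv: "x \<in> W n ==> inv (inv x) = x"
 by (simp add: W_bij inv_inv_eq)

lemma finite_W: "finite (W n)"
proof -
 have "W n \<subseteq> {w. w permutes ({- int n..int n} - {0})}" by (auto simp: W_def)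
 then show ?thesis by (rule finite_subset) (simp add: finite_permutations)
qed

lemma W_ext: assumes "x \<in> W n" "y \<in> W n" "\<And>i. 1 \<le> i ==> i \<le> int n ==> x i = y i" shows "x = y"
proof
 fix i
 consider "i = 0" | "\<bar>i\<bar> > int n" | "1 \<le> i" "i \<le> int n" | "1 \<le> - i" "- i \<le> int n" by linarith
 then show "x i = y i"
 proof cases
  case 4
  then have "x (- i) = y (- i)" by (rule assms(3))
  then show ?thesis using assms by (simp add: W_odd)
 qed (use assms W_0 W_outside in metis)+
qed

subsection \<open>Generators and reflections\<close>

definition gen :: "nat => int => int" where
 "gen j = (if j = 0 then t_gen else s_gen j)"

text \<open>\<open>gen j\<close> exchanges \<open>lo j\<close> and \<open>hi j\<close>, with
  \<open>lo j < hi j\<close>. For \<open>t\<close> the pair is -1, 1, so that a single criterion,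
  comparing \<open>w (lo j)\<close> with \<open>w (hi j)\<close>, decides between ascent and descent
  for all generators.\<close>

definition lo :: "nat => int" where "lo j = (if j = 0 then - 1 else int j)"
definition hi :: "nat => int" where "hi j = int j + 1"

text \<open>All reflections of the group in one form: a sign change if \<open>q = - p\<close>,
  otherwise the exchange of \<open>p\<close> and \<open>q\<close> together with that of
  \<open>- p\<close> and \<open>- q\<close>.\<close>

definition rfl :: "int => int => int => int" where
 "rfl p q = (if q = - p then transpose p (- p) else transpose p q \<circ> transpose (- p) (- q))"

lemma rfl_apply:
 "p ~= 0 ==> q ~= 0 ==> p ~= q ==>
  rfl p q x = (if x = p then q else if x = q then p else if x = - p then - q else if x = - q then - p else x)"
 by (auto simp: rfl_def transpose_def)

lemma gen_eq_rfl: "gen j = rfl (lo j) (hi j)"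
 by (auto simp: gen_def rfl_def lo_def hi_def t_gen_def s_gen_def transpose_commute)

lemma lo_hi: "lo j ~= 0" "hi j ~= 0" "lo j ~= hi j" "lo j < hi j"
 by (auto simp: lo_def hi_def)

lemma gen_apply: "gen j x = (if x = lo j then hi j else if x = hi j then lo j
  else if x = - lo j then - hi j else if x = - hi j then - lo j else x)"
 unfolding gen_eq_rfl using lo_hi by (subst rfl_apply) auto

lemma rfl_rfl: "p ~= 0 ==> q ~= 0 ==> p ~= q ==> rfl p q \<circ> rfl p q = id"
 by (auto simp: fun_eq_iff rfl_apply)

lemma gen_gen [simp]: "gen j \<circ> gen j = id" "gen j (gen j x) = x"
 using rfl_rfl[OF lo_hi(1-3)] unfolding gen_eq_rfl by (simp_all add: fun_eq_iff)

lemma comp_gen_gen [simp]: "w \<circ> gen j \<circ> gen j = w" "gen j \<circ> (gen j \<circ> w) = w"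
 by (simp_all add: fun_eq_iff)

lemma rfl_in_W:
 assumes "p ~= 0" "q ~= 0" "p ~= q" "\<bar>p\<bar> \<le> int n" "\<bar>q\<bar> \<le> int n"
 shows "rfl p q \<in> W n"
proof -
 let ?S = "{- int n..int n} - {0}"
 have "p \<in> ?S" "q \<in> ?S" "- p \<in> ?S" "- q \<in> ?S" using assms by auto
 then have "transpose p (- p) permutes ?S" "transpose p q \<circ> transpose (- p) (- q) permutes ?S"
  by (blast intro: permutes_swap_id permutes_compose)+
 then have "rfl p q permutes ?S" unfolding rfl_def by auto
 moreover have "rfl p q (- i) = - rfl p q i" for i
  using assms by (auto simp: rfl_apply)
 ultimately show ?thesis by (simp add: W_def)
qed

lemma lo_hi_bound: "j < n ==> \<bar>lo j\<bar> \<le> int n" "j < n ==> \<bar>hi j\<bar> \<le> int n"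
 by (auto simp: lo_def hi_def)

lemma gen_in_W: "j < n ==> gen j \<in> W n"
 unfolding gen_eq_rfl by (intro rfl_in_W lo_hi lo_hi_bound)

lemma gens_eq: "0 < n ==> gens n = gen ` {..<n}"
proof -
 assume "0 < n"
 then have "{..<n} = insert 0 {1..n - 1}" by auto
 then show ?thesis by (auto simp: gens_def gen_def image_iff)
qed

lemma inv_gen [simp]: "inv (gen j) = gen j"
 by (rule inv_equality) simp_all

lemma rfl_conj:
 assumes "x \<in> W n" "p ~= 0" "q ~= 0" "p ~= q"
 shows "rfl (x p) (x q) \<circ> x = x \<circ> rfl p q"
proof
 fix i
 have "x p ~= 0" "x q ~= 0" "x p ~= x q"
  using assms by (simp_all add: W_eq_0_iff W_inj)
 moreover have "x i = - x p \<longleftrightarrow> i = - p" "x i = - x q \<longleftrightarrow> i = - q"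
  using W_inj[OF assms(1)] W_odd[OF assms(1)] by metis+
 ultimately show "(rfl (x p) (x q) \<circ> x) i = (x \<circ> rfl p q) i"
  using assms by (auto simp: rfl_apply W_inj W_odd)
qed

lemma rfl_commute: "p ~= 0 ==> q ~= 0 ==> rfl p q = rfl q p"
 by (cases "p = q") (auto simp: fun_eq_iff rfl_apply)

lemma reflections_rfl:
 assumes "0 < n" "r \<in> reflections n"
 obtains p q where "p < q" "p ~= 0" "q ~= 0" "\<bar>p\<bar> \<le> int n" "\<bar>q\<bar> \<le> int n" "r = rfl p q"
proof -
 obtain x j where xj: "x \<in> W n" "j < n" "r = x \<circ> gen j \<circ> inv x"
  using assms unfolding reflections_def gens_eq[OF assms(1)] by auto
 let ?p = "x (lo j)" and ?q = "x (hi j)"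
 have ne: "?p ~= 0" "?q ~= 0" "?p ~= ?q" using xj(1) lo_hi by (simp_all add: W_eq_0_iff W_inj)
 have "r = rfl ?p ?q \<circ> x \<circ> inv x"
  unfolding xj(3) gen_eq_rfl rfl_conj[OF xj(1) lo_hi(1-3)] ..
 then have r: "r = rfl ?p ?q" using W_inv_inverses[OF xj(1)] by (simp add: comp_assoc)
 have b: "\<bar>?p\<bar> \<le> int n" "\<bar>?q\<bar> \<le> int n"
  using W_bound[OF xj(1)] lo_hi_bound[OF xj(2)] by blast+
 show ?thesis
 proof (cases "?p < ?q")
  case True then show ?thesis using that ne r b by blast
 next
  case False
  then show ?thesis using that[of ?q ?p] ne r b rfl_commute[OF ne(1,2)] by force
 qed
qed

text \<open>Up to sign, the only pair of nonzero integers whose order \<open>gen j\<close> reverses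
  is the pair it exchanges. This plays the role of the fact that a simple reflection makes exactly
  one positive root negative.\<close>

lemma gen_reverses:
 assumes "u < v" "gen j u > gen j v" "u ~= 0" "v ~= 0"
 shows "gen j = rfl u v"
proof (cases "j = 0")
 case True
 then have "u = - 1" "v = 1" using assms by (auto simp: gen_apply lo_def hi_def split: if_splits)
 then show ?thesis using True by (simp add: gen_eq_rfl lo_def hi_def)
next
 case False
 then have "(u = int j \<and> v = int j + 1) \<or> (u = - (int j + 1) \<and> v = - int j)"
  using assms by (auto simp: gen_apply lo_def hi_def split: if_splits)
 then show ?thesis using False
  by (auto simp: gen_eq_rfl lo_def hi_def fun_eq_iff rfl_apply)
qed

subsection \<open>Length\<close>

definition wprod :: "nat list => int => int" where
 "wprod js = foldr (\<circ>) (map gen js) id"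

lemma wprod_simps [simp]: "wprod [] = id" "wprod (j # js) = gen j \<circ> wprod js"
 by (simp_all add: wprod_def)

lemma wprod_append [simp]: "wprod (js @ ks) = wprod js \<circ> wprod ks"
 by (induction js) (simp_all add: comp_assoc)

definition is_word :: "nat => nat list => bool" where
 "is_word n js \<longleftrightarrow> set js \<subseteq> {..<n}"

lemma is_word_simps [simp]: "is_word n []" "is_word n (j # js) \<longleftrightarrow> j < n \<and> is_word n js"
 "is_word n (js @ ks) \<longleftrightarrow> is_word n js \<and> is_word n ks"
 by (auto simp: is_word_def)

lemma wprod_in_W: "is_word n js ==> wprod js \<in> W n"
 by (induction js) (simp_all add: W_comp gen_in_W)

lemma wprod_rev: "is_word n js ==> wprod (rev js) = inv (wprod js)"
 by (induction js) (simp_all add: W_inv_comp[of _ n] gen_in_W wprod_in_W)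

text \<open>The sum of \<open>i * w i\<close> grows whenever a descent is removed and is bounded on
  the group, so sorting \<open>w\<close> by generators terminates.\<close>

lemma word_change:
 assumes w: "w \<in> W n" and j: "j < n" and d: "w (hi j) < w (lo j)"
 shows "(\<Sum>i\<in>{1..int n}. i * w i) < (\<Sum>i\<in>{1..int n}. i * (w \<circ> gen j) i)"
proof (cases "j = 0")
 case True
 have "(w \<circ> gen j) i = (if i = 1 then - w 1 else w i)" if "i \<in> {1..int n}" for i
  using that True W_odd[OF w] by (auto simp: gen_apply lo_def hi_def)
 moreover have "w 1 < 0" using d True W_odd[OF w] by (simp add: lo_def hi_def)
 ultimately show ?thesis using j True
  by (intro sum_strict_mono_ex1) (auto intro!: bexI[of _ 1])
next
 case False
 let ?I = "{1..int n} - {int j, int j + 1}"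
 have I: "{1..int n} = insert (int j) (insert (int j + 1) ?I)" using j False by auto
 have "(\<Sum>i\<in>{1..int n}. i * f i) = int j * f (int j) + (int j + 1) * f (int j + 1) + (\<Sum>i\<in>?I. i * f i)" for f
  by (subst I) simp
 moreover have "(\<Sum>i\<in>?I. i * (w \<circ> gen j) i) = (\<Sum>i\<in>?I. i * w i)"
  by (rule sum.cong) (auto simp: gen_apply lo_def hi_def False)
 ultimately show ?thesis using d False
  by (simp add: gen_apply lo_def hi_def algebra_simps)
qed

lemma no_descent_id:
 assumes w: "w \<in> W n" and nd: "\<And>j. j < n ==> w (lo j) \<le> w (hi j)"
 shows "w = id"
proof (rule W_ext[OF w W_id])
 fix i assume i: "1 \<le> i" "i \<le> int n"
 have step: "w (int j) < w (int j + 1)" if "1 \<le> j" "j < n" for j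
  using nd[of j] that W_inj[OF w, of "int j" "int j + 1"] by (simp add: lo_def hi_def)
 \<comment> \<open>A strictly increasing integer sequence starting above 0 satisfies
   \<open>w i \<ge> i\<close>; one ending at most at \<open>n\<close> satisfies
   \<open>w i \<le> i\<close>.\<close>
 have low: "Suc k \<le> n ==> int (Suc k) \<le> w (int (Suc k))" for k
 proof (induction k)
  case 0
  then have "w (- 1) \<le> w 1" using nd[of 0] by (simp add: lo_def hi_def)
  then show ?case using W_odd[OF w, of 1] W_eq_0_iff[OF w, of 1] by simp
 next
  case (Suc k)
  then show ?case using step[of "Suc k"] by (simp add: add.commute)
 qed
 have high: "k < n ==> w (int (n - k)) \<le> int (n - k)" for k
 proof (induction k)
  case 0
  then show ?case using W_bound[OF w, of "int n"] by simp
 next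
  case (Suc k)
  then have "w (int (n - Suc k)) < w (int (n - Suc k) + 1)" by (intro step) auto
  moreover have "int (n - Suc k) + 1 = int (n - k)" using Suc.prems by auto
  ultimately show ?case using Suc by simp
 qed
 obtain k where k: "i = int (Suc k)" using i by (metis Suc_le_D int_one_le_iff_zero_less nonneg_int_cases nat_int of_nat_1 of_nat_le_iff order_trans zero_le_one One_nat_def)
 have "w i = i" using low[of k] high[of "n - Suc k"] k i by simp
 then show "w i = id i" by simp
qed

lemma exists_word: assumes "w \<in> W n" shows "\<exists>js. is_word n js \<and> wprod js = w"
proof -
 define m where "m = (\<lambda>w :: int => int. \<Sum>i\<in>{1..int n}. i * w i)"
 have bound: "m w \<le> (\<Sum>i\<in>{1..int n}. i * int n)" if "w \<in> W n" for w
  unfolding m_def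
 proof (rule sum_mono)
  fix i assume "i \<in> {1..int n}"
  then show "i * w i \<le> i * int n" using W_bound[OF that, of i] by (intro mult_left_mono) auto
 qed
 show ?thesis using assms
 proof (induction "nat ((\<Sum>i\<in>{1..int n}. i * int n) - m w)" arbitrary: w rule: less_induct)
  case less
  show ?case
  proof (cases "\<exists>j<n. w (hi j) < w (lo j)")
   case True
   then obtain j where j: "j < n" "w (hi j) < w (lo j)" by blast
   have "m w < m (w \<circ> gen j)" unfolding m_def by (rule word_change[OF less.prems j])
   moreover have "w \<circ> gen j \<in> W n" using less.prems j gen_in_W W_comp by blast
   ultimately obtain js where "is_word n js" "wprod js = w \<circ> gen j"
    using less.hyps[of "w \<circ> gen j"] bound[of "w \<circ> gen j"] by force
   then show ?thesis using j by (intro exI[of _ "js @ [j]"]) (simp flip: comp_assoc)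
  next
   case False
   then have "w = id" using no_descent_id[OF less.prems] by force
   then show ?thesis by (intro exI[of _ "[]"]) simp
  qed
 qed
qed

lemma len_word:
 assumes "0 < n" shows "len n w = (LEAST k. \<exists>js. is_word n js \<and> length js = k \<and> wprod js = w)"
proof -
 have "(\<exists>ss. set ss \<subseteq> gens n \<and> length ss = k \<and> foldr (\<circ>) ss id = w)
   \<longleftrightarrow> (\<exists>js. is_word n js \<and> length js = k \<and> wprod js = w)" for k
 proof
  assume "\<exists>ss. set ss \<subseteq> gens n \<and> length ss = k \<and> foldr (\<circ>) ss id = w"
  then obtain ss where ss: "set ss \<subseteq> gen ` {..<n}" "length ss = k" "foldr (\<circ>) ss id = w"
   using gens_eq[OF assms] by auto
  then have "ss \<in> lists (gen ` {..<n})" by auto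
  then obtain js where "js \<in> lists {..<n}" "ss = map gen js"
   unfolding lists_image by blast
  then show "\<exists>js. is_word n js \<and> length js = k \<and> wprod js = w"
   using ss by (intro exI[of _ js]) (auto simp: is_word_def wprod_def)
 next
  assume "\<exists>js. is_word n js \<and> length js = k \<and> wprod js = w"
  then obtain js where "is_word n js" "length js = k" "wprod js = w" by blast
  then show "\<exists>ss. set ss \<subseteq> gens n \<and> length ss = k \<and> foldr (\<circ>) ss id = w"
   unfolding gens_eq[OF assms] by (intro exI[of _ "map gen js"]) (auto simp: is_word_def wprod_def)
 qed
 then show ?thesis unfolding len_def by simp
qed

locale type_B =
 fixes n :: nat
 assumes n_pos: "0 < n"
begin

definition reduced :: "nat list => bool" where
 "reduced js \<longleftrightarrow> is_word n js \<and> length js = len n (wprod js)"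

lemma len_le: "is_word n js ==> len n (wprod js) \<le> length js"
 unfolding len_word[OF n_pos] by (rule Least_le) blast

lemma exists_reduced: assumes "w \<in> W n" obtains js where "reduced js" "wprod js = w"
proof -
 have "\<exists>k js. is_word n js \<and> length js = k \<and> wprod js = w" using exists_word[OF assms] by blast
 from LeastI_ex[OF this] show ?thesis using that unfolding reduced_def len_word[OF n_pos] by auto
qed

lemma len_id [simp]: "len n id = 0"
 using len_le[of "[]"] by simp

lemma len_comp_le: assumes "x \<in> W n" "y \<in> W n" shows "len n (x \<circ> y) \<le> len n x + len n y"
proof -
 obtain js ks where "reduced js" "wprod js = x" "reduced ks" "wprod ks = y"
  using assms exists_reduced by metis
 then show ?thesis using len_le[of "js @ ks"] by (auto simp: reduced_def)
qed

lemma len_gen_le: "j < n ==> len n (gen j) \<le> 1"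
 using len_le[of "[j]"] by simp

lemma len_inv: assumes "w \<in> W n" shows "len n (inv w) = len n w"
proof -
 have le: "len n (inv x) \<le> len n x" if x: "x \<in> W n" for x
 proof -
  obtain js where js: "reduced js" "wprod js = x" using exists_reduced[OF x] .
  then have "is_word n (rev js)" by (auto simp: reduced_def is_word_def)
  then show ?thesis using len_le[of "rev js"] js wprod_rev[of n js] by (auto simp: reduced_def)
 qed
 from le[OF assms] le[OF W_inv[OF assms]] show ?thesis
  using W_inv_inv[OF assms] by simp
qed

text \<open>Strong exchange condition. Reading the word from its right end, some letter reverses the
  order of the images of \<open>p\<close> and \<open>q\<close>. By \<open>gen_reverses\<close> that
  letter is the reflection in these images, and conjugating it to the right end deletes it.\<close>

lemma exchange:
 assumes "is_word n js" "p < q" "p ~= 0" "q ~= 0" "wprod js p > wprod js q"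
 shows "\<exists>ks. is_word n ks \<and> Suc (length ks) = length js \<and> wprod ks = wprod js \<circ> rfl p q"
 using assms
proof (induction js)
 case Nil
 then show ?case by simp
next
 case (Cons j js)
 let ?u = "wprod js"
 have u: "?u \<in> W n" using Cons.prems by (simp add: wprod_in_W)
 show ?case
 proof (cases "?u p > ?u q")
  case True
  then obtain ks where "is_word n ks" "Suc (length ks) = length js" "wprod ks = ?u \<circ> rfl p q"
   using Cons.IH[OF _ Cons.prems(2-4) True] Cons.prems(1) unfolding is_word_simps by blast
  then show ?thesis using Cons.prems by (intro exI[of _ "j # ks"]) (simp add: comp_assoc)
 next
  case False
  then have "?u p < ?u q" using W_inj[OF u, of p q] Cons.prems by simp
  then have "gen j = rfl (?u p) (?u q)"
   using Cons.prems u by (intro gen_reverses) (simp_all add: W_eq_0_iff)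
  then have "gen j \<circ> ?u = ?u \<circ> rfl p q"
   using rfl_conj[OF u, of p q] Cons.prems by simp
  then have "wprod (j # js) \<circ> rfl p q = ?u \<circ> (rfl p q \<circ> rfl p q)"
   unfolding wprod_simps by (simp only: comp_assoc)
  then have "wprod (j # js) \<circ> rfl p q = ?u"
   using rfl_rfl[of p q] Cons.prems by (simp only: comp_id) force
  then show ?thesis using Cons.prems(1) by (metis is_word_simps(2) length_Cons)
 qed
qed

lemma len_rfl_less:
 assumes "w \<in> W n" "p < q" "p ~= 0" "q ~= 0" "w p > w q"
 shows "len n (w \<circ> rfl p q) < len n w"
proof -
 obtain js where js: "reduced js" "wprod js = w" using exists_reduced[OF assms(1)] .
 then obtain ks where "is_word n ks" "Suc (length ks) = length js" "wprod ks = w \<circ> rfl p q"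
  using exchange[of js p q] assms by (auto simp: reduced_def)
 then show ?thesis using len_le[of ks] js by (auto simp: reduced_def)
qed

lemma len_rfl_iff:
 assumes "w \<in> W n" "p < q" "p ~= 0" "q ~= 0" "\<bar>p\<bar> \<le> int n" "\<bar>q\<bar> \<le> int n"
 shows "len n (w \<circ> rfl p q) < len n w \<longleftrightarrow> w q < w p" "len n w < len n (w \<circ> rfl p q) \<longleftrightarrow> w p < w q"
proof -
 have *: "len n w < len n (w \<circ> rfl p q)" if "w p < w q"
 proof -
  have "w \<circ> rfl p q \<in> W n" using assms by (intro W_comp rfl_in_W) auto
  then have "len n (w \<circ> rfl p q \<circ> rfl p q) < len n (w \<circ> rfl p q)"
   using assms that by (intro len_rfl_less) (auto simp: rfl_apply)
  then show ?thesis using rfl_rfl[of p q] assms by (simp add: comp_assoc)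
 qed
 have "w p ~= w q" using assms W_inj by auto
 then show "len n (w \<circ> rfl p q) < len n w \<longleftrightarrow> w q < w p" "len n w < len n (w \<circ> rfl p q) \<longleftrightarrow> w p < w q"
  using * len_rfl_less[OF assms(1-4)] by (meson linorder_neqE not_less_iff_gr_or_eq)+
qed

lemma len_gen_right:
 assumes "w \<in> W n" "j < n"
 shows "w (lo j) < w (hi j) ==> len n (w \<circ> gen j) = Suc (len n w)"
  and "w (hi j) < w (lo j) ==> len n w = Suc (len n (w \<circ> gen j))"
proof -
 have wg: "w \<circ> gen j \<in> W n" using assms W_comp gen_in_W by blast
 have "len n (w \<circ> gen j) \<le> Suc (len n w)"
  using len_comp_le[OF assms(1) gen_in_W[OF assms(2)]] len_gen_le[OF assms(2)] by simp
 moreover have "len n w \<le> Suc (len n (w \<circ> gen j))"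
  using len_comp_le[OF wg gen_in_W[OF assms(2)]] len_gen_le[OF assms(2)] by simp
 moreover note len_rfl_iff[OF assms(1) lo_hi(4,1,2) lo_hi_bound[OF assms(2)], folded gen_eq_rfl]
 ultimately show "w (lo j) < w (hi j) ==> len n (w \<circ> gen j) = Suc (len n w)"
  "w (hi j) < w (lo j) ==> len n w = Suc (len n (w \<circ> gen j))" by linarith+
qed

lemma asc_or_desc: "w \<in> W n ==> w (lo j) < w (hi j) \<or> w (hi j) < w (lo j)"
 using W_inj[of w n "lo j" "hi j"] lo_hi(3) by (metis linorder_neqE)

lemma len_gen_left:
 assumes "w \<in> W n" "j < n"
 shows "inv w (lo j) < inv w (hi j) ==> len n (gen j \<circ> w) = Suc (len n w)"
  and "inv w (hi j) < inv w (lo j) ==> len n w = Suc (len n (gen j \<circ> w))"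
proof -
 have *: "len n (gen j \<circ> w) = len n (inv w \<circ> gen j)"
  using len_inv[of "gen j \<circ> w"] W_inv_comp[OF gen_in_W[OF assms(2)] assms(1)]
   W_comp[OF gen_in_W[OF assms(2)] assms(1)] by simp
 show "inv w (lo j) < inv w (hi j) ==> len n (gen j \<circ> w) = Suc (len n w)"
  "inv w (hi j) < inv w (lo j) ==> len n w = Suc (len n (gen j \<circ> w))"
  using len_gen_right[OF W_inv[OF assms(1)] assms(2)] len_inv[OF assms(1)] * by simp_all
qed

subsection \<open>Matsumoto's theorem\<close>

definition oprod :: "(nat => 'x => 'x) => nat list => 'x => 'x" where
 "oprod f js = foldr (\<circ>) (map f js) id"

lemma oprod_simps [simp]: "oprod f [] = id" "oprod f (j # js) = f j \<circ> oprod f js"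
 by (simp_all add: oprod_def)

lemma oprod_append [simp]: "oprod f (js @ ks) = oprod f js \<circ> oprod f ks"
 by (induction js) (simp_all add: comp_assoc)

definition braid :: "(nat => 'x => 'x) => bool" where
 "braid f \<longleftrightarrow>
   (\<forall>i j. Suc i < j \<and> j < n --> f i \<circ> f j = f j \<circ> f i) \<and>
   (\<forall>i. 0 < i \<and> Suc i < n --> f i \<circ> f (Suc i) \<circ> f i = f (Suc i) \<circ> f i \<circ> f (Suc i)) \<and>
   (1 < n --> f 0 \<circ> f 1 \<circ> f 0 \<circ> f 1 = f 1 \<circ> f 0 \<circ> f 1 \<circ> f 0)"

lemma reduced_snoc:
 assumes "reduced js" "j < n" "wprod js (lo j) < wprod js (hi j)" shows "reduced (js @ [j])"
 using assms len_gen_right(1)[OF wprod_in_W] by (auto simp: reduced_def)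

lemma reduced_butlast:
 assumes "reduced (js @ [j])"
 shows "reduced js" "wprod (js @ [j]) (hi j) < wprod (js @ [j]) (lo j)"
proof -
 have w: "is_word n js" "j < n" using assms by (auto simp: reduced_def)
 have W: "wprod js \<in> W n" "wprod (js @ [j]) \<in> W n" using w by (auto intro: wprod_in_W simp del: wprod_append)
 have le: "len n (wprod js \<circ> gen j) \<le> Suc (len n (wprod js))"
  using len_comp_le[OF W(1) gen_in_W[OF w(2)]] len_gen_le[OF w(2)] by simp
 then show red: "reduced js" using assms len_le[OF w(1)] by (auto simp: reduced_def)
 show "wprod (js @ [j]) (hi j) < wprod (js @ [j]) (lo j)"
 proof (rule ccontr)
  assume "\<not> wprod (js @ [j]) (hi j) < wprod (js @ [j]) (lo j)"
  then have "wprod (js @ [j]) (lo j) < wprod (js @ [j]) (hi j)" using asc_or_desc[OF W(2)] by blast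
  from len_gen_right(1)[OF W(2) w(2) this]
  have "len n (wprod js) = Suc (len n (wprod (js @ [j])))"
   by (simp only: wprod_append wprod_simps comp_id comp_gen_gen)
  then show False using assms red by (simp only: reduced_def) simp
 qed
qed

text \<open>If \<open>i\<close> and \<open>j\<close> are both right descents of \<open>w\<close>,
  then \<open>w\<close> ends in the longest element of the dihedral group they generate.
  \<open>us\<close> is a reduced word of the complementary factor, and the two alternating words of
  the longest element complete it.\<close>

lemma braid_words:
 assumes f: "braid f" and w: "w \<in> W n" and ij: "i < j" "j < n"
  and di: "w (hi i) < w (lo i)" and dj: "w (hi j) < w (lo j)"
 shows "\<exists>us A B. reduced (us @ A @ [i]) \<and> reduced (us @ B @ [j]) \<and> wprod (us @ A @ [i]) = w \<and>
   wprod (us @ B @ [j]) = w \<and> oprod f (A @ [i]) = oprod f (B @ [j])"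
proof -
 \<comment> \<open>\<open>C\<close> is a word of the longest dihedral element, inverse to both
   \<open>A @ [i]\<close> and \<open>B @ [j]\<close>. What remains for each dihedral type is that
   the extensions of \<open>us\<close> stay reduced, which is checked letter by letter.\<close>
 have main: ?thesis
  if red: "\<And>us. wprod us = w \<circ> wprod C ==> reduced us ==> reduced (us @ A @ [i]) \<and> reduced (us @ B @ [j])"
   and C: "is_word n C" "wprod C \<circ> wprod (A @ [i]) = id" "wprod C \<circ> wprod (B @ [j]) = id"
   and eq: "oprod f (A @ [i]) = oprod f (B @ [j])" for A B C
 proof -
  obtain us where us: "reduced us" "wprod us = w \<circ> wprod C"
   using exists_reduced[OF W_comp[OF w wprod_in_W[OF C(1)]]] .
  have "wprod (us @ A @ [i]) = w \<circ> (wprod C \<circ> wprod (A @ [i]))"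
   "wprod (us @ B @ [j]) = w \<circ> (wprod C \<circ> wprod (B @ [j]))"
   using us by (simp_all add: comp_assoc)
  then show ?thesis using red[OF us(2,1)] eq C by (intro exI[of _ us] exI[of _ A] exI[of _ B]) simp
 qed
 have odd: "w (- x) = - w x" for x by (rule W_odd[OF w])
 consider "Suc i < j" | "j = Suc i" "0 < i" | "i = 0" "j = 1" using ij by linarith
 then show ?thesis
 proof cases
  case 1
  have G: "gen i (lo j) = lo j" "gen i (hi j) = hi j" "gen j (lo i) = lo i" "gen j (hi i) = hi i"
   "gen i (lo i) = hi i" "gen i (hi i) = lo i" "gen j (lo j) = hi j" "gen j (hi j) = lo j"
   using 1 by (simp_all add: gen_apply) (auto simp: lo_def hi_def)
  have comm: "gen i (gen j x) = gen j (gen i x)" for x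
  proof -
   have "rfl (gen i (lo j)) (gen i (hi j)) \<circ> gen i = gen i \<circ> gen j"
    unfolding gen_eq_rfl[of j] by (rule rfl_conj[of _ n]) (use lo_hi ij gen_in_W in auto)
   then show ?thesis unfolding G gen_eq_rfl[symmetric] by (metis comp_apply)
  qed
  show ?thesis
  proof (rule main[of "[i, j]" "[j]" "[i]"])
   fix us assume us: "wprod us = w \<circ> wprod [i, j]" "reduced us"
   have U: "wprod us (lo i) = w (hi i)" "wprod us (hi i) = w (lo i)"
    "wprod us (lo j) = w (hi j)" "wprod us (hi j) = w (lo j)" by (simp_all add: us G)
   have r: "reduced (us @ [j])" "reduced (us @ [i])"
    by (rule reduced_snoc; use us(2) di dj ij in \<open>simp add: U\<close>)+
   have r': "reduced ((us @ [j]) @ [i])" "reduced ((us @ [i]) @ [j])"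
    by (rule reduced_snoc[OF r(1)] reduced_snoc[OF r(2)]; use di dj ij in \<open>simp add: U G\<close>)+
   show "reduced (us @ [j] @ [i]) \<and> reduced (us @ [i] @ [j])" using r' by simp
  next
   have "f i \<circ> f j = f j \<circ> f i" using f 1 ij unfolding braid_def by blast
   then show "oprod f ([j] @ [i]) = oprod f ([i] @ [j])" by simp
  qed (use ij comm in \<open>auto simp: fun_eq_iff\<close>)
 next
  case 2
  let ?a = "int i" and ?b = "int i + 1" and ?c = "int i + 2"
  have L: "lo i = ?a" "hi i = ?b" "lo j = ?b" "hi j = ?c" using 2 by (simp_all add: lo_def hi_def)
  have G: "gen i ?a = ?b" "gen i ?b = ?a" "gen i ?c = ?c" "gen j ?a = ?a" "gen j ?b = ?c" "gen j ?c = ?b"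
   using 2(2) unfolding gen_apply L by simp_all
  have br: "gen i (gen j (gen i x)) = gen j (gen i (gen j x))" for x
  proof -
   have "rfl (gen i (lo j)) (gen i (hi j)) \<circ> gen i = gen i \<circ> gen j"
    unfolding gen_eq_rfl[of j] by (rule rfl_conj[of _ n]) (use lo_hi ij gen_in_W in auto)
   moreover have "rfl (gen j (lo i)) (gen j (hi i)) \<circ> gen j = gen j \<circ> gen i"
    unfolding gen_eq_rfl[of i] by (rule rfl_conj[of _ n]) (use lo_hi ij gen_in_W in auto)
   ultimately have "rfl ?a ?c \<circ> gen i = gen i \<circ> gen j" "rfl ?a ?c \<circ> gen j = gen j \<circ> gen i"
    by (simp_all add: L G)
   then show ?thesis by (metis comp_apply gen_gen(2))
  qed
  have x: "w ?a > w ?b" "w ?b > w ?c" using di dj by (simp_all add: L)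
  show ?thesis
  proof (rule main[of "[i, j, i]" "[i, j]" "[j, i]"])
   fix us assume us: "wprod us = w \<circ> wprod [i, j, i]" "reduced us"
   have U: "wprod us ?a = w ?c" "wprod us ?b = w ?b" "wprod us ?c = w ?a" by (simp_all add: us G)
   have r: "reduced (us @ [i])" "reduced (us @ [j])"
    by (rule reduced_snoc; use us(2) x ij in \<open>simp add: U L\<close>)+
   have r': "reduced ((us @ [i]) @ [j])" "reduced ((us @ [j]) @ [i])"
    by (rule reduced_snoc[OF r(1)] reduced_snoc[OF r(2)]; use x ij in \<open>simp add: U L G\<close>)+
   have r'': "reduced (((us @ [i]) @ [j]) @ [i])" "reduced (((us @ [j]) @ [i]) @ [j])"
    by (rule reduced_snoc[OF r'(1)] reduced_snoc[OF r'(2)]; use x ij in \<open>simp add: U L G\<close>)+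
   show "reduced (us @ [i, j] @ [i]) \<and> reduced (us @ [j, i] @ [j])" using r'' by simp
  next
   show "oprod f ([i, j] @ [i]) = oprod f ([j, i] @ [j])"
    using f 2 ij by (simp add: braid_def comp_assoc)
  qed (use ij br in \<open>auto simp: fun_eq_iff\<close>)
 next
  case 3
  have L: "lo i = - 1" "hi i = 1" "lo j = 1" "hi j = 2" using 3 by (simp_all add: lo_def hi_def)
  have G: "gen i 1 = - 1" "gen i (- 1) = 1" "gen i 2 = 2" "gen i (- 2) = - 2"
   "gen j 1 = 2" "gen j 2 = 1" "gen j (- 1) = - 2" "gen j (- 2) = - 1"
   by (auto simp: gen_apply L)
  have out: "gen i x = x" "gen j x = x" if "x ~= 1" "x ~= 2" "x ~= - 1" "x ~= - 2" for x
   using that by (auto simp: gen_apply L)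
  have br: "gen i (gen j (gen i (gen j x))) = gen j (gen i (gen j (gen i x)))" for x
   by (cases "x = 1 \<or> x = 2 \<or> x = - 1 \<or> x = - 2") (auto simp: G out)
  have x: "w (- 1) > w 1" "w 1 > w 2" "w (- 1) = - w 1" "w (- 2) = - w 2" using di dj by (simp_all add: L odd)
  show ?thesis
  proof (rule main[of "[i, j, i, j]" "[j, i, j]" "[i, j, i]"])
   fix us assume us: "wprod us = w \<circ> wprod [i, j, i, j]" "reduced us"
   have U: "wprod us 1 = - w 1" "wprod us 2 = - w 2" "wprod us (- 1) = w 1" "wprod us (- 2) = w 2"
    by (simp_all add: us G odd)
   have r: "reduced (us @ [j])" "reduced (us @ [i])"
    by (rule reduced_snoc; use us(2) x ij in \<open>simp add: U L\<close>)+
   have r': "reduced ((us @ [j]) @ [i])" "reduced ((us @ [i]) @ [j])"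
    by (rule reduced_snoc[OF r(1)] reduced_snoc[OF r(2)]; use x ij in \<open>simp add: U L G\<close>)+
   have r'': "reduced (((us @ [j]) @ [i]) @ [j])" "reduced (((us @ [i]) @ [j]) @ [i])"
    by (rule reduced_snoc[OF r'(1)] reduced_snoc[OF r'(2)]; use x ij in \<open>simp add: U L G\<close>)+
   have r''': "reduced ((((us @ [j]) @ [i]) @ [j]) @ [i])" "reduced ((((us @ [i]) @ [j]) @ [i]) @ [j])"
    by (rule reduced_snoc[OF r''(1)] reduced_snoc[OF r''(2)]; use x ij in \<open>simp add: U L G\<close>)+
   show "reduced (us @ [j, i, j] @ [i]) \<and> reduced (us @ [i, j, i] @ [j])" using r''' by simp
  next
   have "f 0 \<circ> (f 1 \<circ> (f 0 \<circ> f 1)) = f 1 \<circ> (f 0 \<circ> (f 1 \<circ> f 0))"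
    using f 3 ij unfolding braid_def comp_assoc by auto
   then show "oprod f ([j, i, j] @ [i]) = oprod f ([i, j, i] @ [j])"
    using 3 by (simp add: comp_assoc)
  qed (use ij br in \<open>auto simp: fun_eq_iff\<close>)
 qed
qed

text \<open>Induction on the length. Words with equal last letters are shortened. If the last
  letters differ, each word is compared by induction with the word from \<open>braid_words\<close>
  having the same last letter, and the two words from there differ by a braid relation.\<close>

lemma matsumoto:
 assumes f: "braid f" and "reduced js" "reduced ks" "wprod js = wprod ks"
 shows "oprod f js = oprod f ks"
 using assms(2-)
proof (induction "length js" arbitrary: js ks rule: less_induct)
 case less
 have len: "length js = length ks" using less.prems by (simp add: reduced_def)
 show ?case
 proof (cases js rule: rev_cases)
  case Nil
  then show ?thesis using len by simp
 next
  case (snoc as i)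
  then obtain bs j where ks: "ks = bs @ [j]" using len by (cases ks rule: rev_cases) auto
  have ij: "i < n" "j < n" using less.prems snoc ks by (auto simp: reduced_def)
  have red: "reduced as" "reduced bs" using less.prems reduced_butlast snoc ks by blast+
  have lt: "length as < length js" "length bs < length js" using snoc ks len by auto
  have cancel: "wprod xs = wprod ys" if "wprod (xs @ [k]) = wprod (ys @ [k])" for xs ys k
  proof -
   have "wprod (xs @ [k]) \<circ> gen k = wprod (ys @ [k]) \<circ> gen k" using that by simp
   then show ?thesis by simp
  qed
  have diff: "oprod f (as' @ [i']) = oprod f (bs' @ [j'])"
   if ord: "i' < j'" and IH: "\<And>cs ds. length cs < length js ==> reduced cs ==> reduced ds ==> wprod cs = wprod ds ==> oprod f cs = oprod f ds"
    and r: "reduced (as' @ [i'])" "reduced (bs' @ [j'])" "wprod (as' @ [i']) = wprod (bs' @ [j'])"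
    and l: "length as' < length js" "length bs' < length js" for as' bs' i' j'
  proof -
   have "j' < n" using r by (auto simp: reduced_def)
   moreover have "wprod (as' @ [i']) \<in> W n" using r unfolding reduced_def by (blast intro: wprod_in_W)
   ultimately obtain us A B where uAB: "reduced ((us @ A) @ [i'])" "reduced ((us @ B) @ [j'])"
    "wprod ((us @ A) @ [i']) = wprod (as' @ [i'])" "wprod ((us @ B) @ [j']) = wprod (as' @ [i'])"
    "oprod f (A @ [i']) = oprod f (B @ [j'])"
    using braid_words[OF f, of "wprod (as' @ [i'])" i' j'] ord reduced_butlast(2)[OF r(1)]
     reduced_butlast(2)[OF r(2)] r(3) unfolding append_assoc by metis
   have "oprod f as' = oprod f (us @ A)"
    using IH[OF l(1) reduced_butlast(1)[OF r(1)] reduced_butlast(1)[OF uAB(1)]] cancel uAB(3) by metis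
   moreover have "oprod f bs' = oprod f (us @ B)"
    using IH[OF l(2) reduced_butlast(1)[OF r(2)] reduced_butlast(1)[OF uAB(2)]] cancel uAB(4) r(3) by metis
   ultimately have "oprod f (as' @ [i']) = oprod f us \<circ> oprod f (A @ [i'])"
    "oprod f (bs' @ [j']) = oprod f us \<circ> oprod f (B @ [j'])"
    by (simp_all add: comp_assoc)
   then show ?thesis using uAB(5) by simp
  qed
  consider "i = j" | "i < j" | "j < i" by linarith
  then show ?thesis
  proof cases
   case 1
   then have "oprod f as = oprod f bs" using less red lt cancel snoc ks by metis
   then show ?thesis using 1 snoc ks by simp
  next
   case 2
   show ?thesis unfolding snoc ks by (rule diff[OF 2 less.hyps]) (use less.prems snoc ks lt in auto)
  next
   case 3
   show ?thesis unfolding snoc ks by (rule diff[OF 3 less.hyps, symmetric]) (use less.prems snoc ks lt in auto)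
  qed
 qed
qed

text \<open>The reduced word is chosen arbitrarily; \<open>matsumoto\<close> makes the operator
  independent of the choice once \<open>f\<close> satisfies the braid relations.\<close>

definition wrep :: "(nat => 'x => 'x) => (int => int) => 'x => 'x" where
 "wrep f w = oprod f (SOME js. reduced js \<and> wprod js = w)"

lemma wrep_eq: assumes "braid f" "reduced js" shows "wrep f (wprod js) = oprod f js"
proof -
 have "reduced (SOME ks. reduced ks \<and> wprod ks = wprod js) \<and>
   wprod (SOME ks. reduced ks \<and> wprod ks = wprod js) = wprod js"
  by (rule someI[of _ js]) (simp add: assms)
 then show ?thesis unfolding wrep_def by (intro matsumoto[OF assms(1) _ assms(2)]) blast+
qed

lemma wrep_id: "braid f ==> wrep f id = id"
 using wrep_eq[of f "[]"] by (simp add: reduced_def)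

lemma wrep_gen: assumes "braid f" "j < n" shows "wrep f (gen j) = f j"
proof -
 have "len n (gen j) = 1" using len_gen_right(1)[OF W_id assms(2)] lo_hi by simp
 then show ?thesis using wrep_eq[of f "[j]"] assms by (simp add: reduced_def)
qed

lemma wrep_right:
 assumes "braid f" "w \<in> W n" "j < n" "w (lo j) < w (hi j)"
 shows "wrep f (w \<circ> gen j) = wrep f w \<circ> f j"
proof -
 obtain js where js: "reduced js" "wprod js = w" using exists_reduced[OF assms(2)] .
 then have "reduced (js @ [j])" using reduced_snoc assms by simp
 from wrep_eq[OF assms(1) this] wrep_eq[OF assms(1) js(1)] js show ?thesis by simp
qed

lemma wrep_left:
 assumes "braid f" "w \<in> W n" "j < n" "inv w (lo j) < inv w (hi j)"
 shows "wrep f (gen j \<circ> w) = f j \<circ> wrep f w"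
proof -
 obtain js where js: "reduced js" "wprod js = w" using exists_reduced[OF assms(2)] .
 then have "reduced (j # js)" using len_gen_left(1)[OF assms(2-4)] assms by (simp add: reduced_def)
 from wrep_eq[OF assms(1) this] wrep_eq[OF assms(1) js(1)] js show ?thesis by simp
qed

end

section \<open>Boxes, contents and standard bitableaux\<close>

lemma zmul_of_nat: "zmul (int k) x = (\<Sum>i<k. x)"
 by (simp add: zmul_def)

lemma zmul_0 [simp]: "zmul 0 x = 0" and zmul_1 [simp]: "zmul 1 x = x"
 by (simp_all add: zmul_def)

lemma zmul_uminus: "zmul (- k) x = - zmul k x"
 by (cases "k = 0"; cases "0 < k") (simp_all add: zmul_def)

lemma zmul_add1: "zmul (k + 1) x = zmul k x + x"
proof (cases "0 \<le> k")
 case True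
 then obtain m where "k = int m" by (metis nonneg_int_cases)
 then show ?thesis using zmul_of_nat[of "Suc m" x] by (simp add: zmul_of_nat add.commute)
next
 case False
 then obtain m where "k = - int (Suc m)" by (metis not_le_imp_less negD)
 then show ?thesis using zmul_uminus[of "int m" x] zmul_uminus[of "int (Suc m)" x]
  zmul_of_nat[of "Suc m" x] zmul_of_nat[of m x] by simp
qed

lemma zmul_add: "zmul (k + l) x = zmul k x + zmul l x"
proof (induction l rule: int_induct[where k = 0])
 case (step1 i)
 then show ?case using zmul_add1[of "k + i" x] zmul_add1[of i x] by (simp add: algebra_simps)
next
 case (step2 i)
 then show ?case using zmul_add1[of "k + i - 1" x] zmul_add1[of "i - 1" x] by (simp add: algebra_simps)
qed simp

lemma zmul_diff: "zmul (k - l) x = zmul k x - zmul l x"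
 by (metis add_uminus_conv_diff zmul_add zmul_uminus)

lemma zmul_pos_iff: assumes "0 < (x :: 'g::linordered_ab_group_add)" shows "0 < zmul k x \<longleftrightarrow> 0 < k"
proof -
 have pos: "0 < zmul k x" if "0 < k" for k
  using that
 proof (induction k rule: int_gr_induct)
  case base
  then show ?case using assms zmul_1[of x] by simp
 next
  case (step i)
  then show ?case using assms by (simp add: zmul_add1 add_pos_pos)
 qed
 show ?thesis using pos[of k] pos[of "- k"] zmul_uminus[of k x]
  by (cases "k = 0"; cases "0 < k") (auto simp: not_less)
qed

type_synonym box = "bool \<times> nat \<times> nat"
type_synonym tab = "nat => box"

text \<open>In a box \<open>(e, r, c)\<close> the flag \<open>e\<close> selects the first (\<open>True\<close>) or second
 component of the bipartition; rows and columns are counted from 0.\<close>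

definition pre :: "box => box set" where
 "pre B = (case B of (e, r, c) => (if 0 < r then {(e, r - 1, c)} else {}) \<union> (if 0 < c then {(e, r, c - 1)} else {}))"

text \<open>Contents are taken with opposite signs in the two components. As a result rows of the
  first component and columns of the second belong to the eigenvalue \<open>- inverse v\<close> of
  the generators \<open>s_i\<close>, see \<open>phi_adj\<close>.\<close>

definition ct :: "box => int" where
 "ct B = (case B of (e, r, c) => if e then int r - int c else int c - int r)"

definition sw :: "nat => tab => tab" where
 "sw i P = P \<circ> transpose i (Suc i)"

lemma sw_apply: "sw i P k = (if k = i then P (Suc i) else if k = Suc i then P i else P k)"
 by (simp add: sw_def transpose_def)

lemma sw_sw [simp]: "sw i (sw i P) = P"
 by (simp add: sw_def comp_assoc)

locale asymptotic = type_B n for n :: nat +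
 fixes a b :: "'g::linordered_ab_group_add"
 assumes a_pos: "0 < a" and b_large: "zmul (int n - 1) a < b"
begin

definition E :: "int => int => 'g K" where
 "E i j = eps (zmul i b + zmul j a)"

lemma E_mult: "E i j * E k l = E (i + k) (j + l)"
 by (simp add: E_def zmul_add eps_add algebra_simps flip: eps_add)

lemma E_0 [simp]: "E 0 0 = 1" by (simp add: E_def)
lemma E_neq_0 [simp]: "E i j ~= 0" by (simp add: E_def)

lemma E_inverse: "inverse (E i j) = E (- i) (- j)"
 by (rule inverse_unique) (simp add: E_mult)

lemma E_divide: "E i j / E k l = E (i - k) (j - l)"
 by (simp add: divide_inverse E_inverse E_mult)

lemma kbar_E [simp]: "kbar (E i j) = E (- i) (- j)"
 by (simp add: E_def zmul_uminus)

text \<open>The hypothesis on \<open>b\<close> enters the limits here: each power of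
  \<open>e^b\<close> in a denominator absorbs \<open>n - 1\<close> powers of
  \<open>e^a\<close>.\<close>

lemma weight_neg: assumes "i < 0" "j \<le> - i * (int n - 1)" shows "zmul i b + zmul j a < 0"
proof -
 have *: "zmul (int (Suc k) * (int n - 1)) a < zmul (int (Suc k)) b" for k
 proof (induction k)
  case 0
  then show ?case using b_large by simp
 next
  case (Suc k)
  have "int (Suc (Suc k)) * (int n - 1) = int (Suc k) * (int n - 1) + (int n - 1)"
   by (simp add: algebra_simps)
  then have "zmul (int (Suc (Suc k)) * (int n - 1)) a = zmul (int (Suc k) * (int n - 1)) a + zmul (int n - 1) a"
   by (simp add: zmul_add)
  also have "\<dots> < zmul (int (Suc k)) b + b" using Suc b_large by (rule add_strict_mono)
  also have "\<dots> = zmul (int (Suc (Suc k))) b" using zmul_add1[of "int (Suc k)" b] by (simp add: algebra_simps)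
  finally show ?case .
 qed
 obtain k where k: "i = - int (Suc k)" using assms(1) by (metis negD)
 define m where "m = int (Suc k) * (int n - 1) - j"
 have "0 \<le> m" using assms(2) k by (simp add: m_def algebra_simps)
 then have "0 \<le> zmul m a" using zmul_pos_iff[OF a_pos, of m] by (cases "m = 0") auto
 then have "zmul j a \<le> zmul (int (Suc k) * (int n - 1)) a" by (simp add: m_def zmul_diff)
 also note *[of k]
 finally show ?thesis by (simp add: k zmul_uminus del: of_nat_Suc)
qed

lemma weight_neg': "j < 0 ==> zmul 0 b + zmul j a < 0"
 using zmul_pos_iff[OF a_pos, of "- j"] by (simp add: zmul_uminus)

lemma tends_E0: "j < 0 ==> tends (E 0 j) 0"
 unfolding E_def by (rule lim_eps[OF weight_neg'])

lemma tends_E: "i < 0 ==> j \<le> - i * (int n - 1) ==> tends (E i j) 0"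
 unfolding E_def by (rule lim_eps[OF weight_neg])

lemma E0_eq_1_iff: "E 0 j = 1 \<longleftrightarrow> j = 0"
proof
 assume "E 0 j = 1"
 then have "E 0 (- j) = 1" using E_mult[of 0 j 0 "- j"] by simp
 with \<open>E 0 j = 1\<close> show "j = 0"
  using tends_E0[of j] tends_E0[of "- j"] lim_unique[OF lim_1, of 0] by (metis linorder_neqE neg_less_0_iff_less zero_neq_one)
qed simp

lemma E_neq_minus_E: "E i j ~= - E k l"
 by (simp add: E_def eps_neq_minus_eps)

abbreviation v where "v \<equiv> E 0 1"

text \<open>Eigenvalue of the \<open>k\<close>-th Jucys-Murphy element, the operator
  \<open>tmul k\<close> below, on a filling with \<open>k\<close> in box \<open>B\<close>.\<close>

definition x :: "box => 'g K" where
 "x B = (if fst B then - E (- 1) (2 * ct B) else E 1 (2 * ct B))"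

text \<open>Diagonal entry of the operator of \<open>s_k\<close> on a filling with \<open>k\<close>
  in \<open>B\<close> and \<open>k + 1\<close> in \<open>B'\<close>. The quadratic relation then
  forces the product of the two off-diagonal entries to be \<open>qf\<close>.\<close>

definition phi :: "box => box => 'g K" where
 "phi B B' = (v - inverse v) * x B' / (x B' - x B)"

definition qf :: "box => box => 'g K" where
 "qf B B' = 1 + phi B B' * phi B' B"

definition blt :: "box => box => bool" where
 "blt B B' = (case B of (e, r, c) => case B' of (e', r', c') =>
   e < e' \<or> (e = e' \<and> (r < r' \<or> (r = r' \<and> c < c'))))"

text \<open>A rescaling of Young's orthogonal form that needs no square roots.\<close>

definition theta :: "box => box => 'g K" where
 "theta B B' = (if blt B B' \<and> qf B B' ~= 0 then 1 else qf B B')"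

text \<open>The exponent of \<open>om B\<close> is the contribution of \<open>B\<close> to the \<open>a\<close>-invariant.\<close>

definition alpha :: "box => 'g" where
 "alpha B = (case B of (e, r, c) => if e then zmul (int r) a else b + zmul (2 * int c - int r) a)"

text \<open>The monomial \<open>eps (alpha B)\<close> with a sign that makes the limits of the
  normalised matrix entries 1 instead of a sign depending on the rows of the second
  component.\<close>

definition om :: "box => 'g K" where
 "om B = (case B of (e, r, c) => if e then E 0 (int r) else (- 1) ^ r * E 1 (2 * int c - int r))"

lemma x_neq_0 [simp]: "x B ~= 0" by (simp add: x_def)
lemma om_neq_0 [simp]: "om B ~= 0" by (auto simp: om_def split: prod.splits)

lemma om_eq: "om B = (if fst B then 1 else (- 1) ^ fst (snd B)) * eps (alpha B)"
 by (auto simp: om_def alpha_def E_def split: prod.splits)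

lemma qf_commute: "qf B B' = qf B' B"
 by (simp add: qf_def mult.commute)

lemma blt_total: "B ~= B' ==> blt B' B \<longleftrightarrow> \<not> blt B B'"
 by (cases B; cases B') (auto simp: blt_def)

lemma theta_mult: "B ~= B' ==> theta B B' * theta B' B = qf B B'"
 using blt_total[of B B'] by (auto simp: theta_def qf_commute[of B' B])

lemma theta_eq_0_iff: "theta B B' = 0 \<longleftrightarrow> qf B B' = 0"
 by (auto simp: theta_def)

lemma v_inverse: "inverse v = E 0 (- 1)" by (simp add: E_inverse)

lemma x_same: "fst B = fst B' ==> x B' = E 0 (2 * (ct B' - ct B)) * x B"
 by (auto simp: x_def E_mult algebra_simps)

lemma x_eq_iff: "x B = x B' \<longleftrightarrow> fst B = fst B' \<and> ct B = ct B'"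
proof (cases "fst B = fst B'")
 case True
 have "x B' = x B \<longleftrightarrow> E 0 (2 * (ct B' - ct B)) = 1"
  unfolding x_same[OF True] by simp
 then show ?thesis using True by (auto simp: E0_eq_1_iff)
next
 case False
 then show ?thesis using E_neq_minus_E E_neq_minus_E[symmetric] by (auto simp: x_def)
qed

lemma phi_sum: "x B ~= x B' ==> phi B B' + phi B' B = v - inverse v"
 unfolding phi_def by (simp add: divide_simps) (simp add: algebra_simps)

text \<open>Yang-Baxter identity for three eigenvalues: an identity between rational functions of
  three distinct quantities, verified by clearing denominators.\<close>

lemma phi_braid1:
 assumes "x B ~= x B'" "x B ~= x B''" "x B' ~= x B''"
 shows "phi B B' * phi B' B'' + phi B B'' * phi B' B = phi B' B'' * phi B B''"
proof -
 have "y2 * y3 / ((y2 - y1) * (y3 - y2)) + y3 * y1 / ((y3 - y1) * (y1 - y2)) = y3 * y3 / ((y3 - y2) * (y3 - y1))"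
  if "y1 ~= y2" "y1 ~= y3" "y2 ~= y3" for y1 y2 y3 :: "'g K"
 proof -
  have nz: "y2 - y1 ~= 0" "y3 - y1 ~= 0" "y3 - y2 ~= 0" using that by auto
  have "y1 - y2 = - (y2 - y1)" by simp
  then have "y2 * y3 / ((y2 - y1) * (y3 - y2)) + y3 * y1 / ((y3 - y1) * (y1 - y2))
    = (y2 * y3 * (y3 - y1) - y3 * y1 * (y3 - y2)) / ((y2 - y1) * (y3 - y2) * (y3 - y1))"
   using nz by (simp add: add_frac_eq divide_simps mult_eq_0_iff) (simp add: algebra_simps)
  also have "y2 * y3 * (y3 - y1) - y3 * y1 * (y3 - y2) = y3 * y3 * (y2 - y1)" by (simp add: algebra_simps)
  also have "y3 * y3 * (y2 - y1) / ((y2 - y1) * (y3 - y2) * (y3 - y1)) = y3 * y3 / ((y3 - y2) * (y3 - y1))"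
   using nz by (simp add: mult.assoc)
  finally show ?thesis .
 qed
 from this[OF assms(1,2,3)] have
  "(v - inverse v)^2 * (x B' * x B'' / ((x B' - x B) * (x B'' - x B')) + x B'' * x B / ((x B'' - x B) * (x B - x B')))
   = (v - inverse v)^2 * (x B'' * x B'' / ((x B'' - x B') * (x B'' - x B)))" by simp
 then show ?thesis unfolding phi_def by (simp add: power2_eq_square distrib_left ac_simps)
qed

text \<open>The diagonal entry of the braid relation. The difference of the two sides is
  \<open>phi B B' - phi B' B''\<close> times the difference of the two sides of
  \<open>phi_braid1\<close>.\<close>

lemma phi_braid2:
 assumes "x B ~= x B'" "x B ~= x B''" "x B' ~= x B''"
 shows "phi B B' * phi B B' * phi B' B'' + qf B B' * phi B B''
    = phi B' B'' * phi B' B'' * phi B B' + qf B' B'' * phi B B''"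
proof -
 have 1: "phi B' B = v - inverse v - phi B B'" "phi B'' B' = v - inverse v - phi B' B''"
  using phi_sum assms by (metis add_diff_cancel_left')+
 have 2: "phi B B' * phi B' B'' + phi B B'' * (v - inverse v - phi B B') = phi B' B'' * phi B B''"
  using phi_braid1[OF assms] 1 by simp
 define p q r s where "p = phi B B'" and "q = phi B' B''" and "r = phi B B''" and "s = v - inverse v"
 have 2: "p * q + r * (s - p) = q * r" using 2 unfolding p_def q_def r_def s_def .
 have "p * p * q + (1 + p * (s - p)) * r - (q * q * p + (1 + q * (s - q)) * r) = (p - q) * (p * q + r * (s - p) - q * r)"
  by (simp add: algebra_simps)
 then have "p * p * q + (1 + p * (s - p)) * r = q * q * p + (1 + q * (s - q)) * r" using 2 by simp
 then show ?thesis unfolding qf_def 1 p_def q_def r_def s_def .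
qed

lemma phi_quadratic:
 assumes "x B ~= x B'"
 shows "phi B B' * phi B B' + qf B B' = (v - inverse v) * phi B B' + 1"
proof -
 have 1: "phi B' B = v - inverse v - phi B B'" using phi_sum[OF assms] by (metis add_diff_cancel_left')
 show ?thesis unfolding qf_def 1 by (simp add: algebra_simps)
qed

lemma kbar_x: "kbar (x B) = inverse (x B)"
 by (auto simp: x_def E_inverse kbar_uminus)

lemma kbar_phi: assumes "x B ~= x B'" shows "kbar (phi B B') = phi B B' - (v - inverse v)"
proof -
 have "kbar (phi B B') = (inverse v - v) * inverse (x B') / (inverse (x B') - inverse (x B))"
  by (simp add: phi_def kbar_divide kbar_mult kbar_diff kbar_x kbar_inverse E_inverse)
 also have "\<dots> = (inverse v - v) * (inverse (x B') / (inverse (x B') - inverse (x B)))"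
  by (rule times_divide_eq_right[symmetric])
 also have "inverse (x B') / (inverse (x B') - inverse (x B)) = x B / (x B - x B')"
  using assms by (simp add: divide_simps)
 also have "inverse v - v = - (v - inverse v)" by simp
 also have "\<dots> * (x B / (x B - x B')) = - phi B' B"
  unfolding phi_def by (simp only: mult_minus_left times_divide_eq_right minus_divide_left)
 finally show ?thesis using phi_sum[OF assms] by (simp add: algebra_simps)
qed

text \<open>Bar subtracts \<open>v - inverse v\<close> from both diagonal entries, which
  interchanges them up to sign, so their product is unchanged. Consequently the off-diagonal entries
  \<open>theta\<close> are bar-invariant.\<close>

lemma kbar_qf: "kbar (qf B B') = qf B B'"
proof (cases "x B = x B'")
 case True
 then show ?thesis by (simp add: qf_def phi_def)
next
 case False
 have 1: "phi B' B = v - inverse v - phi B B'" using phi_sum[OF False] by (metis add_diff_cancel_left')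
 have "kbar (phi B B' * phi B' B) = (phi B B' - (v - inverse v)) * (phi B' B - (v - inverse v))"
  using kbar_phi[OF False] kbar_phi[of B' B] False by (simp add: kbar_mult)
 also have "\<dots> = phi B B' * phi B' B" unfolding 1 by (simp add: algebra_simps)
 finally show ?thesis by (simp add: qf_def kbar_add)
qed

lemma kbar_theta: "kbar (theta B B') = theta B B'"
 by (simp add: theta_def kbar_qf)

lemma phi_adj:
 assumes "fst B = fst B'"
 shows "ct B' = ct B + 1 ==> phi B B' = v" "ct B' = ct B - 1 ==> phi B B' = - inverse v"
proof -
 note xs = x_same[OF assms]
 have e: "E 0 2 = v * v" "E 0 (- 2) = inverse v * inverse v" by (simp_all add: E_inverse E_mult)
 have ne: "v * v ~= 1" "inverse v * inverse v ~= 1" using E0_eq_1_iff[of 2] E0_eq_1_iff[of "- 2"] by (simp_all add: e)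
 have *: "(v - inverse v) * (v * v) = v * (v * v - 1)" by (simp add: algebra_simps E_inverse E_mult)
 assume "ct B' = ct B + 1"
 then have xs: "x B' = v * v * x B" using xs by (simp flip: e)
 then have "phi B B' = (v - inverse v) * (v * v) * x B / ((v * v - 1) * x B)"
  unfolding phi_def xs by (simp only: left_diff_distrib mult_1_left mult.assoc)
 then show "phi B B' = v" unfolding * using ne by simp
next
 note xs = x_same[OF assms]
 have e: "E 0 2 = v * v" "E 0 (- 2) = inverse v * inverse v" by (simp_all add: E_inverse E_mult)
 have ne: "v * v ~= 1" "inverse v * inverse v ~= 1" using E0_eq_1_iff[of 2] E0_eq_1_iff[of "- 2"] by (simp_all add: e)
 have *: "(v - inverse v) * (inverse v * inverse v) = - inverse v * (inverse v * inverse v - 1)"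
  by (simp add: algebra_simps E_inverse E_mult)
 assume "ct B' = ct B - 1"
 then have "2 * (ct B' - ct B) = - 2" by simp
 then have xs: "x B' = inverse v * inverse v * x B" using xs by (simp only: e)
 then have "phi B B' = (v - inverse v) * (inverse v * inverse v) * x B / ((inverse v * inverse v - 1) * x B)"
  unfolding phi_def xs by (simp only: left_diff_distrib mult_1_left mult.assoc)
 then show "phi B B' = - inverse v" unfolding * using ne by simp
qed

lemma qf_adj:
 assumes "fst B = fst B'" "\<bar>ct B' - ct B\<bar> = 1" shows "qf B B' = 0"
proof -
 consider "ct B' = ct B + 1" | "ct B' = ct B - 1" using assms by linarith
 then show ?thesis
  using phi_adj[OF assms(1)] phi_adj[OF assms(1)[symmetric]] by cases (simp_all add: qf_def)
qed

subsection \<open>Asymptotics\<close>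

lemma tends_geom: "tends u 0 ==> tends (inverse (1 - u)) 1"
 using lim_diff[OF lim_1, of u 0] by (intro lim_inverse_1) simp

text \<open>Here and in the next three estimates the ratio of the two eigenvalues, taken in its
  small direction, is \<open>u\<close>. Up to sign and a monomial, \<open>phi\<close> is
  \<open>1 - E 0 (- 2)\<close> times \<open>inverse (1 - u)\<close>.\<close>

lemma tends_phi_up:
 assumes "fst B = fst B'" "ct B < ct B'" shows "tends (phi B B' * E 0 (- 1)) 1"
proof -
 define u where "u = E 0 (2 * (ct B - ct B'))"
 have u: "tends u 0" unfolding u_def using assms by (intro tends_E0) simp
 have x: "x B = u * x B'" unfolding u_def using x_same[of B' B] assms by simp
 have "phi B B' * E 0 (- 1) = (v - inverse v) * E 0 (- 1) * (x B' / (x B' - u * x B'))"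
  by (simp add: phi_def x ac_simps)
 also have "x B' - u * x B' = x B' * (1 - u)" by (simp add: algebra_simps)
 also have "x B' / (x B' * (1 - u)) = inverse (1 - u)" by (simp add: divide_simps)
 also have "(v - inverse v) * E 0 (- 1) = 1 - E 0 (- 2)" by (simp add: v_inverse left_diff_distrib E_mult)
 finally show ?thesis using lim_mult[OF lim_diff[OF lim_1 tends_E0] tends_geom[OF u], of "- 2"] by simp
qed

lemma tends_phi_down:
 assumes "fst B = fst B'" "ct B' < ct B" shows "tends (phi B B' * E 0 (2 * (ct B - ct B') - 1)) (- 1)"
proof -
 define u where "u = E 0 (2 * (ct B' - ct B))"
 have u: "tends u 0" unfolding u_def using assms by (intro tends_E0) simp
 have x: "x B' = u * x B" unfolding u_def using x_same[of B B'] assms by simp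
 have "E 0 (2 * (ct B - ct B') - 1) = E 0 (- 1) * inverse u" by (simp add: u_def E_inverse E_mult)
 then have "phi B B' * E 0 (2 * (ct B - ct B') - 1) = ((v - inverse v) * E 0 (- 1)) * (u * inverse u) * (x B / (u * x B - x B))"
  by (simp add: phi_def x divide_inverse ac_simps)
 also have "u * x B - x B = - (x B * (1 - u))" by (simp add: algebra_simps)
 also have "(v - inverse v) * E 0 (- 1) = 1 - E 0 (- 2)" by (simp add: v_inverse left_diff_distrib E_mult)
 also have "u * inverse u = 1" by (simp add: u_def)
 also have "x B / - (x B * (1 - u)) = - inverse (1 - u)" by (simp add: divide_simps)
 finally show ?thesis
  using lim_mult[OF lim_diff[OF lim_1 tends_E0] lim_uminus[OF tends_geom[OF u]], of "- 2"] by simp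
qed

lemma tends_phi_pm:
 assumes "fst B" "\<not> fst B'" "ct B - ct B' \<le> 2 * (int n - 1)" "ct B - ct B' \<le> int n - 1"
 shows "tends (phi B B' * E 0 (- 1)) 1"
proof -
 define u where "u = - E (- 2) (2 * (ct B - ct B'))"
 have u: "tends u 0" unfolding u_def using assms lim_uminus[OF tends_E[of "- 2" "2 * (ct B - ct B')"]] by simp
 have x: "x B = u * x B'" unfolding u_def using assms by (simp add: x_def E_mult algebra_simps)
 have "phi B B' * E 0 (- 1) = (v - inverse v) * E 0 (- 1) * (x B' / (x B' - u * x B'))"
  by (simp add: phi_def x ac_simps)
 also have "x B' - u * x B' = x B' * (1 - u)" by (simp add: algebra_simps)
 also have "x B' / (x B' * (1 - u)) = inverse (1 - u)" by (simp add: divide_simps)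
 also have "(v - inverse v) * E 0 (- 1) = 1 - E 0 (- 2)" by (simp add: v_inverse left_diff_distrib E_mult)
 finally show ?thesis using lim_mult[OF lim_diff[OF lim_1 tends_E0] tends_geom[OF u], of "- 2"] by simp
qed

lemma tends_phi_mp:
 assumes "\<not> fst B" "fst B'" "ct B' - ct B \<le> int n - 1"
 shows "tends (phi B B' * E 2 (2 * (ct B - ct B') - 1)) 1"
proof -
 define u where "u = - E (- 2) (2 * (ct B' - ct B))"
 have u: "tends u 0" unfolding u_def using assms lim_uminus[OF tends_E[of "- 2" "2 * (ct B' - ct B)"]] by simp
 have x: "x B' = u * x B" unfolding u_def using assms by (simp add: x_def E_mult algebra_simps)
 have "E 2 (2 * (ct B - ct B') - 1) = - E 0 (- 1) * inverse u"
  by (simp add: u_def inverse_minus_eq E_inverse E_mult)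
 then have "phi B B' * E 2 (2 * (ct B - ct B') - 1) = ((v - inverse v) * E 0 (- 1)) * (u * inverse u) * (- x B / (u * x B - x B))"
  by (simp add: phi_def x divide_inverse ac_simps)
 also have "u * x B - x B = - (x B * (1 - u))" by (simp add: algebra_simps)
 also have "(v - inverse v) * E 0 (- 1) = 1 - E 0 (- 2)" by (simp add: v_inverse left_diff_distrib E_mult)
 also have "u * inverse u = 1" by (simp add: u_def)
 also have "- x B / - (x B * (1 - u)) = inverse (1 - u)" by (simp add: divide_simps)
 finally show ?thesis using lim_mult[OF lim_diff[OF lim_1 tends_E0] tends_geom[OF u], of "- 2"] by simp
qed

subsection \<open>Standard bitableaux\<close>

text \<open>A standard bitableau as the map from entries to boxes. That the neighbours above and to
  the left hold smaller entries encodes both the partition shape and standardness; the default box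
  outside \<open>{1..n}\<close> makes equal fillings equal functions.\<close>

definition valid :: "tab => bool" where
 "valid P \<longleftrightarrow> (\<forall>i. i \<notin> {1..n} --> P i = (True, 0, 0)) \<and> inj_on P {1..n} \<and>
   (\<forall>i\<in>{1..n}. pre (P i) \<subseteq> P ` {1..<i})"

lemma valid_inj: "valid P ==> i \<in> {1..n} ==> j \<in> {1..n} ==> P i = P j ==> i = j"
 unfolding valid_def by (blast dest: inj_onD)

lemma valid_NW:
 assumes "valid P" "k \<in> {1..n}" "P k = (e, r, c)" "r' \<le> r" "c' \<le> c"
 shows "\<exists>k'\<in>{1..k}. P k' = (e, r', c')"
 using assms(2-)
proof (induction "(r - r') + (c - c')" arbitrary: k r c)
 case 0
 then show ?case by (intro bexI[of _ k]) auto
next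
 case (Suc m)
 have pre: "pre (P k) \<subseteq> P ` {1..<k}" using assms(1) Suc.prems(1) unfolding valid_def by blast
 consider "r' < r" | "c' < c" using Suc by linarith
 then show ?case
 proof cases
  case 1
  then have "(e, r - 1, c) \<in> pre (P k)" using Suc.prems(2) by (simp add: pre_def)
  then have "(e, r - 1, c) \<in> P ` {1..<k}" using pre by blast
  then obtain k1 where k1: "k1 \<in> {1..<k}" "P k1 = (e, r - 1, c)" by (metis imageE)
  have "\<exists>k'\<in>{1..k1}. P k' = (e, r', c')"
   by (rule Suc.hyps(1)[of "r - 1" c]) (use Suc.prems Suc.hyps(2) k1 1 in auto)
  then show ?thesis using k1(1) by fastforce
 next
  case 2
  then have "(e, r, c - 1) \<in> pre (P k)" using Suc.prems(2) by (simp add: pre_def)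
  then have "(e, r, c - 1) \<in> P ` {1..<k}" using pre by blast
  then obtain k1 where k1: "k1 \<in> {1..<k}" "P k1 = (e, r, c - 1)" by (metis imageE)
  have "\<exists>k'\<in>{1..k1}. P k' = (e, r', c')"
   by (rule Suc.hyps(1)[of r "c - 1"]) (use Suc.prems Suc.hyps(2) k1 2 in auto)
  then show ?thesis using k1(1) by fastforce
 qed
qed

lemma valid_NW_le:
 assumes "valid P" "k \<in> {1..n}" "j \<in> {1..n}" "P k = (e, r, c)" "P j = (e, r', c')" "r' \<le> r" "c' \<le> c"
 shows "j \<le> k"
proof -
 obtain k' where k': "k' \<in> {1..k}" "P k' = (e, r', c')" using valid_NW[OF assms(1,2,4,6,7)] by blast
 then have "k' = j" using valid_inj[OF assms(1), of k' j] assms(2,3,5) by auto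
 then show ?thesis using k' by simp
qed

text \<open>The column above a box and the row to its left contribute \<open>r + c + 1\<close> boxes
  to the filling; counting gives \<open>valid_hook\<close>. For boxes in different components the
  two sets are disjoint, which gives \<open>valid_hooks\<close>. These bounds are what
  \<open>weight_neg\<close> is applied to.\<close>

lemma hook_subset:
 assumes "valid P" "k \<in> {1..n}" "P k = (e, r, c)"
 shows "(\<lambda>r'. (e, r', c)) ` {..r} \<union> (\<lambda>c'. (e, r, c')) ` {..<c} \<subseteq> P ` {1..n}"
proof -
 have "(e, r', c') \<in> P ` {1..n}" if le: "r' \<le> r" "c' \<le> c" for r' c'
 proof -
  obtain k' where "k' \<in> {1..k}" "P k' = (e, r', c')" using valid_NW[OF assms le] by blast
  then show ?thesis using assms(2) by (force intro: image_eqI[of _ _ k'])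
 qed
 then show ?thesis by auto
qed

lemma hook_card: "card ((\<lambda>r'. (e, r', c)) ` {..r} \<union> (\<lambda>c'. (e, r, c')) ` {..<c}) = Suc (r + c)"
 by (subst card_Un_disjoint) (auto simp: card_image inj_on_def)

lemma valid_card: "valid P ==> card (P ` {1..n}) = n"
 by (simp add: valid_def card_image)

lemma valid_hook: assumes "valid P" "k \<in> {1..n}" "P k = (e, r, c)" shows "r + c < n"
 using card_mono[OF _ hook_subset[OF assms]] hook_card[of e c r] valid_card[OF assms(1)] by simp

lemma valid_hooks:
 assumes "valid P" "k \<in> {1..n}" "P k = (e, r, c)" "k' \<in> {1..n}" "P k' = (e', r', c')" "e ~= e'"
 shows "Suc (r + c) + Suc (r' + c') \<le> n"
proof -
 let ?H = "(\<lambda>r'. (e, r', c)) ` {..r} \<union> (\<lambda>c'. (e, r, c')) ` {..<c}"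
 let ?H' = "(\<lambda>r''. (e', r'', c')) ` {..r'} \<union> (\<lambda>c''. (e', r', c'')) ` {..<c'}"
 have "?H \<inter> ?H' = {}" using assms(6) by auto
 then have "card (?H \<union> ?H') = card ?H + card ?H'" by (intro card_Un_disjoint) auto
 moreover have "card (?H \<union> ?H') \<le> card (P ` {1..n})"
  using hook_subset[OF assms(1-3)] hook_subset[OF assms(1,4,5)] by (intro card_mono) auto
 ultimately show ?thesis using hook_card[of e c r] hook_card[of e' c' r'] valid_card[OF assms(1)] by simp
qed

text \<open>Between two boxes of one diagonal the filling contains the two other corners of a 2 by 2
  square, and their entries lie strictly in between. So among three consecutive entries all
  eigenvalues differ, as the braid relation requires.\<close>

lemma valid_same_ct:
 assumes "valid P" "i \<in> {1..n}" "k \<in> {1..n}" "i < k" "fst (P i) = fst (P k)" "ct (P i) = ct (P k)"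
 shows "i + 3 \<le> k"
proof -
 obtain e r c where Pi: "P i = (e, r, c)" by (cases "P i") auto
 obtain r' c' where Pk: "P k = (e, r', c')" using assms(5) Pi by (cases "P k") auto
 have eq: "int r - int c = int r' - int c'" using assms(6) Pi Pk by (auto simp: ct_def split: if_splits)
 have "\<not> (r' \<le> r \<and> c' \<le> c)" using valid_NW_le[OF assms(1,2,3) Pi Pk] assms(4) by auto
 then have lt: "r < r'" "c < c'" using eq by linarith+
 obtain k1 where k1: "k1 \<in> {1..k}" "P k1 = (e, Suc r, c)"
  using valid_NW[OF assms(1,3) Pk, of "Suc r" c] lt by auto
 obtain k2 where k2: "k2 \<in> {1..k}" "P k2 = (e, r, Suc c)"
  using valid_NW[OF assms(1,3) Pk, of r "Suc c"] lt by auto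
 have "k1 \<in> {1..n}" "k2 \<in> {1..n}" using k1 k2 assms(3) by auto
 then have "i \<le> k1" "i \<le> k2"
  using valid_NW_le[OF assms(1) _ assms(2) k1(2) Pi] valid_NW_le[OF assms(1) _ assms(2) k2(2) Pi] by auto
 moreover have "k1 ~= i" "k2 ~= i" "k1 ~= k2" "k1 ~= k" "k2 ~= k" using Pi Pk k1 k2 lt by auto
 ultimately show ?thesis using k1 k2 by auto
qed

lemma valid_x_neq:
 assumes "valid P" "i \<in> {1..n}" "k \<in> {1..n}" "i < k" "k \<le> i + 2"
 shows "x (P i) ~= x (P k)"
 using valid_same_ct[OF assms(1-4)] assms(5) by (auto simp: x_eq_iff)

lemma pre_ct: "B \<in> pre B' ==> fst B = fst B' \<and> \<bar>ct B' - ct B\<bar> = 1"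
 by (cases B'; cases B) (auto simp: pre_def ct_def split: if_splits)

text \<open>A box lying between those of \<open>i\<close> and \<open>i + 1\<close> would have its
  entry between \<open>i\<close> and \<open>i + 1\<close>. Hence consecutive entries on neighbouring
  diagonals are adjacent.\<close>

lemma valid_consecutive:
 assumes "valid P" "1 \<le> i" "i < n" "fst (P i) = fst (P (Suc i))" "\<bar>ct (P (Suc i)) - ct (P i)\<bar> = 1"
 shows "P i \<in> pre (P (Suc i))"
proof -
 have in1: "i \<in> {1..n}" "Suc i \<in> {1..n}" using assms by auto
 obtain e r c where Pi: "P i = (e, r, c)" by (cases "P i") auto
 obtain r' c' where Pk: "P (Suc i) = (e, r', c')" using assms(4) Pi by (cases "P (Suc i)") auto
 have nw: "\<not> (r' \<le> r \<and> c' \<le> c)" using valid_NW_le[OF assms(1) in1 Pi Pk] by auto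
 have eq: "\<bar>(int r' - int c') - (int r - int c)\<bar> = 1" using assms(5) Pi Pk by (auto simp: ct_def split: if_splits)
 have between: "r = r'' \<and> c = c'' \<or> r' = r'' \<and> c' = c''"
  if h: "r'' \<le> r'" "c'' \<le> c'" "r \<le> r''" "c \<le> c''" for r'' c''
 proof -
  obtain k where k: "k \<in> {1..Suc i}" "P k = (e, r'', c'')" using valid_NW[OF assms(1) in1(2) Pk h(1,2)] by blast
  then have "i \<le> k" using valid_NW_le[OF assms(1) _ in1(1) k(2) Pi h(3,4)] in1 by auto
  then have "k = i \<or> k = Suc i" using k by auto
  then show ?thesis using Pi Pk k by auto
 qed
 consider "int r' - int c' = int r - int c + 1" | "int r' - int c' = int r - int c - 1" using eq by linarith
 then show ?thesis
 proof cases
  case 1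
  then have "r < r'" "c \<le> c'" using nw by linarith+
  then have "c = c'" "r' = Suc r" using between[of "Suc r" c] 1 by auto
  then show ?thesis using Pi Pk by (auto simp: pre_def)
 next
  case 2
  then have "c < c'" "r \<le> r'" using nw by linarith+
  then have "r = r'" "c' = Suc c" using between[of r "Suc c"] 2 by auto
  then show ?thesis using Pi Pk by (auto simp: pre_def)
 qed
qed

lemma tends_phi_prod:
 assumes "fst B = fst B'" "2 \<le> \<bar>ct B' - ct B\<bar>" shows "tends (phi B B' * phi B' B) 0"
proof -
 have *: "tends (phi B B' * phi B' B) 0" if "fst B = fst B'" "ct B + 2 \<le> ct B'" for B B'
 proof -
  have "tends ((phi B B' * E 0 (- 1)) * (phi B' B * E 0 (2 * (ct B' - ct B) - 1))) (1 * (- 1))"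
   using that by (intro lim_mult tends_phi_up tends_phi_down) auto
  from lim_mult[OF this tends_E0[of "2 - 2 * (ct B' - ct B)"]] that
  have "tends (phi B B' * phi B' B * (E 0 (- 1) * E 0 (2 * (ct B' - ct B) - 1) * E 0 (2 - 2 * (ct B' - ct B)))) 0"
   by (simp add: ac_simps)
  then show ?thesis by (simp add: E_mult)
 qed
 show ?thesis using *[of B B'] *[of B' B] assms by (cases "ct B \<le> ct B'") (auto simp: mult.commute)
qed

lemma tends_phi_prod_pm:
 assumes "fst B" "\<not> fst B'" "ct B - ct B' \<le> int n - 2"
 shows "tends (phi B B' * phi B' B) 0"
proof (cases "ct B - ct B' \<le> 2 * (int n - 1)")
 case True
 have "tends ((phi B B' * E 0 (- 1)) * (phi B' B * E 2 (2 * (ct B' - ct B) - 1))) (1 * 1)"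
  using assms True by (intro lim_mult tends_phi_pm tends_phi_mp) auto
 from lim_mult[OF this tends_E[of "- 2" "2 - 2 * (ct B' - ct B)"]] assms
 have "tends (phi B B' * phi B' B * (E 0 (- 1) * E 2 (2 * (ct B' - ct B) - 1) * E (- 2) (2 - 2 * (ct B' - ct B)))) 0"
  by (simp add: ac_simps)
 then show ?thesis by (simp add: E_mult)
qed (use assms n_pos in auto)

lemma valid_ct_pm:
 assumes "valid P" "i \<in> {1..n}" "k \<in> {1..n}" "fst (P i) ~= fst (P k)"
 shows "\<bar>ct (P i) - ct (P k)\<bar> \<le> int n - 2"
proof -
 obtain e r c e' r' c' where P: "P i = (e, r, c)" "P k = (e', r', c')" by (metis prod_cases3)
 then have "Suc (r + c) + Suc (r' + c') \<le> n" using valid_hooks[OF assms(1,2) P(1) assms(3) P(2)] assms(4) by simp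
 then show ?thesis using P assms(4) by (auto simp: ct_def)
qed

text \<open>The product of the two diagonal entries tends to 0. Inside a component the contents are
  equal, where \<open>phi\<close> is 0 by division by zero, or at least 2 apart; across components
  the hook bound applies.\<close>

lemma tends_qf:
 assumes "valid P" "i \<in> {1..n}" "k \<in> {1..n}" "fst (P i) = fst (P k) ==> \<bar>ct (P i) - ct (P k)\<bar> ~= 1"
 shows "tends (qf (P i) (P k)) 1"
proof (cases "fst (P i) = fst (P k)")
 case True
 show ?thesis
 proof (cases "ct (P i) = ct (P k)")
  case eq: True
  then have "x (P i) = x (P k)" using True by (simp add: x_eq_iff)
  then show ?thesis by (simp add: qf_def phi_def)
 next
  case False
  then have "2 \<le> \<bar>ct (P k) - ct (P i)\<bar>" using assms(4)[OF True] by linarith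
  then show ?thesis using lim_add[OF lim_1 tends_phi_prod[OF True]] by (simp add: qf_def)
 qed
next
 case False
 then have "tends (phi (P i) (P k) * phi (P k) (P i)) 0"
  using tends_phi_prod_pm[of "P i" "P k"] tends_phi_prod_pm[of "P k" "P i"]
   valid_ct_pm[OF assms(1-3) False] by (cases "fst (P i)") (auto simp: mult.commute)
 then show ?thesis using lim_add[OF lim_1] by (force simp: qf_def)
qed

text \<open>Swapping \<open>k\<close> and \<open>k + 1\<close> leads out of the standard fillings
  only if their boxes are adjacent, and then the coefficient of the swap vanishes.\<close>

lemma theta_adj: "B \<in> pre B' ==> theta B B' = 0"
 using pre_ct[of B B'] by (simp add: theta_eq_0_iff qf_adj)

lemma tends_theta:
 assumes "valid P" "i \<in> {1..n}" "k \<in> {1..n}" "fst (P i) = fst (P k) ==> \<bar>ct (P i) - ct (P k)\<bar> ~= 1"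
 shows "tends (theta (P i) (P k)) 1"
 using tends_qf[OF assms] by (simp add: theta_def)

lemma tends_theta_consecutive:
 assumes "valid P" "1 \<le> i" "i < n" "P i \<notin> pre (P (Suc i))"
 shows "tends (theta (P i) (P (Suc i))) 1" "tends (theta (P (Suc i)) (P i)) 1"
proof -
 have *: "fst (P i) = fst (P (Suc i)) ==> \<bar>ct (P (Suc i)) - ct (P i)\<bar> ~= 1"
  using valid_consecutive[OF assms(1-3)] assms(4) by blast
 show "tends (theta (P i) (P (Suc i))) 1" "tends (theta (P (Suc i)) (P i)) 1"
  by (rule tends_theta[OF assms(1)]; use assms * in force)+
qed

lemma valid_sw:
 assumes "valid P" "1 \<le> i" "i < n" "P i \<notin> pre (P (Suc i))" shows "valid (sw i P)"
proof -
 have img: "sw i P ` {1..n} = P ` {1..n}"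
 proof -
  have "transpose i (Suc i) ` {1..n} = {1..n}" using assms by (intro permutes_image permutes_swap_id) auto
  then show ?thesis unfolding sw_def image_comp[symmetric] by simp
 qed
 have "inj_on (sw i P) {1..n}"
  using assms(1) img by (metis eq_card_imp_inj_on finite_atLeastAtMost valid_card diff_Suc_1 card_atLeastAtMost)
 moreover have "pre (sw i P k) \<subseteq> sw i P ` {1..<k}" if k: "k \<in> {1..n}" for k
 proof -
  have old: "pre (P j) \<subseteq> P ` {1..<j}" if "j \<in> {1..n}" for j using assms(1) that by (simp add: valid_def)
  consider "k < i" | "k = i" | "k = Suc i" | "Suc i < k" by linarith
  then show ?thesis
  proof cases
   case 1
   then have "sw i P ` {1..<k} = P ` {1..<k}" by (intro image_cong) (auto simp: sw_apply)
   then show ?thesis using old[OF k] 1 by (simp add: sw_apply)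
  next
   case 2
   have "pre (P (Suc i)) \<subseteq> P ` {1..<Suc i}" using old[of "Suc i"] assms by auto
   also have "\<dots> = insert (P i) (P ` {1..<i})" using assms(2) by (simp add: atLeastLessThanSuc)
   finally have "pre (P (Suc i)) \<subseteq> P ` {1..<i}" using assms(4) by blast
   also have "\<dots> = sw i P ` {1..<i}" by (intro image_cong) (auto simp: sw_apply)
   finally show ?thesis using 2 by (simp add: sw_apply)
  next
   case 3
   have "pre (P i) \<subseteq> P ` {1..<i}" using old[of i] assms by auto
   also have "\<dots> = sw i P ` {1..<i}" by (intro image_cong) (auto simp: sw_apply)
   also have "\<dots> \<subseteq> sw i P ` {1..<Suc i}" by (intro image_mono) auto
   finally show ?thesis using 3 by (simp add: sw_apply)
  next
   case 4
   have "transpose i (Suc i) ` {1..<k} = {1..<k}" using assms 4 by (intro permutes_image permutes_swap_id) auto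
   then have "sw i P ` {1..<k} = P ` {1..<k}" unfolding sw_def image_comp[symmetric] by simp
   then show ?thesis using old[OF k] 4 by (simp add: sw_apply)
  qed
 qed
 moreover have "sw i P k = (True, 0, 0)" if "k \<notin> {1..n}" for k
  using assms that by (auto simp: sw_apply valid_def)
 ultimately show ?thesis by (simp add: valid_def)
qed

lemma finite_valid: "finite {P. valid P}"
proof -
 let ?Bx = "(UNIV :: bool set) \<times> {..n} \<times> {..n}"
 have "{P. valid P} \<subseteq> {P. \<forall>i. (i \<in> {1..n} --> P i \<in> ?Bx) \<and> (i \<notin> {1..n} --> P i = (True, 0, 0))}"
 proof clarify
  fix P i assume P: "valid P"
  show "(i \<in> {1..n} --> P i \<in> ?Bx) \<and> (i \<notin> {1..n} --> P i = (True, 0, 0))"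
  proof (cases "i \<in> {1..n}")
   case True
   obtain e r c where "P i = (e, r, c)" by (cases "P i") auto
   then show ?thesis using valid_hook[OF P True] True by auto
  qed (use P in \<open>auto simp: valid_def\<close>)
 qed
 moreover have "finite \<dots>" by (intro finite_set_of_finite_funs) auto
 ultimately show ?thesis by (rule finite_subset)
qed

end

section \<open>The seminormal representation\<close>

context asymptotic
begin

definition lw :: "nat => 'g K" where
 "lw j = (if j = 0 then E 1 0 else E 0 1)"

lemma lw_inverse: "inverse (lw j) * lw j = 1" "lw j * inverse (lw j) = 1"
 by (simp_all add: lw_def)

text \<open>Functions on tableaux carry the direct sum of all irreducible representations; at
 fillings that are not standard every generator acts by a scalar, so that the Hecke relations
 hold without side conditions.\<close>

definition Rop :: "nat => (tab => 'g K) => tab => 'g K" where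
 "Rop j X P = (if valid P then
    if j = 0 then x (P 1) * X P
    else phi (P j) (P (Suc j)) * X P + theta (P j) (P (Suc j)) * X (sw j P)
   else lw j * X P)"

definition Fop :: "nat => (tab => 'g K) => tab => 'g K" where
 "Fop j X P = phi (P j) (P (Suc j)) * X P + theta (P j) (P (Suc j)) * X (sw j P)"

text \<open>The Jucys-Murphy operators, diagonal in the basis of fillings. The scalar on
  non-standard fillings is the one that \<open>tmul_Suc\<close> produces from
  \<open>lw\<close>.\<close>

definition tmul :: "nat => (tab => 'g K) => tab => 'g K" where
 "tmul k X P = (if valid P then x (P k) * X P else E 1 (2 * (int k - 1)) * X P)"

lemma valid_sw_theta: "valid P ==> 1 \<le> j ==> j < n ==> theta (P j) (P (Suc j)) ~= 0 ==> valid (sw j P)"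
 using valid_sw theta_adj by blast

text \<open>\<open>Fop\<close> drops the case distinction, because \<open>theta\<close> is 0
  whenever \<open>sw j P\<close> is not standard. The relations can then be checked as algebraic
  identities.\<close>

lemma Rop_Fop:
 assumes "\<And>P. valid P ==> X P = Y P" "valid P" "1 \<le> j" "j < n"
 shows "Rop j X P = Fop j Y P"
 using assms valid_sw_theta[OF assms(2-4)]
 by (cases "theta (P j) (P (Suc j)) = 0") (auto simp: Rop_def Fop_def)

lemma valid_first: assumes "valid P" shows "P 1 = (fst (P 1), 0, 0)"
proof -
 have "pre (P 1) \<subseteq> P ` {1..<1}" using assms n_pos unfolding valid_def by force
 then show ?thesis by (cases "P 1") (auto simp: pre_def split: if_splits)
qed

lemma x_first: "valid P ==> x (P 1) = (if fst (P 1) then - E (- 1) 0 else E 1 0)"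
proof -
 assume "valid P"
 then obtain e where "P 1 = (e, 0, 0)" using valid_first by blast
 then show ?thesis by (simp add: x_def ct_def)
qed

lemma Rop_quadratic:
 assumes "j < n"
 shows "Rop j (Rop j X) P = (lw j - inverse (lw j)) * Rop j X P + X P"
proof (cases "valid P")
 case False
 have "lw j * (lw j * X P) = (lw j - inverse (lw j)) * (lw j * X P) + X P" for j
  using lw_inverse[of j] by (simp add: left_diff_distrib flip: mult.assoc)
 with False show ?thesis by (simp add: Rop_def)
next
 case P: True
 show ?thesis
 proof (cases "j = 0")
  case True
  have "x (P 1) * x (P 1) = (lw 0 - inverse (lw 0)) * x (P 1) + 1"
   using x_first[OF P] by (simp add: lw_def E_inverse E_mult algebra_simps)
  then have "x (P 1) * x (P 1) * X P = ((lw 0 - inverse (lw 0)) * x (P 1) + 1) * X P" by simp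
  then show ?thesis using P True by (simp add: Rop_def distrib_right flip: mult.assoc)
 next
  case False
  then have j: "1 \<le> j" "j < n" using assms by auto
  have ne: "x (P j) ~= x (P (Suc j))" using valid_x_neq[OF P, of j "Suc j"] j by auto
  have "Rop j (Rop j X) P = Fop j (Fop j X) P"
   using Rop_Fop[OF _ P j, of "Rop j X" "Fop j X"] Rop_Fop[OF _ _ j, of X X] by blast
  also have "\<dots> = (phi (P j) (P (Suc j)) * phi (P j) (P (Suc j)) + theta (P j) (P (Suc j)) * theta (P (Suc j)) (P j)) * X P
    + theta (P j) (P (Suc j)) * (phi (P j) (P (Suc j)) + phi (P (Suc j)) (P j)) * X (sw j P)"
   by (simp add: Fop_def sw_apply algebra_simps)
  also have "theta (P j) (P (Suc j)) * theta (P (Suc j)) (P j) = qf (P j) (P (Suc j))"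
   using ne by (intro theta_mult) auto
  also have "phi (P j) (P (Suc j)) + phi (P (Suc j)) (P j) = v - inverse v" by (rule phi_sum[OF ne])
  also note phi_quadratic[OF ne]
  also have "((v - inverse v) * phi (P j) (P (Suc j)) + 1) * X P + theta (P j) (P (Suc j)) * (v - inverse v) * X (sw j P)
    = (v - inverse v) * Fop j X P + X P" by (simp add: Fop_def algebra_simps)
  finally show ?thesis using False Rop_Fop[OF refl P j, of X] by (simp add: lw_def)
 qed
qed

lemma tmul_1: "Rop 0 = tmul 1"
 by (auto simp: fun_eq_iff Rop_def tmul_def lw_def)

text \<open>The recursion \<open>T_k X_k T_k = X_{k+1}\<close> of the Jucys-Murphy elements. The
  off-diagonal part cancels because \<open>phi B B' * x B\<close> and \<open>phi B' B * x B'\<close>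
  are opposite.\<close>

lemma tmul_Suc:
 assumes "1 \<le> k" "k < n" shows "Rop k (tmul k (Rop k X)) = tmul (Suc k) X"
proof
 fix P
 show "Rop k (tmul k (Rop k X)) P = tmul (Suc k) X P"
 proof (cases "valid P")
  case False
  then show ?thesis using assms by (simp add: Rop_def tmul_def lw_def E_mult algebra_simps flip: mult.assoc)
 next
  case P: True
  let ?A = "P k" and ?B = "P (Suc k)"
  have ne: "x ?A ~= x ?B" using valid_x_neq[OF P, of k "Suc k"] assms by auto
  have z: "phi ?A ?B * x ?A + phi ?B ?A * x ?B = 0"
  proof -
   have "x ?B * x ?A / (x ?B - x ?A) + x ?A * x ?B / (x ?A - x ?B) = 0"
    using ne by (simp add: divide_simps) (simp add: algebra_simps)
   then have "(v - inverse v) * (x ?B * x ?A / (x ?B - x ?A) + x ?A * x ?B / (x ?A - x ?B)) = 0" by simp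
   then show ?thesis by (simp add: phi_def distrib_left ac_simps)
  qed
  have "Rop k (tmul k (Rop k X)) P = Fop k (\<lambda>P. x (P k) * Fop k X P) P"
   using Rop_Fop[OF _ P assms, of "tmul k (Rop k X)" "\<lambda>P. x (P k) * Fop k X P"] Rop_Fop[OF _ _ assms, of X X]
   by (auto simp: tmul_def)
  also have "\<dots> = (phi ?A ?B * phi ?A ?B * x ?A + (theta ?A ?B * theta ?B ?A) * x ?B) * X P
    + theta ?A ?B * X (sw k P) * (phi ?A ?B * x ?A + phi ?B ?A * x ?B)"
   by (simp add: Fop_def sw_apply algebra_simps)
  also have "theta ?A ?B * theta ?B ?A = qf ?A ?B" using ne by (intro theta_mult) auto
  also have "phi ?A ?B * phi ?A ?B * x ?A + qf ?A ?B * x ?B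
    = phi ?A ?B * (phi ?A ?B * x ?A + phi ?B ?A * x ?B) + x ?B" by (simp add: qf_def algebra_simps)
  finally have "Rop k (tmul k (Rop k X)) P = x ?B * X P" by (simp only: z) simp
  then show ?thesis using P by (simp only: tmul_def) simp
 qed
qed

lemma phi_braid1':
 assumes "x B ~= x B'" "x B ~= x B''" "x B' ~= x B''"
 shows "phi B B' * phi B' B'' + phi B B'' * phi B'' B' = phi B B' * phi B B''"
proof -
 have 1: "phi B' B = v - inverse v - phi B B'" "phi B'' B' = v - inverse v - phi B' B''"
  using phi_sum assms by (metis add_diff_cancel_left')+
 show ?thesis using phi_braid1[OF assms] unfolding 1 by (simp add: algebra_simps)
qed

lemma Rop_commute:
 assumes "Suc i < j" "j < n" shows "Rop i (Rop j X) P = Rop j (Rop i X) P"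
proof (cases "valid P")
 case False
 then show ?thesis by (simp add: Rop_def)
next
 case P: True
 show ?thesis
 proof (cases "i = 0")
  case True
  have 1: "theta (P j) (P (Suc j)) * Rop 0 X (sw j P) = theta (P j) (P (Suc j)) * (x (P 1) * X (sw j P))"
   using valid_sw_theta[OF P _ assms(2)] assms by (auto simp: Rop_def sw_apply)
  have 2: "Rop 0 Y P = x (P 1) * Y P"
   "Rop j Y P = phi (P j) (P (Suc j)) * Y P + theta (P j) (P (Suc j)) * Y (sw j P)" for Y
   using P assms by (simp_all add: Rop_def)
  show ?thesis unfolding True 2 1 by (simp add: algebra_simps)
 next
  case False
  then have i: "1 \<le> i" "i < n" and j: "1 \<le> j" "j < n" using assms by auto
  have com: "sw i (sw j P) = sw j (sw i P)" using assms by (auto simp: fun_eq_iff sw_apply)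
  have "Rop i (Rop j X) P = Fop i (Fop j X) P"
   using Rop_Fop[OF _ P i, of "Rop j X" "Fop j X"] Rop_Fop[OF _ _ j, of X X] by blast
  also have "\<dots> = Fop j (Fop i X) P" using assms com by (simp add: Fop_def sw_apply algebra_simps)
  also have "\<dots> = Rop j (Rop i X) P"
   using Rop_Fop[OF _ P j, of "Rop i X" "Fop i X"] Rop_Fop[OF _ _ i, of X X] by metis
  finally show ?thesis .
 qed
qed

text \<open>Both sides are expanded over the six arrangements of three consecutive entries. The
  coefficients agree by \<open>theta_mult\<close> and the identities for \<open>phi\<close>.\<close>

lemma Rop_braid3:
 assumes "0 < i" "Suc i < n"
 shows "Rop i (Rop (Suc i) (Rop i X)) P = Rop (Suc i) (Rop i (Rop (Suc i) X)) P"
proof (cases "valid P")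
 case False
 then show ?thesis using assms by (simp add: Rop_def lw_def)
next
 case P: True
 let ?j = "Suc i"
 have i: "1 \<le> i" "i < n" and j: "1 \<le> ?j" "?j < n" using assms by auto
 let ?A = "P i" and ?B = "P ?j" and ?C = "P (Suc ?j)"
 have ne: "x ?A ~= x ?B" "x ?A ~= x ?C" "x ?B ~= x ?C"
  using valid_x_neq[OF P, of i ?j] valid_x_neq[OF P, of i "Suc ?j"] valid_x_neq[OF P, of ?j "Suc ?j"] assms by auto
 have l: "Rop i (Rop ?j (Rop i X)) P = Fop i (Fop ?j (Fop i X)) P"
  using Rop_Fop[OF _ P i, of "Rop ?j (Rop i X)" "Fop ?j (Fop i X)"]
   Rop_Fop[OF _ _ j, of "Rop i X" "Fop i X"] Rop_Fop[OF _ _ i, of X X] by blast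
 have r: "Rop ?j (Rop i (Rop ?j X)) P = Fop ?j (Fop i (Fop ?j X)) P"
  using Rop_Fop[OF _ P j, of "Rop i (Rop ?j X)" "Fop i (Fop ?j X)"]
   Rop_Fop[OF _ _ i, of "Rop ?j X" "Fop ?j X"] Rop_Fop[OF _ _ j, of X X] by blast
 have br: "sw i (sw ?j (sw i P)) = sw ?j (sw i (sw ?j P))" by (auto simp: fun_eq_iff sw_apply)
 have th: "theta ?A ?B * theta ?B ?A = qf ?A ?B" "theta ?B ?C * theta ?C ?B = qf ?B ?C"
  using ne by (auto intro: theta_mult)
 have L: "Fop i (Fop ?j (Fop i X)) P =
   (phi ?A ?B * phi ?A ?B * phi ?B ?C + theta ?A ?B * theta ?B ?A * phi ?A ?C) * X P
  + theta ?A ?B * (phi ?A ?B * phi ?B ?C + phi ?A ?C * phi ?B ?A) * X (sw i P)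
  + theta ?B ?C * (phi ?A ?B * phi ?A ?C) * X (sw ?j P)
  + theta ?A ?B * theta ?A ?C * phi ?B ?C * X (sw ?j (sw i P))
  + theta ?B ?C * theta ?A ?C * phi ?A ?B * X (sw i (sw ?j P))
  + theta ?A ?B * theta ?A ?C * theta ?B ?C * X (sw i (sw ?j (sw i P)))"
  by (simp add: Fop_def sw_apply algebra_simps)
 have R: "Fop ?j (Fop i (Fop ?j X)) P =
   (phi ?B ?C * phi ?B ?C * phi ?A ?B + theta ?B ?C * theta ?C ?B * phi ?A ?C) * X P
  + theta ?A ?B * (phi ?B ?C * phi ?A ?C) * X (sw i P)
  + theta ?B ?C * (phi ?A ?B * phi ?B ?C + phi ?A ?C * phi ?C ?B) * X (sw ?j P)
  + theta ?A ?B * theta ?A ?C * phi ?B ?C * X (sw ?j (sw i P))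
  + theta ?B ?C * theta ?A ?C * phi ?A ?B * X (sw i (sw ?j P))
  + theta ?A ?B * theta ?A ?C * theta ?B ?C * X (sw ?j (sw i (sw ?j P)))"
  by (simp add: Fop_def sw_apply algebra_simps)
 show ?thesis
  unfolding l r L R br th phi_braid1[OF ne] phi_braid1'[OF ne] phi_braid2[OF ne] ..
qed

lemma tmul_commute: "tmul i (tmul j X) = tmul j (tmul i X)"
 by (auto simp: tmul_def fun_eq_iff)

lemma braid_Rop: "braid Rop"
 unfolding braid_def
proof (intro conjI allI impI)
 show "Rop i \<circ> Rop j = Rop j \<circ> Rop i" if "Suc i < j \<and> j < n" for i j
  using Rop_commute that by (auto simp: fun_eq_iff)
 show "Rop i \<circ> Rop (Suc i) \<circ> Rop i = Rop (Suc i) \<circ> Rop i \<circ> Rop (Suc i)" if "0 < i \<and> Suc i < n" for i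
  using Rop_braid3 that by (auto simp: fun_eq_iff)
 assume "1 < n"
 \<comment> \<open>The relation of order four says that \<open>Rop 0\<close> commutes with
   \<open>Rop 1 \<circ> Rop 0 \<circ> Rop 1\<close>. These are \<open>tmul 1\<close> and
   \<open>tmul 2\<close>, both diagonal.\<close>
 have "Rop 0 (Rop 1 (Rop 0 (Rop 1 X))) = Rop 1 (Rop 0 (Rop 1 (Rop 0 X)))" for X
  using tmul_Suc[of 1] \<open>1 < n\<close> tmul_commute by (simp add: tmul_1)
 then show "Rop 0 \<circ> Rop 1 \<circ> Rop 0 \<circ> Rop 1 = Rop 1 \<circ> Rop 0 \<circ> Rop 1 \<circ> Rop 0"
  by (simp add: fun_eq_iff)
qed

definition Rw :: "(int => int) => (tab => 'g K) => tab => 'g K" where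
 "Rw = wrep Rop"

lemma Rw_id [simp]: "Rw id X = X"
 by (simp add: Rw_def wrep_id[OF braid_Rop])

lemma Rw_gen: "j < n ==> Rw (gen j) = Rop j"
 by (simp add: Rw_def wrep_gen[OF braid_Rop])

lemma Rw_right:
 "w \<in> W n ==> j < n ==> w (lo j) < w (hi j) ==> Rw (w \<circ> gen j) X = Rw w (Rop j X)"
 by (simp add: Rw_def wrep_right[OF braid_Rop])

lemma Rw_left:
 "w \<in> W n ==> j < n ==> inv w (lo j) < inv w (hi j) ==> Rw (gen j \<circ> w) X = Rop j (Rw w X)"
 by (simp add: Rw_def wrep_left[OF braid_Rop])

lemma Rw_reduced: "reduced js ==> Rw (wprod js) = oprod Rop js"
 by (simp add: Rw_def wrep_eq[OF braid_Rop])

lemma Rw_desc_left: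
 assumes "w \<in> W n" "j < n" "inv w (hi j) < inv w (lo j)"
 shows "Rop j (Rw w X) P = Rw (gen j \<circ> w) X P + (lw j - inverse (lw j)) * Rw w X P"
proof -
 let ?u = "gen j \<circ> w"
 have u: "?u \<in> W n" using assms gen_in_W W_comp by blast
 have "inv ?u = inv w \<circ> gen j" using W_inv_comp[OF gen_in_W[OF assms(2)] assms(1)] by simp
 then have "inv ?u (lo j) < inv ?u (hi j)"
  using assms(3) lo_hi[of j] by (simp add: gen_apply)
 from Rw_left[OF u assms(2) this] have "Rw w X = Rop j (Rw ?u X)" by simp
 then show ?thesis using Rop_quadratic[OF assms(2), of "Rw ?u X" P] by simp
qed

subsection \<open>Linearity, bar, shapes\<close>

lemma Rop_lin: "Rop j (\<lambda>P. c * X P + d * Y P) = (\<lambda>P. c * Rop j X P + d * Rop j Y P)"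
 by (auto simp: Rop_def fun_eq_iff algebra_simps)

lemma Rw_lin: assumes "w \<in> W n" shows "Rw w (\<lambda>P. c * X P + d * Y P) = (\<lambda>P. c * Rw w X P + d * Rw w Y P)"
proof -
 obtain js where js: "reduced js" "wprod js = w" using exists_reduced[OF assms] .
 have "oprod Rop js (\<lambda>P. c * X P + d * Y P) = (\<lambda>P. c * oprod Rop js X P + d * oprod Rop js Y P)"
  by (induction js) (simp_all add: Rop_lin)
 then show ?thesis using Rw_reduced[OF js(1)] js(2) by simp
qed

lemma Rw_scale: "w \<in> W n ==> Rw w (\<lambda>P. c * X P) = (\<lambda>P. c * Rw w X P)"
 using Rw_lin[of w c X 0 X] by simp

lemma Rw_0: "w \<in> W n ==> Rw w (\<lambda>P. 0) = (\<lambda>P. 0)"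
 using Rw_scale[of w 0 "\<lambda>P. 0"] by simp

lemma Rw_sum:
 assumes "w \<in> W n" "finite S"
 shows "Rw w (\<lambda>P. \<Sum>i\<in>S. c i * X i P) = (\<lambda>P. \<Sum>i\<in>S. c i * Rw w (X i) P)"
 using assms(2)
proof (induction S rule: finite_induct)
 case (insert i S)
 then show ?case using Rw_lin[OF assms(1), of "c i" "X i" 1 "\<lambda>P. \<Sum>i\<in>S. c i * X i P"] by simp
qed (simp add: Rw_0[OF assms(1)])

definition kb :: "(tab => 'g K) => tab => 'g K" where "kb X P = kbar (X P)"

lemma kb_kb [simp]: "kb (kb X) = X"
 by (simp add: kb_def fun_eq_iff)

lemma kbar_lw: "kbar (lw j) = inverse (lw j)"
 by (simp add: lw_def E_inverse)

text \<open>Conjugation with the entrywise bar realises the bar involution on operators: by the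
  quadratic relation it turns a generator into its inverse.\<close>

lemma kb_Rop:
 assumes "j < n" shows "kb (Rop j X) P = Rop j (kb X) P - (lw j - inverse (lw j)) * kb X P"
proof (cases "valid P")
 case False
 then show ?thesis by (simp add: kb_def Rop_def kbar_mult kbar_lw algebra_simps)
next
 case P: True
 show ?thesis
 proof (cases "j = 0")
  case True
  have 1: "inverse (x (P 1)) = x (P 1) - (E 1 0 - inverse (E 1 0))"
   using x_first[OF P] by (auto simp: E_inverse inverse_minus_eq)
  have 2: "kb (Rop j X) P = inverse (x (P 1)) * kb X P" "Rop j (kb X) P = x (P 1) * kb X P"
   using P True by (simp_all add: kb_def Rop_def kbar_mult kbar_x)
  have 3: "lw j = E 1 0" using True by (simp add: lw_def)
  show ?thesis unfolding 2 1 3 by (simp add: algebra_simps)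
 next
  case False
  have "x (P j) ~= x (P (Suc j))" using valid_x_neq[OF P, of j "Suc j"] False assms by auto
  then show ?thesis using P False
   by (simp add: kb_def Rop_def kbar_mult kbar_add kbar_phi kbar_theta lw_def algebra_simps)
 qed
qed

lemma Rop_kb_Rop: assumes "j < n" shows "Rop j (kb (Rop j X)) = kb X" "kb (Rop j (kb (Rop j X))) = X"
proof -
 have "kb (Rop j X) = (\<lambda>P. 1 * Rop j (kb X) P + (- (lw j - inverse (lw j))) * kb X P)"
  using kb_Rop[OF assms, of X] by (auto simp: fun_eq_iff algebra_simps)
 then have "Rop j (kb (Rop j X)) = (\<lambda>P. 1 * Rop j (Rop j (kb X)) P + (- (lw j - inverse (lw j))) * Rop j (kb X) P)"
  by (simp only: Rop_lin)
 then show "Rop j (kb (Rop j X)) = kb X"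
  using Rop_quadratic[OF assms, of "kb X"] by (auto simp: fun_eq_iff algebra_simps)
 then show "kb (Rop j (kb (Rop j X))) = X" by simp
qed

lemma Rw_inverse_bar:
 assumes "w \<in> W n"
 shows "Rw (inv w) (kb (Rw w (kb X))) = X" "kb (Rw w (kb (Rw (inv w) X))) = X"
proof -
 obtain js where js: "reduced js" "wprod js = w" using exists_reduced[OF assms] .
 then have w: "is_word n js" by (simp add: reduced_def)
 then have rv: "wprod (rev js) = inv w" using wprod_rev js(2) by simp
 have red: "reduced (rev js)" using js rv len_inv[OF assms] w by (auto simp: reduced_def is_word_def)
 then have R: "Rw (inv w) = oprod Rop (rev js)" "Rw w = oprod Rop js"
  using Rw_reduced[OF red] Rw_reduced[OF js(1)] rv js(2) by simp_all
 have 1: "oprod Rop (rev ks) (kb (oprod Rop ks (kb X))) = X" if "is_word n ks" for ks X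
  using that by (induction ks arbitrary: X) (auto simp: Rop_kb_Rop)
 have 2: "kb (oprod Rop ks (kb (oprod Rop (rev ks) X))) = X" if "is_word n ks" for ks X
  using that
 proof (induction ks arbitrary: X)
  case (Cons k ks)
  have "oprod Rop ks (kb (oprod Rop (rev ks) (Rop k X))) = kb (Rop k X)"
   using Cons by (metis is_word_simps(2) kb_kb)
  then show ?case using Rop_kb_Rop(1)[of k X] Cons.prems by simp
 qed simp
 show "Rw (inv w) (kb (Rw w (kb X))) = X" "kb (Rw w (kb (Rw (inv w) X))) = X"
  unfolding R using 1[OF w] 2[OF w] by blast+
qed

definition shp :: "tab => box set" where "shp P = P ` {1..n}"

lemma shp_sw: "1 \<le> j ==> j < n ==> shp (sw j P) = shp P"
proof -
 assume "1 \<le> j" "j < n"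
 then have "transpose j (Suc j) ` {1..n} = {1..n}" by (intro permutes_image permutes_swap_id) auto
 then show ?thesis unfolding shp_def sw_def image_comp[symmetric] by simp
qed

lemma Rw_induct:
 assumes "w \<in> W n" "Q X" "\<And>j Y. j < n ==> Q Y ==> Q (Rop j Y)"
 shows "Q (Rw w X)"
proof -
 obtain js where js: "reduced js" "wprod js = w" using exists_reduced[OF assms(1)] .
 then have "is_word n js" by (simp add: reduced_def)
 then have "Q (oprod Rop js X)" by (induction js) (simp_all add: assms)
 then show ?thesis using Rw_reduced[OF js(1)] js(2) by simp
qed

text \<open>Functions vanishing on given shapes form a submodule, since generators only exchange
  entries inside a shape.\<close>

lemma Rw_shape:
 assumes "w \<in> W n" "\<And>P. valid P ==> shp P \<in> \<S> ==> X P = 0" "valid P" "shp P \<in> \<S>"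
 shows "Rw w X P = 0"
proof -
 have "\<forall>P. valid P --> shp P \<in> \<S> --> Rw w X P = 0"
 proof (rule Rw_induct[OF assms(1), of "\<lambda>X. \<forall>P. valid P --> shp P \<in> \<S> --> X P = 0"])
  fix j Y assume j: "j < n" and Y: "\<forall>P. valid P --> shp P \<in> \<S> --> Y P = (0 :: 'g K)"
  show "\<forall>P. valid P --> shp P \<in> \<S> --> Rop j Y P = 0"
  proof (intro allI impI)
   fix P assume P: "valid P" "shp P \<in> \<S>"
   show "Rop j Y P = 0"
   proof (cases "j = 0")
    case True then show ?thesis using P Y by (simp add: Rop_def)
   next
    case False
    then have "theta (P j) (P (Suc j)) * Y (sw j P) = 0"
     using valid_sw_theta[OF P(1), of j] shp_sw[of j P] P Y j
     by (cases "theta (P j) (P (Suc j)) = 0") auto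
    then show ?thesis using P Y False by (simp add: Rop_def)
   qed
  qed
 qed (use assms in auto)
 then show ?thesis using assms by blast
qed

definition dl :: "tab => tab => 'g K" where "dl Q P = (if P = Q then 1 else 0)"

subsection \<open>The invariant form\<close>

definition theta' :: "box => box => 'g K" where
 "theta' B B' = (if theta B B' = 0 then 1 else theta B B')"

text \<open>Diagonal of the Gram matrix of an invariant form. Swapping \<open>k\<close> and
  \<open>k + 1\<close> changes only the factor of that pair, which compensates the asymmetry between
  \<open>theta B B'\<close> and \<open>theta B' B\<close>. Vanishing factors are replaced by 1 to
  keep the form nondegenerate.\<close>

definition Dg :: "tab => 'g K" where
 "Dg P = (\<Prod>(i, j)\<in>{(i, j). 1 \<le> i \<and> i < j \<and> j \<le> n}. theta' (P j) (P i))"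

lemma finite_pairs: "finite {(i, j). 1 \<le> i \<and> i < j \<and> j \<le> (m::nat)}"
 by (rule finite_subset[of _ "{1..m} \<times> {1..m}"]) auto

lemma Dg_neq_0 [simp]: "Dg P ~= 0"
 unfolding Dg_def by (subst prod_zero_iff[OF finite_pairs]) (auto simp: theta'_def)

lemma kbar_Dg: "kbar (Dg P) = Dg P"
 unfolding Dg_def kbar_prod by (rule prod.cong) (auto simp: theta'_def kbar_theta)

lemma tends_Dg: assumes "valid P" shows "tends (Dg P) 1"
proof -
 have "tends (theta' (P j) (P i)) 1" if "1 \<le> i" "i < j" "j \<le> n" for i j
 proof (cases "fst (P j) = fst (P i) \<and> \<bar>ct (P j) - ct (P i)\<bar> = 1")
  case True
  then have "qf (P j) (P i) = 0" by (intro qf_adj) auto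
  then show ?thesis by (simp add: theta'_def theta_eq_0_iff)
 next
  case False
  then have "tends (theta (P j) (P i)) 1" using that by (intro tends_theta[OF assms]) auto
  then show ?thesis by (simp add: theta'_def)
 qed
 then have "tends (Dg P) (\<Prod>(i, j)\<in>{(i, j). 1 \<le> i \<and> i < j \<and> j \<le> n}. 1)"
  unfolding Dg_def by (intro lim_prod) auto
 then show ?thesis by (simp add: case_prod_unfold)
qed

lemma Dg_sw:
 assumes P: "valid P" and k: "1 \<le> k" "k < n"
 shows "Dg P * theta (P k) (P (Suc k)) = Dg (sw k P) * theta (P (Suc k)) (P k)"
proof (cases "qf (P k) (P (Suc k)) = 0")
 case True
 then have "theta (P k) (P (Suc k)) = 0" "theta (P (Suc k)) (P k) = 0"
  by (simp_all add: theta_eq_0_iff qf_commute[of "P (Suc k)"])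
 then show ?thesis by simp
next
 case False
 then have nz: "theta (P k) (P (Suc k)) ~= 0" "theta (P (Suc k)) (P k) ~= 0"
  by (simp_all add: theta_eq_0_iff qf_commute[of "P (Suc k)"])
 let ?S = "{(i, j). 1 \<le> i \<and> i < j \<and> j \<le> n}" and ?S' = "{(i, j). 1 \<le> i \<and> i < j \<and> j \<le> n} - {(k, Suc k)}"
 let ?t = "transpose k (Suc k)"
 have S: "?S = insert (k, Suc k) ?S'" using k by auto
 have D: "Dg Q = theta' (Q (Suc k)) (Q k) * (\<Prod>(i, j)\<in>?S'. theta' (Q j) (Q i))" for Q
  unfolding Dg_def by (subst S, subst prod.insert) (use finite_pairs in auto)
 have "(\<Prod>(i, j)\<in>?S'. theta' (sw k P j) (sw k P i)) = (\<Prod>(i, j)\<in>?S'. theta' (P j) (P i))"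
  by (rule prod.reindex_bij_witness[of _ "\<lambda>(i, j). (?t i, ?t j)" "\<lambda>(i, j). (?t i, ?t j)"])
   (use k in \<open>auto simp: sw_def transpose_def split: if_splits\<close>)
 then show ?thesis using nz unfolding D[of P] D[of "sw k P"] by (simp add: sw_apply theta'_def)
qed

definition ip :: "(tab => 'g K) => (tab => 'g K) => 'g K" where
 "ip X Y = (\<Sum>P\<in>{P. valid P}. X P * Y P * Dg P)"

lemma ip_Rop: assumes "j < n" shows "ip (Rop j X) Y = ip X (Rop j Y)"
proof (cases "j = 0")
 case True
 then show ?thesis unfolding ip_def by (intro sum.cong) (simp_all add: Rop_def)
next
 case False
 then have j: "1 \<le> j" "j < n" using assms by auto
 let ?V = "{P. valid P}" and ?S = "{P. valid P \<and> theta (P j) (P (Suc j)) ~= 0}"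
 have sub: "?S \<subseteq> ?V" by auto
 have re: "(\<Sum>P\<in>?V. theta (P j) (P (Suc j)) * X (sw j P) * Y P * Dg P)
   = (\<Sum>P\<in>?V. X P * (theta (P j) (P (Suc j)) * Y (sw j P)) * Dg P)" (is "?l = ?r")
 proof -
  have "?l = (\<Sum>P\<in>?S. theta (P j) (P (Suc j)) * X (sw j P) * Y P * Dg P)"
   by (rule sum.mono_neutral_right[OF finite_valid sub]) auto
  also have "\<dots> = (\<Sum>P\<in>?S. X P * (theta (P j) (P (Suc j)) * Y (sw j P)) * Dg P)"
  proof (rule sum.reindex_bij_witness[of _ "sw j" "sw j"])
   fix P assume "P \<in> ?S"
   then show "sw j P \<in> ?S"
    using valid_sw_theta[OF _ j, of P] theta_eq_0_iff qf_commute by (auto simp: sw_apply)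
   show "X (sw j P) * (theta (sw j P j) (sw j P (Suc j)) * Y (sw j (sw j P))) * Dg (sw j P) =
     theta (P j) (P (Suc j)) * X (sw j P) * Y P * Dg P"
    using Dg_sw[of P j] j \<open>P \<in> ?S\<close> by (simp add: sw_apply ac_simps)
   show "sw j P \<in> ?S" by fact
  qed auto
  also have "\<dots> = ?r" by (rule sum.mono_neutral_left[OF finite_valid sub]) auto
  finally show ?thesis .
 qed
 have "ip (Rop j X) Y = (\<Sum>P\<in>?V. phi (P j) (P (Suc j)) * X P * Y P * Dg P) + ?l"
  unfolding ip_def sum.distrib[symmetric] using False by (intro sum.cong) (simp_all add: Rop_def algebra_simps)
 also have "\<dots> = (\<Sum>P\<in>?V. phi (P j) (P (Suc j)) * X P * Y P * Dg P) + ?r" unfolding re ..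
 also have "\<dots> = ip X (Rop j Y)"
  unfolding ip_def sum.distrib[symmetric] using False by (intro sum.cong) (simp_all add: Rop_def algebra_simps)
 finally show ?thesis .
qed

lemma ip_Rw: assumes "w \<in> W n" shows "ip (Rw w X) Y = ip X (Rw (inv w) Y)"
proof -
 obtain js where js: "reduced js" "wprod js = w" using exists_reduced[OF assms] .
 then have w: "is_word n js" by (simp add: reduced_def)
 then have rv: "wprod (rev js) = inv w" using wprod_rev js(2) by simp
 have red: "reduced (rev js)" using js rv len_inv[OF assms] w by (auto simp: reduced_def is_word_def)
 then have R: "Rw (inv w) = oprod Rop (rev js)" "Rw w = oprod Rop js"
  using Rw_reduced[OF red] Rw_reduced[OF js(1)] rv js(2) by simp_all
 have "ip (oprod Rop ks X) Y = ip X (oprod Rop (rev ks) Y)" if "is_word n ks" for ks Y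
  using that by (induction ks arbitrary: Y) (simp_all add: ip_Rop)
 then show ?thesis unfolding R using w by blast
qed

lemma ip_dl: "valid P ==> ip X (dl P) = X P * Dg P"
 unfolding ip_def dl_def using finite_valid by (simp add: sum.delta if_distrib[of "\<lambda>z. _ * z * _"] cong: if_cong)

text \<open>Self-adjointness of the generators, read on basis vectors. Later it turns operators with
  a prescribed column into operators with a prescribed row.\<close>

lemma Rw_transpose:
 assumes "w \<in> W n" "valid P" "valid Q"
 shows "Rw w (dl Q) P * Dg P = Rw (inv w) (dl P) Q * Dg Q"
proof -
 have c: "ip X Y = ip Y X" for X Y unfolding ip_def by (simp add: mult.commute)
 show ?thesis using ip_Rw[OF assms(1), of "dl Q" "dl P"] ip_dl[OF assms(2), of "Rw w (dl Q)"]
  ip_dl[OF assms(3), of "Rw (inv w) (dl P)"] c by metis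
qed

end

section \<open>Row insertion on row maps\<close>

text \<open>A tableau is recorded by the component and row of each entry. The column is the number
  of smaller entries of that row, so insertion changes the map only at the inserted and the bumped
  entries.\<close>

type_synonym rmap = "nat => (bool \<times> nat) option"

definition cnt :: "rmap => bool \<times> nat => nat => nat" where
 "cnt f l i = card {y \<in> {1..i}. f y = Some l}"

lemma cnt_0 [simp]: "cnt f l 0 = 0"
 by (simp add: cnt_def)

lemma cnt_Suc: "cnt f l (Suc i) = cnt f l i + (if f (Suc i) = Some l then 1 else 0)"
proof -
 have "{y \<in> {1..Suc i}. f y = Some l} = (if f (Suc i) = Some l then insert (Suc i) {y \<in> {1..i}. f y = Some l}
   else {y \<in> {1..i}. f y = Some l})" by (auto simp: le_Suc_eq)
 then show ?thesis by (simp add: cnt_def)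
qed

lemma cnt_pred: "0 < i ==> cnt f l i = cnt f l (i - 1) + (if f i = Some l then 1 else 0)"
 using cnt_Suc[of f l "i - 1"] by simp

lemma cnt_mono: "i \<le> j ==> cnt f l i \<le> cnt f l j"
 by (induction j rule: dec_induct) (simp_all add: cnt_Suc)

lemma cnt_const: "i \<le> j ==> (\<And>z. i < z ==> z \<le> j ==> f z ~= Some l) ==> cnt f l j = cnt f l i"
 by (induction j rule: dec_induct) (simp_all add: cnt_Suc)

lemma cnt_cong: "(\<And>z. 1 \<le> z ==> z \<le> i ==> f z = g z) ==> cnt f l i = cnt g l i"
 by (induction i) (simp_all add: cnt_Suc)

lemma cnt_upd:
 assumes "1 \<le> k"
 shows "cnt (f(k := u)) l i + (if k \<le> i \<and> f k = Some l then 1 else 0)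
    = cnt f l i + (if k \<le> i \<and> u = Some l then 1 else 0)"
 using assms by (induction i) (auto simp: cnt_Suc le_Suc_eq)

lemma cnt_exists: "c < cnt f l i ==> \<exists>j\<in>{1..i}. f j = Some l \<and> cnt f l (j - 1) = c"
proof (induction i)
 case (Suc i)
 show ?case
 proof (cases "c < cnt f l i")
  case True
  then show ?thesis using Suc.IH by force
 next
  case False
  then have "f (Suc i) = Some l" "cnt f l i = c" using Suc.prems by (auto simp: cnt_Suc split: if_splits)
  then show ?thesis by (intro bexI[of _ "Suc i"]) auto
 qed
qed simp

text \<open>The ballot condition: restricted to entries up to \<open>i\<close>, row lengths decrease
  weakly. For row maps it expresses standardness, see \<open>valid_lat\<close> and
  \<open>mk_valid\<close>.\<close>

definition lat :: "rmap => bool" where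
 "lat f \<longleftrightarrow> (\<forall>e r i. cnt f (e, Suc r) i \<le> cnt f (e, r) i)"

text \<open>\<open>Ins e r k f F R\<close>: inserting \<open>k\<close> into row \<open>r\<close> of component \<open>e\<close> of the row map
 \<open>f\<close> gives \<open>F\<close>, with the new box in row \<open>R\<close>. Only values above \<open>k\<close> of \<open>f\<close>, and only
 values from \<open>k\<close> on of \<open>F\<close>, matter.\<close>

inductive Ins :: "bool => nat => nat => rmap => rmap => nat => bool" for e where
 base: "(\<And>y. k < y ==> f y ~= Some (e, r)) ==> F k = Some (e, r) ==>
     (\<And>y. k < y ==> F y = f y) ==> Ins e r k f F r"
| step: "k < y ==> f y = Some (e, r) ==> F k = Some (e, r) ==>
     (\<And>z. k < z ==> z < y ==> f z ~= Some (e, r) \<and> F z = f z) ==>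
     Ins e (Suc r) y f F R ==> Ins e r k f F R"

lemma Ins_row_le: "Ins e r k f F R ==> r \<le> R"
 by (induction rule: Ins.induct) auto

lemma Ins_label: "Ins e r k f F R ==> F k = Some (e, r)"
 by (induction rule: Ins.induct) auto

lemma Ins_cong:
 assumes "Ins e r k f F R" "\<And>y. k < y ==> f y = g y" "\<And>y. k \<le> y ==> F y = G y"
 shows "Ins e r k g G R"
 using assms
proof (induction arbitrary: rule: Ins.induct)
 case (base k f r F)
 then show ?case by (intro Ins.base) (metis less_imp_le order_refl)+
next
 case (step k y f r F R)
 show ?case
 proof (rule Ins.step[of k y])
  show "Ins e (Suc r) y g G R" using step by (intro step.IH) auto
  show "g z ~= Some (e, r) \<and> G z = g z" if "k < z" "z < y" for z
   using step.hyps(4)[OF that] step.prems(1)[OF that(1)] step.prems(2)[of z] that by auto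
 qed (use step in auto)
qed

lemma Ins_total:
 assumes "\<And>y. N < y ==> f y = None" shows "\<exists>F R. Ins e r k f F R \<and> (\<forall>y<k. F y = f y)"
proof (induction "N - k" arbitrary: k r rule: less_induct)
 case less
 show ?case
 proof (cases "\<exists>y>k. f y = Some (e, r)")
  case False
  then have "Ins e r k f (f(k := Some (e, r))) r" by (intro Ins.base) auto
  then show ?thesis by (intro exI[of _ "f(k := Some (e, r))"] exI[of _ r]) auto
 next
  case True
  define y where "y = (LEAST y. k < y \<and> f y = Some (e, r))"
  have y: "k < y" "f y = Some (e, r)" using LeastI_ex[of "\<lambda>y. k < y \<and> f y = Some (e, r)"] True by (auto simp: y_def)
  have nl: "f z ~= Some (e, r)" if "k < z" "z < y" for z
   using not_less_Least[of z "\<lambda>y. k < y \<and> f y = Some (e, r)"] that by (auto simp: y_def)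
  have "y \<le> N" using y(2) assms[of y] by (cases "N < y") auto
  then obtain F R where F: "Ins e (Suc r) y f F R" "\<forall>z<y. F z = f z" using less[of y] y(1) by fastforce
  let ?F = "F(k := Some (e, r))"
  have "Ins e (Suc r) y f ?F R" by (rule Ins_cong[OF F(1)]) (use y in auto)
  then have "Ins e r k f ?F R" using y nl F(2) by (intro Ins.step[of k y]) auto
  then show ?thesis using F(2) y by (intro exI[of _ ?F] exI[of _ R]) auto
 qed
qed

lemma Ins_det:
 "Ins e r k f F R ==> Ins e r k f G S ==> R = S \<and> (\<forall>y\<ge>k. F y = G y)"
proof (induction arbitrary: G S rule: Ins.induct)
 case (base k f r F)
 from base(4) show ?case
 proof (cases rule: Ins.cases)
  case base
  then show ?thesis using base.hyps by (metis le_neq_implies_less)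
 next
  case (step y)
  then show ?thesis using base.hyps(1) by blast
 qed
next
 case (step k y f r F R)
 from step(7) show ?case
 proof (cases rule: Ins.cases)
  case (step y')
  have "\<not> y' < y" using step(1,2) step.hyps(4) by blast
  moreover have "\<not> y < y'" using step(4) step.hyps(1,2) by blast
  ultimately have y: "y' = y" by simp
  then have 1: "R = S \<and> (\<forall>z\<ge>y. F z = G z)" using step(5) step.IH by blast
  have "F z = G z" if kz: "k \<le> z" for z
  proof -
   consider "z = k" | "k < z" "z < y" | "y \<le> z" using kz by linarith
   then show ?thesis
   proof cases
    case 1 then show ?thesis using step(3) step.hyps(3) by simp
   next
    case 2 then show ?thesis using step(4)[of z] step.hyps(4)[of z] y by simp
   next
    case 3 then show ?thesis using 1 by blast
   qed
  qed
  then show ?thesis using 1 by blast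
 next
  case base
  then show ?thesis using step.hyps(1,2) by blast
 qed
qed

text \<open>Reverse bumping is deterministic: once the bumped entry \<open>y\<close> is known, the
  entry that displaced it is the largest one below \<open>y\<close> in the corresponding row of
  \<open>F\<close>.\<close>

lemma Ins_rev_det:
 "Ins e r k f F R ==> Ins e r k' f' F R ==> k = k' \<and> (\<forall>y>k. f y = f' y)"
proof (induction arbitrary: k' f' rule: Ins.induct)
 case (base k f r F)
 from base(4) show ?case
 proof (cases rule: Ins.cases)
  case base
  then have "k = k'" using base.hyps by (metis linorder_neqE_nat)
  then show ?thesis using base base.hyps by auto
 next
  case (step y)
  then show ?thesis using Ins_row_le[OF step(5)] by simp
 qed
next
 case (step k y f r F R)
 from step(7) show ?case
 proof (cases rule: Ins.cases)
  case base
  then show ?thesis using Ins_row_le[OF step(5)] by simp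
 next
  case (step y')
  then have y: "y = y'" "\<forall>z>y. f z = f' z" using step.IH by blast+
  have "k = k'"
  proof (rule ccontr)
   assume "k ~= k'"
   then consider "k < k'" | "k' < k" by linarith
   then show False
   proof cases
    case 1
    then show False using step.hyps(4)[of k'] step y by auto
   next
    case 2
    then show False using step(4)[of k] step.hyps y by auto
   qed
  qed
  then show ?thesis using y step step.hyps by (metis linorder_neqE_nat)
 qed
qed

lemma Ins_dom: "Ins e r k f F R ==> z \<ge> k ==> F z = None \<longleftrightarrow> f z = None \<and> z ~= k"
proof (induction rule: Ins.induct)
 case (base k f r F)
 then show ?case by (cases "z = k") auto
next
 case (step k y f r F R)
 consider "z = k" | "k < z" "z < y" | "y \<le> z" using step.prems by linarith
 then show ?case using step by cases auto
qed

text \<open>\<open>G\<close> is the filling after the part of the insertion from row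
  \<open>r\<close> on, with \<open>k\<close> already moved out of row \<open>r - 1\<close>. The
  bound of row \<open>r\<close> by the old row \<open>r - 1\<close> is the form in which the ballot
  condition passes through the induction: the entry replacing \<open>k\<close> in row
  \<open>r - 1\<close> is smaller and can only raise the counts there.\<close>

lemma Ins_counts:
 assumes "Ins e r k f F R" "lat f" "1 \<le> k" "r = 0 \<and> f k = None \<or> 0 < r \<and> f k = Some (e, r - 1)"
 defines "G \<equiv> \<lambda>y. if y < k then f y else F y"
 shows "(\<forall>s\<ge>r. \<forall>i. cnt G (e, Suc s) i \<le> cnt G (e, s) i) \<and>
   (0 < r --> (\<forall>i. cnt G (e, r) i \<le> cnt f (e, r - 1) i)) \<and>
   (\<forall>l i. fst l ~= e \<or> snd l < r --> cnt G l i + (if k \<le> i \<and> f k = Some l then 1 else 0) = cnt f l i) \<and>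
   (\<forall>l i. k \<le> i \<and> (\<forall>y>i. f y = None) -->
    cnt G l i + (if f k = Some l then 1 else 0) = cnt f l i + (if l = (e, R) then 1 else 0))"
 using assms(1-4) unfolding G_def
proof (induction rule: Ins.induct)
 case (base k f r F)
 have G: "(\<lambda>y. if y < k then f y else F y) = f(k := Some (e, r))"
  using base(2,3) by (auto simp: fun_eq_iff not_less)
 note upd = cnt_upd[of k f "Some (e, r)", OF base.prems(2)]
 \<comment> \<open>\<open>k\<close> itself lies in row \<open>r - 1\<close>, and row
   \<open>r\<close> has no entries from \<open>k\<close> up to \<open>i\<close>, so the count of row
   \<open>r - 1\<close> is ahead by one.\<close>
 have bound: "cnt f (e, r) i + 1 \<le> cnt f (e, r - 1) i" if "0 < r" "k \<le> i" for i
 proof -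
  have fk: "f k = Some (e, r - 1)" using base.prems(3) that by auto
  have "cnt f (e, r) i = cnt f (e, r) (k - 1)"
  proof (rule cnt_const)
   fix z assume "k - 1 < z" "z \<le> i"
   then show "f z ~= Some (e, r)" using base(1)[of z] fk that by (cases "z = k") auto
  qed (use that in simp)
  also have "\<dots> \<le> cnt f (e, r - 1) (k - 1)"
   using base.prems(1) that(1) unfolding lat_def by (metis Suc_pred')
  also have "cnt f (e, r - 1) (k - 1) + 1 = cnt f (e, r - 1) k"
   using cnt_pred[of k f "(e, r - 1)"] base.prems(2) fk by simp
  also have "\<dots> \<le> cnt f (e, r - 1) i" using that by (intro cnt_mono)
  finally show ?thesis by simp
 qed
 have latf: "cnt f (e, Suc s) i \<le> cnt f (e, s) i" for s i using base.prems(1) by (simp add: lat_def)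
 show ?case unfolding G
 proof (intro conjI allI impI)
  fix s i assume "r \<le> s"
  then show "cnt (f(k := Some (e, r))) (e, Suc s) i \<le> cnt (f(k := Some (e, r))) (e, s) i"
   using upd[of "(e, Suc s)" i] upd[of "(e, s)" i] latf[of s i] base.prems(3) by (auto split: if_splits)
 next
  fix i assume "0 < r"
  then show "cnt (f(k := Some (e, r))) (e, r) i \<le> cnt f (e, r - 1) i"
   using upd[of "(e, r)" i] latf[of "r - 1" i] bound[of i] base.prems(3) by (auto split: if_splits)
 next
  fix l :: "bool \<times> nat" and i assume "fst l ~= e \<or> snd l < r"
  then show "cnt (f(k := Some (e, r))) l i + (if k \<le> i \<and> f k = Some l then 1 else 0) = cnt f l i"
   using upd[of l i] by auto
 next
  fix l :: "bool \<times> nat" and i assume "k \<le> i \<and> (\<forall>y>i. f y = None)"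
  then show "cnt (f(k := Some (e, r))) l i + (if f k = Some l then 1 else 0) = cnt f l i + (if l = (e, r) then 1 else 0)"
   using upd[of l i] by (auto split: if_splits)
 qed
next
 case (step k y f r F R)
 let ?G = "\<lambda>z. if z < k then f z else F z" and ?G' = "\<lambda>z. if z < y then f z else F z"
 have G: "?G = ?G'(k := Some (e, r))"
  using step.hyps(1,3,4) by (auto simp: fun_eq_iff not_less)
 have G'k: "?G' k = f k" using step.hyps(1) by simp
 note upd = cnt_upd[of k ?G' "Some (e, r)", OF step.prems(2), folded G, unfolded G'k]
 have p: "1 \<le> y" "Suc r = 0 \<and> f y = None \<or> 0 < Suc r \<and> f y = Some (e, Suc r - 1)"
  using step.prems(2) step.hyps(1,2) by simp_all
 note IHc = step.IH[OF step.prems(1) p]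
 have IH: "\<forall>s\<ge>Suc r. \<forall>i. cnt ?G' (e, Suc s) i \<le> cnt ?G' (e, s) i"
   "\<And>i. cnt ?G' (e, Suc r) i \<le> cnt f (e, r) i"
   "\<And>l i. fst l ~= e \<or> snd l < Suc r ==> cnt ?G' l i + (if y \<le> i \<and> f y = Some l then 1 else 0) = cnt f l i"
   "\<And>l i. y \<le> i ==> (\<forall>z>i. f z = None) ==>
    cnt ?G' l i + (if f y = Some l then 1 else 0) = cnt f l i + (if l = (e, R) then 1 else 0)"
  subgoal using IHc by blast
  subgoal for i using IHc by (metis diff_Suc_1 zero_less_Suc)
  subgoal for l i using IHc by blast
  subgoal for l i using IHc by blast
  done
 have latf: "cnt f (e, Suc s) i \<le> cnt f (e, s) i" for s i using step.prems(1) by (simp add: lat_def)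
 have row: "cnt ?G' (e, r) i + (if y \<le> i then 1 else 0) = cnt f (e, r) i" for i
  using IH(3)[of "(e, r)" i] step.hyps(2) by simp
 have bound: "cnt f (e, r) i + 1 \<le> cnt f (e, r - 1) i" if "0 < r" "k \<le> i" "i < y" for i
 proof -
  have fk: "f k = Some (e, r - 1)" using step.prems(3) that by auto
  have "f z ~= Some (e, r)" if "k - 1 < z" "z \<le> i" for z
   using step.hyps(4)[of z] fk that \<open>i < y\<close> \<open>0 < r\<close> step.prems(2) by (cases "z = k") auto
  then have "cnt f (e, r) i = cnt f (e, r) (k - 1)"
   using that by (intro cnt_const) auto
  also have "\<dots> \<le> cnt f (e, r - 1) (k - 1)"
   using step.prems(1) that(1) unfolding lat_def by (metis Suc_pred')
  also have "cnt f (e, r - 1) (k - 1) + 1 = cnt f (e, r - 1) k"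
   using cnt_pred[of k f "(e, r - 1)"] step.prems(2) fk by simp
  also have "\<dots> \<le> cnt f (e, r - 1) i" using that by (intro cnt_mono)
  finally show ?thesis by simp
 qed
 show ?case
 proof (intro conjI allI impI)
  fix s i assume "r \<le> s"
  then consider "s = r" | "Suc r \<le> s" by linarith
  then show "cnt ?G (e, Suc s) i \<le> cnt ?G (e, s) i"
  proof cases
   case 1
   then show ?thesis using upd[of "(e, Suc s)" i] upd[of "(e, s)" i] IH(2)[of i] row[of i] step.prems(3) step.hyps(1)
    by (auto split: if_splits)
  next
   case 2
   then show ?thesis using upd[of "(e, Suc s)" i] upd[of "(e, s)" i] IH(1) step.prems(3)
    by (auto split: if_splits)
  qed
 next
  fix i assume "0 < r"
  then show "cnt ?G (e, r) i \<le> cnt f (e, r - 1) i"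
   using upd[of "(e, r)" i] row[of i] latf[of "r - 1" i] bound[of i] step.prems(3) step.hyps(1) by (auto split: if_splits)
 next
  fix l :: "bool \<times> nat" and i assume l: "fst l ~= e \<or> snd l < r"
  then show "cnt ?G l i + (if k \<le> i \<and> f k = Some l then 1 else 0) = cnt f l i"
   using upd[of l i] IH(3)[of l i] step.hyps(2) by (auto split: if_splits)
 next
  fix l :: "bool \<times> nat" and i assume i: "k \<le> i \<and> (\<forall>z>i. f z = None)"
  then have "y \<le> i" using step.hyps(2) by (metis not_le option.distinct(1))
  then show "cnt ?G l i + (if f k = Some l then 1 else 0) = cnt f l i + (if l = (e, R) then 1 else 0)"
   using upd[of l i] IH(4)[of i l] i step.hyps(2) by (auto split: if_splits)
 qed
qed

lemma Ins_lat:
 assumes I: "Ins e 0 k f F R" "\<And>y. y < k ==> F y = f y" and f: "lat f" "f k = None" and k: "1 \<le> k"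
 shows "lat F" "\<And>l i. k \<le> i ==> (\<forall>y>i. f y = None) ==> cnt F l i = cnt f l i + (if l = (e, R) then 1 else 0)"
proof -
 have G: "(\<lambda>y. if y < k then f y else F y) = F" using I(2) by auto
 note c = Ins_counts[OF I(1) f(1) k, unfolded G]
 show "lat F" unfolding lat_def
 proof (intro allI)
  fix e' r i
  show "cnt F (e', Suc r) i \<le> cnt F (e', r) i"
  proof (cases "e' = e")
   case True
   then show ?thesis using c f(2) by simp
  next
   case False
   then have "cnt F (e', s) i = cnt f (e', s) i" for s using c f(2) by simp
   then show ?thesis using f(1) by (simp add: lat_def)
  qed
 qed
 show "cnt F l i = cnt f l i + (if l = (e, R) then 1 else 0)" if "k \<le> i" "\<forall>y>i. f y = None" for l i
 proof -
  have "cnt F l i + (if f k = Some l then 1 else 0) = cnt f l i + (if l = (e, R) then 1 else 0)"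
   using c f(2) that by blast
  then show ?thesis using f(2) by simp
 qed
qed

text \<open>Reverse bumping from the corner in row \<open>R\<close>. After climbing \<open>d\<close>
  rows, \<open>y\<close> is the entry taken out of row \<open>R - d\<close>; the next one is the
  largest smaller entry of the row above, which exists by the ballot condition.\<close>

lemma Ins_reverse:
 assumes F: "lat F" "\<And>y. M < y ==> F y = None" "F 0 = None"
  and c: "0 < cnt F (e, R) M" "cnt F (e, Suc R) M < cnt F (e, R) M"
 shows "\<exists>k f. 1 \<le> k \<and> Ins e 0 k f F R \<and> (\<forall>y<k. F y = f y) \<and> f k = None \<and> lat f"
proof -
 have latF: "cnt F (e', Suc s) i \<le> cnt F (e', s) i" for e' s i using F(1) by (simp add: lat_def)
 have ge1: "1 \<le> y" if "F y = Some l" for y l using F(3) that by (cases y) auto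
 have "\<exists>y g. F y = Some (e, R - d) \<and> g y = None \<and> (\<forall>z<y. g z = F z) \<and> Ins e (R - d) y g F R \<and>
   (\<forall>s\<ge>R - d. \<forall>i. cnt g (e, Suc s) i \<le> cnt g (e, s) i) \<and> (\<forall>i. cnt g (e, R - d) i \<le> cnt F (e, R - d) i) \<and>
   (\<forall>l i. fst l ~= e \<or> snd l < R - d --> cnt g l i = cnt F l i)" if "d \<le> R" for d
  using that
 proof (induction d)
  case 0
  define y where "y = Max {y \<in> {1..M}. F y = Some (e, R)}"
  have ne: "{y \<in> {1..M}. F y = Some (e, R)} ~= {}" using c(1) unfolding cnt_def by (metis card.empty less_irrefl)
  have y: "y \<in> {1..M}" "F y = Some (e, R)" using Max_in[OF _ ne] by (auto simp: y_def)
  have nl: "F z ~= Some (e, R)" if "y < z" for z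
  proof
   assume Fz: "F z = Some (e, R)"
   then have "z \<in> {1..M}" using F(2)[of z] that by (cases "M < z") auto
   then have "z \<le> y" unfolding y_def using Fz by (intro Max_ge) auto
   then show False using that by simp
  qed
  let ?g = "F(y := None)"
  note upd = cnt_upd[of y F None, simplified]
  have bound: "cnt F (e, Suc R) i + 1 \<le> cnt F (e, R) i" if "y \<le> i" for i
  proof -
   have "cnt F l i \<le> cnt F l M" for l
   proof (cases "i \<le> M")
    case False
    then have "cnt F l i = cnt F l M" using F(2) by (intro cnt_const) auto
    then show ?thesis by simp
   qed (rule cnt_mono)
   moreover have "cnt F (e, R) i = cnt F (e, R) y" "cnt F (e, R) M = cnt F (e, R) y"
    using nl that y by (auto intro!: cnt_const)
   ultimately show ?thesis using c(2) by (metis Suc_eq_plus1 Suc_leI le_less_trans)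
  qed
  have "Ins e R y ?g F R" using nl y by (intro Ins.base) auto
  moreover have "cnt ?g (e, Suc s) i \<le> cnt ?g (e, s) i" if "R \<le> s" for s i
   using upd[of "(e, Suc s)" i] upd[of "(e, s)" i] y latF[of e s i] bound[of i] that
   by (cases "s = R") (auto split: if_splits)
  moreover have "cnt ?g l i \<le> cnt F l i" for l i using upd[of l i] y by auto
  moreover have "cnt ?g l i = cnt F l i" if "fst l ~= e \<or> snd l < R" for l i
   using upd[of l i] y that by (cases "l = (e, R)") auto
  moreover have "F y = Some (e, R - 0)" "?g y = None" "\<forall>z<y. ?g z = F z" using y by simp_all
  ultimately show ?case unfolding diff_zero by blast
 next
  case (Suc d)
  then obtain y g where y: "F y = Some (e, R - d)" "g y = None" "\<forall>z<y. g z = F z" "Ins e (R - d) y g F R"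
   "\<forall>s\<ge>R - d. \<forall>i. cnt g (e, Suc s) i \<le> cnt g (e, s) i" "\<forall>i. cnt g (e, R - d) i \<le> cnt F (e, R - d) i"
   "\<forall>l i. fst l ~= e \<or> snd l < R - d --> cnt g l i = cnt F l i" by fastforce
  define r where "r = R - Suc d"
  have r: "R - d = Suc r" "R - Suc d = r" using Suc.prems by (auto simp: r_def)
  note y = y[unfolded r]
  have y1: "1 \<le> y" using ge1 y(1) by blast
  have "cnt F (e, Suc r) y \<ge> 1" using cnt_pred[of y F "(e, Suc r)"] y(1) y1 by simp
  then have cr: "1 \<le> cnt F (e, r) y" using latF[of e r y] by simp
  define y' where "y' = Max {z \<in> {1..y}. F z = Some (e, r)}"
  have ne: "{z \<in> {1..y}. F z = Some (e, r)} ~= {}" using cr unfolding cnt_def by (metis card.empty not_one_le_zero)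
  have y': "y' \<in> {1..y}" "F y' = Some (e, r)" using Max_in[OF _ ne] by (auto simp: y'_def)
  have lt: "y' < y" using y' y(1) by (cases "y' = y") auto
  have nl: "F z ~= Some (e, r)" if "y' < z" "z \<le> y" for z
  proof
   assume "F z = Some (e, r)"
   then have "z \<le> y'" unfolding y'_def using that by (intro Max_ge) auto
   then show False using that by simp
  qed
  let ?h = "g(y := Some (e, r))" and ?g = "g(y := Some (e, r), y' := None)"
  have gy': "?h y' = Some (e, r)" using lt y(3) y' by simp
  have y'1: "1 \<le> y'" using y' by simp
  note upd1 = cnt_upd[of y g "Some (e, r)", OF y1, unfolded y(2), simplified]
  note upd2 = cnt_upd[of y' ?h None, OF y'1, unfolded gy', simplified]
  have c': "cnt ?g l i + (if y' \<le> i \<and> l = (e, r) then 1 else 0) = cnt g l i + (if y \<le> i \<and> l = (e, r) then 1 else 0)" for l i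
   using upd1[of l i] upd2[of l i] by (auto split: if_splits)
  have "Ins e (Suc r) y ?g F R" by (rule Ins_cong[OF y(4)]) (use lt in auto)
  then have ins: "Ins e r y' ?g F R"
   using lt y' y(3) nl by (intro Ins.step[of y' y]) auto
  have row: "cnt g (e, r) i = cnt F (e, r) i" for i using y(7) by simp
  have bound: "cnt g (e, Suc r) i + 1 \<le> cnt F (e, r) i" if "y' \<le> i" "i < y" for i
  proof -
   have "cnt g (e, Suc r) i = cnt F (e, Suc r) i" using y(3) that by (intro cnt_cong) auto
   also have "\<dots> + 1 \<le> cnt F (e, Suc r) y"
    using cnt_mono[of i "y - 1" F "(e, Suc r)"] cnt_pred[of y F "(e, Suc r)"] y(1) y1 that by simp
   also have "\<dots> \<le> cnt F (e, r) y" by (rule latF)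
   also have "\<dots> = cnt F (e, r) i" using nl that by (intro cnt_const) auto
   finally show ?thesis by simp
  qed
  have le: "cnt g (e, Suc r) i \<le> cnt F (e, r) i" for i using y(6) latF[of e r i] by (metis le_trans)
  have "cnt ?g (e, Suc s) i \<le> cnt ?g (e, s) i" if "r \<le> s" for s i
  proof (cases "s = r")
   case True
   then show ?thesis using c'[of "(e, Suc r)" i] c'[of "(e, r)" i] row[of i] bound[of i] le[of i] lt
    by (auto split: if_splits)
  next
   case False
   then have "Suc r \<le> s" using that by simp
   then show ?thesis using c'[of "(e, Suc s)" i] c'[of "(e, s)" i] y(5) by auto
  qed
  moreover have "cnt ?g (e, r) i \<le> cnt F (e, r) i" for i
   using c'[of "(e, r)" i] row[of i] lt by (auto split: if_splits)
  moreover have "cnt ?g l i = cnt F l i" if "fst l ~= e \<or> snd l < r" for l i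
  proof -
   have "cnt g l i = cnt F l i" using y(7) that by (metis less_SucI)
   then show ?thesis using c'[of l i] that by (cases "l = (e, r)") auto
  qed
  moreover have "?g y' = None" "\<forall>z<y'. ?g z = F z" using lt y(3) by auto
  ultimately show ?case unfolding r using y'(2) ins by blast
 qed
 from this[of R] obtain k f where kf: "F k = Some (e, 0)" "f k = None" "\<forall>z<k. f z = F z" "Ins e 0 k f F R"
   "\<forall>s i. cnt f (e, Suc s) i \<le> cnt f (e, s) i" "\<forall>l i. fst l ~= e --> cnt f l i = cnt F l i"
  by auto
 have "lat f" unfolding lat_def
 proof (intro allI)
  fix e' s i show "cnt f (e', Suc s) i \<le> cnt f (e', s) i"
   using kf(5,6) latF[of e' s i] by (cases "e' = e") auto
 qed
 then show ?thesis using kf ge1 by (intro exI[of _ k] exI[of _ f]) auto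
qed

text \<open>Insertion depends only on the relative order of the entries, and exchanging
  \<open>j\<close> with \<open>j + 1\<close> preserves this order when they do not both
  occur.\<close>

lemma Ins_swap:
 assumes "Ins e r k f F R" "\<not> (j \<in> D \<and> Suc j \<in> D)" "k \<in> D" "\<And>z. z \<notin> D ==> f z = None \<and> F z = None"
 defines "s \<equiv> transpose j (Suc j)"
 shows "Ins e r (s k) (f \<circ> s) (F \<circ> s) R"
proof -
 have ss: "s (s y) = y" for y by (simp add: s_def)
 have mono: "s y < s z \<longleftrightarrow> y < z" if "y \<in> D" "z \<in> D" for y z
  using assms(2) that by (auto simp: s_def transpose_def)
 show ?thesis using assms(1,3,4)
 proof (induction rule: Ins.induct)
  case (base k f r F)
  show ?case
  proof (rule Ins.base)
   fix y assume "s k < y"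
   then have "s y \<in> D ==> k < s y" using mono[OF base(4), of "s y"] ss by simp
   then show "(f \<circ> s) y ~= Some (e, r)" "(F \<circ> s) y = (f \<circ> s) y"
    using base by (cases "s y \<in> D"; auto)+
  qed (simp add: ss base)
 next
  case (step k y f r F R)
  have y: "y \<in> D" using step.hyps(2) step.prems(2) by force
  show ?case
  proof (rule Ins.step[of _ "s y"])
   show "s k < s y" using mono step y by simp
   show "Ins e (Suc r) (s y) (f \<circ> s) (F \<circ> s) R" using step.IH[OF y step.prems(2)] by blast
   fix z assume z: "s k < z" "z < s y"
   then have "s z \<in> D ==> k < s z \<and> s z < y" using mono[OF step.prems(1), of "s z"] mono[OF _ y, of "s z"] ss by simp
   then show "(f \<circ> s) z ~= Some (e, r) \<and> (F \<circ> s) z = (f \<circ> s) z"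
    using step by (cases "s z \<in> D") auto
  qed (simp_all add: ss step)
 qed
qed

subsection \<open>The correspondence\<close>

definition insert1 :: "bool => nat => rmap => rmap \<times> nat" where
 "insert1 e k f = (SOME FR. Ins e 0 k f (fst FR) (snd FR) \<and> (\<forall>y<k. fst FR y = f y))"

lemma insert1_eq:
 assumes "Ins e 0 k f F R" "\<And>y. y < k ==> F y = f y" shows "insert1 e k f = (F, R)"
 unfolding insert1_def
proof (rule some_equality)
 fix FR assume FR: "Ins e 0 k f (fst FR) (snd FR) \<and> (\<forall>y<k. fst FR y = f y)"
 then have "snd FR = R" "\<forall>y\<ge>k. fst FR y = F y" using Ins_det[OF _ assms(1)] by blast+
 then show "FR = (F, R)" using FR assms(2) by (metis ext not_le prod.collapse)
qed (use assms in auto)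

lemma insert1_Ins:
 assumes "\<And>y. N < y ==> f y = None"
 shows "Ins e 0 k f (fst (insert1 e k f)) (snd (insert1 e k f))" "\<And>y. y < k ==> fst (insert1 e k f) y = f y"
 using Ins_total[of N f e 0 k, OF assms] insert1_eq[of e k f] by force+

text \<open>Both insertions run in one row map; the sign of the letter selects the
  component.\<close>

fun rsP :: "(int => int) => nat => rmap" where
 "rsP u 0 = (\<lambda>_. None)"
| "rsP u (Suc m) = fst (insert1 (0 < u (int (Suc m))) (nat \<bar>u (int (Suc m))\<bar>) (rsP u m))"

definition rsQ :: "(int => int) => nat => bool \<times> nat" where
 "rsQ u m = (0 < u (int m), snd (insert1 (0 < u (int m)) (nat \<bar>u (int m)\<bar>) (rsP u (m - 1))))"

definition Qmap :: "(int => int) => nat => rmap" where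
 "Qmap u m i = (if i \<in> {1..m} then Some (rsQ u i) else None)"

abbreviation au :: "(int => int) => nat => nat" where "au u i \<equiv> nat \<bar>u (int i)\<bar>"

definition good_word :: "(int => int) => nat => bool" where
 "good_word u m \<longleftrightarrow> inj_on (au u) {1..m} \<and> (\<forall>i\<in>{1..m}. u (int i) ~= 0)"

lemma good_word_Suc:
 "good_word u (Suc m) \<longleftrightarrow> good_word u m \<and> u (int (Suc m)) ~= 0 \<and> au u (Suc m) \<notin> au u ` {1..m}"
proof -
 have "{1..Suc m} = insert (Suc m) {1..m}" "{1..m} - {Suc m} = {1..m}" by auto
 then show ?thesis unfolding good_word_def by (simp only: inj_on_insert ball_simps) auto
qed

lemma rsP_cong: "(\<And>i. i \<in> {1..m} ==> u (int i) = u' (int i)) ==> rsP u m = rsP u' m"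
proof (induction m)
 case (Suc m)
 have "u (int (Suc m)) = u' (int (Suc m))" using Suc.prems[of "Suc m"] by simp
 moreover have "rsP u m = rsP u' m" using Suc by simp
 ultimately show ?case unfolding rsP.simps by simp
qed simp

text \<open>The parts are proved together: the domain shows that the next letter is new, the ballot
  condition is passed on by \<open>Ins_lat\<close>, and the counts equate the shapes of the
  insertion and the recording tableau.\<close>

lemma rsP_main:
 assumes "good_word u m"
 shows "(\<forall>y. rsP u m y = None \<longleftrightarrow> y \<notin> au u ` {1..m}) \<and> lat (rsP u m) \<and>
  (\<forall>l i. (\<forall>y\<in>au u ` {1..m}. y \<le> i) --> cnt (rsP u m) l i = cnt (Qmap u m) l m)"
 using assms
proof (induction m)
 case 0
 then show ?case by (simp add: lat_def cnt_def)
next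
 case (Suc m)
 let ?f = "rsP u m" and ?k = "au u (Suc m)" and ?e = "0 < u (int (Suc m))"
 have gw: "good_word u m" "u (int (Suc m)) ~= 0" "?k \<notin> au u ` {1..m}" using Suc.prems good_word_Suc by blast+
 note IH = Suc.IH[OF gw(1)]
 have fin: "finite (au u ` {1..m})" by simp
 obtain N where N: "\<forall>y\<in>au u ` {1..m}. y \<le> N" using finite_nat_set_iff_bounded_le[of "au u ` {1..m}"] by blast
 then have f: "?f y = None" if "N < y" for y using IH that by (meson not_le)
 define F where "F = fst (insert1 ?e ?k ?f)"
 define R where "R = snd (insert1 ?e ?k ?f)"
 have F: "Ins ?e 0 ?k ?f F R" "\<And>y. y < ?k ==> F y = ?f y"
  unfolding F_def R_def using insert1_Ins[of N ?f] f by blast+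
 have PF: "rsP u (Suc m) = F" by (simp add: F_def)
 have k: "?f ?k = None" "1 \<le> ?k" using IH gw by auto
 have dom: "F y = None \<longleftrightarrow> y \<notin> au u ` {1..Suc m}" for y
 proof -
  have "au u ` {1..Suc m} = insert ?k (au u ` {1..m})" by (simp add: atLeastAtMostSuc_conv)
  then show ?thesis using Ins_dom[OF F(1), of y] F(2)[of y] IH by (cases "y < ?k") auto
 qed
 note L = Ins_lat[OF F conjunct1[OF conjunct2[OF IH]] k]
 have "lat F" by (rule L(1))
 moreover have "cnt F l i = cnt (Qmap u (Suc m)) l (Suc m)" if i: "\<forall>y\<in>au u ` {1..Suc m}. y \<le> i" for l i
 proof -
  have sub: "au u ` {1..m} \<subseteq> au u ` {1..Suc m}" by (intro image_mono) auto
  then have "\<forall>y>i. ?f y = None" using IH i by (meson not_le subsetD)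
  moreover have "?k \<le> i" by (rule bspec[OF i], rule image_eqI[of _ _ "Suc m"]) simp_all
  ultimately have "cnt F l i = cnt ?f l i + (if l = (?e, R) then 1 else 0)"
   by (intro L(2))
  also have "\<forall>y\<in>au u ` {1..m}. y \<le> i" using i sub by blast
  then have "cnt ?f l i = cnt (Qmap u m) l m" using conjunct2[OF conjunct2[OF IH]] by blast
  also have "cnt (Qmap u m) l m = cnt (Qmap u (Suc m)) l m" by (intro cnt_cong) (simp add: Qmap_def)
  also have "\<dots> + (if l = (?e, R) then 1 else 0) = cnt (Qmap u (Suc m)) l (Suc m)"
   by (auto simp: cnt_Suc Qmap_def rsQ_def R_def)
  finally show ?thesis .
 qed
 ultimately show ?case unfolding PF using dom by blast
qed

lemma rsP_Ins:
 assumes "good_word u (Suc m)"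
 shows "Ins (0 < u (int (Suc m))) 0 (au u (Suc m)) (rsP u m) (rsP u (Suc m)) (snd (rsQ u (Suc m)))"
  "\<And>y. y < au u (Suc m) ==> rsP u (Suc m) y = rsP u m y"
proof -
 obtain N where N: "\<forall>y\<in>au u ` {1..m}. y \<le> N" using finite_nat_set_iff_bounded_le[of "au u ` {1..m}"] by blast
 have "rsP u m y = None" if "N < y" for y
  using rsP_main[of u m] assms good_word_Suc N that by (meson not_le)
 from insert1_Ins[of N "rsP u m", OF this]
 show "Ins (0 < u (int (Suc m))) 0 (au u (Suc m)) (rsP u m) (rsP u (Suc m)) (snd (rsQ u (Suc m)))"
  "\<And>y. y < au u (Suc m) ==> rsP u (Suc m) y = rsP u m y" by (simp_all add: rsQ_def)
qed

text \<open>Counts in the recording map up to \<open>i\<close> are row lengths of the insertion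
  tableau after \<open>i\<close> letters, to which the ballot condition applies.\<close>

lemma Qmap_lat: assumes "good_word u m" shows "lat (Qmap u m)"
 unfolding lat_def
proof (intro allI)
 fix e r i
 have small: "cnt (Qmap u m) (e, Suc r) i \<le> cnt (Qmap u m) (e, r) i" if "i \<le> m" for i
 proof -
  have gw: "good_word u i" using assms that unfolding good_word_def by (auto intro: inj_on_subset)
  obtain N where N: "\<forall>y\<in>au u ` {1..i}. y \<le> N" using finite_nat_set_iff_bounded_le[of "au u ` {1..i}"] by blast
  have "cnt (Qmap u m) l i = cnt (Qmap u i) l i" for l
   using that by (intro cnt_cong) (simp add: Qmap_def)
  also have "\<dots> l = cnt (rsP u i) l N" for l using rsP_main[OF gw] N by metis
  finally show ?thesis using rsP_main[OF gw] by (simp add: lat_def)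
 qed
 show "cnt (Qmap u m) (e, Suc r) i \<le> cnt (Qmap u m) (e, r) i"
 proof (cases "i \<le> m")
  case False
  then have "cnt (Qmap u m) l i = cnt (Qmap u m) l m" for l
   by (intro cnt_const) (auto simp: Qmap_def)
  then show ?thesis using small[of m] by simp
 qed (rule small)
qed

text \<open>The last label gives the row of the last new box, and reverse bumping from there
  recovers the last letter and the previous tableau.\<close>

lemma rs_inj:
 assumes "good_word u m" "good_word u' m" "rsP u m = rsP u' m" "Qmap u m = Qmap u' m" "i \<in> {1..m}"
 shows "u (int i) = u' (int i)"
 using assms
proof (induction m arbitrary: i)
 case (Suc m)
 have q: "rsQ u j = rsQ u' j" if "j \<in> {1..Suc m}" for j
  using fun_cong[OF Suc.prems(4), of j] that by (simp add: Qmap_def)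
 then have sg: "(0 < u (int (Suc m))) = (0 < u' (int (Suc m)))" "snd (rsQ u (Suc m)) = snd (rsQ u' (Suc m))"
  using arg_cong[OF q[of "Suc m"], of fst] arg_cong[OF q[of "Suc m"], of snd]
  by (simp add: rsQ_def, simp)
 note I = rsP_Ins[OF Suc.prems(1)] and I' = rsP_Ins[OF Suc.prems(2)]
 have k: "au u (Suc m) = au u' (Suc m)" "\<forall>y>au u (Suc m). rsP u m y = rsP u' m y"
  using Ins_rev_det[OF I(1), of "au u' (Suc m)" "rsP u' m"] I'(1)
  unfolding sg(1)[symmetric] sg(2)[symmetric] Suc.prems(3)[symmetric] by blast+
 have gw: "good_word u m" "good_word u' m" using Suc.prems good_word_Suc by blast+
 have "rsP u m y = rsP u' m y" for y
 proof -
  consider "y < au u (Suc m)" | "y = au u (Suc m)" | "au u (Suc m) < y" by linarith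
  then show ?thesis
  proof cases
   case 1
   then show ?thesis using I(2) I'(2) k(1) Suc.prems(3) by metis
  next
   case 2
   then have "rsP u m y = None" "rsP u' m y = None"
    using rsP_main[OF gw(1)] rsP_main[OF gw(2)] Suc.prems(1,2) k(1) by (metis good_word_Suc)+
   then show ?thesis by simp
  qed (use k in auto)
 qed
 moreover have "Qmap u m = Qmap u' m" using q by (auto simp: Qmap_def fun_eq_iff)
 ultimately have IH: "u (int j) = u' (int j)" if "j \<in> {1..m}" for j
  using Suc.IH[OF gw] that by blast
 show ?case
 proof (cases "i = Suc m")
  case True
  have "u (int (Suc m)) ~= 0" "u' (int (Suc m)) ~= 0" using Suc.prems good_word_Suc by blast+
  then show ?thesis using k(1) sg(1) unfolding True by (simp add: abs_if split: if_splits)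
 next
  case False
  then show ?thesis using IH Suc.prems by simp
 qed
qed simp

text \<open>Induction on \<open>m\<close>: the last label of \<open>G\<close> names a corner of
  \<open>F\<close>, reverse bumping from it yields the last letter, and the component of the corner
  yields its sign.\<close>

lemma rs_surj:
 assumes "lat F" "finite {y. F y ~= None}" "F 0 = None" "card {y. F y ~= None} = m"
  and "lat G" "\<And>i. G i = None \<longleftrightarrow> i \<notin> {1..m}"
  and "\<And>l i. (\<forall>y. F y ~= None --> y \<le> i) ==> cnt F l i = cnt G l m"
 shows "\<exists>u. good_word u m \<and> rsP u m = F \<and> Qmap u m = G"
 using assms
proof (induction m arbitrary: F G)
 case 0
 then have "{y. F y ~= None} = {}" by simp
 then have "F = (\<lambda>_. None)" by blast
 moreover have "G = (\<lambda>_. None)" using 0 by (auto simp: fun_eq_iff)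
 ultimately show ?case by (intro exI[of _ id]) (auto simp: good_word_def Qmap_def fun_eq_iff)
next
 case (Suc m)
 obtain e R where GR: "G (Suc m) = Some (e, R)" using Suc.prems(6)[of "Suc m"] by auto
 obtain M where M: "\<forall>y. F y ~= None --> y \<le> M"
  using finite_nat_set_iff_bounded_le[of "{y. F y ~= None}"] Suc.prems(2) by auto
 have FN: "F y = None" if "M < y" for y using M that by (meson not_le)
 have cF: "cnt F l M = cnt G l (Suc m)" for l using Suc.prems(7)[OF M] .
 have c1: "0 < cnt F (e, R) M" unfolding cF by (simp add: cnt_Suc GR)
 have c2: "cnt F (e, Suc R) M < cnt F (e, R) M"
  unfolding cF using Suc.prems(5) by (simp add: cnt_Suc GR lat_def less_Suc_eq_le)
 obtain k f where kf: "1 \<le> k" "Ins e 0 k f F R" "\<forall>y<k. F y = f y" "f k = None" "lat f"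
  using Ins_reverse[OF Suc.prems(1) FN Suc.prems(3) c1 c2] by blast
 have domF: "F y = None \<longleftrightarrow> f y = None \<and> y ~= k" for y
  using Ins_dom[OF kf(2), of y] kf(3) by (cases "y < k") auto
 then have dom: "{y. F y ~= None} = insert k {y. f y ~= None}" by auto
 have fin: "finite {y. f y ~= None}" using Suc.prems(2) unfolding dom by simp
 have card: "card {y. f y ~= None} = m" using Suc.prems(4) unfolding dom using fin kf(4) by simp
 have GN: "G z = None" if "Suc m < z" for z using Suc.prems(6)[of z] that by simp
 let ?G = "\<lambda>i. if i = Suc m then None else G i"
 have cG: "cnt ?G l i = cnt G l (min i m)" for l i
 proof (cases "i \<le> m")
  case True
  then show ?thesis by (simp add: min_def) (intro cnt_cong, auto)
 next
  case False
  have "?G z ~= Some l" if "m < z" for z using GN[of z] that by (cases "z = Suc m") auto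
  then have "cnt ?G l i = cnt ?G l m" using False by (intro cnt_const) auto
  also have "\<dots> = cnt G l m" by (intro cnt_cong) auto
  finally show ?thesis using False by simp
 qed
 have "lat ?G" using Suc.prems(5) by (simp add: lat_def cG)
 moreover have "cnt f l i = cnt ?G l m" if i: "\<forall>y. f y ~= None --> y \<le> i" for l i
 proof -
  let ?i = "max i (max k M)"
  have fi: "\<forall>y>?i. f y = None" using i by (meson max.strict_boundedE not_le)
  have Fi: "\<forall>y. F y ~= None --> y \<le> ?i" using M by (meson le_max_iff_disj)
  have "f z ~= Some l" if z: "i < z" for z
  proof
   assume "f z = Some l"
   then have "f z ~= None" by simp
   then have "z \<le> i" using i by blast
   then show False using z by simp
  qed
  then have "cnt f l i = cnt f l ?i" by (intro cnt_const[symmetric]) auto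
  moreover have "cnt F l ?i = cnt f l ?i + (if l = (e, R) then 1 else 0)"
   using kf(3) fi by (intro Ins_lat(2)[OF kf(2) _ kf(5,4,1)]) auto
  moreover have "cnt F l ?i = cnt G l (Suc m)" by (rule Suc.prems(7)[OF Fi])
  moreover have "cnt G l (Suc m) = cnt G l m + (if l = (e, R) then 1 else 0)" by (auto simp: cnt_Suc GR)
  ultimately show ?thesis by (simp add: cG)
 qed
 moreover have "f 0 = None" using kf(1,3) Suc.prems(3) by simp
 moreover have "?G i = None \<longleftrightarrow> i \<notin> {1..m}" for i using Suc.prems(6)[of i] by auto
 ultimately obtain u where u: "good_word u m" "rsP u m = f" "Qmap u m = ?G"
  using Suc.IH[of f ?G] kf(5) fin card by blast
 let ?u = "u(int (Suc m) := (if e then int k else - int k))"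
 have P: "rsP ?u m = f" unfolding u(2)[symmetric] by (rule rsP_cong) auto
 have auu: "au ?u i = au u i" if "i \<in> {1..m}" for i using that by auto
 have im: "au ?u ` {1..m} = au u ` {1..m}" using auu by (intro image_cong) auto
 have inj: "good_word ?u m"
 proof -
  have "inj_on (au ?u) {1..m} \<longleftrightarrow> inj_on (au u) {1..m}" by (rule inj_on_cong) (rule auu)
  moreover have "?u (int i) = u (int i)" if "i \<in> {1..m}" for i using that by simp
  ultimately show ?thesis using u(1) by (simp only: good_word_def ball_simps) auto
 qed
 have k: "au ?u (Suc m) = k" "(0 < ?u (int (Suc m))) = e" using kf(1) by auto
 have "k \<notin> au u ` {1..m}" using rsP_main[OF u(1)] u(2) kf(4) by metis
 then have gw: "good_word ?u (Suc m)" using inj im k kf(1) by (simp only: good_word_Suc) simp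
 have i1: "insert1 e k f = (F, R)" using kf by (intro insert1_eq) auto
 have "rsP ?u (Suc m) = F" using i1 P k by (simp del: fun_upd_apply)
 moreover have "rsQ ?u (Suc m) = (e, R)" using i1 P k by (simp add: rsQ_def del: fun_upd_apply)
 moreover have "rsQ ?u i = rsQ u i" if "i \<in> {1..m}" for i
 proof -
  have "rsP ?u (i - 1) = rsP u (i - 1)" using that by (intro rsP_cong) auto
  then show ?thesis using that by (simp add: rsQ_def)
 qed
 ultimately have Qu: "Qmap ?u (Suc m) i = (if i = Suc m then Some (e, R) else Qmap u m i)" for i
  by (simp add: Qmap_def le_Suc_eq)
 have "Qmap ?u (Suc m) = G" unfolding fun_eq_iff Qu u(3) by (simp add: GR)
 then show ?case using gw \<open>rsP ?u (Suc m) = F\<close> by blast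
qed

lemma gen_abs:
 assumes "1 \<le> j" shows "nat \<bar>gen j y\<bar> = transpose j (Suc j) (nat \<bar>y\<bar>)" "0 < gen j y \<longleftrightarrow> 0 < y"
proof -
 have lh: "lo j = int j" "hi j = int j + 1" using assms by (simp_all add: lo_def hi_def)
 consider "y = int j" | "y = int j + 1" | "y = - int j" | "y = - (int j + 1)"
  | "nat \<bar>y\<bar> ~= j" "nat \<bar>y\<bar> ~= Suc j" by linarith
 then have "nat \<bar>gen j y\<bar> = transpose j (Suc j) (nat \<bar>y\<bar>) \<and> (0 < gen j y \<longleftrightarrow> 0 < y)"
 proof cases
  case 5
  then have "gen j y = y" unfolding gen_apply lh by auto
  then show ?thesis using 5 by (simp add: transpose_def)
 qed (use assms in \<open>auto simp: gen_apply lh transpose_def nat_add_distrib\<close>)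
 then show "nat \<bar>gen j y\<bar> = transpose j (Suc j) (nat \<bar>y\<bar>)" "0 < gen j y \<longleftrightarrow> 0 < y" by blast+
qed

text \<open>Meant for partial words: while \<open>k\<close> is still to be inserted,
  \<open>k\<close> and \<open>k + 1\<close> are not both present, so exchanging them relabels the
  insertion tableau and leaves the recording tableau alone.\<close>

lemma rsP_swap:
 assumes "1 \<le> j" "good_word u m" "\<not> (j \<in> au u ` {1..m} \<and> Suc j \<in> au u ` {1..m})"
 shows "rsP (gen j \<circ> u) m = rsP u m \<circ> transpose j (Suc j)" "i \<in> {1..m} ==> rsQ (gen j \<circ> u) i = rsQ u i"
proof -
 let ?s = "transpose j (Suc j)"
 have main: "rsP (gen j \<circ> u) m = rsP u m \<circ> ?s \<and> (\<forall>i\<in>{1..m}. rsQ (gen j \<circ> u) i = rsQ u i)"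
  using assms(2,3)
 proof (induction m)
  case 0
  then show ?case by auto
 next
  case (Suc m)
  let ?D = "au u ` {1..Suc m}" and ?k = "au u (Suc m)" and ?e = "0 < u (int (Suc m))" and ?R = "snd (rsQ u (Suc m))"
  have gw: "good_word u m" using Suc.prems good_word_Suc by blast
  have sub: "au u ` {1..m} \<subseteq> ?D" by auto
  then have IH: "rsP (gen j \<circ> u) m = rsP u m \<circ> ?s" "\<forall>i\<in>{1..m}. rsQ (gen j \<circ> u) i = rsQ u i"
   using Suc.IH[OF gw] Suc.prems(2) by blast+
  have out: "rsP u m z = None \<and> rsP u (Suc m) z = None" if "z \<notin> ?D" for z
   using that rsP_main[OF gw] rsP_main[OF Suc.prems(1)] sub by blast
  have kD: "?k \<in> ?D" by (rule image_eqI[of _ _ "Suc m"]) simp_all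
  note I = rsP_Ins[OF Suc.prems(1)]
  have ins: "Ins ?e 0 (?s ?k) (rsP u m \<circ> ?s) (rsP u (Suc m) \<circ> ?s) ?R"
   by (rule Ins_swap[OF I(1) Suc.prems(2) kD out])
  have below: "(rsP u (Suc m) \<circ> ?s) y = (rsP u m \<circ> ?s) y" if "y < ?s ?k" for y
  proof (cases "?s y \<in> ?D")
   case True
   then have "?s y < ?k" using that kD Suc.prems(2) by (auto simp: transpose_def split: if_splits)
   then show ?thesis using I(2) by simp
  qed (use out in simp)
  have eq: "insert1 ?e (?s ?k) (rsP u m \<circ> ?s) = (rsP u (Suc m) \<circ> ?s, ?R)"
   by (rule insert1_eq[OF ins below])
  have k: "au (gen j \<circ> u) (Suc m) = ?s ?k" "(0 < (gen j \<circ> u) (int (Suc m))) = ?e"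
   using gen_abs[OF assms(1)] by simp_all
  have "rsP (gen j \<circ> u) (Suc m) = rsP u (Suc m) \<circ> ?s" unfolding rsP.simps(2)[of "gen j \<circ> u"] IH k eq by simp
  moreover have "rsQ (gen j \<circ> u) (Suc m) = rsQ u (Suc m)"
   unfolding rsQ_def[of "gen j \<circ> u"] diff_Suc_1 IH k eq by (simp add: rsQ_def)
  moreover have "i \<in> {1..m}" if "i \<in> {1..Suc m}" "i ~= Suc m" for i using that by auto
  ultimately show ?case using IH(2) by metis
 qed
 then show "rsP (gen j \<circ> u) m = rsP u m \<circ> ?s" "i \<in> {1..m} ==> rsQ (gen j \<circ> u) i = rsQ u i" by auto
qed

section \<open>Leading coefficients of the seminormal representation\<close>

definition lab :: "box => bool \<times> nat" where "lab B = (fst B, fst (snd B))"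

lemma lab_simp [simp]: "lab (e, r, c) = (e, r)" by (simp add: lab_def)

definition rowm :: "tab => nat => rmap" where
 "rowm P m i = (if i \<in> {1..m} then Some (lab (P i)) else None)"

context asymptotic
begin

definition mk :: "rmap => tab" where
 "mk f i = (case f i of Some (e, r) => (e, r, cnt f (e, r) (i - 1)) | None => (True, 0, 0))"

lemma valid_col:
 assumes P: "valid P" and i: "i \<in> {1..n}" and Pi: "P i = (e, r, c)"
 shows "c = cnt (rowm P n) (e, r) (i - 1)"
proof -
 let ?S = "{y \<in> {1..i - 1}. rowm P n y = Some (e, r)}"
 have S: "P y = (e, r, snd (snd (P y)))" "y \<in> {1..n}" "y < i" if "y \<in> ?S" for y
  using that i by (auto simp: rowm_def lab_def split: if_splits intro: prod_eqI)
 have "bij_betw (\<lambda>y. snd (snd (P y))) ?S {..<c}"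
 proof (rule bij_betw_imageI)
  show "inj_on (\<lambda>y. snd (snd (P y))) ?S"
  proof (rule inj_onI)
   fix y z assume "y \<in> ?S" "z \<in> ?S" "snd (snd (P y)) = snd (snd (P z))"
   then have "P y = P z" using S(1)[of y] S(1)[of z] by simp
   then show "y = z" using valid_inj[OF P] S(2) \<open>y \<in> ?S\<close> \<open>z \<in> ?S\<close> by blast
  qed
  show "(\<lambda>y. snd (snd (P y))) ` ?S = {..<c}"
  proof (intro equalityI subsetI)
   fix d assume "d \<in> (\<lambda>y. snd (snd (P y))) ` ?S"
   then obtain y where y: "y \<in> ?S" "d = snd (snd (P y))" by blast
   have "\<not> c \<le> d"
    using valid_NW_le[OF P S(2)[OF y(1)] i S(1)[OF y(1)] Pi] S(3)[OF y(1)] y(2) by auto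
   then show "d \<in> {..<c}" by simp
  next
   fix d assume d: "d \<in> {..<c}"
   then obtain y where y: "y \<in> {1..i}" "P y = (e, r, d)" using valid_NW[OF P i Pi, of r d] by auto
   moreover have "y ~= i" using y Pi d by auto
   ultimately have "y \<in> ?S" using i by (auto simp: rowm_def)
   then show "d \<in> (\<lambda>y. snd (snd (P y))) ` ?S" using y by (intro image_eqI[of _ _ y]) auto
  qed
 qed
 then show ?thesis unfolding cnt_def using bij_betw_same_card by fastforce
qed

lemma valid_eqI:
 assumes "valid P" "valid Q" "rowm P n = rowm Q n" shows "P = Q"
proof
 fix i
 show "P i = Q i"
 proof (cases "i \<in> {1..n}")
  case True
  then have "lab (P i) = lab (Q i)" using fun_cong[OF assms(3), of i] by (simp add: rowm_def)
  moreover obtain e r c where Pi: "P i = (e, r, c)" by (cases "P i") auto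
  ultimately obtain c' where Qi: "Q i = (e, r, c')" by (cases "Q i") auto
  show ?thesis using valid_col[OF assms(1) True Pi] valid_col[OF assms(2) True Qi] assms(3) Pi Qi by simp
 next
  case False
  then show ?thesis using assms(1,2) by (simp add: valid_def)
 qed
qed

lemma valid_lat: assumes P: "valid P" shows "lat (rowm P n)"
 unfolding lat_def
proof (intro allI)
 fix e r i
 let ?S = "\<lambda>r. {y \<in> {1..i}. rowm P n y = Some (e, r)}"
 have S: "P y = (e, r, snd (snd (P y)))" "y \<in> {1..n}" "y \<le> i" if "y \<in> ?S r" for y r
  using that by (auto simp: rowm_def lab_def split: if_splits intro: prod_eqI)
 let ?c = "\<lambda>y. snd (snd (P y))"
 have inj: "inj_on ?c (?S r)" for r
 proof (rule inj_onI)
  fix y z assume "y \<in> ?S r" "z \<in> ?S r" "?c y = ?c z"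
  then have "P y = P z" using S(1)[of y r] S(1)[of z r] by simp
  then show "y = z" using valid_inj[OF P] S(2) \<open>y \<in> ?S r\<close> \<open>z \<in> ?S r\<close> by blast
 qed
 have "?c ` ?S (Suc r) \<subseteq> ?c ` ?S r"
 proof
  fix c assume "c \<in> ?c ` ?S (Suc r)"
  then obtain y where y: "y \<in> ?S (Suc r)" "c = ?c y" by blast
  have Py: "P y = (e, Suc r, c)" using S(1)[OF y(1)] y(2) by simp
  obtain y' where y': "y' \<in> {1..y}" "P y' = (e, r, c)"
   using valid_NW[OF P S(2)[OF y(1)] Py, of r c] by auto
  then have "y' \<in> ?S r" using S(2,3)[OF y(1)] by (auto simp: rowm_def)
  then show "c \<in> ?c ` ?S r" using y' by (intro image_eqI[of _ _ y']) auto
 qed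
 then have "card (?c ` ?S (Suc r)) \<le> card (?c ` ?S r)" by (intro card_mono) auto
 then show "cnt (rowm P n) (e, Suc r) i \<le> cnt (rowm P n) (e, r) i"
  unfolding cnt_def card_image[OF inj] .
qed

lemma mk_valid:
 assumes f: "lat f" "\<And>i. f i = None \<longleftrightarrow> i \<notin> {1..n}"
 shows "valid (mk f)" "rowm (mk f) n = f"
proof -
 have some: "\<exists>e r. f i = Some (e, r) \<and> mk f i = (e, r, cnt f (e, r) (i - 1))" if "i \<in> {1..n}" for i
  using f(2)[of i] that by (auto simp: mk_def)
 show "rowm (mk f) n = f"
 proof
  fix i show "rowm (mk f) n i = f i" using some[of i] f(2)[of i] by (cases "i \<in> {1..n}") (auto simp: rowm_def)
 qed
 have "mk f i = (True, 0, 0)" if "i \<notin> {1..n}" for i using f(2)[of i] that by (simp add: mk_def)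
 moreover have "inj_on (mk f) {1..n}"
 proof (rule linorder_inj_onI')
  fix i j assume ij: "i \<in> {1..n}" "j \<in> {1..n}" "i < j"
  show "mk f i ~= mk f j"
  proof
   assume eq: "mk f i = mk f j"
   obtain e r where i: "f i = Some (e, r)" "mk f i = (e, r, cnt f (e, r) (i - 1))" using some ij by blast
   obtain e' r' where j: "f j = Some (e', r')" "mk f j = (e', r', cnt f (e', r') (j - 1))" using some ij by blast
   have "cnt f (e, r) (i - 1) < cnt f (e, r) i" using cnt_pred[of i f "(e, r)"] i ij by simp
   also have "\<dots> \<le> cnt f (e, r) (j - 1)" using ij by (intro cnt_mono) auto
   finally have lt: "cnt f (e, r) (i - 1) < cnt f (e, r) (j - 1)" .
   have "e' = e" "r' = r" "cnt f (e', r') (j - 1) = cnt f (e, r) (i - 1)" using eq i(2) j(2) by auto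
   then show False using lt by simp
  qed
 qed
 moreover have "pre (mk f i) \<subseteq> mk f ` {1..<i}" if i: "i \<in> {1..n}" for i
 proof -
  obtain e r where fi: "f i = Some (e, r)" "mk f i = (e, r, cnt f (e, r) (i - 1))" using some i by blast
  let ?c = "cnt f (e, r) (i - 1)"
  have mem: "(e, r', c') \<in> mk f ` {1..<i}" if c': "c' < cnt f (e, r') (i - 1)" for r' c'
  proof -
   obtain j where j: "j \<in> {1..i - 1}" "f j = Some (e, r')" "cnt f (e, r') (j - 1) = c'" using cnt_exists[OF c'] by blast
   then have "mk f j = (e, r', c')" by (simp add: mk_def)
   then show ?thesis using j by (intro image_eqI[of _ _ j]) auto
  qed
  have "(e, r - 1, ?c) \<in> mk f ` {1..<i}" if "0 < r"
  proof (rule mem)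
   have "?c < cnt f (e, r) i" using cnt_pred[of i f "(e, r)"] fi i by simp
   also have "\<dots> \<le> cnt f (e, r - 1) i" using f(1) that unfolding lat_def by (metis Suc_pred')
   also have "\<dots> = cnt f (e, r - 1) (i - 1)" using cnt_pred[of i f "(e, r - 1)"] fi i that by auto
   finally show "?c < cnt f (e, r - 1) (i - 1)" .
  qed
  moreover have "(e, r, ?c - 1) \<in> mk f ` {1..<i}" if "0 < ?c" using that by (intro mem) simp
  ultimately show ?thesis unfolding fi(2) by (auto simp: pre_def)
 qed
 ultimately show "valid (mk f)" unfolding valid_def by blast
qed

lemma shp_eq: assumes P: "valid P" shows "shp P = {(e, r, c). c < cnt (rowm P n) (e, r) n}"
proof (intro equalityI subsetI)
 fix B assume "B \<in> shp P"
 then obtain i where i: "i \<in> {1..n}" "B = P i" unfolding shp_def by blast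
 obtain e r c where B: "P i = (e, r, c)" by (cases "P i") auto
 have "c < cnt (rowm P n) (e, r) i"
  using valid_col[OF P i(1) B] cnt_pred[of i "rowm P n" "(e, r)"] i B by (simp add: rowm_def)
 also have "\<dots> \<le> cnt (rowm P n) (e, r) n" using i by (intro cnt_mono) auto
 finally show "B \<in> {(e, r, c). c < cnt (rowm P n) (e, r) n}" using B i by simp
next
 fix B assume "B \<in> {(e, r, c). c < cnt (rowm P n) (e, r) n}"
 then obtain e r c where B: "B = (e, r, c)" "c < cnt (rowm P n) (e, r) n" by blast
 obtain j where j: "j \<in> {1..n}" "rowm P n j = Some (e, r)" "cnt (rowm P n) (e, r) (j - 1) = c"
  using cnt_exists[OF B(2)] by blast
 then obtain c' where "P j = (e, r, c')" by (cases "P j") (auto simp: rowm_def)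
 then have "P j = B" using valid_col[OF P j(1)] j B by simp
 then show "B \<in> shp P" using j(1) unfolding shp_def by blast
qed

lemma shp_cnt: assumes "valid P" "valid Q" "shp P = shp Q" shows "cnt (rowm P n) l n = cnt (rowm Q n) l n"
proof -
 obtain e r where l: "l = (e, r)" by (cases l) auto
 have "{c. c < cnt (rowm P n) l n} = {c. c < cnt (rowm Q n) l n}"
  using assms(3) unfolding shp_eq[OF assms(1)] shp_eq[OF assms(2)] l by (auto simp: set_eq_iff)
 then have "{..<cnt (rowm P n) l n} = {..<cnt (rowm Q n) l n}" by (simp add: lessThan_def)
 then show ?thesis by simp
qed

subsection \<open>The tableaux of a group element\<close>

lemma W_good: assumes "w \<in> W n" "m \<le> n" shows "good_word w m"
proof -
 have "inj_on (au w) {1..m}"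
 proof (rule inj_onI)
  fix i j assume ij: "i \<in> {1..m}" "j \<in> {1..m}" "au w i = au w j"
  then have "w (int i) = w (int j) \<or> w (int i) = w (- int j)" using W_odd[OF assms(1)] by simp linarith
  then show "i = j" using W_inj[OF assms(1)] ij by auto
 qed
 moreover have "w (int i) ~= 0" if "i \<in> {1..m}" for i using W_eq_0_iff[OF assms(1)] that by auto
 ultimately show ?thesis by (simp add: good_word_def)
qed

lemma au_range: assumes "w \<in> W n" shows "au w ` {1..n} = {1..n}"
proof (rule endo_inj_surj)
 show "au w ` {1..n} \<subseteq> {1..n}"
 proof clarify
  fix i assume "i \<in> {1..n}"
  then show "au w i \<in> {1..n}" using W_bound[OF assms, of "int i"] W_eq_0_iff[OF assms, of "int i"] by auto
 qed
 show "inj_on (au w) {1..n}" using W_good[OF assms order_refl] by (simp add: good_word_def)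
qed simp

definition PT :: "(int => int) => tab" where "PT w = mk (rsP w n)"
definition QT :: "(int => int) => tab" where "QT w = mk (Qmap w n)"

lemma rsP_W:
 assumes "w \<in> W n" shows "rsP w n i = None \<longleftrightarrow> i \<notin> {1..n}" "lat (rsP w n)"
  "cnt (rsP w n) l n = cnt (Qmap w n) l n" "lat (Qmap w n)" "Qmap w n i = None \<longleftrightarrow> i \<notin> {1..n}"
proof -
 note m = rsP_main[OF W_good[OF assms order_refl], unfolded au_range[OF assms]]
 show "rsP w n i = None \<longleftrightarrow> i \<notin> {1..n}" "lat (rsP w n)" "cnt (rsP w n) l n = cnt (Qmap w n) l n"
  using m by (blast, blast, (metis atLeastAtMost_iff))
 show "lat (Qmap w n)" by (rule Qmap_lat[OF W_good[OF assms order_refl]])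
 show "Qmap w n i = None \<longleftrightarrow> i \<notin> {1..n}" by (simp add: Qmap_def)
qed

lemma PT_QT:
 assumes "w \<in> W n"
 shows "valid (PT w)" "valid (QT w)" "rowm (PT w) n = rsP w n" "rowm (QT w) n = Qmap w n" "shp (PT w) = shp (QT w)"
proof -
 show P: "valid (PT w)" "rowm (PT w) n = rsP w n"
  unfolding PT_def using mk_valid[OF rsP_W(2)[OF assms] rsP_W(1)[OF assms]] by blast+
 show Q: "valid (QT w)" "rowm (QT w) n = Qmap w n"
  unfolding QT_def using mk_valid[OF rsP_W(4)[OF assms] rsP_W(5)[OF assms]] by blast+
 show "shp (PT w) = shp (QT w)"
  unfolding shp_eq[OF P(1)] shp_eq[OF Q(1)] P(2) Q(2) rsP_W(3)[OF assms] ..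
qed

lemma RS_inj: assumes "w \<in> W n" "w' \<in> W n" "PT w = PT w'" "QT w = QT w'" shows "w = w'"
proof (rule W_ext[OF assms(1,2)])
 fix i assume i: "1 \<le> i" "i \<le> int n"
 have "rsP w n = rsP w' n" "Qmap w n = Qmap w' n"
  using PT_QT(3,4)[OF assms(1)] PT_QT(3,4)[OF assms(2)] assms(3,4) by simp_all
 then have "w (int (nat i)) = w' (int (nat i))"
  using i by (intro rs_inj[OF W_good[OF assms(1) order_refl] W_good[OF assms(2) order_refl]]) auto
 then show "w i = w' i" using i by simp
qed

lemma RS_surj: assumes P: "valid P" and Q: "valid Q" and "shp P = shp Q"
 obtains w where "w \<in> W n" "PT w = P" "QT w = Q"
proof -
 have dom: "rowm X n i = None \<longleftrightarrow> i \<notin> {1..n}" for X i by (simp add: rowm_def)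
 have S: "{y. rowm P n y ~= None} = {1..n}" by (simp only: dom not_not Collect_mem_eq)
 have "cnt (rowm P n) l i = cnt (rowm Q n) l n" if "\<forall>y. rowm P n y ~= None --> y \<le> i" for l i
 proof -
  have "n \<le> i" using that n_pos dom[of P n] by auto
  then have "cnt (rowm P n) l i = cnt (rowm P n) l n" by (intro cnt_const) (auto simp: rowm_def)
  then show ?thesis using shp_cnt[OF assms] by simp
 qed
 moreover have "finite {y. rowm P n y ~= None}" "card {y. rowm P n y ~= None} = n" "rowm P n 0 = None"
  unfolding S by (simp_all add: rowm_def)
 ultimately obtain u where u: "good_word u n" "rsP u n = rowm P n" "Qmap u n = rowm Q n"
  using rs_surj[OF valid_lat[OF P] _ _ _ valid_lat[OF Q] dom] by blast
 have img: "au u ` {1..n} = {1..n}"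
 proof -
  have "y \<in> au u ` {1..n} \<longleftrightarrow> y \<in> {1..n}" for y using rsP_main[OF u(1)] u(2) dom[of P y] by metis
  then show ?thesis by blast
 qed
 define w where "w = (\<lambda>i. if 1 \<le> i \<and> i \<le> int n then u i else if 1 \<le> - i \<and> - i \<le> int n then - u (- i) else i)"
 have wi: "w (int i) = u (int i)" if "i \<in> {1..n}" for i using that by (simp add: w_def)
 have odd: "w (- i) = - w i" for i by (auto simp: w_def)
 let ?S = "{- int n..int n} - {0}"
 have ab: "\<bar>w i\<bar> = int (au u (nat \<bar>i\<bar>))" if "i \<in> ?S" for i
  using that by (auto simp: w_def)
 have wS: "w ` ?S \<subseteq> ?S"
 proof (rule image_subsetI)
  fix i assume i: "i \<in> ?S"
  then have "nat \<bar>i\<bar> \<in> {1..n}" by auto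
  then have "au u (nat \<bar>i\<bar>) \<in> {1..n}" using img by blast
  then show "w i \<in> ?S" using ab[OF i] by auto
 qed
 have "inj_on w ?S"
 proof (rule inj_onI)
  fix i j assume ij: "i \<in> ?S" "j \<in> ?S" "w i = w j"
  then have "int (au u (nat \<bar>i\<bar>)) = int (au u (nat \<bar>j\<bar>))" using ab[OF ij(1)] ab[OF ij(2)] by simp
  then have "au u (nat \<bar>i\<bar>) = au u (nat \<bar>j\<bar>)" by (simp only: of_nat_eq_iff)
  moreover have "nat \<bar>i\<bar> \<in> {1..n}" "nat \<bar>j\<bar> \<in> {1..n}" using ij by auto
  ultimately have "nat \<bar>i\<bar> = nat \<bar>j\<bar>" using u(1) unfolding good_word_def by (meson inj_onD)
  then have "\<bar>i\<bar> = \<bar>j\<bar>" by simp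
  moreover have "w i ~= 0" using wS ij(1) by blast
  ultimately show "i = j" using odd[of j] ij(3) by (auto simp: abs_eq_iff)
 qed
 then have "bij_betw w ?S ?S" using wS by (simp add: endo_inj_surj bij_betw_imageI)
 then have "w permutes ?S" by (rule bij_imp_permutes) (auto simp: w_def)
 then have W: "w \<in> W n" using odd by (simp add: W_def)
 have "rsP w k = rsP u k" if "k \<le> n" for k using wi that by (intro rsP_cong) auto
 note wP = this
 have "rsQ w i = rsQ u i" if "i \<in> {1..n}" for i
 proof -
  have "i - 1 \<le> n" using that by auto
  then show ?thesis unfolding rsQ_def wi[OF that] by (simp only: wP)
 qed
 then have "Qmap w n = Qmap u n" by (auto simp: fun_eq_iff Qmap_def)
 then have eq: "rsP w n = rowm P n" "Qmap w n = rowm Q n" using u(2,3) wP by simp_all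
 have "PT w = P" "QT w = Q"
  using valid_eqI[OF PT_QT(1)[OF W] P] valid_eqI[OF PT_QT(2)[OF W] Q] PT_QT(3,4)[OF W] eq by simp_all
 then show ?thesis using that W by blast
qed

subsection \<open>One step of a bumping path\<close>

lemma tends_E_le: "j \<le> 0 ==> tends (E 0 j) (if j = 0 then 1 else 0)"
 using tends_E0[of j] by auto

lemma consecutive_position:
 assumes P: "valid P" and k: "1 \<le> k" "k < n" and B: "P k = (e, r, c)" "P (Suc k) = (e, r', c')"
 shows "r < r' \<and> c' \<le> c \<or> r' \<le> r \<and> c < c'" "r' = r ==> c' = Suc c"
proof -
 have in1: "k \<in> {1..n}" "Suc k \<in> {1..n}" using k by auto
 have nw: "\<not> (r' \<le> r \<and> c' \<le> c)" using valid_NW_le[OF P in1 B] by auto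
 have between: "r'' = r \<and> c'' = c \<or> r'' = r' \<and> c'' = c'"
  if h: "r'' \<le> r'" "c'' \<le> c'" "r \<le> r''" "c \<le> c''" for r'' c''
 proof -
  obtain j where j: "j \<in> {1..Suc k}" "P j = (e, r'', c'')" using valid_NW[OF P in1(2) B(2) h(1,2)] by blast
  then have "k \<le> j" using valid_NW_le[OF P _ in1(1) j(2) B(1) h(3,4)] in1 by auto
  then have "j = k \<or> j = Suc k" using j by auto
  then show ?thesis using B j by auto
 qed
 have "\<not> (r < r' \<and> c < c')" using between[of r' c] by auto
 then show "r < r' \<and> c' \<le> c \<or> r' \<le> r \<and> c < c'" using nw by linarith
 assume "r' = r"
 then show "c' = Suc c" using between[of r "Suc c"] nw by auto
qed

definition rw :: "box => nat" where "rw B = fst (snd B)"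

text \<open>The weights \<open>om\<close> are made so that the diagonal entry survives in the limit
  only if \<open>k + 1\<close> lies one row below that of \<open>k\<close> in the same component,
  the position of an entry just bumped by \<open>k\<close>. Across components the exponents are
  controlled by \<open>valid_hooks\<close>.\<close>

lemma tends_phi_om:
 assumes P: "valid P" and k: "1 \<le> k" "k < n"
 shows "tends (phi (P k) (P (Suc k)) * om (P k) / om (P (Suc k)))
  (if fst (P k) = fst (P (Suc k)) \<and> rw (P (Suc k)) = Suc (rw (P k)) then 1 else 0)"
proof -
 have in1: "k \<in> {1..n}" "Suc k \<in> {1..n}" using k by auto
 obtain e r c where B: "P k = (e, r, c)" by (cases "P k") auto
 obtain e' r' c' where B': "P (Suc k) = (e', r', c')" by (cases "P (Suc k)") auto
 let ?p = "phi (e, r, c) (e', r', c')"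
 show ?thesis
 proof (cases "e = e'")
  case same: True
  note pos = consecutive_position(1)[OF P k B B'[folded same]]
  define s :: "'g K" where "s = (if e then 1 else (- 1) ^ r / (- 1) ^ r')"
  have s: "s = of_int (if e then 1 else (- 1) ^ (r + r'))"
   by (auto simp: s_def power_add minus_one_power_iff)
  have omq: "om (P k) / om (P (Suc k)) = s * E 0 (if e then int r - int r' else 2 * int c - int r - (2 * int c' - int r'))"
   unfolding B B' s_def using same by (auto simp: om_def E_divide simp flip: times_divide_times_eq)
  consider (S) "r < r'" "c' \<le> c" | (N) "r' \<le> r" "c < c'" using pos by blast
  then show ?thesis
  proof cases
   case S
   let ?lim = "(if e then 1 else - 1) :: int"
   let ?d = "if e then 1 else 2 * (int r' - int r + (int c - int c')) - 1 :: int"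
   have t: "tends (?p * E 0 (if e then - 1 else ?d)) ?lim"
    using tends_phi_up[of "(e, r, c)" "(e', r', c')"] tends_phi_down[of "(e, r, c)" "(e', r', c')"] S same
    by (auto simp: ct_def algebra_simps)
   have "?p * om (P k) / om (P (Suc k)) = (?p * E 0 (if e then - 1 else ?d)) * (E 0 (int r - int r' + 1) * s)"
   proof -
    have "E 0 (if e then int r - int r' else 2 * int c - int r - (2 * int c' - int r'))
      = E 0 (if e then - 1 else ?d) * E 0 (int r - int r' + 1)" by (simp add: E_mult algebra_simps)
    then show ?thesis unfolding times_divide_eq_right[symmetric] omq by (simp only: ac_simps)
   qed
   moreover have "tends \<dots> (?lim * ((if int r - int r' + 1 = 0 then 1 else 0) * (if e then 1 else (- 1) ^ (r + r'))))"
    unfolding s using S by (intro lim_mult t tends_E_le lim_of_int) auto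
   moreover have "?lim * ((if int r - int r' + 1 = 0 then 1 else 0) * (if e then 1 else (- 1) ^ (r + r')))
     = (if r' = Suc r then 1 else 0)" by auto
   ultimately show ?thesis unfolding B B' using same by (simp add: rw_def)
  next
   case N
   let ?lim = "(if e then - 1 else 1) :: int"
   let ?d = "if e then 2 * (int r - int r' + (int c' - int c)) - 1 else - 1 :: int"
   have t: "tends (?p * E 0 ?d) ?lim"
    using tends_phi_up[of "(e, r, c)" "(e', r', c')"] tends_phi_down[of "(e, r, c)" "(e', r', c')"] N same
    by (auto simp: ct_def algebra_simps)
   let ?x = "int r' - int r - 2 * (int c' - int c) + 1"
   have "?p * om (P k) / om (P (Suc k)) = (?p * E 0 ?d) * (E 0 ?x * s)"
   proof -
    have "E 0 (if e then int r - int r' else 2 * int c - int r - (2 * int c' - int r')) = E 0 ?d * E 0 ?x"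
     by (simp add: E_mult algebra_simps)
    then show ?thesis unfolding times_divide_eq_right[symmetric] omq by (simp only: ac_simps)
   qed
   moreover have "tends \<dots> (?lim * (0 * (if e then 1 else (- 1) ^ (r + r'))))"
    unfolding s using N by (intro lim_mult t tends_E0 lim_of_int) auto
   ultimately show ?thesis unfolding B B' using N by (simp add: rw_def)
  qed
 next
  case diff: False
  have h: "Suc (r + c) + Suc (r' + c') \<le> n" using valid_hooks[OF P in1(1) B in1(2) B' diff] .
  define s :: "'g K" where "s = (if e then 1 / (- 1) ^ r' else (- 1) ^ r)"
  have s: "s = of_int (if e then (- 1) ^ r' else (- 1) ^ r)"
   by (auto simp: s_def minus_one_power_iff)
  have omq: "om (P k) / om (P (Suc k)) = s * (if e then E (- 1) (int r - (2 * int c' - int r')) else E 1 (2 * int c - int r - int r'))"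
   unfolding B B' s_def using diff by (auto simp: om_def E_divide divide_inverse inverse_mult_distrib E_inverse E_mult algebra_simps)
  let ?D = "if e then E 0 (- 1) else E 2 (2 * (int c - int r - (int r' - int c')) - 1)"
  have t: "tends (?p * ?D) 1"
   using tends_phi_pm[of "(e, r, c)" "(e', r', c')"] tends_phi_mp[of "(e, r, c)" "(e', r', c')"] diff h
   by (auto simp: ct_def)
  let ?x = "E (- 1) (int r + int r' - 2 * int c' + 1)"
  have "?p * om (P k) / om (P (Suc k)) = (?p * ?D) * (?x * s)"
  proof -
   have "(if e then E (- 1) (int r - (2 * int c' - int r')) else E 1 (2 * int c - int r - int r')) = ?D * ?x"
    by (simp add: E_mult algebra_simps)
   then show ?thesis unfolding times_divide_eq_right[symmetric] omq by (simp only: ac_simps)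
  qed
  moreover have "tends \<dots> (1 * (0 * (if e then (- 1) ^ r' else (- 1) ^ r)))"
   unfolding s using h by (intro lim_mult t tends_E lim_of_int) auto
  ultimately show ?thesis unfolding B B' using diff by simp
 qed
qed

text \<open>\<open>CC f F k e R\<close>: the tail of a row insertion starts with \<open>k\<close> in its row of \<open>F\<close>.\<close>

definition CC :: "rmap => rmap => nat => bool => nat => bool" where
 "CC f F k e R \<longleftrightarrow> (\<forall>y<k. F y = f y) \<and> (\<exists>r. F k = Some (e, r) \<and> Ins e r k f F R)"

text \<open>The recursion of bumping paths that matches \<open>Rop k\<close>. If
  \<open>k + 1\<close> lies in the row of \<open>f\<close> which \<open>k\<close> enters, then
  \<open>k\<close> bumps it and the diagonal term continues the path. Otherwise \<open>k + 1\<close>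
  is a bystander, and exchanging the roles of \<open>k\<close> and \<open>k + 1\<close> gives the
  same path. At most one of the two terms contributes.\<close>

lemma CC_step:
 fixes e :: bool and R :: nat
 assumes P: "valid P" and k: "1 \<le> k" "Suc k \<le> M" "M \<le> n" and f: "lat f" "f k = None"
 defines "F \<equiv> rowm P M" and "s \<equiv> transpose k (Suc k)"
 defines "stay \<equiv> fst (P k) = fst (P (Suc k)) \<and> rw (P (Suc k)) = Suc (rw (P k)) \<and> CC (f \<circ> s) F (Suc k) e R"
  and "swap \<equiv> P k \<notin> pre (P (Suc k)) \<and> CC (f \<circ> s) (F \<circ> s) (Suc k) e R"
 shows "(if CC f F k e R then 1 else 0 :: int) = (if stay then 1 else 0) + (if swap then 1 else 0)"
proof -
 have in1: "k \<in> {1..n}" "Suc k \<in> {1..n}" "k < n" using k by auto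
 obtain e0 r c where B: "P k = (e0, r, c)" by (cases "P k") auto
 obtain e' r' c' where B': "P (Suc k) = (e', r', c')" by (cases "P (Suc k)") auto
 have Fk: "F k = Some (e0, r)" "F (Suc k) = Some (e', r')" using k B B' by (simp_all add: F_def rowm_def)
 have fs: "(f \<circ> s) k = f (Suc k)" "(f \<circ> s) (Suc k) = None" "\<And>y. y ~= k ==> y ~= Suc k ==> (f \<circ> s) y = f y"
  using f(2) by (auto simp: s_def transpose_def)
 have Fs: "(F \<circ> s) k = F (Suc k)" "(F \<circ> s) (Suc k) = F k" "\<And>y. y ~= k ==> y ~= Suc k ==> (F \<circ> s) y = F y"
  by (auto simp: s_def transpose_def)
 have all: "(\<forall>y<Suc k. Q y) \<longleftrightarrow> (\<forall>y<k. Q y) \<and> Q k" for Q by (auto simp: less_Suc_eq)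
 have st: "CC (f \<circ> s) F (Suc k) e R \<longleftrightarrow> (\<forall>y<k. F y = f y) \<and> F k = f (Suc k) \<and> (e' = e \<and> Ins e r' (Suc k) (f \<circ> s) F R)"
  unfolding CC_def all using fs Fk by auto
 have sp: "CC (f \<circ> s) (F \<circ> s) (Suc k) e R \<longleftrightarrow> (\<forall>y<k. F y = f y) \<and> F (Suc k) = f (Suc k) \<and> (e0 = e \<and> Ins e r (Suc k) (f \<circ> s) (F \<circ> s) R)"
  unfolding CC_def all using fs Fs Fk by auto
 have cc: "CC f F k e R \<longleftrightarrow> (\<forall>y<k. F y = f y) \<and> (e0 = e \<and> Ins e r k f F R)"
  unfolding CC_def using Fk by auto
 show ?thesis
 proof (cases "f (Suc k) = Some (e0, r)")
  case True
  have "\<not> swap"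
  proof
   assume sw: "swap"
   then have "e' = e0" "r' = r" using sp True Fk unfolding swap_def by auto
   then have "P k \<in> pre (P (Suc k))" using consecutive_position(2)[OF P k(1) in1(3) B] B' B by (auto simp: pre_def)
   then show False using sw unfolding swap_def by blast
  qed
  moreover have "stay \<longleftrightarrow> CC f F k e R"
  proof -
   have c1: "Ins e q (Suc k) (f \<circ> s) F R \<longleftrightarrow> Ins e q (Suc k) f F R" for q
    using Ins_cong[of e q "Suc k" f F R "f \<circ> s" F] Ins_cong[of e q "Suc k" "f \<circ> s" F R f F] fs(3) by auto
   have "Ins e r k f F R \<longleftrightarrow> Ins e (Suc r) (Suc k) f F R" if "e0 = e"
   proof
    assume "Ins e r k f F R"
    then show "Ins e (Suc r) (Suc k) f F R"
    proof (cases rule: Ins.cases)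
     case base
     then show ?thesis using base(2)[of "Suc k"] True that by simp
    next
     case (step y)
     have "y = Suc k" using step(1) step(4)[of "Suc k"] True that by (cases "Suc k < y") auto
     then show ?thesis using step by simp
    qed
   next
    assume "Ins e (Suc r) (Suc k) f F R"
    then show "Ins e r k f F R" using True Fk that by (intro Ins.step[of k "Suc k"]) auto
   qed
   then show ?thesis unfolding stay_def st cc c1 using True Fk B B' Ins_label[of e "Suc r" "Suc k" f F R]
    by (auto simp: rw_def)
  qed
  ultimately show ?thesis by simp
 next
  case False
  then have "\<not> stay" unfolding stay_def st using Fk by auto
  moreover have "Ins e r k f F R \<longleftrightarrow> F (Suc k) = f (Suc k) \<and> Ins e r (Suc k) (f \<circ> s) (F \<circ> s) R" if e: "e0 = e"
  proof
   assume "Ins e r k f F R"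
   then show "F (Suc k) = f (Suc k) \<and> Ins e r (Suc k) (f \<circ> s) (F \<circ> s) R"
   proof (cases rule: Ins.cases)
    case base
    have "(f \<circ> s) y = f y" "(F \<circ> s) y = F y" if "Suc k < y" for y using fs(3)[of y] Fs(3)[of y] that by auto
    then have "Ins e r (Suc k) (f \<circ> s) (F \<circ> s) r"
     using base Fs(2) Suc_lessD by (intro Ins.base) (metis, metis, metis)
    then show ?thesis using base by simp
   next
    case (step y)
    have y: "Suc k < y" using step(1,2) False e by (cases "y = Suc k") auto
    have eq: "(f \<circ> s) z = f z" "(F \<circ> s) z = F z" if "Suc k < z" for z using fs(3)[of z] Fs(3)[of z] that by auto
    have "Ins e (Suc r) y (f \<circ> s) (F \<circ> s) R" by (rule Ins_cong[OF step(5)]) (use eq y in auto)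
    then have "Ins e r (Suc k) (f \<circ> s) (F \<circ> s) R"
     using step y eq Fs(2) by (intro Ins.step[of "Suc k" y]) auto
    then show ?thesis using step(4)[of "Suc k"] y by simp
   qed
  next
   assume "F (Suc k) = f (Suc k) \<and> Ins e r (Suc k) (f \<circ> s) (F \<circ> s) R"
   then have F1: "F (Suc k) = f (Suc k)" and I: "Ins e r (Suc k) (f \<circ> s) (F \<circ> s) R" by auto
   have eq: "(f \<circ> s) z = f z" "(F \<circ> s) z = F z" if "Suc k < z" for z using fs(3)[of z] Fs(3)[of z] that by auto
   from I show "Ins e r k f F R"
   proof (cases rule: Ins.cases)
    case base
    have "f y ~= Some (e, r) \<and> F y = f y" if "k < y" for y
     using base(2)[of y] base(4)[of y] eq[of y] F1 False e that by (cases "y = Suc k") auto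
    then have "Ins e r k f F r" using Fk(1) e by (intro Ins.base) auto
    then show ?thesis using base by simp
   next
    case (step y)
    have mid: "f z ~= Some (e, r) \<and> F z = f z" if "k < z" "z < y" for z
     using step(4)[of z] eq[of z] F1 False e that by (cases "z = Suc k") auto
    have "Ins e (Suc r) y f F R" by (rule Ins_cong[OF step(5)]) (use eq step(1) in auto)
    then show ?thesis using step(1,2) eq(1)[of y] Fk(1) e mid by (intro Ins.step[of k y]) auto
   qed
  qed
  then have "CC f F k e R \<longleftrightarrow> CC (f \<circ> s) (F \<circ> s) (Suc k) e R" unfolding cc sp by blast
  \<comment> \<open>The ballot condition of \<open>f\<close> is used here: adjacency would put
    \<open>k + 1\<close> directly below \<open>k\<close> and make the lower row of \<open>f\<close>
    overtake the upper one at \<open>k + 1\<close>.\<close>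
  moreover have "P k \<notin> pre (P (Suc k))" if "CC (f \<circ> s) (F \<circ> s) (Suc k) e R"
  proof
   assume "P k \<in> pre (P (Suc k))"
   then have ee: "e' = e0" and alt: "r' = Suc r \<and> c' = c \<or> r' = r" using B B' by (auto simp: pre_def split: if_splits)
   have F1: "F (Suc k) = f (Suc k)" and below: "\<forall>y<k. F y = f y" using that sp by blast+
   then have r': "r' = Suc r" "c' = c" using alt False Fk ee by auto
   have cF: "cnt (rowm P n) l i = cnt F l i" if "i \<le> k" for l i
    using that k by (intro cnt_cong) (simp add: F_def rowm_def)
   have cf: "cnt F l (k - 1) = cnt f l (k - 1)" for l
    using below k(1) by (intro cnt_cong) auto
   have "c = cnt f (e0, r) (k - 1)" using valid_col[OF P in1(1) B] cF[of "k - 1"] cf by simp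
   moreover have "c = cnt F (e0, Suc r) k" using valid_col[OF P in1(2) B'] cF[of k] r' ee by simp
   then have "c = cnt f (e0, Suc r) (k - 1)" using cnt_pred[of k F "(e0, Suc r)"] k(1) Fk(1) cf by simp
   moreover have "cnt f (e0, Suc r) (Suc k) \<le> cnt f (e0, r) (Suc k)" using f(1) by (simp add: lat_def)
   ultimately show False
    using cnt_pred[of k f "(e0, Suc r)"] cnt_pred[of k f "(e0, r)"] k(1) f(2)
     cnt_Suc[of f "(e0, Suc r)" k] cnt_Suc[of f "(e0, r)" k]
    unfolding F1[symmetric] Fk(2) ee r' by simp
  qed
  ultimately show ?thesis unfolding swap_def by auto
 qed
qed

subsection \<open>The leading coefficient theorem\<close>

definition omm :: "tab => nat => 'g K" where "omm P m = (\<Prod>i\<in>{1..m}. om (P i))"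

lemma omm_neq_0 [simp]: "omm P m ~= 0"
 by (simp add: omm_def)

lemma omm_Suc: "omm P (Suc m) = omm P m * om (P (Suc m))"
 by (simp add: omm_def mult.commute)

lemma omm_sw: assumes "1 \<le> k" "Suc k \<le> m" shows "omm (sw k P) m = omm P m"
 unfolding omm_def
 by (rule prod.reindex_bij_witness[of _ "transpose k (Suc k)" "transpose k (Suc k)"])
  (use assms in \<open>auto simp: sw_def transpose_def\<close>)

definition WW :: "nat => (int => int) set" where
 "WW m = {w \<in> W n. \<forall>i. int m < \<bar>i\<bar> --> w i = i}"

lemma WW_W: "w \<in> WW m ==> w \<in> W n" by (simp add: WW_def)

lemma WW_bound: assumes "w \<in> WW m" "\<bar>i\<bar> \<le> int m" shows "\<bar>w i\<bar> \<le> int m"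
proof (rule ccontr)
 assume "\<not> \<bar>w i\<bar> \<le> int m"
 then have "w (w i) = w i" using assms by (auto simp: WW_def)
 then have "w i = i" using W_inj[OF WW_W[OF assms(1)]] by blast
 then show False using \<open>\<not> \<bar>w i\<bar> \<le> int m\<close> assms by simp
qed

definition agree :: "nat => (int => int) => tab => tab => bool" where
 "agree m w P Q \<longleftrightarrow> (\<forall>i\<in>{m + 1..n}. P i = Q i) \<and> rowm P m = rsP w m \<and> rowm Q m = Qmap w m"

text \<open>The claim during the insertion of \<open>k\<close> as \<open>m\<close>-th letter.\<close>

definition agree' :: "nat => (int => int) => nat => tab => tab => bool" where
 "agree' m w k P Q \<longleftrightarrow> (\<forall>i\<in>{Suc m + 1..n}. P i = Q i) \<and> rowm Q m = Qmap w m \<and>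
   CC (rsP w m) (rowm P (Suc m)) k (fst (Q (Suc m))) (rw (Q (Suc m)))"

lemma lab_rw: "lab B = (fst B, rw B)" by (simp add: lab_def rw_def)

text \<open>\<open>m + 1\<close> exceeds all entries present, so a tail of a bumping path starting
  with it ends at once. It remains to recover the column of \<open>m + 1\<close> in both fillings,
  by counting.\<close>

lemma agree'_start:
 assumes P: "valid P" and Q: "valid Q" and m: "Suc m \<le> n" and w: "w \<in> WW m"
 shows "agree' m w (Suc m) P Q \<longleftrightarrow> agree m w P Q"
proof -
 have gw: "good_word w m" using W_good[OF WW_W[OF w]] m by simp
 have img: "au w ` {1..m} = {1..m}"
 proof (rule endo_inj_surj)
  show "au w ` {1..m} \<subseteq> {1..m}"
  proof (rule image_subsetI)
   fix i assume "i \<in> {1..m}"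
   then show "au w i \<in> {1..m}" using WW_bound[OF w, of "int i"] W_eq_0_iff[OF WW_W[OF w], of "int i"] by auto
  qed
  show "inj_on (au w) {1..m}" using gw by (simp add: good_word_def)
 qed simp
 note main = rsP_main[OF gw, unfolded img]
 have dom: "rsP w m y = None" if "m < y" for y using main that by auto
 have Fm: "rowm P (Suc m) (Suc m) = Some (lab (P (Suc m)))" by (simp add: rowm_def)
 have ins: "Ins e r (Suc m) (rsP w m) (rowm P (Suc m)) R \<longleftrightarrow> R = r \<and> lab (P (Suc m)) = (e, r)" for e r R
 proof
  assume "Ins e r (Suc m) (rsP w m) (rowm P (Suc m)) R"
  then show "R = r \<and> lab (P (Suc m)) = (e, r)"
  proof (cases rule: Ins.cases)
   case base
   then show ?thesis using Fm by simp
  next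
   case (step y)
   then show ?thesis using dom[of y] by simp
  qed
 next
  assume "R = r \<and> lab (P (Suc m)) = (e, r)"
  then show "Ins e r (Suc m) (rsP w m) (rowm P (Suc m)) R"
   using dom Fm by (auto intro!: Ins.base simp: rowm_def)
 qed
 have CC: "CC (rsP w m) (rowm P (Suc m)) (Suc m) e R \<longleftrightarrow> rowm P m = rsP w m \<and> lab (P (Suc m)) = (e, R)" for e R
 proof -
  have "(\<forall>y<Suc m. rowm P (Suc m) y = rsP w m y) \<longleftrightarrow> rowm P m = rsP w m"
  proof
   assume h: "\<forall>y<Suc m. rowm P (Suc m) y = rsP w m y"
   show "rowm P m = rsP w m"
   proof
    fix y show "rowm P m y = rsP w m y"
     using spec[OF h, of y] dom[of y] by (cases "y \<le> m") (auto simp: rowm_def)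
   qed
  next
   assume "rowm P m = rsP w m"
   moreover have "rowm P (Suc m) y = rowm P m y" if "y < Suc m" for y using that by (simp add: rowm_def)
   ultimately show "\<forall>y<Suc m. rowm P (Suc m) y = rsP w m y" by simp
  qed
  then show ?thesis unfolding CC_def ins Fm by auto
 qed
 have "P (Suc m) = Q (Suc m)" if h: "rowm P m = rsP w m" "rowm Q m = Qmap w m" "lab (P (Suc m)) = lab (Q (Suc m))"
 proof -
  have c: "cnt (rowm X n) l m = cnt (rowm X m) l m" for X l
   using m by (intro cnt_cong) (simp add: rowm_def)
  have eq: "cnt (rowm P n) l m = cnt (rowm Q n) l m" for l
   unfolding c h(1,2) using main by (metis atLeastAtMost_iff)
  obtain e r d where B: "P (Suc m) = (e, r, d)" by (cases "P (Suc m)") auto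
  obtain d' where B': "Q (Suc m) = (e, r, d')" using h(3) B by (cases "Q (Suc m)") auto
  show ?thesis using valid_col[OF P _ B] valid_col[OF Q _ B'] m eq B B' by simp
 qed
 moreover have "(\<forall>i\<in>{m + 1..n}. P i = Q i) \<longleftrightarrow> (\<forall>i\<in>{Suc m + 1..n}. P i = Q i) \<and> P (Suc m) = Q (Suc m)"
 proof -
  have "{m + 1..n} = insert (Suc m) {Suc m + 1..n}" using m by auto
  then show ?thesis by auto
 qed
 ultimately show ?thesis unfolding agree'_def agree_def CC lab_rw[symmetric] by auto
qed

text \<open>Together with \<open>tends_om_neg\<close> this fixes the start of the bumping path: a
  positive letter enters row 0 of the first component, a negative one row 0 of the second.\<close>

lemma tends_om_pos:
 assumes "valid P" "k \<in> {1..n}"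
 shows "tends (1 / om (P k)) (if lab (P k) = (True, 0) then 1 else 0)"
proof -
 obtain e r c where B: "P k = (e, r, c)" by (cases "P k") auto
 have h: "r + c < n" by (rule valid_hook[OF assms B])
 show ?thesis
 proof (cases e)
  case True
  then show ?thesis using tends_E_le[of "- int r"] by (simp add: B om_def E_inverse divide_inverse)
 next
  case False
  have "1 / om (P k) = of_int ((- 1) ^ r) * E (- 1) (int r - 2 * int c)"
   using False by (simp add: B om_def divide_inverse inverse_mult_distrib E_inverse minus_one_power_iff)
  moreover have "tends \<dots> ((- 1) ^ r * 0)" using h by (intro lim_mult lim_of_int tends_E) auto
  ultimately show ?thesis using False by (simp add: B)
 qed
qed

lemma tends_om_neg:
 assumes "valid P" "k \<in> {1..n}"
 shows "tends (x (P k) / om (P k)) (if lab (P k) = (False, 0) then 1 else 0)"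
proof -
 obtain e r c where B: "P k = (e, r, c)" by (cases "P k") auto
 have h: "r + c < n" by (rule valid_hook[OF assms B])
 show ?thesis
 proof (cases e)
  case True
  then have "x (P k) / om (P k) = - E (- 1) (int r - 2 * int c)"
   by (simp add: B om_def x_def ct_def E_inverse E_mult divide_inverse algebra_simps)
  moreover have "tends \<dots> (- 0)" using h by (intro lim_uminus tends_E) auto
  ultimately show ?thesis using True by (simp add: B)
 next
  case False
  have "x (P k) / om (P k) = of_int ((- 1) ^ r) * E 0 (- int r)"
   using False by (simp add: B om_def x_def ct_def divide_inverse inverse_mult_distrib E_inverse minus_one_power_iff E_mult)
  moreover have "tends \<dots> ((- 1) ^ r * (if - int r = 0 then 1 else 0))" by (intro lim_mult lim_of_int tends_E_le) auto
  ultimately show ?thesis using False by (simp add: B split: if_splits)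
 qed
qed

lemma WW_gen_left: "w \<in> WW m ==> 1 \<le> k ==> k < m ==> m \<le> n ==> gen k \<circ> w \<in> WW m"
 unfolding WW_def using W_comp[OF gen_in_W[of k n]] by (auto simp: gen_apply lo_def hi_def)

text \<open>\<open>w\<close> is \<open>s_k s_{k+1} ... s_m\<close> times an element of the smaller
  group, and the induction removes these factors from the left. The factor \<open>om (P k)\<close>
  cancels the weight of the entry in motion; it is accounted for only when the start of the path is
  fixed.\<close>

lemma agree'_tends:
 assumes lead: "\<And>w P Q. w \<in> WW m ==> valid P ==> valid Q ==>
   tends (Rw w (dl Q) P / omm P m) (if agree m w P Q then 1 else 0)"
  and m: "Suc m \<le> n" and k: "1 \<le> k" "k \<le> Suc m"
  and w: "w \<in> WW (Suc m)" "w (int (Suc m)) = int k" and PQ: "valid P" "valid Q"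
 shows "tends (Rw w (dl Q) P * om (P k) / omm P (Suc m)) (if agree' m w k P Q then 1 else 0)"
 using k(2,1) w PQ(1)
proof (induction k arbitrary: w P rule: inc_induct)
 case base
 have "w i = i" if mi: "int m < \<bar>i\<bar>" for i
 proof -
  consider "int (Suc m) < \<bar>i\<bar>" | "i = int (Suc m)" | "i = - int (Suc m)" using mi by linarith
  then show ?thesis
  proof cases
   case 3
   then show ?thesis using base.prems(3) W_odd[OF WW_W[OF base.prems(2)], of "int (Suc m)"] by simp
  qed (use base.prems in \<open>auto simp: WW_def\<close>)
 qed
 then have w': "w \<in> WW m" using base.prems by (auto simp: WW_def)
 have "Rw w (dl Q) P * om (P (Suc m)) / omm P (Suc m) = Rw w (dl Q) P / omm P m"
  by (simp add: omm_Suc)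
 then show ?case using lead[OF w' base.prems(4) PQ(2)] agree'_start[OF base.prems(4) PQ(2) m w'] by simp
next
 case (step k)
 let ?s = "transpose k (Suc k)" and ?w = "gen k \<circ> w" and ?Z = "Rw (gen k \<circ> w) (dl Q)"
 have kn: "k < n" "Suc k \<le> Suc m" using step m by auto
 have W: "w \<in> W n" using step.prems WW_W by blast
 have w': "?w \<in> WW (Suc m)" using WW_gen_left step m by simp
 have gk: "gen k (int k) = int (Suc k)" "lo k = int k" "hi k = int (Suc k)"
  using step.prems by (simp_all add: gen_apply lo_def hi_def)
 have wm: "?w (int (Suc m)) = int (Suc k)" using step.prems gk by simp
 have inv: "inv ?w y = inv w (gen k y)" for y
  using W_inv_comp[OF gen_in_W[OF kn(1)] W] by simp
 have i1: "inv ?w (int (Suc k)) = int (Suc m)"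
  unfolding inv using gk gen_gen(2)[of k "int k"] W_inv_inverses(3)[OF W, of "int (Suc m)"] step.prems(3) by metis
 have i2: "inv ?w (int k) < int (Suc m)"
 proof -
  let ?y = "inv ?w (int k)"
  have "\<not> int (Suc m) < \<bar>?y\<bar>"
  proof
   assume "int (Suc m) < \<bar>?y\<bar>"
   then have "?w ?y = ?y" using w' unfolding WW_def by blast
   then have "?y = int k" using W_inv_inverses(4)[OF WW_W[OF w']] by metis
   then show False using \<open>int (Suc m) < \<bar>?y\<bar>\<close> step by simp
  qed
  moreover have "?y ~= int (Suc m)" using i1 W_inj[OF W_inv[OF WW_W[OF w']], of "int k" "int (Suc k)"] by auto
  ultimately show ?thesis by linarith
 qed
 have "Rw (gen k \<circ> ?w) (dl Q) = Rop k ?Z"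
  by (rule Rw_left[OF WW_W[OF w'] kn(1)]) (use i1 i2 gk in simp)
 then have Rw: "Rw w (dl Q) P = phi (P k) (P (Suc k)) * ?Z P + theta (P k) (P (Suc k)) * ?Z (sw k P)"
  using step.prems by (simp add: Rop_def)
 let ?c1 = "fst (P k) = fst (P (Suc k)) \<and> rw (P (Suc k)) = Suc (rw (P k))"
 have IH: "valid X ==> tends (?Z X * om (X (Suc k)) / omm X (Suc m)) (if agree' m ?w (Suc k) X Q then 1 else 0)" for X
  by (rule step.IH[OF _ w' wm]) simp_all
 have t1: "tends (phi (P k) (P (Suc k)) * ?Z P * om (P k) / omm P (Suc m))
   ((if ?c1 then 1 else 0) * (if agree' m ?w (Suc k) P Q then 1 else 0))"
 proof -
  have "phi (P k) (P (Suc k)) * ?Z P * om (P k) / omm P (Suc m)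
   = (phi (P k) (P (Suc k)) * om (P k) / om (P (Suc k))) * (?Z P * om (P (Suc k)) / omm P (Suc m))"
   by simp
  then show ?thesis using lim_mult[OF tends_phi_om[OF step.prems(4,1) kn(1)] IH[OF step.prems(4)]]
   by (simp only:)
 qed
 have t2: "tends (theta (P k) (P (Suc k)) * ?Z (sw k P) * om (P k) / omm P (Suc m))
   (if P k \<notin> pre (P (Suc k)) \<and> agree' m ?w (Suc k) (sw k P) Q then 1 else 0)"
 proof (cases "P k \<in> pre (P (Suc k))")
  case True
  then show ?thesis by (simp add: theta_adj)
 next
  case False
  have vs: "valid (sw k P)" by (rule valid_sw[OF step.prems(4,1) kn(1) False])
  have "theta (P k) (P (Suc k)) * ?Z (sw k P) * om (P k) / omm P (Suc m)
    = theta (P k) (P (Suc k)) * (?Z (sw k P) * om (sw k P (Suc k)) / omm (sw k P) (Suc m))"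
   using step.prems kn by (simp add: omm_sw sw_apply)
  then show ?thesis using lim_mult[OF tends_theta_consecutive(1)[OF step.prems(4,1) kn(1) False] IH[OF vs]] False
   by simp
 qed
 have gw: "good_word w m" "good_word w (Suc m)" using W_good[OF W] m by simp_all
 have k0: "k \<notin> au w ` {1..m}"
 proof -
  have "au w (Suc m) = k" using step.prems by simp
  then show ?thesis using gw(2) unfolding good_word_Suc by simp
 qed
 have f: "rsP ?w m = rsP w m \<circ> ?s" "Qmap ?w m = Qmap w m"
  using rsP_swap[OF step.prems(1) gw(1)] k0 by (auto simp: Qmap_def fun_eq_iff)
 have fk: "lat (rsP w m)" "rsP w m k = None" using rsP_main[OF gw(1)] k0 by auto
 have rs: "rowm (sw k P) (Suc m) = rowm P (Suc m) \<circ> ?s"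
  using step.prems kn by (auto simp: fun_eq_iff rowm_def sw_apply transpose_def)
 have out: "(\<forall>i\<in>{Suc m + 1..n}. sw k P i = Q i) \<longleftrightarrow> (\<forall>i\<in>{Suc m + 1..n}. P i = Q i)"
  using kn by (intro ball_cong) (auto simp: sw_apply)
 let ?common = "(\<forall>i\<in>{Suc m + 1..n}. P i = Q i) \<and> rowm Q m = Qmap w m"
 have "(if ?c1 then 1 else 0) * (if agree' m ?w (Suc k) P Q then 1 else 0) +
    (if P k \<notin> pre (P (Suc k)) \<and> agree' m ?w (Suc k) (sw k P) Q then 1 else 0)
   = (if agree' m w k P Q then 1 else 0 :: int)"
 proof (cases ?common)
  case True
  then show ?thesis
   using CC_step[OF step.prems(4,1) kn(2) m fk, of "fst (Q (Suc m))" "rw (Q (Suc m))"]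
   unfolding agree'_def f rs out by auto
 next
  case False
  then show ?thesis unfolding agree'_def f out by auto
 qed
 then show ?case using lim_add[OF t1 t2] unfolding Rw by (simp add: distrib_right add_divide_distrib)
qed

text \<open>Induction on the value \<open>k\<close>: passing from \<open>k\<close> to
  \<open>k + 1\<close> surrounds the operator by two copies of \<open>Rop k\<close>, which is the
  recursion \<open>tmul_Suc\<close>.\<close>

lemma Rw_negate:
 assumes w: "w \<in> W n" and m: "1 \<le> m" "m \<le> n" and k: "1 \<le> k" "k \<le> n"
  and wm: "w (int m) = int k" and big: "\<And>i. int m < \<bar>i\<bar> ==> w i = i"
 shows "Rw (w \<circ> rfl (- int m) (int m)) X = tmul k (Rw w X)"
 using k w wm big
proof (induction k arbitrary: w rule: nat_induct_at_least)
 case base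
 let ?t = "rfl (- int m) (int m)"
 have "w \<circ> ?t = rfl (w (- int m)) (w (int m)) \<circ> w"
  using rfl_conj[OF base.prems(2), of "- int m" "int m"] m by simp
 also have "rfl (w (- int m)) (w (int m)) = gen 0"
  using W_odd[OF base.prems(2)] base.prems(3) by (simp add: gen_eq_rfl lo_def hi_def)
 finally have eq: "w \<circ> ?t = gen 0 \<circ> w" .
 have "inv w 1 = int m" using W_inv_inverses(3)[OF base.prems(2), of "int m"] base.prems(3) by simp
 then have "inv w (lo 0) < inv w (hi 0)" using W_odd[OF W_inv[OF base.prems(2)], of 1] m by (simp add: lo_def hi_def)
 then show ?case unfolding eq using Rw_left[OF base.prems(2) n_pos] tmul_1 by (simp only:)
next
 case (Suc k)
 let ?t = "rfl (- int m) (int m)" and ?w = "gen k \<circ> w"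
 have kn: "k < n" "1 \<le> k" using Suc by auto
 have gk: "gen k (int (Suc k)) = int k" "gen k (int k) = int (Suc k)" "lo k = int k" "hi k = int (Suc k)"
  using kn by (simp_all add: gen_apply lo_def hi_def)
 have w': "?w \<in> W n" using Suc.prems gen_in_W[OF kn(1)] W_comp by blast
 have wm': "?w (int m) = int k" using Suc.prems gk by simp
 have km: "Suc k \<le> m"
 proof (rule ccontr)
  assume "\<not> Suc k \<le> m"
  then have "w (int (Suc k)) = int (Suc k)" by (intro Suc.prems(4)) simp
  then have "int m = int (Suc k)" using Suc.prems(3) W_inj[OF Suc.prems(2)] by metis
  then show False using \<open>\<not> Suc k \<le> m\<close> by simp
 qed
 have big': "?w i = i" if "int m < \<bar>i\<bar>" for i
  using Suc.prems(4)[OF that] that km kn by (auto simp: gen_apply lo_def hi_def)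
 have inv: "inv ?w y = inv w (gen k y)" for y
  using W_inv_comp[OF gen_in_W[OF kn(1)] Suc.prems(2)] by simp
 have i0: "inv w (int (Suc k)) = int m" using W_inv_inverses(3)[OF Suc.prems(2), of "int m"] Suc.prems(3) by simp
 have bd: "\<bar>inv w (int k)\<bar> \<le> int m"
 proof (rule ccontr)
  assume h: "\<not> \<bar>inv w (int k)\<bar> \<le> int m"
  then have "w (inv w (int k)) = inv w (int k)" by (intro Suc.prems(4)) simp
  then have "inv w (int k) = int k" using W_inv_inverses(4)[OF Suc.prems(2)] by metis
  then show False using h km by simp
 qed
 have ne: "inv w (int k) ~= int m" "inv w (int k) ~= - int m"
 proof -
  show "inv w (int k) ~= int m" using i0 W_inj[OF W_inv[OF Suc.prems(2)], of "int k" "int (Suc k)"] by simp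
  have "inv w (- int (Suc k)) = - int m" using i0 W_odd[OF W_inv[OF Suc.prems(2)]] by metis
  then show "inv w (int k) ~= - int m" using W_inj[OF W_inv[OF Suc.prems(2)], of "int k" "- int (Suc k)"] by auto
 qed
 have tW: "?t \<in> W n" using m by (intro rfl_in_W) auto
 have t2: "?t \<circ> ?t = id" using m by (intro rfl_rfl) auto
 have invt: "inv ?t = ?t" using t2 by (intro inv_unique_comp) auto
 have "Rw (gen k \<circ> w) X = Rw ?w X" by simp
 have e1: "Rw ?w X = Rop k (Rw w X)"
  using bd ne i0 gk by (intro Rw_left[OF Suc.prems(2) kn(1)]) (simp del: of_nat_Suc)
 let ?u = "?w \<circ> ?t"
 have u: "?u \<in> W n" using w' tW W_comp by blast
 have invu: "inv ?u y = ?t (inv w (gen k y))" for y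
  using W_inv_comp[OF w' tW] invt inv by simp
 have ti: "?t (int m) = - int m" "?t (inv w (int k)) = inv w (int k)"
  using m ne by (simp_all add: rfl_apply)
 have "Rw (gen k \<circ> ?u) X = Rop k (Rw ?u X)"
 proof (rule Rw_left[OF u kn(1)])
  have "inv ?u (int k) = - int m" "inv ?u (int (Suc k)) = inv w (int k)"
   unfolding invu gk i0 ti by simp_all
  then show "inv ?u (lo k) < inv ?u (hi k)" unfolding gk(3,4) using bd ne by simp
 qed
 moreover have "gen k \<circ> ?u = w \<circ> ?t" by (simp add: comp_assoc[symmetric])
 moreover have "Rw ?u X = tmul k (Rw ?w X)"
  by (rule Suc.IH[OF _ w' wm' big']) (use kn in auto)
 ultimately have "Rw (w \<circ> ?t) X = Rop k (tmul k (Rw ?w X))" by (simp only:)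
 then show ?case unfolding e1 by (simp only: tmul_Suc[OF kn(2,1)])
qed

lemma cancel1: "c ~= 0 ==> y / z = (1 / c) * (y * c / z)" for y z c :: "'g K"
 by simp

lemma cancel2: "c ~= 0 ==> d * y / z = (d / c) * (y * c / z)" for y z c d :: "'g K"
 by simp

text \<open>Induction on the number \<open>m\<close> of letters. The last letter is made positive
  (\<open>u\<close>) and treated by \<open>agree'_tends\<close>; for a negative letter
  \<open>Rw_negate\<close> restores the sign at the cost of the eigenvalue \<open>x\<close>. The
  remaining factor in \<open>om\<close> decides whether the path starts in row 0 of the right
  component.\<close>

theorem leading_coefficient:
 assumes "m \<le> n" "w \<in> WW m" "valid P" "valid Q"
 shows "tends (Rw w (dl Q) P / omm P m) (if agree m w P Q then 1 else 0)"
 using assms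
proof (induction m arbitrary: w P Q)
 case 0
 then have "w = id" using W_ext[OF WW_W[OF 0(2)] W_id] by (auto simp: WW_def)
 moreover have "agree 0 id P Q \<longleftrightarrow> P = Q"
 proof
  assume h: "agree 0 id P Q"
  have "P i = Q i" for i
   using h 0(3,4) by (cases "i \<in> {1..n}") (auto simp: agree_def valid_def)
  then show "P = Q" by blast
 qed (auto simp: agree_def fun_eq_iff rowm_def Qmap_def)
 moreover have "tends (dl Q P / omm P 0) (if P = Q then 1 else 0)" by (simp add: omm_def dl_def)
 ultimately show ?case by (simp only: Rw_id)
next
 case (Suc m)
 note lead = Suc.IH[OF Suc_leD[OF Suc.prems(1)]]
 let ?M = "Suc m" and ?k = "au w (Suc m)" and ?e = "0 < w (int (Suc m))"
 have W: "w \<in> W n" using WW_W Suc.prems by blast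
 have k: "1 \<le> ?k" "?k \<le> Suc m"
  using WW_bound[OF Suc.prems(2), of "int ?M"] W_eq_0_iff[OF W, of "int ?M"] by auto
 then have kn: "?k \<in> {1..n}" using Suc.prems by auto
 let ?t = "rfl (- int ?M) (int ?M)"
 define u where "u = (if ?e then w else w \<circ> ?t)"
 have tW: "?t \<in> W n" using Suc.prems by (intro rfl_in_W) auto
 have uW: "u \<in> W n" using W W_comp[OF W tW] by (simp add: u_def)
 have tap: "?t i = (if i = int ?M then - int ?M else if i = - int ?M then int ?M else i)" for i
  by (subst rfl_apply) auto
 have u: "u \<in> WW ?M" unfolding WW_def
 proof (intro CollectI conjI allI impI uW)
  fix i assume i: "int ?M < \<bar>i\<bar>"
  then have "?t i = i" unfolding tap by auto
  then show "u i = i" using Suc.prems(2) i by (simp add: u_def WW_def)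
 qed
 have uM: "u (int ?M) = int ?k" 
 proof (cases ?e)
  case False
  have "?t (int ?M) = - int ?M" by (subst rfl_apply) auto
  then have "u (int ?M) = w (- int ?M)" using False unfolding u_def by (simp only: if_False comp_apply)
  then show ?thesis using W_odd[OF W, of "int ?M"] False by simp
 qed (simp add: u_def)
 have ui: "u (int i) = w (int i)" if "i \<in> {1..m}" for i
 proof -
  have "?t (int i) = int i" using that unfolding tap by auto
  then show ?thesis by (simp add: u_def)
 qed
 have uP: "rsP u j = rsP w j" if "j \<le> m" for j using ui that by (intro rsP_cong) auto
 have "rsQ u i = rsQ w i" if "i \<in> {1..m}" for i
 proof -
  have "i - 1 \<le> m" using that by auto
  then show ?thesis unfolding rsQ_def ui[OF that] by (simp only: uP)
 qed
 then have uQ: "Qmap u m = Qmap w m" by (auto simp: fun_eq_iff Qmap_def)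
 note A = agree'_tends[OF lead Suc.prems(1) k u uM Suc.prems(3,4)]
 have "agree ?M w P Q \<longleftrightarrow> lab (P ?k) = (?e, 0) \<and> agree' m u ?k P Q"
 proof -
  have gw: "good_word w ?M" by (rule W_good[OF W Suc.prems(1)])
  note I = rsP_Ins[OF gw]
  have Pk: "rowm P ?M ?k = Some (lab (P ?k))" using k by (simp add: rowm_def)
  have Q: "rowm Q ?M = Qmap w ?M \<longleftrightarrow> rowm Q m = Qmap w m \<and> lab (Q ?M) = rsQ w ?M"
  proof
   assume h: "rowm Q ?M = Qmap w ?M"
   have "rowm Q m i = Qmap w m i" for i using fun_cong[OF h, of i] by (auto simp: rowm_def Qmap_def split: if_splits)
   then show "rowm Q m = Qmap w m \<and> lab (Q ?M) = rsQ w ?M"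
    using fun_cong[OF h, of ?M] by (auto simp: rowm_def Qmap_def)
  next
   assume h: "rowm Q m = Qmap w m \<and> lab (Q ?M) = rsQ w ?M"
   have "rowm Q ?M i = Qmap w ?M i" for i
   proof (cases "i = ?M")
    case True
    then show ?thesis using h by (simp add: rowm_def Qmap_def)
   next
    case False
    then show ?thesis using fun_cong[OF conjunct1[OF h], of i]
     by (auto simp: rowm_def Qmap_def split: if_splits)
   qed
   then show "rowm Q ?M = Qmap w ?M" by blast
  qed
  have rsq: "rsQ w ?M = (?e, snd (rsQ w ?M))" by (simp add: rsQ_def)
  have core: "rowm P ?M = rsP w ?M \<and> lab (Q ?M) = rsQ w ?M \<longleftrightarrow>
    lab (P ?k) = (?e, 0) \<and> CC (rsP w m) (rowm P ?M) ?k (fst (Q ?M)) (rw (Q ?M))"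
  proof
   assume h: "rowm P ?M = rsP w ?M \<and> lab (Q ?M) = rsQ w ?M"
   then have "(fst (Q ?M), rw (Q ?M)) = (?e, snd (rsQ w ?M))" using rsq unfolding lab_rw by metis
   then have q: "fst (Q ?M) = ?e" "rw (Q ?M) = snd (rsQ w ?M)" unfolding prod.inject by blast+
   have F: "rsP w ?M ?k = Some (?e, 0)" by (rule Ins_label[OF I(1)])
   then have "lab (P ?k) = (?e, 0)" using h Pk by simp
   moreover have "CC (rsP w m) (rowm P ?M) ?k (fst (Q ?M)) (rw (Q ?M))"
    unfolding CC_def q using I F h by auto
   ultimately show "lab (P ?k) = (?e, 0) \<and> CC (rsP w m) (rowm P ?M) ?k (fst (Q ?M)) (rw (Q ?M))" by blast
  next
   assume h: "lab (P ?k) = (?e, 0) \<and> CC (rsP w m) (rowm P ?M) ?k (fst (Q ?M)) (rw (Q ?M))"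
   then have q: "fst (Q ?M) = ?e" and below: "\<forall>y<?k. rowm P ?M y = rsP w m y"
    and ins: "Ins ?e 0 ?k (rsP w m) (rowm P ?M) (rw (Q ?M))"
    unfolding CC_def using Pk by auto
   have R: "snd (rsQ w ?M) = rw (Q ?M)" and F: "\<forall>y\<ge>?k. rsP w ?M y = rowm P ?M y"
    using Ins_det[OF I(1) ins] by blast+
   have "rowm P ?M y = rsP w ?M y" for y
    using F below I(2)[of y] by (cases "y < ?k") auto
   then have eq: "rowm P ?M = rsP w ?M" by blast
   have "rsQ w ?M = (fst (Q ?M), rw (Q ?M))" unfolding q R[symmetric] by (rule rsq)
   then show "rowm P ?M = rsP w ?M \<and> lab (Q ?M) = rsQ w ?M" using eq unfolding lab_rw by simp
  qed
  show ?thesis unfolding agree_def agree'_def Q uP[OF order_refl] uQ using core by auto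
 qed
 then have ind: "(if agree ?M w P Q then 1 else 0) =
   (if lab (P ?k) = (?e, 0) then 1 else 0) * (if agree' m u ?k P Q then 1 else 0 :: int)" by simp
 show ?case
 proof (cases ?e)
  case True
  then have uw: "u = w" unfolding u_def by (rule if_P)
  have eq: "Rw w (dl Q) P / omm P ?M = (1 / om (P ?k)) * (Rw u (dl Q) P * om (P ?k) / omm P ?M)"
   unfolding uw by (rule cancel1[OF om_neq_0])
  have eT: "?e = True" using True by blast
  show ?thesis
   by (subst eq, subst ind, subst eT, rule lim_mult[OF tends_om_pos[OF Suc.prems(3) kn] A])
 next
  case False
  have tt: "?t \<circ> ?t = id" by (rule rfl_rfl) auto
  have ut: "u \<circ> ?t = w" using False tt unfolding u_def by (simp only: if_False comp_assoc comp_id)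
  have "Rw (u \<circ> ?t) (dl Q) = tmul ?k (Rw u (dl Q))"
  proof (rule Rw_negate[OF uW _ Suc.prems(1) k(1) _ uM])
   show "1 \<le> ?M" by simp
   show "?k \<le> n" using kn by simp
   show "u i = i" if "int ?M < \<bar>i\<bar>" for i using u that unfolding WW_def by blast
  qed
  then have "Rw w (dl Q) = tmul ?k (Rw u (dl Q))" unfolding ut .
  then have e: "Rw w (dl Q) P = x (P ?k) * Rw u (dl Q) P" using Suc.prems(3) by (simp only: tmul_def if_True)
  have eq: "Rw w (dl Q) P / omm P ?M = (x (P ?k) / om (P ?k)) * (Rw u (dl Q) P * om (P ?k) / omm P ?M)"
   unfolding e by (rule cancel2[OF om_neq_0])
  have eF: "?e = False" using False by blast
  show ?thesis
   by (subst eq, subst ind, subst eF, rule lim_mult[OF tends_om_neg[OF Suc.prems(3) kn] A])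
 qed
qed

corollary leading_coefficient':
 assumes "w \<in> W n" "valid P" "valid Q"
 shows "tends (Rw w (dl Q) P / omm P n) (if P = PT w \<and> Q = QT w then 1 else 0)"
proof -
 have "w \<in> WW n" using assms W_outside by (auto simp: WW_def)
 moreover have "agree n w P Q \<longleftrightarrow> P = PT w \<and> Q = QT w"
  using valid_eqI[OF assms(2) PT_QT(1)[OF assms(1)]] valid_eqI[OF assms(3) PT_QT(2)[OF assms(1)]]
   PT_QT(3,4)[OF assms(1)] by (auto simp: agree_def)
 ultimately show ?thesis using leading_coefficient[OF order_refl _ assms(2,3), of w] by (simp only:)
qed

end

section \<open>The Hecke algebra and its Kazhdan--Lusztig basis\<close>

text \<open>Add to the part with positive exponents its mirror image and keep the constant
  term.\<close>

lemma bar_invariant_part: "\<exists>s. A_bar s = s \<and> p - s \<in> A_neg" for p :: "'g::linordered_ab_group_add gring"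
proof (rule gring_induct[of _ p])
 fix \<gamma> :: 'g and k :: int
 consider "\<gamma> < 0" | "\<gamma> = 0" | "0 < \<gamma>" using less_linear[of \<gamma> 0] by blast
 then show "\<exists>s. A_bar s = s \<and> Poly_Mapping.single \<gamma> k - s \<in> A_neg"
 proof cases
  case 1
  then show ?thesis by (intro exI[of _ 0]) (auto simp: A_neg_coef lookup_single)
 next
  case 2
  then show ?thesis by (intro exI[of _ "Poly_Mapping.single \<gamma> k"]) (simp add: A_bar_single)
 next
  case 3
  then have "coef (Poly_Mapping.single (- \<gamma>) k) \<delta> = 0" if "0 \<le> \<delta>" for \<delta>
   using that by (auto simp: lookup_single when_def)
  then have "- Poly_Mapping.single (- \<gamma>) k \<in> A_neg" by (intro A_neg_uminus) (simp add: A_neg_coef)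
  then show ?thesis
   by (intro exI[of _ "Poly_Mapping.single \<gamma> k + Poly_Mapping.single (- \<gamma>) k"]) (simp add: A_bar_add A_bar_single)
 qed
next
 fix p q :: "'g gring" assume "\<exists>s. A_bar s = s \<and> p - s \<in> A_neg" "\<exists>s. A_bar s = s \<and> q - s \<in> A_neg"
 then obtain s t where "A_bar s = s" "p - s \<in> A_neg" "A_bar t = t" "q - t \<in> A_neg" by blast
 then show "\<exists>s. A_bar s = s \<and> p + q - s \<in> A_neg" using A_neg_add[of "p - s" "q - t"]
  by (intro exI[of _ "s + t"]) (simp add: A_bar_add algebra_simps)
qed

text \<open>The usual argument inverts the bar map on a basis. Here the family \<open>m\<close> may be linearly
 dependent, and bar-invariant lifts with arbitrary coefficients are given instead.\<close>

lemma kazhdan_lusztig_lift: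
 fixes m :: "'i => 'x => 'g::linordered_ab_group_add K" and rk :: "'i => nat"
 assumes fin: "finite I" and less: "\<And>i j. i \<in> I ==> ls j i ==> j \<in> I \<and> rk j < rk i"
  and trans: "\<And>i j k. ls k j ==> ls j i ==> ls k i"
  and B: "\<And>f g s. B f ==> B g ==> A_bar s = s ==> B (\<lambda>x. f x + to_fract s * g x)"
  and c: "\<And>i. i \<in> I ==> \<exists>a. B (\<lambda>x. m i x + (\<Sum>j\<in>{j. ls j i}. to_fract (a j) * m j x))"
  and i: "i \<in> I"
 shows "\<exists>q. (\<forall>j. q j \<in> A_neg) \<and> B (\<lambda>x. m i x + (\<Sum>j\<in>{j. ls j i}. to_fract (q j) * m j x))"
 using i
proof (induction "rk i" arbitrary: i rule: less_induct)
 case less': less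
 let ?S = "{j. ls j i}"
 have S: "?S \<subseteq> I" using less less' by blast
 then have finS: "finite ?S" using fin finite_subset by blast
 have "\<forall>j\<in>?S. \<exists>q. (\<forall>k. q k \<in> A_neg) \<and> B (\<lambda>x. m j x + (\<Sum>k\<in>{k. ls k j}. to_fract (q k) * m k x))"
  using less'.hyps less'.prems less by blast
 from bchoice[OF this] obtain q where q': "\<forall>j\<in>?S. (\<forall>k. q j k \<in> A_neg) \<and>
  B (\<lambda>x. m j x + (\<Sum>k\<in>{k. ls k j}. to_fract (q j k) * m k x))" ..
 have q: "j \<in> ?S ==> q j k \<in> A_neg"
  "j \<in> ?S ==> B (\<lambda>x. m j x + (\<Sum>k\<in>{k. ls k j}. to_fract (q j k) * m k x))" for j k
  using bspec[OF q', of j] by simp_all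
 \<comment> \<open>After \<open>d\<close> rounds the coefficients on the top \<open>d\<close> ranks
   below \<open>i\<close> lie in \<open>A_neg\<close>. A round subtracts, for each index of the next
   rank, the bar-invariant part of its coefficient times the lift known by induction;
   \<open>a'\<close> records the result.\<close>
 have "\<exists>a. (\<forall>j\<in>?S. rk i \<le> rk j + d --> a j \<in> A_neg) \<and> B (\<lambda>x. m i x + (\<Sum>j\<in>?S. to_fract (a j) * m j x))" for d
 proof (induction d)
  case 0
  obtain a where "B (\<lambda>x. m i x + (\<Sum>j\<in>?S. to_fract (a j) * m j x))" using c less'.prems by blast
  then show ?case using less less'.prems by (intro exI[of _ a]) fastforce
 next
  case (Suc d)
  then obtain a where a: "\<And>j. j \<in> ?S ==> rk i \<le> rk j + d ==> a j \<in> A_neg"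
   and Ba: "B (\<lambda>x. m i x + (\<Sum>j\<in>?S. to_fract (a j) * m j x))" by blast
  have "\<forall>j. \<exists>s. A_bar s = s \<and> a j - s \<in> A_neg" using bar_invariant_part by blast
  from choice[OF this] obtain s where s: "\<And>j. A_bar (s j) = s j" "\<And>j. a j - s j \<in> A_neg" by blast
  let ?J = "{j\<in>?S. rk i = rk j + Suc d}"
  have finJ: "finite ?J" using finS by simp
  define a' where "a' k = a k - (if k \<in> ?J then s k else 0) - (\<Sum>j\<in>?J. if ls k j then s j * q j k else 0)" for k
  have "B (\<lambda>x. (m i x + (\<Sum>j\<in>?S. to_fract (a j) * m j x)) +
    (\<Sum>j\<in>J. to_fract (- s j) * (m j x + (\<Sum>k\<in>{k. ls k j}. to_fract (q j k) * m k x))))"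
   if "J \<subseteq> ?J" for J
   using finite_subset[OF that finJ] that
  proof (induction J rule: finite_induct)
   case (insert j J)
   have "A_bar (- s j) = - s j" by (simp add: A_bar_uminus s)
   moreover have "j \<in> ?S" using insert.prems by auto
   ultimately have "B (\<lambda>x. ((m i x + (\<Sum>j\<in>?S. to_fract (a j) * m j x)) +
     (\<Sum>j\<in>J. to_fract (- s j) * (m j x + (\<Sum>k\<in>{k. ls k j}. to_fract (q j k) * m k x)))) +
     to_fract (- s j) * (m j x + (\<Sum>k\<in>{k. ls k j}. to_fract (q j k) * m k x)))"
    using insert.prems by (intro B insert.IH q(2)) auto
   then show ?case unfolding sum.insert[OF insert.hyps] by (simp only: ac_simps)
  qed (simp add: Ba)
  from this[OF order_refl] have B1: "B (\<lambda>x. (m i x + (\<Sum>j\<in>?S. to_fract (a j) * m j x)) +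
    (\<Sum>j\<in>?J. to_fract (- s j) * (m j x + (\<Sum>k\<in>{k. ls k j}. to_fract (q j k) * m k x))))" .
  have inner: "(\<Sum>k\<in>{k. ls k j}. to_fract (q j k) * m k x) = (\<Sum>k\<in>?S. if ls k j then to_fract (q j k) * m k x else 0)"
   if "j \<in> ?S" for j x
   using that trans by (intro sum.mono_neutral_cong_left[OF finS]) auto
  have neg: "to_fract (- p) = - to_fract p" for p :: "'g gring"
   using to_fract_diff[of 0 p] by simp
  have "(\<Sum>j\<in>?S. to_fract (a j) * m j x) +
    (\<Sum>j\<in>?J. to_fract (- s j) * (m j x + (\<Sum>k\<in>{k. ls k j}. to_fract (q j k) * m k x)))
    = (\<Sum>k\<in>?S. to_fract (a' k) * m k x)" for x
  proof -
   have "(\<Sum>j\<in>?J. to_fract (- s j) * (m j x + (\<Sum>k\<in>{k. ls k j}. to_fract (q j k) * m k x)))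
    = - ((\<Sum>j\<in>?J. to_fract (s j) * m j x) +
      (\<Sum>j\<in>?J. \<Sum>k\<in>?S. to_fract (s j) * (if ls k j then to_fract (q j k) * m k x else 0)))"
    unfolding sum.distrib[symmetric] sum_negf[symmetric] sum_distrib_left[symmetric]
    by (rule sum.cong) (auto simp: inner distrib_left neg)
   also have "(\<Sum>j\<in>?J. to_fract (s j) * m j x) = (\<Sum>k\<in>?S. to_fract (if k \<in> ?J then s k else 0) * m k x)"
    by (rule sum.mono_neutral_cong_left[OF finS]) auto
   also have "(\<Sum>j\<in>?J. \<Sum>k\<in>?S. to_fract (s j) * (if ls k j then to_fract (q j k) * m k x else 0))
     = (\<Sum>k\<in>?S. \<Sum>j\<in>?J. to_fract (s j) * (if ls k j then to_fract (q j k) * m k x else 0))"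
    by (rule sum.swap)
   also have "\<dots> = (\<Sum>k\<in>?S. to_fract (\<Sum>j\<in>?J. if ls k j then s j * q j k else 0) * m k x)"
    unfolding to_fract_sum sum_distrib_right
    by (intro sum.cong refl) (auto simp: mult.assoc)
   finally show ?thesis unfolding a'_def
    by (simp add: sum.distrib sum_subtractf algebra_simps)
  qed
  then have "B (\<lambda>x. m i x + (\<Sum>k\<in>?S. to_fract (a' k) * m k x))" using B1 by (simp add: add.assoc)
  moreover have "a' k \<in> A_neg" if k: "k \<in> ?S" "rk i \<le> rk k + Suc d" for k
  proof -
   have "\<not> ls k j" if "j \<in> ?J" for j
   proof
    assume "ls k j"
    then have "rk k < rk j" using less[of j k] that S by auto
    then show False using that k by auto
   qed
   then have "(\<Sum>j\<in>?J. if ls k j then s j * q j k else 0) = 0" by (intro sum.neutral) auto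
   then have "a' k = a k - (if k \<in> ?J then s k else 0)" by (simp add: a'_def)
   then show ?thesis using a[OF k(1)] s(2)[of k] k by (cases "rk i = rk k + Suc d") auto
  qed
  ultimately show ?case by blast
 qed
 from this[of "rk i"] obtain a where a: "\<And>j. j \<in> ?S ==> a j \<in> A_neg"
  "B (\<lambda>x. m i x + (\<Sum>j\<in>?S. to_fract (a j) * m j x))" by fastforce
 let ?q = "\<lambda>j. if j \<in> ?S then a j else 0"
 have "(\<Sum>j\<in>?S. to_fract (?q j) * m j x) = (\<Sum>j\<in>?S. to_fract (a j) * m j x)" for x
  by (rule sum.cong) auto
 then show ?case using a by (intro exI[of _ ?q]) (auto simp del: mem_Collect_eq)
qed

text \<open>Coefficients are taken in the group ring, not in its fraction field. So
  \<open>spn Rw (W n)\<close> describes the image of the Hecke algebra itself, and exponents of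
  coefficients make sense.\<close>

definition spn :: "('i => ('x => 'y => 'g::linordered_ab_group_add K)) => 'i set => ('x => 'y => 'g K) => bool" where
 "spn M Y F \<longleftrightarrow> (\<exists>h. \<forall>X P. F X P = (\<Sum>y\<in>Y. to_fract (h y) * M y X P))"

lemma spn_single: "finite Y ==> y \<in> Y ==> spn M Y (M y)"
 unfolding spn_def
proof (intro exI[of _ "\<lambda>z. if z = y then 1 else 0"] allI)
 fix X P assume y: "finite Y" "y \<in> Y"
 have "(\<Sum>z\<in>Y. to_fract (if z = y then 1 else 0) * M z X P) = (\<Sum>z\<in>Y. if z = y then M y X P else 0)"
  by (rule sum.cong) auto
 then show "M y X P = (\<Sum>z\<in>Y. to_fract (if z = y then 1 else 0) * M z X P)" using y by (simp add: sum.delta)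
qed

lemma spn_lin:
 assumes "spn M Y F" "spn M Y G" shows "spn M Y (\<lambda>X P. to_fract p * F X P + to_fract q * G X P)"
proof -
 obtain h k where "\<And>X P. F X P = (\<Sum>y\<in>Y. to_fract (h y) * M y X P)" "\<And>X P. G X P = (\<Sum>y\<in>Y. to_fract (k y) * M y X P)"
  using assms unfolding spn_def by blast
 then show ?thesis unfolding spn_def
  by (intro exI[of _ "\<lambda>y. p * h y + q * k y"]) (simp add: sum_distrib_left sum.distrib[symmetric] algebra_simps)
qed

lemma spn_0: "spn M Y (\<lambda>X P. 0)"
 unfolding spn_def by (intro exI[of _ "\<lambda>y. 0"]) simp

lemma spn_add: "spn M Y F ==> spn M Y G ==> spn M Y (\<lambda>X P. F X P + G X P)"
 using spn_lin[of M Y F G 1 1] by simp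

lemma spn_scale: "spn M Y F ==> spn M Y (\<lambda>X P. to_fract p * F X P)"
 using spn_lin[of M Y F F p 0] by simp

lemma spn_sum:
 "finite S ==> (\<And>i. i \<in> S ==> spn M Y (F i)) ==> spn M Y (\<lambda>X P. \<Sum>i\<in>S. to_fract (c i) * F i X P)"
proof (induction S rule: finite_induct)
 case (insert i S)
 then show ?case using spn_lin[of M Y "F i" "\<lambda>X P. \<Sum>i\<in>S. to_fract (c i) * F i X P" "c i" 1] by simp
qed (simp add: spn_0)

lemma spn_trans:
 assumes "spn M Y F" "finite Y" "\<And>y. y \<in> Y ==> spn M' Y' (M y)" shows "spn M' Y' F"
proof -
 obtain h where h: "\<And>X P. F X P = (\<Sum>y\<in>Y. to_fract (h y) * M y X P)" using assms(1) unfolding spn_def by blast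
 have "F = (\<lambda>X P. \<Sum>y\<in>Y. to_fract (h y) * M y X P)" by (intro ext h)
 then show ?thesis using spn_sum[OF assms(2), of M' Y' M h] assms(3) by simp
qed

section \<open>The Bruhat order under left multiplication by a generator\<close>

context type_B
begin

abbreviation step :: "((int => int) \<times> (int => int)) set" where
 "step \<equiv> {(u, u \<circ> r) | u r. u \<in> W n \<and> r \<in> reflections n \<and> len n u < len n (u \<circ> r)}"

lemma reflections_W: assumes "r \<in> reflections n" shows "r \<in> W n"
 proof -
 obtain p q where "p < q" "p ~= 0" "q ~= 0" "\<bar>p\<bar> \<le> int n" "\<bar>q\<bar> \<le> int n" "r = rfl p q"
  using reflections_rfl[OF n_pos assms] .
 then show ?thesis using rfl_in_W[of p q n] by simp
qed

lemma stepD: assumes "(u, w) \<in> step" shows "u \<in> W n" "w \<in> W n" "len n u < len n w"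
proof -
 obtain r where r: "u \<in> W n" "r \<in> reflections n" "w = u \<circ> r" "len n u < len n (u \<circ> r)" using assms by blast
 then show "u \<in> W n" "w \<in> W n" "len n u < len n w" using W_comp[OF r(1) reflections_W[OF r(2)]] by simp_all
qed

lemma bruhat_lessD:
 assumes "bruhat_less n y w" shows "y \<in> W n" "w \<in> W n" "len n y < len n w"
proof -
 have "(y, w) \<in> step\<^sup>+" using assms unfolding bruhat_less_def .
 then have "y \<in> W n \<and> w \<in> W n \<and> len n y < len n w"
 proof (induction rule: trancl_induct)
  case (base w) then show ?case using stepD[OF base] by simp
 next
  case (step w z) then show ?case using stepD[OF step(2)] by simp
 qed
 then show "y \<in> W n" "w \<in> W n" "len n y < len n w" by simp_all
qed

lemma bruhat_less_trans: "bruhat_less n x y ==> bruhat_less n y z ==> bruhat_less n x z"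
 unfolding bruhat_less_def by (rule trancl_trans)

lemma gen_conj_reflection:
 assumes "w \<in> W n" "j < n" shows "inv w \<circ> gen j \<circ> w \<in> reflections n"
 unfolding reflections_def using W_inv[OF assms(1)] W_inv_inv[OF assms(1)] gens_eq[OF n_pos] assms(2) by force

lemma bruhat_less_gen:
 assumes "w \<in> W n" "j < n" "len n w < len n (gen j \<circ> w)" shows "bruhat_less n w (gen j \<circ> w)"
proof -
 have "w \<circ> (inv w \<circ> gen j \<circ> w) = gen j \<circ> w" using W_inv_inverses(2)[OF assms(1)] by (simp add: o_assoc)
 then have "(w, gen j \<circ> w) \<in> step" using gen_conj_reflection[OF assms(1,2)] assms
  by (intro CollectI exI[of _ w] exI[of _ "inv w \<circ> gen j \<circ> w"]) simp
 then show ?thesis unfolding bruhat_less_def by blast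
qed

text \<open>A step is characterised by \<open>u p < u q\<close>. A generator preserves this
  inequality unless it exchanges exactly these two values, and then \<open>gen j \<circ> u\<close>
  equals \<open>w\<close>.\<close>

lemma step_gen:
 assumes "(u, w) \<in> step" "j < n" shows "(gen j \<circ> u, gen j \<circ> w) \<in> step \<or> gen j \<circ> u = w"
proof -
 obtain r where r: "u \<in> W n" "r \<in> reflections n" "w = u \<circ> r" "len n u < len n (u \<circ> r)" using assms(1) by blast
 obtain p q where pq: "p < q" "p ~= 0" "q ~= 0" "\<bar>p\<bar> \<le> int n" "\<bar>q\<bar> \<le> int n" "r = rfl p q"
  using reflections_rfl[OF n_pos r(2)] .
 have su: "gen j \<circ> u \<in> W n" using W_comp[OF gen_in_W[OF assms(2)] r(1)] .
 have upq: "u p < u q" using len_rfl_iff(2)[OF r(1) pq(1-5)] r(4) pq(6) by simp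
 show ?thesis
 proof (cases "gen j (u p) < gen j (u q)")
  case True
  then have "len n (gen j \<circ> u) < len n (gen j \<circ> u \<circ> r)"
   using len_rfl_iff(2)[OF su pq(1-5)] pq(6) by simp
  then have "(gen j \<circ> u, gen j \<circ> u \<circ> r) \<in> step" using su r(2) by blast
  then show ?thesis using r(3) by (simp add: o_assoc)
 next
  case False
  have "(gen j \<circ> u) p ~= (gen j \<circ> u) q" unfolding W_inj[OF su] using pq(1) by simp
  then have "gen j (u q) < gen j (u p)" using False by simp
  then have "gen j = rfl (u p) (u q)"
   using gen_reverses[OF upq] W_eq_0_iff[OF r(1)] pq by simp
  then have "gen j \<circ> u = u \<circ> rfl p q" using rfl_conj[OF r(1) pq(2,3)] pq(1) by simp
  then show ?thesis using r(3) pq(6) by simp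
 qed
qed

lemma bruhat_less_lift:
 assumes "bruhat_less n y w" "j < n" "len n w < len n (gen j \<circ> w)"
 shows "bruhat_less n (gen j \<circ> y) (gen j \<circ> w)" "bruhat_less n y (gen j \<circ> w)"
proof -
 have w: "w \<in> W n" using bruhat_lessD[OF assms(1)] by simp
 have up: "bruhat_less n w (gen j \<circ> w)" using bruhat_less_gen[OF w assms(2,3)] .
 show "bruhat_less n y (gen j \<circ> w)" using bruhat_less_trans[OF assms(1) up] .
 have "(y, w) \<in> step\<^sup>+" using assms(1) unfolding bruhat_less_def .
 then show "bruhat_less n (gen j \<circ> y) (gen j \<circ> w)"
 proof (induction rule: converse_trancl_induct)
  case (base u)
  then show ?case using step_gen[OF base assms(2)] up unfolding bruhat_less_def by auto
 next
  case (step u u')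
  have "bruhat_less n u' w" using step(2) unfolding bruhat_less_def .
  then have "bruhat_less n u' (gen j \<circ> w)" using bruhat_less_trans up by blast
  then show ?case using step_gen[OF step(1) assms(2)] step.IH unfolding bruhat_less_def
   by (metis (no_types, lifting) trancl_into_trancl2)
 qed
qed

lemma reduced_Cons_induct [consumes 1, case_names id gen]:
 assumes "w \<in> W n" "Q id"
  "\<And>j w. w \<in> W n ==> j < n ==> inv w (lo j) < inv w (hi j) ==> len n (gen j \<circ> w) = Suc (len n w) ==> Q w ==> Q (gen j \<circ> w)"
 shows "Q w"
 using assms(1)
proof (induction "len n w" arbitrary: w rule: less_induct)
 case less
 obtain js where js: "reduced js" "wprod js = w" using exists_reduced[OF less.prems] .
 show ?case
 proof (cases js)
  case Nil then show ?thesis using js assms(2) by simp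
 next
  case (Cons j ks)
  let ?u = "gen j \<circ> w"
  have j: "j < n" and ks: "is_word n ks" using js Cons by (simp_all add: reduced_def)
  have u: "?u = wprod ks" using js(2) Cons by auto
  have uW: "?u \<in> W n" using wprod_in_W[OF ks] u by simp
  have l: "len n ?u < len n w" using len_le[OF ks] u js Cons by (simp add: reduced_def)
  have gu: "gen j \<circ> ?u = w" by (rule ext) simp
  have asc: "inv ?u (lo j) < inv ?u (hi j)"
  proof (rule ccontr)
   assume "\<not> ?thesis"
   then have "inv ?u (hi j) < inv ?u (lo j)" using asc_or_desc[OF W_inv[OF uW], of j] by blast
   then show False using len_gen_left(2)[OF uW j] l unfolding gu by simp
  qed
  then have "len n (gen j \<circ> ?u) = Suc (len n ?u)" using len_gen_left(1)[OF uW j] by blast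
  then have "Q (gen j \<circ> ?u)" using assms(3)[OF uW j asc] less.hyps[OF l uW] by blast
  then show ?thesis unfolding gu .
 qed
qed

end

context asymptotic
begin

abbreviation Asp :: "((tab => 'g K) => tab => 'g K) => bool" where
 "Asp \<equiv> spn Rw (W n)"

definition lwA :: "nat => 'g gring" where "lwA j = (if j = 0 then ex b else ex a)"

lemma lw_lwA: "lw j = to_fract (lwA j)" "inverse (lw j) = to_fract (A_bar (lwA j))"
 "inverse (to_fract (lwA j)) = to_fract (A_bar (lwA j))"
proof -
 show 1: "lw j = to_fract (lwA j)" by (simp add: lw_def lwA_def E_def eps_def)
 show 2: "inverse (lw j) = to_fract (A_bar (lwA j))" using kbar_lw[of j] unfolding 1 by simp
 show "inverse (to_fract (lwA j)) = to_fract (A_bar (lwA j))" using 2 unfolding 1 .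
qed

lemma Rop_sum:
 assumes "j < n" "finite S"
 shows "Rop j (\<lambda>P. \<Sum>i\<in>S. c i * X i P) P = (\<Sum>i\<in>S. c i * Rop j (X i) P)"
 using Rw_sum[OF gen_in_W[OF assms(1)] assms(2), of c X] Rw_gen[OF assms(1)] by simp

lemma spn_Rop:
 assumes F: "spn Rw Y F" and j: "j < n" and Y: "finite Y" "Y \<subseteq> W n" "finite Z"
  and Z: "\<And>y. y \<in> Y ==> y \<in> Z" "\<And>y. y \<in> Y ==> gen j \<circ> y \<in> Z"
 shows "spn Rw Z (\<lambda>X. Rop j (F X))"
proof -
 obtain h where h: "\<And>X P. F X P = (\<Sum>y\<in>Y. to_fract (h y) * Rw y X P)" using F unfolding spn_def by blast
 have "F = (\<lambda>X P. \<Sum>y\<in>Y. to_fract (h y) * Rw y X P)" by (intro ext h)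
 then have "(\<lambda>X. Rop j (F X)) = (\<lambda>X P. \<Sum>y\<in>Y. to_fract (h y) * Rop j (Rw y X) P)"
  using Rop_sum[OF j Y(1), of "\<lambda>y. to_fract (h y)"] by (intro ext) simp
 moreover have "spn Rw Z (\<lambda>X P. Rop j (Rw y X) P)" if y: "y \<in> Y" for y
 proof -
  have yW: "y \<in> W n" using y Y by blast
  have 1: "spn Rw Z (Rw (gen j \<circ> y))" "spn Rw Z (Rw y)"
   using Z[OF y] by (auto intro: spn_single[OF Y(3)])
  consider "inv y (lo j) < inv y (hi j)" | "inv y (hi j) < inv y (lo j)"
   using asc_or_desc[OF W_inv[OF yW]] by blast
  then show ?thesis
  proof cases
   case 1
   have "(\<lambda>X P. Rop j (Rw y X) P) = Rw (gen j \<circ> y)" using Rw_left[OF yW j 1] by (intro ext) simp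
   then show ?thesis using \<open>spn Rw Z (Rw (gen j \<circ> y))\<close> by simp
  next
   case 2
   have "(\<lambda>X P. Rop j (Rw y X) P) = (\<lambda>X P. to_fract 1 * Rw (gen j \<circ> y) X P + to_fract (lwA j - A_bar (lwA j)) * Rw y X P)"
    using Rw_desc_left[OF yW j 2] by (intro ext) (simp add: lw_lwA)
   then show ?thesis using spn_lin[OF 1, of 1 "lwA j - A_bar (lwA j)"] by (simp only:)
  qed
 qed
 ultimately show ?thesis using spn_sum[OF Y(1), of Rw Z "\<lambda>y X P. Rop j (Rw y X) P" h] by simp
qed

lemma Asp_Rop: "Asp F ==> j < n ==> Asp (\<lambda>X. Rop j (F X))"
 by (rule spn_Rop[OF _ _ finite_W order_refl finite_W]) (auto intro: W_comp gen_in_W)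

lemma Asp_Rw: "w \<in> W n ==> Asp (Rw w)"
 by (rule spn_single[OF finite_W])

lemma Asp_id: "Asp (\<lambda>X. X)"
proof -
 have "Rw id = (\<lambda>X. X)" by (rule ext) simp
 then show ?thesis using Asp_Rw[OF W_id] by simp
qed

lemma Asp_Rw_comp:
 assumes "w \<in> W n" "Asp F" shows "Asp (\<lambda>X. Rw w (F X))"
 using assms(1)
proof (induction w rule: reduced_Cons_induct)
 case (gen j w)
 have "(\<lambda>X. Rw (gen j \<circ> w) (F X)) = (\<lambda>X. Rop j (Rw w (F X)))"
  using Rw_left[OF gen(1-3)] by (intro ext) simp
 then show ?case using Asp_Rop[OF gen(5,2)] by (simp only:)
next
 case id
 show ?case unfolding Rw_id by (rule assms(2))
qed

lemma Asp_comp: assumes "Asp F" "Asp G" shows "Asp (\<lambda>X. F (G X))"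
proof -
 obtain h where h: "\<And>X P. F X P = (\<Sum>y\<in>W n. to_fract (h y) * Rw y X P)" using assms(1) unfolding spn_def by blast
 have "(\<lambda>X. F (G X)) = (\<lambda>X P. \<Sum>y\<in>W n. to_fract (h y) * Rw y (G X) P)" by (intro ext h)
 moreover have "Asp (\<lambda>X P. \<Sum>y\<in>W n. to_fract (h y) * Rw y (G X) P)"
  by (rule spn_sum[OF finite_W, where F = "\<lambda>y X. Rw y (G X)"]) (rule Asp_Rw_comp[OF _ assms(2)])
 ultimately show ?thesis by (simp only:)
qed

lemma Asp_lin:
 assumes "Asp F"
 shows "F (\<lambda>P. c * X P + d * Y P) P = c * F X P + d * F Y P"
  and "finite S ==> F (\<lambda>P. \<Sum>i\<in>S. u i * Z i P) P = (\<Sum>i\<in>S. u i * F (Z i) P)"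
proof -
 obtain h where h: "\<And>X P. F X P = (\<Sum>y\<in>W n. to_fract (h y) * Rw y X P)" using assms unfolding spn_def by blast
 have "F (\<lambda>P. c * X P + d * Y P) P = (\<Sum>y\<in>W n. to_fract (h y) * (c * Rw y X P + d * Rw y Y P))"
  unfolding h using Rw_lin[of _ c X d Y] by (intro sum.cong) (auto simp: fun_eq_iff)
 also have "\<dots> = c * F X P + d * F Y P"
  unfolding h sum_distrib_left sum.distrib[symmetric] by (intro sum.cong) (auto simp: algebra_simps)
 finally show "F (\<lambda>P. c * X P + d * Y P) P = c * F X P + d * F Y P" .
 assume S: "finite S"
 have "F (\<lambda>P. \<Sum>i\<in>S. u i * Z i P) P = (\<Sum>y\<in>W n. \<Sum>i\<in>S. to_fract (h y) * (u i * Rw y (Z i) P))"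
  unfolding h using Rw_sum[OF _ S, of _ u Z] by (intro sum.cong) (auto simp: sum_distrib_left)
 also have "\<dots> = (\<Sum>i\<in>S. \<Sum>y\<in>W n. to_fract (h y) * (u i * Rw y (Z i) P))" by (rule sum.swap)
 also have "\<dots> = (\<Sum>i\<in>S. u i * F (Z i) P)"
  unfolding h sum_distrib_left by (intro sum.cong) (auto simp: ac_simps)
 finally show "F (\<lambda>P. \<Sum>i\<in>S. u i * Z i P) P = (\<Sum>i\<in>S. u i * F (Z i) P)" .
qed

lemma Asp_kb_Rw:
 assumes "w \<in> W n" shows "Asp (\<lambda>X. kb (Rw w (kb X)))"
 using assms
proof (induction w rule: reduced_Cons_induct)
 case id
 show ?case unfolding Rw_id kb_kb by (rule Asp_id)
next
 case (gen j w)
 let ?G = "\<lambda>X. kb (Rw w (kb X))" and ?d = "- (lwA j - A_bar (lwA j))"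
 have "kb (Rw (gen j \<circ> w) (kb X)) P = to_fract 1 * Rop j (?G X) P + to_fract ?d * ?G X P" for X P
  unfolding Rw_left[OF gen(1-3)] kb_Rop[OF gen(2)] by (simp add: lw_lwA algebra_simps)
 then have "(\<lambda>X. kb (Rw (gen j \<circ> w) (kb X))) = (\<lambda>X P. to_fract 1 * Rop j (?G X) P + to_fract ?d * ?G X P)"
  by (intro ext)
 then show ?case using spn_lin[OF Asp_Rop[OF gen(5,2)] gen(5), of 1 ?d] by (simp only:)
qed

lemma Asp_kb: assumes "Asp F" shows "Asp (\<lambda>X. kb (F (kb X)))"
proof -
 obtain h where h: "\<And>X P. F X P = (\<Sum>y\<in>W n. to_fract (h y) * Rw y X P)" using assms unfolding spn_def by blast
 have "(\<lambda>X. kb (F (kb X))) = (\<lambda>X P. \<Sum>y\<in>W n. to_fract (A_bar (h y)) * kb (Rw y (kb X)) P)"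
  by (intro ext) (simp add: kb_def h kbar_sum kbar_mult)
 moreover have "Asp (\<lambda>X P. \<Sum>y\<in>W n. to_fract (A_bar (h y)) * kb (Rw y (kb X)) P)"
  by (rule spn_sum[OF finite_W, where F = "\<lambda>y X. kb (Rw y (kb X))"]) (rule Asp_kb_Rw)
 ultimately show ?thesis by (simp only:)
qed

subsection \<open>Coefficients from leading entries\<close>

text \<open>The property shared by the standard and the Kazhdan-Lusztig basis, so that coefficients
  with respect to either are read off by the same lemma.\<close>

definition leads :: "((int => int) => (tab => 'g K) => tab => 'g K) => bool" where
 "leads M \<longleftrightarrow> (\<forall>w\<in>W n. \<forall>P Q. valid P --> valid Q -->
   tends (M w (dl Q) P / omm P n) (if P = PT w \<and> Q = QT w then 1 else 0))"

lemma leads_Rw: "leads Rw"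
 unfolding leads_def using leading_coefficient' by blast

lemma leadsD:
 assumes "leads M" "w \<in> W n" "z \<in> W n"
 shows "tends (M w (dl (QT z)) (PT z) / omm (PT z) n) (if w = z then 1 else 0)"
proof -
 have "tends (M w (dl (QT z)) (PT z) / omm (PT z) n) (if PT z = PT w \<and> QT z = QT w then 1 else 0)"
  using assms PT_QT(1,2)[OF assms(3)] unfolding leads_def by blast
 moreover have "(PT z = PT w \<and> QT z = QT w) = (w = z)" using RS_inj[OF assms(2,3)] by auto
 ultimately show ?thesis by (simp only:)
qed

text \<open>Let \<mu> be the largest exponent in the coefficients \<open>ex \<delta> * h w\<close>.
  After scaling by \<open>eps (- \<mu>)\<close>, the limit at the position
  \<open>(PT z, QT z)\<close> is the coefficient at \<mu> belonging to \<open>z\<close>. If \<mu>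
  were positive, the assumed limits would make all of these 0. So no exponent is positive, and the
  constant terms are the limits.\<close>

lemma leading_terms:
 assumes M: "leads M" and Z: "Z \<subseteq> W n"
  and t: "\<And>z. z \<in> Z ==> tends (eps \<delta> * (\<Sum>w\<in>Z. to_fract (h w) * M w (dl (QT z)) (PT z)) / omm (PT z) n) (k z)"
  and z: "z \<in> Z"
 shows "tends (eps \<delta> * to_fract (h z)) (k z)"
proof -
 define h' where "h' w = ex \<delta> * h w" for w
 let ?S = "\<lambda>z. (\<Sum>w\<in>Z. to_fract (h' w) * M w (dl (QT z)) (PT z)) / omm (PT z) n"
 have t': "tends (?S z) (k z)" if "z \<in> Z" for z
  using t[OF that] by (simp add: h'_def eps_def sum_distrib_left mult.assoc)
 have fin: "finite Z" using finite_W Z finite_subset by blast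
 have sums: "tends (eps (- \<gamma>) * ?S z) (coef (h' z) \<gamma>)"
  if z: "z \<in> Z" and g: "\<And>w \<beta>. w \<in> Z ==> \<gamma> < \<beta> ==> coef (h' w) \<beta> = 0" for z \<gamma>
 proof -
  have "tends (to_fract (ex (- \<gamma>) * h' w)) (coef (h' w) \<gamma>)" if w: "w \<in> Z" for w
   using g[OF w] by (intro lim_to_fract)
    (auto simp: A_neg_coef lookup_minus coef_of_int coef_ex_mult)
  then have "tends (\<Sum>w\<in>Z. to_fract (ex (- \<gamma>) * h' w) * (M w (dl (QT z)) (PT z) / omm (PT z) n))
    (\<Sum>w\<in>Z. coef (h' w) \<gamma> * (if w = z then 1 else 0))"
   using leadsD[OF M _ subsetD[OF Z z]] subsetD[OF Z] by (intro lim_sum lim_mult) blast+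
  moreover have "(\<Sum>w\<in>Z. coef (h' w) \<gamma> * (if w = z then 1 else 0)) = coef (h' z) \<gamma>"
   using fin z by (simp add: if_distrib[of "\<lambda>c. _ * c"] sum.delta cong: if_cong)
  moreover have "(\<Sum>w\<in>Z. to_fract (ex (- \<gamma>) * h' w) * (M w (dl (QT z)) (PT z) / omm (PT z) n)) = eps (- \<gamma>) * ?S z"
   by (simp add: eps_def sum_distrib_left sum_divide_distrib mult.assoc)
  ultimately show ?thesis by (simp only:)
 qed
 let ?D = "\<Union>w\<in>Z. Poly_Mapping.keys (h' w)"
 have finD: "finite ?D" using fin by simp
 have le0: "\<gamma> \<le> 0" if g: "\<gamma> \<in> ?D" for \<gamma>
 proof (rule ccontr)
  assume "\<not> \<gamma> \<le> 0"
  define \<mu> where "\<mu> = Max ?D"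
  have "?D ~= {}" using g by blast
  from Max_in[OF finD this] have mu: "\<mu> \<in> ?D" unfolding \<mu>_def .
  have pos: "0 < \<mu>" using Max_ge[OF finD g] \<open>\<not> \<gamma> \<le> 0\<close> unfolding \<mu>_def by simp
  have up: "coef (h' w) \<beta> = 0" if "w \<in> Z" "\<mu> < \<beta>" for w \<beta>
  proof (rule ccontr)
   assume "coef (h' w) \<beta> ~= 0"
   then have "\<beta> \<in> ?D" using that(1) by (auto simp: in_keys_iff)
   then show False using Max_ge[OF finD] that(2) unfolding \<mu>_def by fastforce
  qed
  obtain w where w: "w \<in> Z" "coef (h' w) \<mu> ~= 0" using mu by (auto simp: in_keys_iff)
  have "tends (eps (- \<mu>) * ?S w) (0 * k w)" using pos by (intro lim_mult lim_eps t' w) simp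
  from lim_unique[OF this sums[OF w(1) up]] w(2) show False by simp
 qed
 have up0: "coef (h' w) \<beta> = 0" if "w \<in> Z" "0 < \<beta>" for w \<beta>
 proof (rule ccontr)
  assume "coef (h' w) \<beta> ~= 0"
  then have "\<beta> \<in> ?D" using that(1) by (auto simp: in_keys_iff)
  then show False using le0[of \<beta>] that by simp
 qed
 have "tends (?S z) (coef (h' z) 0)" using sums[OF z, of 0] up0 by simp
 then have "coef (h' z) 0 = k z" using lim_unique t'[OF z] by blast
 then have "h' z - of_int (k z) \<in> A_neg" using up0[OF z]
  by (auto simp: A_neg_coef lookup_minus coef_of_int le_less)
 from lim_to_fract[OF this] show ?thesis by (simp add: h'_def eps_def)
qed

text \<open>Any exponent of any coefficient would be seen by \<open>leading_terms\<close>. For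
  \<open>Rw\<close> this is the faithfulness of the sum of the seminormal representations.\<close>

lemma leads_independent:
 assumes M: "leads M" and 0: "\<And>X P. (\<Sum>w\<in>W n. to_fract (h w) * M w X P) = 0" and z: "z \<in> W n"
 shows "h z = 0"
proof (rule ccontr)
 assume nz: "h z ~= 0"
 then obtain \<gamma> where g: "coef (h z) \<gamma> ~= 0" by (metis lookup_not_eq_zero_eq_in_keys keys_eq_empty equals0I)
 have "tends (eps (- \<gamma>) * to_fract (h z)) 0"
  by (rule leading_terms[OF M order_refl, where k = "\<lambda>_. 0"]) (use 0 z in simp_all)
 then have "tends (to_fract (ex (- \<gamma>) * h z)) 0" by (simp add: eps_def)
 from to_fract_eq_lim[OF this] have "coef (ex (- \<gamma>) * h z) 0 = 0" by (simp add: A_neg_coef)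
 then show False using g by (simp add: coef_ex_mult)
qed

lemma leads_unique:
 assumes M: "leads M" and eq: "\<And>X P. (\<Sum>w\<in>W n. to_fract (h w) * M w X P) = (\<Sum>w\<in>W n. to_fract (k w) * M w X P)"
  and z: "z \<in> W n"
 shows "h z = k z"
proof -
 have "(\<Sum>w\<in>W n. to_fract (h w - k w) * M w X P) = 0" for X P
  using eq by (simp add: sum_subtractf left_diff_distrib)
 from leads_independent[OF M this z] show ?thesis by simp
qed

subsection \<open>Bar-invariant elements\<close>

definition binv :: "((tab => 'g K) => tab => 'g K) => bool" where
 "binv F \<longleftrightarrow> (\<forall>X P. kb (F (kb X)) P = F X P)"

lemma binv_lin: "binv F ==> binv G ==> A_bar s = s ==> binv (\<lambda>X P. F X P + to_fract s * G X P)"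
 unfolding binv_def kb_def by (simp add: kbar_add kbar_mult)

text \<open>The added scalar makes the generator bar-invariant: the sum is the operator of
  \<open>C'_s\<close>.\<close>

lemma binv_gen:
 assumes "binv F" "j < n" shows "binv (\<lambda>X P. Rop j (F X) P + inverse (lw j) * F X P)"
proof -
 have F: "kb (F (kb X)) = F X" for X using assms(1) unfolding binv_def by blast
 have "kb (\<lambda>P. Rop j (F (kb X)) P + inverse (lw j) * F (kb X) P) P
   = kb (Rop j (F (kb X))) P + lw j * kb (F (kb X)) P" for X P
  unfolding kb_def by (simp add: kbar_add kbar_mult kbar_inverse kbar_lw)
 then show ?thesis unfolding binv_def kb_Rop[OF assms(2)] F by (simp add: algebra_simps)
qed

text \<open>The product of the operators of \<open>C'_s\<close> along a reduced word of
  \<open>w\<close> is bar-invariant and unitriangular for the Bruhat order. It is the input required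
  by \<open>kazhdan_lusztig_lift\<close>.\<close>

lemma kl_start:
 assumes "w \<in> W n"
 shows "\<exists>F. binv F \<and> spn Rw {y. bruhat_less n y w} (\<lambda>X P. F X P - Rw w X P)"
 using assms
proof (induction w rule: reduced_Cons_induct)
 case id
 have "binv (\<lambda>X. X)" by (simp add: binv_def)
 moreover have "spn Rw {y. bruhat_less n y id} (\<lambda>X P. X P - Rw id X P)" unfolding Rw_id using spn_0 by simp
 ultimately show ?case by (intro exI[of _ "\<lambda>X. X"]) (rule conjI)
next
 case (gen j w)
 then obtain F where F: "binv F" "spn Rw {y. bruhat_less n y w} (\<lambda>X P. F X P - Rw w X P)" by blast
 let ?G = "\<lambda>X P. Rop j (F X) P + inverse (lw j) * F X P" and ?D = "\<lambda>X P. F X P - Rw w X P"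
  and ?Z = "{y. bruhat_less n y (gen j \<circ> w)}"
 have sub: "{y. bruhat_less n y u} \<subseteq> W n" for u using bruhat_lessD(1) by blast
 have fin: "finite {y. bruhat_less n y u}" for u using finite_subset[OF sub finite_W] .
 have up: "len n w < len n (gen j \<circ> w)" using gen(4) by simp
 have 1: "spn Rw ?Z (\<lambda>X. Rop j (?D X))"
  using bruhat_less_lift[OF _ gen(2) up] by (intro spn_Rop[OF F(2) gen(2) fin sub fin]) auto
 have 2: "spn Rw ?Z ?D"
  by (rule spn_trans[OF F(2) fin]) (use bruhat_less_lift(2)[OF _ gen(2) up] in \<open>auto intro: spn_single[OF fin]\<close>)
 have 3: "spn Rw ?Z (Rw w)" using bruhat_less_gen[OF gen(1,2) up] by (intro spn_single[OF fin]) simp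
 have "spn Rw ?Z (\<lambda>X P. Rop j (?D X) P + (to_fract (A_bar (lwA j)) * ?D X P + to_fract (A_bar (lwA j)) * Rw w X P))"
  by (intro spn_add[OF 1] spn_lin[OF 2 3])
 moreover have "Rop j (?D X) P = Rop j (F X) P - Rw (gen j \<circ> w) X P" for X P
  using Rop_lin[of j 1 "F X" "- 1" "Rw w X"] Rw_left[OF gen(1-3), of X] by (simp add: fun_eq_iff)
 ultimately have "spn Rw ?Z (\<lambda>X P. ?G X P - Rw (gen j \<circ> w) X P)"
  by (simp add: lw_lwA algebra_simps)
 then show ?case using binv_gen[OF F(1) gen(2)] by blast
qed

lemma kl_exists:
 assumes w: "w \<in> W n"
 shows "\<exists>q. (\<forall>y. q y \<in> A_neg) \<and> binv (\<lambda>X P. Rw w X P + (\<Sum>y\<in>{y. bruhat_less n y w}. to_fract (q y) * Rw y X P))"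
proof -
 let ?m = "\<lambda>w (X, P). Rw w X P" and ?B = "\<lambda>F. binv (\<lambda>X P. F (X, P))"
 have "\<exists>q. (\<forall>y. q y \<in> A_neg) \<and> ?B (\<lambda>x. ?m w x + (\<Sum>y\<in>{y. bruhat_less n y w}. to_fract (q y) * ?m y x))"
 proof (rule kazhdan_lusztig_lift[OF finite_W _ _ _ _ w, where rk = "len n" and ls = "bruhat_less n" and B = ?B and m = ?m])
  fix w assume w: "w \<in> W n"
  then obtain F where F: "binv F" "spn Rw {y. bruhat_less n y w} (\<lambda>X P. F X P - Rw w X P)" using kl_start by blast
  then obtain h where "\<And>X P. F X P - Rw w X P = (\<Sum>y\<in>{y. bruhat_less n y w}. to_fract (h y) * Rw y X P)"
   unfolding spn_def by blast
  then have "F = (\<lambda>X P. Rw w X P + (\<Sum>y\<in>{y. bruhat_less n y w}. to_fract (h y) * Rw y X P))"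
   by (intro ext) (metis add.commute diff_add_cancel)
  then show "\<exists>a. ?B (\<lambda>x. ?m w x + (\<Sum>y\<in>{y. bruhat_less n y w}. to_fract (a y) * ?m y x))"
   using F(1) by (intro exI[of _ h]) simp
 qed (blast intro: bruhat_lessD bruhat_less_trans, blast intro: bruhat_lessD bruhat_less_trans, rule binv_lin)
 then show ?thesis by simp
qed

definition klq :: "(int => int) => (int => int) => 'g gring" where
 "klq w = (SOME q. (\<forall>y. q y \<in> A_neg) \<and>
   binv (\<lambda>X P. Rw w X P + (\<Sum>y\<in>{y. bruhat_less n y w}. to_fract (q y) * Rw y X P)))"

text \<open>The operator of \<open>C'_w\<close>, constructed inside the representation;
  \<open>rho_KL_basis\<close> identifies it with the image of \<open>KL_basis\<close>.\<close>

definition Cw :: "(int => int) => (tab => 'g K) => tab => 'g K" where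
 "Cw w X P = Rw w X P + (\<Sum>y\<in>{y. bruhat_less n y w}. to_fract (klq w y) * Rw y X P)"

lemma klq: assumes "w \<in> W n" shows "klq w y \<in> A_neg" "binv (Cw w)"
proof -
 have "(\<forall>y. klq w y \<in> A_neg) \<and>
   binv (\<lambda>X P. Rw w X P + (\<Sum>y\<in>{y. bruhat_less n y w}. to_fract (klq w y) * Rw y X P))"
  unfolding klq_def by (rule someI_ex[OF kl_exists[OF assms]])
 moreover have "Cw w = (\<lambda>X P. Rw w X P + (\<Sum>y\<in>{y. bruhat_less n y w}. to_fract (klq w y) * Rw y X P))"
  by (intro ext) (simp add: Cw_def)
 ultimately show "klq w y \<in> A_neg" "binv (Cw w)" by simp_all
qed

lemma leads_perturb:
 assumes "w \<in> W n" "\<And>y. bruhat_less n y w ==> q y \<in> A_neg" "valid P" "valid Q"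
 shows "tends ((Rw w (dl Q) P + (\<Sum>y\<in>{y. bruhat_less n y w}. to_fract (q y) * Rw y (dl Q) P)) / omm P n)
   (if P = PT w \<and> Q = QT w then 1 else 0)"
proof -
 let ?d = "\<lambda>w. if P = PT w \<and> Q = QT w then 1 else (0 :: int)"
 have "tends (Rw w (dl Q) P / omm P n + (\<Sum>y\<in>{y. bruhat_less n y w}. to_fract (q y) * (Rw y (dl Q) P / omm P n)))
   (?d w + (\<Sum>y\<in>{y. bruhat_less n y w}. 0 * ?d y))"
  using assms bruhat_lessD(1)
  by (intro lim_add lim_sum lim_mult leading_coefficient' lim_to_fract) auto
 then show ?thesis by (simp add: add_divide_distrib sum_divide_distrib)
qed

lemma leads_Cw: "leads Cw"
 unfolding leads_def Cw_def using leads_perturb klq(1) by blast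

lemma Asp_Cw: assumes "w \<in> W n" shows "Asp (Cw w)"
proof -
 have 1: "finite {y. bruhat_less n y w}" using bruhat_lessD(1) by (intro finite_subset[OF _ finite_W]) blast
 have "Asp (\<lambda>X P. Rw w X P + (\<Sum>y\<in>{y. bruhat_less n y w}. to_fract (klq w y) * Rw y X P))"
  by (intro spn_add Asp_Rw[OF assms] spn_sum 1 Asp_Rw) (use bruhat_lessD(1) in auto)
 moreover have "Cw w = (\<lambda>X P. Rw w X P + (\<Sum>y\<in>{y. bruhat_less n y w}. to_fract (klq w y) * Rw y X P))"
  by (intro ext) (simp add: Cw_def)
 ultimately show ?thesis by simp
qed

lemma spn_Cw_Rw: "w \<in> W n ==> spn Cw (W n) (Rw w)"
proof (induction "len n w" arbitrary: w rule: less_induct)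
 case less
 let ?S = "{y. bruhat_less n y w}"
 have 1: "finite ?S" using bruhat_lessD(1) by (intro finite_subset[OF _ finite_W]) blast
 have "spn Cw (W n) (\<lambda>X P. to_fract 1 * Cw w X P + to_fract (- 1) * (\<Sum>y\<in>?S. to_fract (klq w y) * Rw y X P))"
  by (intro spn_lin spn_sum 1 spn_single finite_W less.prems less.hyps) (use bruhat_lessD in auto)
 moreover have "Rw w = (\<lambda>X P. to_fract 1 * Cw w X P + to_fract (- 1) * (\<Sum>y\<in>?S. to_fract (klq w y) * Rw y X P))"
  by (intro ext) (simp add: Cw_def)
 ultimately show ?case by simp
qed

lemma Asp_expand:
 assumes "Asp F" obtains h where "\<And>X P. F X P = (\<Sum>z\<in>W n. to_fract (h z) * Cw z X P)"
 using spn_trans[OF assms finite_W spn_Cw_Rw] unfolding spn_def by blast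

lemma binv_coefficients:
 assumes "binv F" "\<And>X P. F X P = (\<Sum>z\<in>W n. to_fract (h z) * Cw z X P)" "z \<in> W n"
 shows "A_bar (h z) = h z"
proof (rule leads_unique[OF leads_Cw _ assms(3)])
 fix X P
 have "(\<Sum>z\<in>W n. to_fract (A_bar (h z)) * Cw z X P) = (\<Sum>z\<in>W n. to_fract (A_bar (h z)) * kb (Cw z (kb X)) P)"
  using klq(2) unfolding binv_def by (intro sum.cong) auto
 also have "\<dots> = kb (F (kb X)) P" unfolding kb_def assms(2) by (simp add: kbar_sum kbar_mult)
 also have "\<dots> = F X P" using assms(1) unfolding binv_def by blast
 finally show "(\<Sum>z\<in>W n. to_fract (A_bar (h z)) * Cw z X P) = (\<Sum>z\<in>W n. to_fract (h z) * Cw z X P)"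
  unfolding assms(2) .
qed

end

section \<open>The Hecke algebra of the definitions as an algebra of operators\<close>

lemma lookup_scale: "Poly_Mapping.lookup (scale p h) w = p * Poly_Mapping.lookup h w"
 unfolding scale_def by (simp add: Poly_Mapping.map.rep_eq when_def)

lemma H_lookup: "h \<in> H n \<longleftrightarrow> (\<forall>w. w \<notin> W n --> Poly_Mapping.lookup h w = 0)"
 unfolding H_def by (auto simp: in_keys_iff subset_iff)

lemma lookup_T: "Poly_Mapping.lookup (T w) y = (if y = w then 1 else 0)"
 unfolding T_def by (simp add: lookup_single when_def)

lemma H_closed:
 fixes g h :: "'g::linordered_ab_group_add hecke" and f :: "'i => 'g hecke"
 shows "0 \<in> H n" "h \<in> H n ==> scale p h \<in> H n" "w \<in> W n ==> T w \<in> H n" "g \<in> H n ==> h \<in> H n ==> g + h \<in> H n"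
 "(\<And>i. i \<in> S ==> f i \<in> H n) ==> sum f S \<in> H n"
proof -
 show *: "0 \<in> H n" "h \<in> H n ==> scale p h \<in> H n" "w \<in> W n ==> T w \<in> H n"
  and add: "g \<in> H n ==> h \<in> H n ==> g + h \<in> H n" for g h :: "'g hecke" and p w
  by (auto simp: H_lookup lookup_scale lookup_T lookup_add)
 show "sum f S \<in> H n" if "\<And>i. i \<in> S ==> f i \<in> H n"
  using that by (induction S rule: infinite_finite_induct) (simp_all add: * add)
qed

lemma lookup_hecke_sum:
 assumes "finite S"
 shows "Poly_Mapping.lookup (\<Sum>w\<in>S. scale (f w) (T w)) y = (if y \<in> S then f y else 0)"
proof -
 have "Poly_Mapping.lookup (\<Sum>w\<in>S. scale (f w) (T w)) y = (\<Sum>w\<in>S. if y = w then f w else 0)"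
  unfolding lookup_sum by (intro sum.cong) (simp_all add: lookup_scale lookup_T)
 then show ?thesis using assms by (simp add: sum.delta')
qed

lemma H_expand: "h \<in> H n ==> h = (\<Sum>w\<in>W n. scale (Poly_Mapping.lookup h w) (T w))"
 by (rule poly_mapping_eqI) (simp add: lookup_hecke_sum[OF finite_W] H_lookup)

lemma H_induct [consumes 1, case_names T add]:
 assumes h: "h \<in> H n" and T: "\<And>p w. w \<in> W n ==> Q (scale p (T w))"
  and add: "\<And>g h. g \<in> H n ==> h \<in> H n ==> Q g ==> Q h ==> Q (g + h)"
 shows "Q h"
proof -
 have "scale 0 (T id :: 'a hecke) = 0" by (rule poly_mapping_eqI) (simp add: lookup_scale)
 then have Q0: "Q 0" using T[OF W_id, of 0] by simp
 have "Q (\<Sum>w\<in>S. scale (Poly_Mapping.lookup h w) (T w))" if "S \<subseteq> W n" for S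
  using finite_subset[OF that finite_W] that
 proof (induction S rule: finite_induct)
  case (insert w S)
  then have "Q (scale (Poly_Mapping.lookup h w) (T w) + (\<Sum>w\<in>S. scale (Poly_Mapping.lookup h w) (T w)))"
   by (intro add T H_closed) auto
  then show ?case using insert.hyps by simp
 qed (simp add: Q0)
 from this[OF order_refl] show ?thesis using H_expand[OF h] by simp
qed

locale hecke_B = asymptotic n a b for n :: nat and a b :: "'g::linordered_ab_group_add" +
 fixes L :: "(int => int) => 'g"
 assumes L_gen: "\<And>j. j < n ==> L (gen j) = (if j = 0 then b else a)"
begin

text \<open>Sends \<open>T w\<close> to \<open>Rw w\<close>. It maps \<open>H n\<close> bijectively
  onto the operators satisfying \<open>Asp\<close>, so products, inverses and bar can be computed
  with operators.\<close>

definition rho :: "'g hecke => (tab => 'g K) => tab => 'g K" where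
 "rho h X P = (\<Sum>w\<in>W n. to_fract (Poly_Mapping.lookup h w) * Rw w X P)"

lemma rho_add: "rho (g + h) X P = rho g X P + rho h X P"
 by (simp add: rho_def lookup_add distrib_right sum.distrib)

lemma rho_scale: "rho (scale p h) X P = to_fract p * rho h X P"
 by (simp add: rho_def lookup_scale sum_distrib_left mult.assoc)

lemma rho_sum: "rho (sum f S) X P = (\<Sum>i\<in>S. rho (f i) X P)"
proof (induction S rule: infinite_finite_induct)
 case (insert i S) then show ?case by (simp add: rho_add)
qed (simp_all add: rho_def)

lemma rho_T: assumes "w \<in> W n" shows "rho (T w) X P = Rw w X P"
proof -
 have "rho (T w) X P = (\<Sum>y\<in>W n. if y = w then Rw w X P else 0)"
  unfolding rho_def lookup_T by (rule sum.cong) auto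
 then show ?thesis using assms finite_W by (simp add: sum.delta)
qed

lemma Asp_rho: "Asp (rho h)"
 unfolding spn_def rho_def by blast

lemma rho_inj: assumes "g \<in> H n" "h \<in> H n" "\<And>X P. rho g X P = rho h X P" shows "g = h"
proof (rule poly_mapping_eqI)
 fix w
 show "Poly_Mapping.lookup g w = Poly_Mapping.lookup h w"
 proof (cases "w \<in> W n")
  case True
  from leads_unique[OF leads_Rw assms(3)[unfolded rho_def] this] show ?thesis .
 next
  case False
  then show ?thesis using assms(1,2) by (simp add: H_lookup)
 qed
qed

lemma rho_surj: assumes "Asp F" obtains h where "h \<in> H n" "\<And>X P. rho h X P = F X P"
proof -
 obtain f where f: "\<And>X P. F X P = (\<Sum>w\<in>W n. to_fract (f w) * Rw w X P)" using assms unfolding spn_def by blast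
 let ?h = "\<Sum>w\<in>W n. scale (f w) (T w)"
 have "rho ?h X P = F X P" for X P
  unfolding f rho_def by (intro sum.cong) (simp_all add: lookup_hecke_sum[OF finite_W])
 moreover have "?h \<in> H n" by (intro H_closed)
 ultimately show ?thesis using that by blast
qed

lemma rho_lin: "rho g (\<lambda>P. c * X P + d * Y P) P = c * rho g X P + d * rho g Y P"
 by (rule Asp_lin(1)[OF Asp_rho])

lemma rho_gen_T:
 assumes "j < n" "w \<in> W n"
 shows "len n (gen j \<circ> w) > len n w ==> Rop j (Rw w X) P = Rw (gen j \<circ> w) X P"
  and "len n (gen j \<circ> w) < len n w ==>
   Rop j (Rw w X) P = Rw (gen j \<circ> w) X P + to_fract (ex (L (gen j)) - ex (- L (gen j))) * Rw w X P"
proof -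
 have d: "inv w (lo j) < inv w (hi j) \<or> inv w (hi j) < inv w (lo j)" using asc_or_desc[OF W_inv[OF assms(2)]] .
 show "Rop j (Rw w X) P = Rw (gen j \<circ> w) X P" if l: "len n (gen j \<circ> w) > len n w"
 proof -
  have "inv w (lo j) < inv w (hi j)" using d len_gen_left(2)[OF assms(2,1)] l by fastforce
  then show ?thesis using Rw_left[OF assms(2,1)] by simp
 qed
 show "Rop j (Rw w X) P = Rw (gen j \<circ> w) X P + to_fract (ex (L (gen j)) - ex (- L (gen j))) * Rw w X P"
  if l: "len n (gen j \<circ> w) < len n w"
 proof -
  have "inv w (hi j) < inv w (lo j)" using d len_gen_left(1)[OF assms(2,1)] l by fastforce
  moreover have "ex (L (gen j)) = lwA j" "ex (- L (gen j)) = A_bar (lwA j)"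
   using L_gen[OF assms(1)] by (simp_all add: lwA_def)
  ultimately show ?thesis using Rw_desc_left[OF assms(2,1)] by (simp add: lw_lwA)
 qed
qed

lemma hecke_mult_exists: "\<exists>m. is_hecke_mult n L m"
proof -
 have "\<exists>h. h \<in> H n \<and> (\<forall>X P. rho h X P = rho x (rho y X) P)" for x y
  using rho_surj[OF Asp_comp[OF Asp_rho Asp_rho], of x y] by metis
 then have "\<exists>m. \<forall>x y. m x y \<in> H n \<and> (\<forall>X P. rho (m x y) X P = rho x (rho y X) P)" by metis
 then obtain m where m: "\<And>x y. m x y \<in> H n" "\<And>x y X P. rho (m x y) X P = rho x (rho y X) P" by blast
 have m': "rho (m x y) X = rho x (rho y X)" for x y X by (rule ext) (rule m(2))
 note cl = H_closed(2-4)
 have "is_hecke_mult n L m"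
  unfolding is_hecke_mult_def
 proof (intro conjI ballI allI impI)
  fix x y z :: "'g hecke" assume H: "x \<in> H n" "y \<in> H n" "z \<in> H n"
  show "m (m x y) z = m x (m y z)" by (rule rho_inj) (simp_all add: m(1) m')
  show "m (x + y) z = m x z + m y z"
   by (rule rho_inj) (simp_all add: m cl rho_add)
  have "rho (y + z) X = (\<lambda>P. 1 * rho y X P + 1 * rho z X P)" for X by (rule ext) (simp add: rho_add)
  then have "rho x (rho (y + z) X) P = rho x (rho y X) P + rho x (rho z X) P" for X P
   using rho_lin[of x 1 "rho y X" 1 "rho z X"] by simp
  then show "m x (y + z) = m x y + m x z"
   by (intro rho_inj) (simp_all add: m cl rho_add)
 next
  fix p and x y :: "'g hecke" assume H: "x \<in> H n" "y \<in> H n"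
  show "m (scale p x) y = scale p (m x y)" by (rule rho_inj) (simp_all add: m cl rho_scale)
  have "rho (scale p y) X = (\<lambda>P. to_fract p * rho y X P + 0 * rho y X P)" for X by (rule ext) (simp add: rho_scale)
  then have "rho x (rho (scale p y) X) P = to_fract p * rho x (rho y X) P" for X P
   using rho_lin[of x "to_fract p" "rho y X" 0 "rho y X"] by simp
  then show "m x (scale p y) = scale p (m x y)" by (intro rho_inj) (simp_all add: m cl rho_scale)
 next
  fix x :: "'g hecke" assume x: "x \<in> H n"
  have i: "rho (T id) X = X" for X by (rule ext) (simp only: rho_T[OF W_id] Rw_id)
  show "m (T id) x = x" "m x (T id) = x" by (rule rho_inj; simp only: m m' x i)+
 next
  fix s w assume s: "s \<in> gens n" and w: "w \<in> W n"
  obtain j where j: "j < n" "s = gen j" using s gens_eq[OF n_pos] by blast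
  have sw: "s \<circ> w \<in> W n" "s \<in> W n" using W_comp gen_in_W j w by blast+
  have Tw: "rho (T w) X = Rw w X" for X by (rule ext) (rule rho_T[OF w])
  have r: "rho (m (T s) (T w)) X P = Rop j (Rw w X) P" for X P
   unfolding m(2) rho_T[OF sw(2)] Tw using j Rw_gen by simp
  show "m (T s) (T w) = T (s \<circ> w)" if l: "len n (s \<circ> w) > len n w"
   by (rule rho_inj[OF m(1) H_closed(3)[OF sw(1)]])
    (unfold r rho_T[OF sw(1)] rho_gen_T(1)[OF j(1) w l[unfolded j(2)]], simp only: j(2))
  show "m (T s) (T w) = T (s \<circ> w) + scale (ex (L s) - ex (- L s)) (T w)" if l: "len n (s \<circ> w) < len n w"
   by (rule rho_inj[OF m(1) H_closed(4)[OF H_closed(3)[OF sw(1)] H_closed(2)[OF H_closed(3)[OF w]]]])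
    (unfold r rho_add rho_scale rho_T[OF sw(1)] rho_T[OF w] rho_gen_T(2)[OF j(1) w l[unfolded j(2)]], simp only: j(2))
 qed (rule m(1))
 then show ?thesis by (rule exI[of _ m])
qed

text \<open>\<open>hecke_mult\<close> is merely some multiplication with the prescribed properties,
  so its agreement with composition is derived from \<open>is_hecke_mult\<close>: for generators
  times basis elements, then by linearity, then along reduced words by associativity.\<close>

lemma rho_mult:
 fixes x y :: "'g hecke"
 assumes "x \<in> H n" "y \<in> H n"
 shows "hecke_mult n L x y \<in> H n" "rho (hecke_mult n L x y) X P = rho x (rho y X) P"
proof -
 define m where "m = hecke_mult n L"
 have "is_hecke_mult n L m" unfolding m_def hecke_mult_def by (rule someI_ex[OF hecke_mult_exists])
 note * = this[unfolded is_hecke_mult_def]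
 have cl: "m x y \<in> H n" if "x \<in> H n" "y \<in> H n" for x y using * that by blast
 have assoc: "m (m x y) z = m x (m y z)" if "x \<in> H n" "y \<in> H n" "z \<in> H n" for x y z using * that by blast
 have add: "m (x + y) z = m x z + m y z" "m x (y + z) = m x y + m x z"
  if "x \<in> H n" "y \<in> H n" "z \<in> H n" for x y z using * that by blast+
 have sc: "m (scale p x) y = scale p (m x y)" "m x (scale p y) = scale p (m x y)"
  if "x \<in> H n" "y \<in> H n" for x y p using * that by blast+
 have one: "m (T id) x = x" if "x \<in> H n" for x using * that by blast
 have gn: "len n (gen j \<circ> w) > len n w ==> m (T (gen j)) (T w) = T (gen j \<circ> w)"
  "len n (gen j \<circ> w) < len n w ==>
   m (T (gen j)) (T w) = T (gen j \<circ> w) + scale (ex (L (gen j)) - ex (- L (gen j))) (T w)"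
  if "j < n" "w \<in> W n" for j w
 proof -
  have "gen j \<in> gens n" using gens_eq[OF n_pos] that(1) by blast
  note c = bspec[OF bspec[OF *[THEN conjunct2, THEN conjunct2, THEN conjunct2, THEN conjunct2, THEN conjunct2] this] that(2)]
  from c show "len n (gen j \<circ> w) > len n w ==> m (T (gen j)) (T w) = T (gen j \<circ> w)"
   "len n (gen j \<circ> w) < len n w ==>
    m (T (gen j)) (T w) = T (gen j \<circ> w) + scale (ex (L (gen j)) - ex (- L (gen j))) (T w)"
   by blast+
 qed
 have 1: "rho (m (T (gen j)) y) X = Rop j (rho y X)" if j: "j < n" and y: "y \<in> H n" for j y X
  using y
 proof (induction y rule: H_induct)
  case (T p w)
  have sw: "gen j \<circ> w \<in> W n" "gen j \<in> W n" using W_comp gen_in_W j T by blast+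
  have "rho (m (T (gen j)) (T w)) X P = Rop j (Rw w X) P" for P
  proof (cases "len n (gen j \<circ> w) > len n w")
   case True
   show ?thesis unfolding gn(1)[OF j T True] rho_T[OF sw(1)] rho_gen_T(1)[OF j T True] ..
  next
   case False
   moreover have "len n (gen j \<circ> w) ~= len n w"
    using asc_or_desc[OF W_inv[OF T], of j] len_gen_left[OF T j] by (metis n_not_Suc_n)
   ultimately have l: "len n (gen j \<circ> w) < len n w" by simp
   show ?thesis unfolding gn(2)[OF j T l] rho_add rho_scale rho_T[OF sw(1)] rho_T[OF T] rho_gen_T(2)[OF j T l] ..
  qed
  moreover have "m (T (gen j)) (scale p (T w)) = scale p (m (T (gen j)) (T w))"
   by (rule sc(2)) (intro H_closed sw T)+
  moreover have "rho (scale p (T w)) X = (\<lambda>P. to_fract p * Rw w X P + 0 * Rw w X P)"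
   by (rule ext) (simp add: rho_scale rho_T[OF T])
  moreover have "rho (T w) X = Rw w X" by (rule ext) (rule rho_T[OF T])
  ultimately show ?case using Rop_lin[of j "to_fract p" "Rw w X" 0 "Rw w X"]
   by (simp add: rho_scale fun_eq_iff)
 next
  case (add g h)
  have "rho (g + h) X = (\<lambda>P. 1 * rho g X P + 1 * rho h X P)" by (rule ext) (simp add: rho_add)
  moreover have "m (T (gen j)) (g + h) = m (T (gen j)) g + m (T (gen j)) h"
   by (rule \<open>\<And>z y x. x \<in> H n ==> y \<in> H n ==> z \<in> H n ==> m x (y + z) = m x y + m x z\<close>)
    (intro H_closed gen_in_W j add)+
  ultimately show ?case using Rop_lin[of j 1 "rho g X" 1 "rho h X"] add
   by (simp add: rho_add fun_eq_iff)
 qed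
 have 2: "rho (m (T w) y) X = Rw w (rho y X)" if y: "y \<in> H n" and w: "w \<in> W n" for w y X
  using w
 proof (induction w rule: reduced_Cons_induct)
  case id
  then show ?case unfolding one[OF y] Rw_id ..
 next
  case (gen j w)
  have H: "T (gen j) \<in> H n" "T w \<in> H n" using H_closed(3) gen_in_W gen by blast+
  have "T (gen j \<circ> w) = m (T (gen j)) (T w)" using gn(1)[OF gen(2,1)] gen(4) by simp
  then have "m (T (gen j \<circ> w)) y = m (T (gen j)) (m (T w) y)" using assoc[OF H y] by simp
  then have "rho (m (T (gen j \<circ> w)) y) X = Rop j (rho (m (T w) y) X)" using 1[OF gen(2) cl[OF H(2) y]] by simp
  then show ?case unfolding gen(5) Rw_left[OF gen(1-3)] .
 qed
 have "rho (m x y) X = rho x (rho y X)" using assms(1)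
 proof (induction x rule: H_induct)
  case (T p w)
  show ?case unfolding sc(1)[OF H_closed(3)[OF T] assms(2)]
   by (rule ext) (simp add: rho_scale rho_T[OF T] 2[OF assms(2) T])
 next
  case (add g h)
  have "m (g + h) y = m g y + m h y"
   using \<open>\<And>z y x. x \<in> H n ==> y \<in> H n ==> z \<in> H n ==> m (x + y) z = m x z + m y z\<close>[OF add(1,2) assms(2)] .
  then show ?case using add by (intro ext) (simp add: rho_add)
 qed
 then show "rho (hecke_mult n L x y) X P = rho x (rho y X) P" unfolding m_def by simp
 show "hecke_mult n L x y \<in> H n" using cl[OF assms] unfolding m_def .
qed

text \<open>\<open>Rw_inverse_bar\<close> supplies the inverse, and injectivity of
  \<open>rho\<close> its uniqueness.\<close>

lemma hecke_inv:
 assumes w: "w \<in> W n"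
 shows "hecke_inv n L (T (inv w)) \<in> H n" "rho (hecke_inv n L (T (inv w))) X P = kb (Rw w (kb X)) P"
proof -
 note iw = W_inv[OF w]
 have Ti: "T (inv w) \<in> H n" using H_closed(3)[OF iw] .
 obtain g where g: "g \<in> H n" "\<And>X P. rho g X P = kb (Rw w (kb X)) P"
  using rho_surj[OF Asp_kb_Rw[OF w]] by metis
 have g': "rho g X = kb (Rw w (kb X))" for X by (rule ext) (rule g(2))
 have ti: "rho (T (inv w)) X = Rw (inv w) X" for X by (rule ext) (rule rho_T[OF iw])
 have one: "rho (T id) X P = X P" for X P using rho_T[OF W_id] by simp
 have id: "T id \<in> H n" using H_closed(3)[OF W_id] .
 have "hecke_inv n L (T (inv w)) = g"
  unfolding hecke_inv_def
 proof (rule the_equality)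
  show "g \<in> H n \<and> hecke_mult n L g (T (inv w)) = T id \<and> hecke_mult n L (T (inv w)) g = T id"
   using g(1) rho_mult(1)[OF g(1) Ti] rho_mult(1)[OF Ti g(1)]
   by (intro conjI rho_inj[OF _ id])
    (simp_all add: rho_mult(2)[OF g(1) Ti] rho_mult(2)[OF Ti g(1)] one g' ti Rw_inverse_bar[OF w] del: id_apply)
 next
  fix h assume h: "h \<in> H n \<and> hecke_mult n L h (T (inv w)) = T id \<and> hecke_mult n L (T (inv w)) h = T id"
  have "rho h (rho (T (inv w)) Y) P = Y P" for Y P
   using h one rho_mult(2)[OF _ Ti, of h] by metis
  then have "rho h X P = rho g X P" for X P
   using Rw_inverse_bar(1)[OF w, of X] by (metis ti g')
  then show "h = g" using rho_inj[of h g] h g(1) by blast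
 qed
 then show "hecke_inv n L (T (inv w)) \<in> H n" "rho (hecke_inv n L (T (inv w))) X P = kb (Rw w (kb X)) P"
  using g by simp_all
qed

lemma rho_bar:
 assumes h: "h \<in> H n"
 shows "hecke_bar n L h \<in> H n" "rho (hecke_bar n L h) X P = kb (rho h (kb X)) P"
proof -
 have sub: "Poly_Mapping.keys h \<subseteq> W n" using h unfolding H_def by blast
 show "hecke_bar n L h \<in> H n" unfolding hecke_bar_def
  by (intro H_closed hecke_inv) (use sub in blast)
 have "rho (hecke_bar n L h) X P = (\<Sum>w\<in>Poly_Mapping.keys h. to_fract (A_bar (Poly_Mapping.lookup h w)) * kb (Rw w (kb X)) P)"
  unfolding hecke_bar_def rho_sum rho_scale using hecke_inv(2) sub by (intro sum.cong) auto
 also have "\<dots> = (\<Sum>w\<in>W n. to_fract (A_bar (Poly_Mapping.lookup h w)) * kb (Rw w (kb X)) P)"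
  by (rule sum.mono_neutral_left[OF finite_W sub]) (simp add: in_keys_iff)
 also have "\<dots> = kb (rho h (kb X)) P" unfolding kb_def rho_def by (simp add: kbar_sum kbar_mult)
 finally show "rho (hecke_bar n L h) X P = kb (rho h (kb X)) P" .
qed

lemma bar_fixed_iff: "h \<in> H n ==> hecke_bar n L h = h \<longleftrightarrow> binv (rho h)"
 using rho_bar rho_inj[of "hecke_bar n L h" h] unfolding binv_def by metis

lemma rho_KL_basis:
 assumes w: "w \<in> W n"
 shows "KL_basis n L w \<in> H n" "rho (KL_basis n L w) X P = Cw w X P"
proof -
 let ?S = "{y. bruhat_less n y w}" and ?e = "\<lambda>q. T w + (\<Sum>y\<in>{y\<in>W n. bruhat_less n y w}. scale (q y) (T y))"
 have S: "{y\<in>W n. bruhat_less n y w} = ?S" using bruhat_lessD(1) by blast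
 have eH: "?e q \<in> H n" for q by (intro H_closed w) auto
 have re: "rho (?e q) X P = Rw w X P + (\<Sum>y\<in>?S. to_fract (q y) * Rw y X P)" for q X P
  unfolding rho_add rho_sum rho_scale rho_T[OF w] S
  by (intro arg_cong2[of _ _ _ _ "(+)"] refl sum.cong) (use rho_T bruhat_lessD(1) in auto)
 have rC: "rho (?e (klq w)) X P = Cw w X P" for X P unfolding re Cw_def ..
 have rC': "rho (?e (klq w)) = Cw w" by (intro ext rC)
 have "KL_basis n L w = ?e (klq w)"
  unfolding KL_basis_def
 proof (rule the_equality)
  have "hecke_bar n L (?e (klq w)) = ?e (klq w)" unfolding bar_fixed_iff[OF eH] rC' by (rule klq(2)[OF w])
  note fixed = this
  have "\<exists>P. (\<forall>y. bruhat_less n y w --> P y \<in> A_neg) \<and> ?e (klq w) = ?e P"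
   by (rule exI[of _ "klq w"]) (simp add: klq(1)[OF w])
  with fixed show "hecke_bar n L (?e (klq w)) = ?e (klq w) \<and>
    (\<exists>P. (\<forall>y. bruhat_less n y w --> P y \<in> A_neg) \<and> ?e (klq w) = ?e P)" by (rule conjI)
 next
  fix c assume "hecke_bar n L c = c \<and> (\<exists>P. (\<forall>y. bruhat_less n y w --> P y \<in> A_neg) \<and> c = ?e P)"
  then obtain q where q: "hecke_bar n L c = c" "\<And>y. bruhat_less n y w ==> q y \<in> A_neg" "c = ?e q" by blast
  have cH: "c \<in> H n" using eH q(3) by simp
  have bc: "binv (rho c)" using q(1) bar_fixed_iff[OF cH] by blast
  obtain h where h: "\<And>X P. rho c X P = (\<Sum>z\<in>W n. to_fract (h z) * Cw z X P)" using Asp_expand[OF Asp_rho[of c]] by blast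
  \<comment> \<open>Any candidate has bar-invariant coefficients in the basis \<open>Cw\<close>.
    Their limits are 0 or 1 because the lower terms of the candidate lie in \<open>A_neg\<close>, so
    \<open>bar_invariant_limit\<close> determines them.\<close>
  have hz: "h z = (if z = w then 1 else 0)" if z: "z \<in> W n" for z
  proof -
   have "tends (eps 0 * to_fract (h z)) (if PT z = PT w \<and> QT z = QT w then 1 else 0)"
   proof (rule leading_terms[OF leads_Cw order_refl _ z])
    fix z assume z: "z \<in> W n"
    show "tends (eps 0 * (\<Sum>x\<in>W n. to_fract (h x) * Cw x (dl (QT z)) (PT z)) / omm (PT z) n)
     (if PT z = PT w \<and> QT z = QT w then 1 else 0)"
     unfolding h[symmetric] q(3) re eps_0 mult_1_left
     by (rule leads_perturb[OF w q(2) PT_QT(1,2)[OF z]])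
   qed
   moreover have "(PT z = PT w \<and> QT z = QT w) = (z = w)" using RS_inj[OF z w] by auto
   ultimately have "tends (to_fract (h z)) (if z = w then 1 else 0)" by simp
   from bar_invariant_limit[OF binv_coefficients[OF bc h z] this] show ?thesis by simp
  qed
  have "rho c X P = Cw w X P" for X P
  proof -
   have "rho c X P = (\<Sum>z\<in>W n. if z = w then Cw w X P else 0)" unfolding h using hz by (intro sum.cong) auto
   then show ?thesis using w finite_W by (simp add: sum.delta)
  qed
  then show "c = ?e (klq w)" by (intro rho_inj[OF cH eH]) (simp only: rC)
 qed
 then show "KL_basis n L w \<in> H n" "rho (KL_basis n L w) X P = Cw w X P" using eH rC by simp_all
qed

lemma h_coeff:
 fixes x y :: "int => int"
 assumes x: "x \<in> W n" and y: "y \<in> W n"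
 shows "Cw x (Cw y X) P = (\<Sum>z\<in>W n. to_fract (h_coeff n L x y z) * Cw z X P)"
  and "z \<in> W n ==> A_bar (h_coeff n L x y z) = h_coeff n L x y z"
proof -
 note K = rho_KL_basis
 have Ky: "rho (KL_basis n L y) X = Cw y X" for X by (rule ext) (rule K(2)[OF y])
 obtain h where h: "\<And>X P. Cw x (Cw y X) P = (\<Sum>z\<in>W n. to_fract (h z) * Cw z X P)"
  using Asp_expand[OF Asp_comp[OF Asp_Cw[OF x] Asp_Cw[OF y]]] by blast
 define f where "f z = (if z \<in> W n then h z else 0)" for z
 have f: "Cw x (Cw y X) P = (\<Sum>z\<in>W n. to_fract (f z) * Cw z X P)" for X P
  unfolding h by (rule sum.cong) (simp_all add: f_def)
 have prod: "rho (hecke_mult n L (KL_basis n L x) (KL_basis n L y)) X P = Cw x (Cw y X) P" for X P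
  using rho_mult(2)[OF K(1)[OF x] K(1)[OF y]] by (simp add: K(2)[OF x] Ky)
 have sm: "rho (\<Sum>z\<in>W n. scale (g z) (KL_basis n L z)) X P = (\<Sum>z\<in>W n. to_fract (g z) * Cw z X P)" for g X P
  unfolding rho_sum rho_scale by (rule sum.cong) (simp_all add: K(2))
 have smH: "(\<Sum>z\<in>W n. scale (g z) (KL_basis n L z)) \<in> H n" for g by (intro H_closed K(1))
 have "h_coeff n L x y = f"
  unfolding h_coeff_def
 proof (rule the_equality)
  show "(\<forall>z. z \<notin> W n --> f z = 0) \<and>
   hecke_mult n L (KL_basis n L x) (KL_basis n L y) = (\<Sum>z\<in>W n. scale (f z) (KL_basis n L z))"
   by (intro conjI rho_inj[OF rho_mult(1)[OF K(1)[OF x] K(1)[OF y]] smH])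
    (simp_all only: prod sm f[symmetric], simp add: f_def)
 next
  fix g assume g: "(\<forall>z. z \<notin> W n --> g z = 0) \<and>
   hecke_mult n L (KL_basis n L x) (KL_basis n L y) = (\<Sum>z\<in>W n. scale (g z) (KL_basis n L z))"
  have "(\<Sum>z\<in>W n. to_fract (g z) * Cw z X P) = (\<Sum>z\<in>W n. to_fract (f z) * Cw z X P)" for X P
  proof -
   have "(\<Sum>z\<in>W n. to_fract (g z) * Cw z X P) = rho (\<Sum>z\<in>W n. scale (g z) (KL_basis n L z)) X P"
    by (rule sm[symmetric])
   also have "\<dots> = rho (hecke_mult n L (KL_basis n L x) (KL_basis n L y)) X P" by (simp only: g[THEN conjunct2])
   also have "\<dots> = Cw x (Cw y X) P" by (rule prod)
   also have "\<dots> = (\<Sum>z\<in>W n. to_fract (f z) * Cw z X P)" by (rule f)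
   finally show ?thesis .
  qed
  note eq = leads_unique[OF leads_Cw this]
  have "g z = f z" for z by (cases "z \<in> W n") (use eq g in \<open>simp_all add: f_def\<close>)
  then show "g = f" by (rule ext)
 qed
 then show "Cw x (Cw y X) P = (\<Sum>z\<in>W n. to_fract (h_coeff n L x y z) * Cw z X P)" using f by simp
 have b: "binv (\<lambda>X. Cw x (Cw y X))"
 proof -
  have c: "kb (Cw w (kb Y)) = Cw w Y" if "w \<in> W n" for w Y using klq(2)[OF that] unfolding binv_def by blast
  have "Cw y (kb X) = kb (Cw y X)" for X using c[OF y, of X] kb_kb[of "Cw y (kb X)"] by simp
  then show ?thesis unfolding binv_def by (simp add: c[OF x])
 qed
 show "A_bar (h_coeff n L x y z) = h_coeff n L x y z" if z: "z \<in> W n"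
  unfolding \<open>h_coeff n L x y = f\<close> by (rule binv_coefficients[OF b f z])
qed

end

section \<open>Bar-invariant vectors in the irreducible representations\<close>

text \<open>The shortest element with negative values exactly on \<open>{1..l}\<close>, up to left multiplication by
 permutations.\<close>

definition al :: "nat => int => int" where
 "al l i = (if i = 0 \<or> \<bar>i\<bar> > int l then i else if 0 < i then i - int l - 1 else i + int l + 1)"

lemma al_al: "al l (al l i) = i" by (simp add: al_def)

lemma al_odd: "al l (- i) = - al l i" by (auto simp: al_def)

lemma al_in_W: assumes "l \<le> n" shows "al l \<in> W n"
 unfolding W_def
proof (intro CollectI conjI allI)
 have "bij_betw (al l) ({- int n..int n} - {0}) ({- int n..int n} - {0})"
  by (rule bij_betw_byWitness[where f' = "al l"]) (use assms in \<open>auto simp: al_al, auto simp: al_def split: if_splits\<close>)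
 then show "al l permutes ({- int n..int n} - {0})"
  by (rule bij_imp_permutes) (use assms in \<open>auto simp: al_def\<close>)
qed (rule al_odd)

lemma inv_al: "inv (al l) = al l"
 by (rule inv_unique_comp) (simp_all add: fun_eq_iff al_al)

fun alw :: "nat => nat list" where
 "alw 0 = []"
| "alw (Suc l) = [0..<Suc l] @ alw l"

section \<open>Reduced words for \<open>al l\<close> and the symmetric group inside
  \<open>W n\<close>\<close>

context type_B
begin

lemma reduced_Cons:
 assumes "reduced js" "j < n" "inv (wprod js) (lo j) < inv (wprod js) (hi j)" shows "reduced (j # js)"
 using assms len_gen_left(1)[OF wprod_in_W assms(2,3)] by (simp add: reduced_def)

lemma reduced_rev: assumes "reduced js" shows "reduced (rev js)" "wprod (rev js) = inv (wprod js)"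
proof -
 have w: "is_word n js" using assms by (simp add: reduced_def)
 show 1: "wprod (rev js) = inv (wprod js)" using wprod_rev[OF w] .
 show "reduced (rev js)" using assms 1 len_inv[OF wprod_in_W[OF w]] w by (auto simp: reduced_def is_word_def)
qed

text \<open>Letters are prefixed one at a time, and the explicit inverse shows each of them to be an
  ascent. In \<open>alw\<close> the letter 0 then completes the word of
  \<open>al (Suc l)\<close>.\<close>

lemma alw_chain:
 assumes IH: "reduced (alw l)" "wprod (alw l) = al l" and l: "l < n" and k: "1 \<le> k" "k \<le> Suc l"
 shows "reduced ([k..<Suc l] @ alw l) \<and> (\<forall>i\<ge>1. inv (wprod ([k..<Suc l] @ alw l)) i =
  (if i < int k then al l i else if i = int k then int l + 1 else if i \<le> int l + 1 then al l (i - 1) else i))"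
 using k(2,1)
proof (induction k rule: inc_induct)
 case base
 have "al l i = i" if "i \<ge> int (Suc l)" for i using that by (simp add: al_def)
 then show ?case using IH by (simp add: inv_al)
next
 case (step k)
 let ?js = "[Suc k..<Suc l] @ alw l"
 have ih: "reduced ?js \<and> (\<forall>i\<ge>1. inv (wprod ?js) i =
  (if i < int (Suc k) then al l i else if i = int (Suc k) then int l + 1 else if i \<le> int l + 1 then al l (i - 1) else i))"
  by (rule step.IH) simp
 note red = conjunct1[OF ih] and inv = conjunct2[OF ih, rule_format]
 have k: "1 \<le> k" "k < Suc l" using step by auto
 have js: "[k..<Suc l] @ alw l = k # ?js" using k by (simp add: upt_conv_Cons)
 note w = wprod_in_W[OF conjunct1[OF red[unfolded reduced_def]]]
 have "al l (int k) < int l + 1" using k by (simp add: al_def)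
 then have red': "reduced (k # ?js)"
  using inv[of "int k"] inv[of "int k + 1"] k l by (intro reduced_Cons[OF red]) (simp_all add: lo_def hi_def)
 have eq: "inv (wprod (k # ?js)) i = inv (wprod ?js) (gen k i)" for i
  using W_inv_comp[OF gen_in_W w, of k] k l by (simp only: wprod_simps o_apply inv_gen)
 have "inv (wprod (k # ?js)) i =
  (if i < int k then al l i else if i = int k then int l + 1 else if i \<le> int l + 1 then al l (i - 1) else i)"
  if i: "i \<ge> 1" for i
 proof -
  have g: "gen k i = (if i = int k then int k + 1 else if i = int k + 1 then int k else i)"
   using i k by (simp add: gen_apply lo_def hi_def)
  then have "1 \<le> gen k i" using i k by simp
  from inv[OF this] show ?thesis unfolding eq using g i k by auto
 qed
 then show ?case unfolding js using red' by blast
qed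

lemma alw: "l \<le> n ==> reduced (alw l) \<and> wprod (alw l) = al l"
proof (induction l)
 case 0
 have "al 0 = id" by (rule ext) (simp add: al_def)
 then show ?case by (simp add: reduced_def)
next
 case (Suc l)
 let ?js = "[1..<Suc l] @ alw l"
 have l: "l < n" and IH: "reduced (alw l)" "wprod (alw l) = al l" using Suc by auto
 note ch = alw_chain[OF IH l, of 1]
 have red: "reduced ?js" using ch by simp
 have inv: "inv (wprod ?js) i = (if i = 1 then int l + 1 else if i \<le> int l + 1 then al l (i - 1) else i)" if "i \<ge> 1" for i
  using ch that by auto
 note w = wprod_in_W[OF conjunct1[OF red[unfolded reduced_def]]]
 have js: "alw (Suc l) = 0 # ?js" by (simp add: upt_conv_Cons)
 have m1: "inv (wprod ?js) (- 1) = - (int l + 1)" using W_odd[OF W_inv[OF w], of 1] inv[of 1] by simp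
 have r: "reduced (0 # ?js)"
  using inv[of 1] m1 l by (intro reduced_Cons[OF red]) (simp_all add: lo_def hi_def)
 have i0: "inv (wprod (0 # ?js)) = inv (wprod ?js) \<circ> gen 0"
  using W_inv_comp[OF gen_in_W w, of 0] l by simp
 note wW = wprod_in_W[OF conjunct1[OF r[unfolded reduced_def]]]
 have "inv (wprod (0 # ?js)) = al (Suc l)"
 proof (rule W_ext[OF W_inv[OF wW] al_in_W[OF Suc.prems]])
  fix i assume i: "1 \<le> i" "i \<le> int n"
  show "inv (wprod (0 # ?js)) i = al (Suc l) i"
  proof (cases "i = 1")
   case True
   then show ?thesis unfolding i0 using m1 by (simp add: gen_apply lo_def hi_def al_def)
  next
   case False
   then have "gen 0 i = i" using i by (simp add: gen_apply lo_def hi_def)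
   then show ?thesis unfolding i0 o_apply using inv[OF i(1)] False i by (auto simp: al_def)
  qed
 qed
 then have "wprod (0 # ?js) = al (Suc l)" using W_inv_inv[OF wW] inv_al by metis
 then show ?case using r unfolding js by simp
qed

definition Sn :: "(int => int) set" where "Sn = {u \<in> W n. \<forall>i. 1 \<le> i \<and> i \<le> int n --> 0 < u i}"

lemma SnD: assumes "u \<in> Sn" shows "u \<in> W n" "0 < u i \<longleftrightarrow> 0 < i"
proof -
 show u: "u \<in> W n" using assms by (simp add: Sn_def)
 consider "\<bar>i\<bar> > int n" | "i = 0" | "1 \<le> i" "i \<le> int n" | "1 \<le> - i" "- i \<le> int n" by linarith
 then show "0 < u i \<longleftrightarrow> 0 < i"
 proof cases
  case 4
  then have "0 < u (- i)" using assms by (simp add: Sn_def)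
  then show ?thesis using 4 W_odd[OF u, of i] by simp
 qed (use assms W_0[OF u] W_outside[OF u] in \<open>auto simp: Sn_def\<close>)
qed

lemma SnI: "u \<in> W n ==> (\<And>i. 1 \<le> i ==> i \<le> int n ==> 0 < u i) ==> u \<in> Sn"
 by (simp add: Sn_def)

lemma Sn_inv: assumes "u \<in> Sn" shows "inv u \<in> Sn"
proof (rule SnI)
 fix i assume i: "1 \<le> i" "i \<le> int n"
 show "0 < inv u i" using SnD(2)[OF assms, of "inv u i"] W_inv_inverses(4)[OF SnD(1)[OF assms]] i by simp
qed (rule W_inv[OF SnD(1)[OF assms]])

lemma Sn_comp: "u \<in> Sn ==> u' \<in> Sn ==> u \<circ> u' \<in> Sn"
 using SnD by (intro SnI W_comp) auto

lemma Sn_gen: "1 \<le> j ==> j < n ==> gen j \<in> Sn"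
 by (intro SnI gen_in_W) (auto simp: gen_apply lo_def hi_def)

text \<open>A reflection that shortens \<open>u\<close> removes an inversion. Inversions of a
  sign-preserving map occur only between integers of equal sign, so the reflection preserves signs
  as well.\<close>

lemma Sn_step: assumes "(y, u) \<in> step" "u \<in> Sn" shows "y \<in> Sn"
proof -
 obtain r where r: "y \<in> W n" "r \<in> reflections n" "u = y \<circ> r" "len n y < len n (y \<circ> r)" using assms(1) by blast
 obtain p q where pq: "p < q" "p ~= 0" "q ~= 0" "\<bar>p\<bar> \<le> int n" "\<bar>q\<bar> \<le> int n" "r = rfl p q"
  using reflections_rfl[OF n_pos r(2)] .
 have ry: "u \<circ> rfl p q = y" unfolding r(3) pq(6) using rfl_rfl[of p q] pq by (simp add: comp_assoc)
 have "u q < u p" using len_rfl_iff(1)[OF SnD(1)[OF assms(2)] pq(1-5)] r(3,4) ry by simp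
 then have same: "0 < p \<longleftrightarrow> 0 < q" using SnD(2)[OF assms(2), of p] SnD(2)[OF assms(2), of q] pq by auto
 have "0 < u (rfl p q i)" if "1 \<le> i" for i
  unfolding SnD(2)[OF assms(2)] using that same pq by (auto simp: rfl_apply)
 then show ?thesis unfolding ry[symmetric] using r(1) ry by (intro SnI) auto
qed

lemma Sn_bruhat: assumes "bruhat_less n y u" "u \<in> Sn" shows "y \<in> Sn"
proof -
 have "(y, u) \<in> step\<^sup>+" using assms(1) unfolding bruhat_less_def .
 then show ?thesis
 proof (induction rule: converse_trancl_induct)
  case (base y)
  then show ?case using Sn_step assms(2) by blast
 next
  case (step y z)
  then show ?case using Sn_step by blast
 qed
qed

lemma Sn_left_induct [consumes 1, case_names id gen]:
 assumes u: "u \<in> Sn" and "Q id"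
  and step: "\<And>j w. w \<in> Sn ==> 1 \<le> j ==> j < n ==> inv w (lo j) < inv w (hi j) ==> Q w ==> Q (gen j \<circ> w)"
 shows "Q u"
proof -
 have "u \<in> Sn --> Q u" using SnD(1)[OF u]
 proof (induction u rule: reduced_Cons_induct)
  case (gen j w)
  show ?case
  proof
   assume S: "gen j \<circ> w \<in> Sn"
   have "j ~= 0"
   proof
    assume j: "j = 0"
    have "0 < inv w 1" using gen(3) W_odd[OF W_inv[OF gen(1)], of 1] by (simp add: j lo_def hi_def)
    then have "0 < gen j (w (inv w 1))" using SnD(2)[OF S, of "inv w 1"] by simp
    then show False using W_inv_inverses(4)[OF gen(1)] by (simp add: j gen_apply lo_def hi_def)
   qed
   then have j: "1 \<le> j" by simp
   have "gen j \<circ> (gen j \<circ> w) \<in> Sn" by (rule Sn_comp[OF Sn_gen[OF j gen(2)] S])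
   then have w: "w \<in> Sn" by simp
   then show "Q (gen j \<circ> w)" using step[OF w j gen(2,3)] gen(5) by blast
  qed
 qed (rule impI, rule assms(2))
 then show ?thesis using u by blast
qed

end

context asymptotic
begin

text \<open>Monotonicity of \<open>inv w\<close> makes \<open>w\<close> the shortest among the
  elements \<open>u \<circ> w\<close>, so lengths add.\<close>

lemma Rw_Sn:
 assumes u: "u \<in> Sn" and w: "w \<in> W n" and mono: "\<And>i k. 0 < i ==> i < k ==> inv w i < inv w k"
 shows "Rw (u \<circ> w) X = Rw u (Rw w X)"
 using u
proof (induction u rule: Sn_left_induct)
 case (gen j u)
 have uW: "u \<in> W n" using SnD gen by blast
 have pos: "0 < inv u (int j)" using SnD(2)[OF Sn_inv[OF gen(1)]] gen by simp
 have lt: "inv (u \<circ> w) (lo j) < inv (u \<circ> w) (hi j)"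
  unfolding W_inv_comp[OF uW w] o_apply using gen pos by (intro mono) (simp_all add: lo_def hi_def)
 have "Rw (gen j \<circ> u \<circ> w) X = Rop j (Rw (u \<circ> w) X)"
  using Rw_left[OF W_comp[OF uW w] gen(3) lt] by (simp add: o_assoc)
 then show ?case unfolding gen(5) Rw_left[OF uW gen(3,4)] .
qed (simp only: Rw_id id_comp)

lemma Rw_Sn_al: "u \<in> Sn ==> l \<le> n ==> Rw (u \<circ> al l) X = Rw u (Rw (al l) X)"
 by (rule Rw_Sn[OF _ al_in_W]) (auto simp: inv_al al_def)

text \<open>For such functions with \<open>0 < l\<close>, \<open>t\<close> acts by the scalar
  \<open>E 1 0\<close>, and the generators below \<open>l\<close> preserve the condition; this makes
  the operator of \<open>al l\<close> computable.\<close>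

definition first_neg :: "nat => (tab => 'g K) => bool" where
 "first_neg l X \<longleftrightarrow> (\<forall>P. valid P --> X P ~= 0 --> (\<forall>i\<in>{1..l}. \<not> fst (P i)))"

lemma first_neg_Rop: assumes "first_neg l X" "j < l" "l \<le> n" shows "first_neg l (Rop j X)"
 unfolding first_neg_def
proof (intro allI impI ballI)
 fix P i assume P: "valid P" "Rop j X P ~= 0" and i: "i \<in> {1..l}"
 show "\<not> fst (P i)"
 proof (cases "j = 0 \<or> X P ~= 0")
  case True
  then have "X P ~= 0" using P by (auto simp: Rop_def)
  then show ?thesis using assms(1) P(1) i unfolding first_neg_def by blast
 next
  case False
  then have 1: "theta (P j) (P (Suc j)) ~= 0" "X (sw j P) ~= 0" using P by (auto simp: Rop_def)
  then have "valid (sw j P)" using valid_sw_theta[OF P(1)] False assms by simp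
  then have "\<not> fst (sw j P k)" if "k \<in> {1..l}" for k using assms(1) 1(2) that unfolding first_neg_def by blast
  from this[of i] this[of "Suc j"] this[of j] show ?thesis using i False assms by (auto simp: sw_apply split: if_splits)
 qed
qed

lemma first_neg_oprod: "first_neg l X ==> set js \<subseteq> {..<l} ==> l \<le> n ==> first_neg l (oprod Rop js X)"
 by (induction js) (simp_all add: first_neg_Rop)

lemma first_neg_0: assumes "first_neg l X" "0 < l" shows "Rop 0 X = (\<lambda>P. E 1 0 * X P)"
proof
 fix P
 have "\<not> fst (P 1)" if "valid P" "X P ~= 0" using assms that unfolding first_neg_def by force
 then show "Rop 0 X P = E 1 0 * X P" using x_first[of P] by (cases "X P = 0") (auto simp: Rop_def lw_def)
qed

lemma scale_Rop: "Rop j (\<lambda>P. c * X P) = (\<lambda>P. c * Rop j X P)"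
 using Rop_lin[of j c X 0 X] by simp

lemma scale_oprod: "oprod Rop js (\<lambda>P. c * X P) = (\<lambda>P. c * oprod Rop js X P)"
 by (induction js) (simp_all add: scale_Rop)

lemma scale_tmul: "tmul k (\<lambda>P. c * X P) = (\<lambda>P. c * tmul k X P)"
 by (rule ext) (simp add: tmul_def)

lemma tmul_Rop_commute: assumes "Suc j < k" "k \<le> n" shows "tmul k (Rop j X) = Rop j (tmul k X)"
proof
 fix P
 have "theta (P j) (P (Suc j)) * (x (P k) * X (sw j P)) = theta (P j) (P (Suc j)) * (tmul k X (sw j P))"
  if "valid P" "0 < j"
  using valid_sw_theta[OF that(1), of j] that assms
  by (cases "theta (P j) (P (Suc j)) = 0") (auto simp: tmul_def sw_apply)
 then show "tmul k (Rop j X) P = Rop j (tmul k X) P"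
  by (cases "valid P"; cases "j = 0") (simp_all add: tmul_def Rop_def algebra_simps)
qed

lemma tmul_oprod_commute: "set js \<subseteq> {..<l} ==> l < n ==> tmul (Suc l) (oprod Rop js X) = oprod Rop js (tmul (Suc l) X)"
 by (induction js) (auto simp: tmul_Rop_commute)

text \<open>The square of \<open>Rop 0\<close> in the middle is \<open>E 1 0\<close> times
  \<open>Rop 0\<close>, and the letters around it build \<open>tmul (Suc k)\<close> by
  \<open>tmul_Suc\<close>.\<close>

lemma oprod_up_down:
 "first_neg m X ==> k < m ==> m \<le> n ==>
  oprod Rop (rev [0..<Suc k]) (oprod Rop [0..<Suc k] X) = (\<lambda>P. E 1 0 * tmul (Suc k) X P)"
proof (induction k arbitrary: X)
 case 0
 then have "Rop 0 X = (\<lambda>P. E 1 0 * X P)" using first_neg_0[of m X] by simp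
 from arg_cong[OF this, of "Rop 0"] have "Rop 0 (Rop 0 X) = (\<lambda>P. E 1 0 * Rop 0 X P)" unfolding scale_Rop .
 then show ?case by (simp add: tmul_1)
next
 case (Suc k)
 let ?Y = "Rop (Suc k) X"
 have Y: "first_neg m ?Y" by (rule first_neg_Rop) (use Suc.prems in auto)
 have "oprod Rop (rev [0..<Suc (Suc k)]) (oprod Rop [0..<Suc (Suc k)] X)
   = Rop (Suc k) (oprod Rop (rev [0..<Suc k]) (oprod Rop [0..<Suc k] ?Y))"
  by simp
 also have "oprod Rop (rev [0..<Suc k]) (oprod Rop [0..<Suc k] ?Y) = (\<lambda>P. E 1 0 * tmul (Suc k) ?Y P)"
  using Suc.IH[OF Y] Suc.prems by simp
 also have "Rop (Suc k) \<dots> = (\<lambda>P. E 1 0 * tmul (Suc (Suc k)) X P)"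
  unfolding scale_Rop using tmul_Suc[of "Suc k" X] Suc.prems by simp
 finally show ?case .
qed

primrec tmuls :: "nat => (tab => 'g K) => tab => 'g K" where
 "tmuls 0 X = X"
| "tmuls (Suc l) X = tmul (Suc l) (tmuls l X)"

lemma Rw_al:
 assumes "l \<le> n"
 shows "Rw (al l) = oprod Rop (alw l)" "Rw (al l) = oprod Rop (rev (alw l))" "set (alw l) \<subseteq> {..<l}"
proof -
 have red: "reduced (alw l)" "wprod (alw l) = al l" using alw[OF assms] by auto
 show "Rw (al l) = oprod Rop (alw l)" using Rw_reduced[OF red(1)] red(2) by simp
 show "Rw (al l) = oprod Rop (rev (alw l))"
  using Rw_reduced[OF reduced_rev(1)[OF red(1)]] reduced_rev(2)[OF red(1)] red(2) inv_al by simp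
 show "set (alw l) \<subseteq> {..<l}" by (induction l) auto
qed

text \<open>\<open>al l\<close> is an involution, so its operator is given by the word
  \<open>alw l\<close> and also by its reverse. In the product of the two,
  \<open>oprod_up_down\<close> collapses each level to a Jucys-Murphy operator.\<close>

lemma Rw_al_square:
 "l \<le> m ==> m \<le> n ==> first_neg m X ==> Rw (al l) (Rw (al l) X) = (\<lambda>P. E (int l) 0 * tmuls l X P)"
proof (induction l)
 case 0
 have "al 0 = id" by (rule ext) (simp add: al_def)
 then show ?case unfolding \<open>al 0 = id\<close> Rw_id by (simp add: E_0)
next
 case (Suc l)
 note R = Rw_al[of l] and R' = Rw_al[of "Suc l"]
 have l: "l \<le> n" "Suc l \<le> n" using Suc.prems by auto
 let ?A = "Rw (al l)"
 have s: "set (alw l) \<subseteq> {..<m}" "set (alw l) \<subseteq> {..<l}" using R(3)[OF l(1)] Suc.prems by auto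
 have AX: "first_neg m (?A X)" unfolding R(1)[OF l(1)] by (rule first_neg_oprod) (use Suc.prems s in auto)
 have "Rw (al (Suc l)) (Rw (al (Suc l)) X)
   = oprod Rop (rev (alw l)) (oprod Rop (rev [0..<Suc l]) (oprod Rop [0..<Suc l] (?A X)))"
  by (subst R'(2)[OF l(2)], subst R'(1)[OF l(2)], subst R(1)[OF l(1)])
   (simp only: alw.simps rev_append oprod_append o_apply)
 also have "\<dots> = oprod Rop (rev (alw l)) (\<lambda>P. E 1 0 * tmul (Suc l) (?A X) P)"
  using oprod_up_down[OF AX, of l] Suc.prems by simp
 also have "\<dots> = (\<lambda>P. E 1 0 * tmul (Suc l) (?A (?A X)) P)"
  unfolding scale_oprod using tmul_oprod_commute[of "rev (alw l)" l "?A X"] s(2) l R(2)[OF l(1)] by simp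
 also have "?A (?A X) = (\<lambda>P. E (int l) 0 * tmuls l X P)" using Suc by simp
 finally show ?case unfolding scale_tmul tmuls.simps by (simp add: mult.assoc[symmetric] E_mult)
qed

lemma tmuls_dl: "valid Q ==> tmuls l (dl Q) = (\<lambda>P. (\<Prod>i\<in>{1..l}. x (Q i)) * dl Q P)"
proof (induction l)
 case (Suc l)
 then show ?case by (intro ext) (simp add: scale_tmul tmul_def dl_def atLeastAtMostSuc_conv)
qed simp

lemma E_prod: "(\<Prod>i\<in>S. E (f i) (g i)) = E (\<Sum>i\<in>S. f i) (\<Sum>i\<in>S. g i)"
 by (induction S rule: infinite_finite_induct) (simp_all add: E_mult E_0)

lemma E_eq_to_fract: "E i j = to_fract (ex (zmul i b + zmul j a))"
 by (simp add: E_def eps_def)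

lemma Rw_inj: assumes "w \<in> W n" "Rw w X = Rw w Y" shows "X = Y"
 using Rw_inverse_bar(2)[OF W_inv[OF assms(1)], of X] Rw_inverse_bar(2)[OF W_inv[OF assms(1)], of Y]
  W_inv_inv[OF assms(1)] assms(2) by metis

end

section \<open>Fillings ordered by rows of the second and columns of the first component\<close>

definition dd :: "box => nat" where "dd B = (case B of (e, r, c) => if e then r else c)"

context asymptotic
begin

text \<open>Number of the block of a box. Rows of the second component come first, columns of the
  first are shifted by \<open>n\<close> to come after them; \<open>dd\<close> is the position inside
  the block.\<close>

definition key2 :: "box => nat" where
 "key2 B = (case B of (e, r, c) => if e then n + c else r)"

definition ordered :: "tab => bool" where
 "ordered P \<longleftrightarrow> valid P \<and> (\<forall>j. 1 \<le> j \<and> j < n --> key2 (P j) \<le> key2 (P (Suc j)))"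

lemma weighted_sw:
 fixes g :: "box => int"
 assumes "1 \<le> j" "j < n"
 shows "(\<Sum>i\<in>{1..n}. int i * g (sw j P i)) = (\<Sum>i\<in>{1..n}. int i * g (P i)) + g (P j) - g (P (Suc j))"
proof -
 have S: "{1..n} = insert j (insert (Suc j) ({1..n} - {j, Suc j}))" using assms by auto
 have "(\<Sum>i\<in>{1..n} - {j, Suc j}. int i * g (sw j P i)) = (\<Sum>i\<in>{1..n} - {j, Suc j}. int i * g (P i))"
  by (rule sum.cong) (auto simp: sw_apply)
 then show ?thesis by (subst (1 2) S) (simp add: sw_apply algebra_simps)
qed

text \<open>Take a filling of the shape that maximises the sum of \<open>i * key2\<close>. Where
  keys decrease, the two boxes are not adjacent, and swapping them would increase the sum.\<close>

lemma ordered_exists: assumes "valid P" shows "\<exists>T. ordered T \<and> shp T = shp P"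
proof -
 let ?V = "{Q. valid Q \<and> shp Q = shp P}" and ?\<phi> = "\<lambda>Q. \<Sum>i\<in>{1..n}. int i * int (key2 (Q i))"
 have fin: "finite (?\<phi> ` ?V)" by (intro finite_imageI finite_subset[OF _ finite_valid]) auto
 have "Max (?\<phi> ` ?V) \<in> ?\<phi> ` ?V" using assms by (intro Max_in[OF fin]) auto
 then obtain T where T: "valid T" "shp T = shp P" "Max (?\<phi> ` ?V) = ?\<phi> T" by blast
 have max: "?\<phi> Q \<le> ?\<phi> T" if "valid Q" "shp Q = shp P" for Q
  unfolding T(3)[symmetric] using that by (intro Max_ge[OF fin]) blast
 have "key2 (T j) \<le> key2 (T (Suc j))" if j: "1 \<le> j" "j < n" for j
 proof (cases "T j \<in> pre (T (Suc j))")
  case True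
  then show ?thesis by (cases "T (Suc j)") (auto simp: pre_def key2_def split: if_splits)
 next
  case False
  have "?\<phi> (sw j T) \<le> ?\<phi> T"
   using valid_sw[OF T(1) j False] shp_sw[OF j] T(2) by (intro max) auto
  then show ?thesis using weighted_sw[OF j, of "\<lambda>B. int (key2 B)" T] by simp
 qed
 then show ?thesis using T unfolding ordered_def by blast
qed

end

locale ordered_tab = asymptotic n a b for n :: nat and a b :: "'g::linordered_ab_group_add" +
 fixes T0 :: tab
 assumes T0: "ordered T0"
begin

abbreviation ky :: "nat => nat" where "ky i \<equiv> key2 (T0 i)"
abbreviation f0 :: "tab => 'g K" where "f0 \<equiv> dl T0"

lemma vT: "valid T0" using T0 by (simp add: ordered_def)

lemma ky_mono: "i \<le> k ==> 1 \<le> i ==> k \<le> n ==> ky i \<le> ky k"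
proof (induction k rule: dec_induct)
 case (step k)
 then have "ky k \<le> ky (Suc k)" using T0 by (simp add: ordered_def)
 then show ?case using step by simp
qed simp

lemma ky_neg: assumes "i \<in> {1..n}" shows "ky i < n \<longleftrightarrow> \<not> fst (T0 i)"
proof -
 obtain e r c where B: "T0 i = (e, r, c)" by (cases "T0 i")
 show ?thesis using valid_hook[OF vT assms B] B by (auto simp: key2_def)
qed

definition ll :: nat where "ll = card {i \<in> {1..n}. \<not> fst (T0 i)}"

lemma neg_iff: assumes "i \<in> {1..n}" shows "\<not> fst (T0 i) \<longleftrightarrow> i \<le> ll"
proof -
 let ?A = "{i \<in> {1..n}. \<not> fst (T0 i)}"
 define m where "m = (if ?A = {} then 0 else Max ?A)"
 have "?A = {1..m}"
 proof (cases "?A = {}")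
  case False
  have fin: "finite ?A" by simp
  have mM: "m = Max ?A" unfolding m_def using False by (rule if_not_P)
  have m: "m \<in> ?A" unfolding mM by (rule Max_in[OF fin False])
  have m1: "m \<in> {1..n}" and m2: "\<not> fst (T0 m)" using m by simp_all
  have "ky m < n" using ky_neg[OF m1] m2 by simp
  have "k \<in> ?A" if k: "1 \<le> k" "k \<le> m" for k
  proof -
   have kn: "k \<in> {1..n}" using k m1 by auto
   have "ky k \<le> ky m" using ky_mono[OF k(2,1)] m1 by simp
   then have "ky k < n" using \<open>ky m < n\<close> by simp
   then have "\<not> fst (T0 k)" using ky_neg[OF kn] by simp
   then show ?thesis using kn by simp
  qed
  note down = this
  have up: "k \<le> m" if "k \<in> ?A" for k unfolding mM by (rule Max_ge[OF fin that])
  show ?thesis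
  proof (intro equalityI subsetI)
   fix k assume k: "k \<in> ?A"
   then have "1 \<le> k" by simp
   then show "k \<in> {1..m}" using up[OF k] by simp
  next
   fix k assume "k \<in> {1..m}"
   then show "k \<in> ?A" by (intro down) simp_all
  qed
 next
  case True
  then have "m = 0" by (simp add: m_def)
  then show ?thesis using True by simp
 qed
 note A = this
 have l: "ll = m" unfolding ll_def A by simp
 have "i \<in> ?A \<longleftrightarrow> i \<in> {1..m}" unfolding A ..
 then show ?thesis using assms unfolding l by simp
qed

lemma ll_le: "ll \<le> n"
proof -
 have "ll \<le> card {1..n}" unfolding ll_def by (rule card_mono) auto
 then show ?thesis by simp
qed

lemma dd_count: assumes i: "i \<in> {1..n}" shows "dd (T0 i) = card {k \<in> {1..<i}. ky k = ky i}"
proof -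
 obtain e r c where B: "T0 i = (e, r, c)" by (cases "T0 i")
 let ?S = "{k \<in> {1..<i}. ky k = ky i}" and ?D = "(\<lambda>d. if e then (e, d, c) else (e, r, d)) ` {..<dd (T0 i)}"
 have "T0 ` ?S = ?D"
 proof (intro equalityI subsetI)
  fix B' assume "B' \<in> T0 ` ?S"
  then obtain k where k: "1 \<le> k" "k < i" "ky k = ky i" "B' = T0 k" by auto
  have kn: "k \<in> {1..n}" using k i by auto
  obtain e' r' c' where B': "T0 k = (e', r', c')" by (cases "T0 k")
  have e: "e' = e" using ky_neg[OF kn] ky_neg[OF i] k(3) B B' by auto
  have "dd (T0 k) < dd (T0 i)"
  proof (rule ccontr)
   assume "\<not> ?thesis"
   then have "r \<le> r' \<and> c \<le> c'" using k(3) B B' e by (auto simp: dd_def key2_def split: if_splits)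
   then have "i \<le> k" using valid_NW_le[OF vT kn i] B B' e by auto
   then show False using k by simp
  qed
  then show "B' \<in> ?D" unfolding k(4) using k(3) B B' e
   by (auto simp: dd_def key2_def split: if_splits)
 next
  fix B' assume "B' \<in> ?D"
  then obtain d where d: "d < dd (T0 i)" "B' = (if e then (e, d, c) else (e, r, d))" by blast
  have "\<exists>k\<in>{1..i}. T0 k = B'"
   using valid_NW[OF vT i B, of "if e then d else r" "if e then c else d"] d B by (auto simp: dd_def split: if_splits)
  then obtain k where k: "k \<in> {1..i}" "T0 k = B'" by blast
  have "k ~= i" using k d B by (auto simp: dd_def split: if_splits)
  then have "k \<in> ?S" using k d B by (auto simp: key2_def)
  then show "B' \<in> T0 ` ?S" using k by blast
 qed
 moreover have "inj_on T0 ?S"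
 proof (rule inj_onI)
  fix k k' assume "k \<in> ?S" "k' \<in> ?S" "T0 k = T0 k'"
  then show "k = k'" using i by (intro valid_inj[OF vT]) auto
 qed
 ultimately have "card ?S = card ?D" using card_image[of T0 ?S] by (simp only:)
 also have "card ?D = dd (T0 i)" by (subst card_image) (auto simp: inj_on_def)
 finally show ?thesis ..
qed

text \<open>The generators inside blocks. They generate the Young subgroup \<open>WJ\<close>, on
  which \<open>f0\<close> is an eigenvector with eigenvalue \<open>v\<close> for each
  generator.\<close>

definition J :: "nat set" where "J = {j. 1 \<le> j \<and> j < n \<and> ky j = ky (Suc j)}"

lemma J_D: assumes "j \<in> J" shows "1 \<le> j" "j < n" "ky (Suc j) = ky j" "j ~= ll"
proof -
 show j: "1 \<le> j" "j < n" "ky (Suc j) = ky j" using assms by (auto simp: J_def)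
 show "j ~= ll" using neg_iff[of j] neg_iff[of "Suc j"] ky_neg[of j] ky_neg[of "Suc j"] j by auto
qed

lemma J_adj: assumes "j \<in> J" shows "T0 j \<in> pre (T0 (Suc j))" "fst (T0 (Suc j)) = fst (T0 j)" "ct (T0 (Suc j)) = ct (T0 j) + 1"
proof -
 note j = J_D[OF assms]
 have jn: "j \<in> {1..n}" "Suc j \<in> {1..n}" using j by auto
 obtain e r c e' r' c' where B: "T0 j = (e, r, c)" "T0 (Suc j) = (e', r', c')" by (cases "T0 j"; cases "T0 (Suc j)")
 have e: "e' = e" using ky_neg[OF jn(1)] ky_neg[OF jn(2)] j(3) B by auto
 have "{k \<in> {1..<Suc j}. ky k = ky (Suc j)} = insert j {k \<in> {1..<j}. ky k = ky j}" using j by auto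
 then have "dd (T0 (Suc j)) = Suc (dd (T0 j))" unfolding dd_count[OF jn(1)] dd_count[OF jn(2)] by simp
 then show "T0 j \<in> pre (T0 (Suc j))" "fst (T0 (Suc j)) = fst (T0 j)" "ct (T0 (Suc j)) = ct (T0 j) + 1"
  using j(3) B e by (auto simp: dd_def key2_def pre_def ct_def split: if_splits)
qed

lemma Rop_f0: assumes "j \<in> J" shows "Rop j f0 = (\<lambda>P. v * f0 P)"
proof
 fix P
 note j = J_D[OF assms]
 note adj = J_adj[OF assms]
 consider "\<not> valid P" | "valid P" "P = T0" | "valid P" "P ~= T0" by blast
 then show "Rop j f0 P = v * f0 P"
 proof cases
  case 1
  then show ?thesis using j by (simp add: Rop_def lw_def)
 next
  case 2
  then show ?thesis using j phi_adj(1)[of "T0 j" "T0 (Suc j)"] adj theta_adj[OF adj(1)] by (simp add: Rop_def dl_def)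
 next
  case 3
  have "sw j P ~= T0" if th: "theta (P j) (P (Suc j)) ~= 0"
  proof
   assume "sw j P = T0"
   then have "T0 (Suc j) = P j" "T0 j = P (Suc j)" by (auto simp: sw_apply)
   then have "theta (P (Suc j)) (P j) = 0" using theta_adj[OF adj(1)] by simp
   then show False using th by (simp add: theta_eq_0_iff qf_commute)
  qed
  then show ?thesis using 3 j by (auto simp: Rop_def dl_def)
 qed
qed

text \<open>Pairs of entries in one block, that is, the positive roots of the Young subgroup;
  \<open>NN\<close> is then the length of its longest element.\<close>

definition PP :: "(nat \<times> nat) set" where "PP = {(i, k). 1 \<le> i \<and> i < k \<and> k \<le> n \<and> ky i = ky k}"

definition NN :: nat where "NN = card PP"

lemma finite_PP: "finite PP"
 by (rule finite_subset[OF _ finite_pairs[of n]]) (auto simp: PP_def)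

lemma NN_sum: "NN = (\<Sum>k\<in>{1..n}. dd (T0 k))"
proof -
 have "PP = (\<lambda>(k, i). (i, k)) ` (SIGMA k:{1..n}. {i \<in> {1..<k}. ky i = ky k})" by (auto simp: PP_def image_iff)
 then have "NN = card (SIGMA k:{1..n}. {i \<in> {1..<k}. ky i = ky k})"
  unfolding NN_def by (simp add: card_image inj_on_def split: prod.splits)
 also have "\<dots> = (\<Sum>k\<in>{1..n}. card {i \<in> {1..<k}. ky i = ky k})" by (subst card_SigmaI) auto
 also have "\<dots> = (\<Sum>k\<in>{1..n}. dd (T0 k))" by (rule sum.cong) (simp_all add: dd_count)
 finally show ?thesis .
qed

definition ctm :: int where "ctm = (\<Sum>i\<in>{1..n}. if fst (T0 i) then 0 else ct (T0 i))"

definition sg :: int where "sg = (\<Prod>i\<in>{1..n}. if fst (T0 i) then 1 else (- 1) ^ fst (snd (T0 i)))"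

lemma sg_sg: "sg * sg = 1"
 unfolding sg_def prod.distrib[symmetric] by (rule prod.neutral) (auto simp flip: power_mult_distrib)

text \<open>In each box the coefficient of \<open>a\<close> in \<open>alpha\<close> is the content,
  counted in the second component only, plus the position \<open>dd\<close> in the block. The
  positions add up to \<open>NN\<close>.\<close>

lemma omm_T0: "omm T0 n = of_int sg * E (int ll) (ctm + int NN)"
proof -
 have "om B = of_int (if fst B then 1 else (- 1) ^ fst (snd B)) *
   E (if fst B then 0 else 1) ((if fst B then 0 else ct B) + int (dd B))" for B
  by (cases B) (auto simp: om_def ct_def dd_def algebra_simps)
 then have "omm T0 n = of_int sg * E (\<Sum>i\<in>{1..n}. if fst (T0 i) then 0 else 1)
   (\<Sum>i\<in>{1..n}. (if fst (T0 i) then 0 else ct (T0 i)) + int (dd (T0 i)))"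
  unfolding omm_def sg_def by (simp only: prod.distrib of_int_prod E_prod)
 moreover have "(\<Sum>i\<in>{1..n}. if fst (T0 i) then 0 else 1) = int ll"
 proof -
  have "(\<Sum>i\<in>{1..n}. if fst (T0 i) then 0 else (1 :: int)) = (\<Sum>i\<in>{i \<in> {1..n}. \<not> fst (T0 i)}. 1)"
   by (rule sum.mono_neutral_cong_right) auto
  then show ?thesis by (simp add: ll_def)
 qed
 ultimately show ?thesis by (simp add: sum.distrib ctm_def NN_sum)
qed

lemma omm_shape: assumes "valid P" "valid Q" "shp P = shp Q" shows "omm P n = omm Q n"
proof -
 have *: "omm P n = prod om (shp P)" if "valid P" for P
  using that unfolding omm_def shp_def valid_def by (simp add: prod.reindex)
 show ?thesis unfolding *[OF assms(1)] *[OF assms(2)] assms(3) ..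
qed

lemma prod_x: "(\<Prod>i\<in>{1..ll}. x (T0 i)) = E (int ll) (2 * ctm)"
proof -
 have "(\<Prod>i\<in>{1..ll}. x (T0 i)) = (\<Prod>i\<in>{1..ll}. E 1 (2 * ct (T0 i)))"
 proof (rule prod.cong[OF refl])
  fix i assume "i \<in> {1..ll}"
  then have "\<not> fst (T0 i)" using neg_iff[of i] ll_le by auto
  then show "x (T0 i) = E 1 (2 * ct (T0 i))" by (simp add: x_def)
 qed
 also have "\<dots> = E (int ll) (2 * (\<Sum>i\<in>{1..ll}. ct (T0 i)))" by (simp add: E_prod sum_distrib_left)
 also have "(\<Sum>i\<in>{1..ll}. ct (T0 i)) = ctm"
  unfolding ctm_def
 proof (rule sum.mono_neutral_cong_left)
  have nf: "fst (T0 i) \<longleftrightarrow> ll < i" if "i \<in> {1..n}" for i using neg_iff[OF that] by auto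
  show "\<forall>i\<in>{1..n} - {1..ll}. (if fst (T0 i) then 0 else ct (T0 i)) = 0" using nf by auto
  show "ct (T0 i) = (if fst (T0 i) then 0 else ct (T0 i))" if "i \<in> {1..ll}" for i
   using nf[of i] that ll_le by auto
 qed (use ll_le in auto)
 finally show ?thesis .
qed

lemma first_neg_f0: "first_neg ll f0"
 unfolding first_neg_def dl_def using neg_iff ll_le by (auto split: if_splits)

text \<open>The scalar makes the vector bar-invariant, see \<open>kb_g0\<close>: the square of the
  operator of \<open>al ll\<close> multiplies \<open>f0\<close> by the inverse square of this
  scalar.\<close>

definition g0 :: "tab => 'g K" where "g0 = (\<lambda>P. E (- int ll) (- ctm) * Rw (al ll) f0 P)"

lemma kb_f0: "kb f0 = f0"
 by (rule ext) (simp add: kb_def dl_def)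

lemma kb_g0: "kb g0 = g0"
proof (rule Rw_inj[OF al_in_W[OF ll_le]])
 note w = al_in_W[OF ll_le]
 have 1: "Rw (al ll) (kb (Rw (al ll) f0)) = f0"
  using Rw_inverse_bar(1)[OF w, of f0] unfolding inv_al kb_f0 .
 have "kb g0 = (\<lambda>P. E (int ll) ctm * kb (Rw (al ll) f0) P)"
  by (rule ext) (simp add: g0_def kb_def kbar_mult)
 then have "Rw (al ll) (kb g0) = (\<lambda>P. E (int ll) ctm * f0 P)"
  using Rw_scale[OF w, of "E (int ll) ctm" "kb (Rw (al ll) f0)"] 1 by simp
 also have "\<dots> = (\<lambda>P. E (- int ll) (- ctm) * (E (int ll) 0 * (E (int ll) (2 * ctm) * f0 P)))"
  by (rule ext) (simp add: mult.assoc[symmetric] E_mult)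
 also have "\<dots> = (\<lambda>P. E (- int ll) (- ctm) * Rw (al ll) (Rw (al ll) f0) P)"
  unfolding Rw_al_square[OF order_refl ll_le first_neg_f0] tmuls_dl[OF vT] prod_x ..
 also have "\<dots> = Rw (al ll) g0" unfolding g0_def by (rule Rw_scale[OF w, symmetric])
 finally show "Rw (al ll) (kb g0) = Rw (al ll) g0" .
qed

text \<open>The length of the Young subgroup part when \<open>z\<close> is written as a shortest
  coset representative times an element of that subgroup.\<close>

definition invJ :: "(int => int) => nat" where
 "invJ z = card {(i, k) \<in> PP. z (int k) < z (int i)}"

lemma invJ_le: "invJ z \<le> NN"
 unfolding invJ_def NN_def by (rule card_mono[OF finite_PP]) auto

lemma invJ_step:
 assumes j: "j \<in> J" and asc: "z (int j) < z (int j + 1)"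
 shows "invJ (z \<circ> gen j) = Suc (invJ z)"
proof -
 note jD = J_D[OF j]
 let ?t = "transpose j (Suc j)" and ?I = "\<lambda>z :: int => int. {(i, k) \<in> PP. z (int k) < z (int i)}"
 let ?f = "\<lambda>(i, k). (?t i, ?t k)"
 have g: "gen j (int i) = int (?t i)" if "1 \<le> i" for i
  using that jD by (auto simp: gen_apply lo_def hi_def transpose_def)
 have ff: "?f (?f p) = p" for p by (cases p) simp
 have kt: "ky (?t i) = ky i" for i using jD(3) by (auto simp: transpose_def)
 have PP: "(?t i, ?t k) \<in> PP" if "(i, k) \<in> PP" "(i, k) ~= (j, Suc j)" for i k
  using that jD kt unfolding PP_def by (auto simp: transpose_def split: if_splits)
 have "?I (z \<circ> gen j) = insert (j, Suc j) (?f ` ?I z)"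
 proof (intro equalityI subsetI)
  fix p assume p: "p \<in> ?I (z \<circ> gen j)"
  obtain i k where ik: "p = (i, k)" by (cases p)
  have pos: "1 \<le> i" "1 \<le> k" using p ik by (auto simp: PP_def)
  show "p \<in> insert (j, Suc j) (?f ` ?I z)"
  proof (cases "p = (j, Suc j)")
   case False
   then have "?f p \<in> ?I z" using p ik PP[of i k] g[OF pos(1)] g[OF pos(2)] by auto
   then have "?f (?f p) \<in> ?f ` ?I z" by (rule imageI)
   then show ?thesis unfolding ff by (rule insertI2)
  qed simp
 next
  fix p assume "p \<in> insert (j, Suc j) (?f ` ?I z)"
  then consider "p = (j, Suc j)" | i k where "(i, k) \<in> PP" "z (int k) < z (int i)" "p = (?t i, ?t k)" by auto
  then show "p \<in> ?I (z \<circ> gen j)"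
  proof cases
   case 1
   then show ?thesis using jD asc g[of j] g[of "Suc j"] by (auto simp: PP_def add.commute)
  next
   case 2
   have ne: "(i, k) ~= (j, Suc j)" using 2 asc by (auto simp: add.commute)
   have m: "(?t i, ?t k) \<in> PP" using PP[OF 2(1) ne] .
   then have "1 \<le> ?t i" "1 \<le> ?t k" by (auto simp: PP_def)
   then show ?thesis using 2 m g[of "?t i"] g[of "?t k"] by simp
  qed
 qed
 moreover have "(j, Suc j) \<notin> ?f ` ?I z"
 proof
  assume "(j, Suc j) \<in> ?f ` ?I z"
  then obtain i k where "(i, k) \<in> PP" "?t i = j" "?t k = Suc j" by auto
  then show False by (auto simp: PP_def transpose_def split: if_splits)
 qed
 moreover have "finite (?I z)" by (rule finite_subset[OF _ finite_PP]) auto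
 moreover have "inj_on ?f (?I z)" by (rule inj_on_inverseI[where g = ?f]) (rule ff)
 ultimately show ?thesis unfolding invJ_def by (simp add: card_image)
qed

text \<open>Depends only on the coset of \<open>z\<close> modulo the Young subgroup, because
  \<open>f0\<close> is an eigenvector. \<open>climb\<close> passes to the longest representative,
  where leading terms are visible; \<open>descend\<close> passes to the shortest, which suits the
  induction on length.\<close>

definition mz :: "(int => int) => tab => 'g K" where
 "mz z P = E 0 (- int (invJ z)) * Rw z f0 P"

lemma mz_step:
 assumes "z \<in> W n" "j \<in> J" "z (int j) < z (int j + 1)" shows "mz (z \<circ> gen j) = mz z"
proof
 fix P
 note j = J_D[OF assms(2)]
 have "Rw (z \<circ> gen j) f0 = (\<lambda>P. v * Rw z f0 P)"
  using Rw_right[OF assms(1) j(2), of f0] assms(3) j Rop_f0[OF assms(2)] Rw_scale[OF assms(1), of v f0]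
  by (simp add: lo_def hi_def)
 then show "mz (z \<circ> gen j) P = mz z P"
  unfolding mz_def invJ_step[where z = z, OF assms(2,3)] by (simp add: mult.assoc[symmetric] E_mult)
qed

lemma sorted_blocks:
 assumes all: "\<And>j. j \<in> J ==> R (z (int j)) (z (int j + 1))" and tr: "\<And>u w y. R u w ==> R w y ==> R u y"
  and ik: "(i, k) \<in> PP"
 shows "R (z (int i)) (z (int k :: int))"
proof -
 have "Suc i \<le> k" using ik by (simp add: PP_def)
 then show ?thesis using ik
 proof (induction k rule: dec_induct)
  case base
  then have "i \<in> J" by (auto simp: PP_def J_def)
  then show ?case using all[of i] by (simp add: add.commute)
 next
  case (step k)
  have "ky i \<le> ky k" by (rule ky_mono) (use step in \<open>auto simp: PP_def\<close>)
  moreover have "ky k \<le> ky (Suc k)" by (rule ky_mono) (use step in \<open>auto simp: PP_def\<close>)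
  ultimately have "(i, k) \<in> PP" "k \<in> J" using step by (auto simp: PP_def J_def)
  then show ?case using step.IH tr all[of k] by (simp add: add.commute)
 qed
qed

definition WJ :: "(int => int) set" where
 "WJ = {y \<in> Sn. \<forall>i\<in>{1..n}. ky (nat (y (int i))) = ky i}"

lemma gen_ky: assumes "j \<in> J" "0 < i" shows "ky (nat (gen j i)) = ky (nat i)"
 using J_D[OF assms(1)] assms(2) by (auto simp: gen_apply lo_def hi_def nat_add_distrib)

lemma WJ_gen: assumes "y \<in> WJ" "j \<in> J" shows "gen j \<circ> y \<in> WJ" "y \<circ> gen j \<in> WJ"
proof -
 note j = J_D[OF assms(2)]
 have y: "y \<in> Sn" and ky: "\<And>i. i \<in> {1..n} ==> ky (nat (y (int i))) = ky i" using assms(1) by (auto simp: WJ_def)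
 have g: "gen j \<in> Sn" using Sn_gen j by blast
 have "ky (nat (gen j (y (int i)))) = ky i" if "i \<in> {1..n}" for i
  using gen_ky[OF assms(2), of "y (int i)"] SnD(2)[OF y] ky[OF that] that by simp
 then show "gen j \<circ> y \<in> WJ" using Sn_comp[OF g y] by (simp add: WJ_def)
 have "ky (nat (y (gen j (int i)))) = ky i" if i: "i \<in> {1..n}" for i
 proof -
  have p: "0 < gen j (int i)" using SnD(2)[OF g] i by simp
  have "nat (gen j (int i)) \<in> {1..n}" using W_bound[OF gen_in_W[OF j(2)], of "int i"] p i by auto
  from ky[OF this] show ?thesis using gen_ky[OF assms(2), of "int i"] p i by simp
 qed
 then show "y \<circ> gen j \<in> WJ" using Sn_comp[OF y g] by (simp add: WJ_def)
qed

lemma climb: "z \<in> W n ==> \<exists>z'\<in>W n. invJ z' = NN \<and> mz z' = mz z \<and> (z \<in> WJ --> z' \<in> WJ)"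
proof (induction "NN - invJ z" arbitrary: z rule: less_induct)
 case less
 show ?case
 proof (cases "\<exists>j\<in>J. z (int j) < z (int j + 1)")
  case True
  then obtain j where j: "j \<in> J" "z (int j) < z (int j + 1)" by blast
  have inv: "invJ (z \<circ> gen j) = Suc (invJ z)" using invJ_step[where z = z, OF j] .
  have W: "z \<circ> gen j \<in> W n" using W_comp[OF less.prems gen_in_W[OF J_D(2)[OF j(1)]]] .
  have "NN - invJ (z \<circ> gen j) < NN - invJ z" using inv invJ_le[of "z \<circ> gen j"] by simp
  from less.hyps[OF this W] obtain z' where
   "z' \<in> W n" "invJ z' = NN" "mz z' = mz (z \<circ> gen j)" "z \<circ> gen j \<in> WJ --> z' \<in> WJ" by blast
  then show ?thesis using mz_step[OF less.prems j] WJ_gen(2)[OF _ j(1), of z] by (intro bexI[of _ z']) auto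
 next
  case False
  have "z (int j + 1) < z (int j)" if "j \<in> J" for j
  proof -
   have "z (int j + 1) ~= z (int j)" unfolding W_inj[OF less.prems] by simp
   then show ?thesis using False that by force
  qed
  then have "z (int k) < z (int i)" if "(i, k) \<in> PP" for i k
   by (intro sorted_blocks[where R = "\<lambda>u w. w < u" and z = z, OF _ _ that]) auto
  then have "invJ z = NN" unfolding invJ_def NN_def by (intro arg_cong[where f = card]) auto
  then show ?thesis using less.prems by blast
 qed
qed

text \<open>\<open>al ll\<close> is increasing on each block and keeps a block within one sign.
  Removing an inversion inside a block therefore multiplies \<open>u\<close> by a reflection of
  \<open>Sn\<close> that shortens it.\<close>

lemma descend:
 "u \<in> Sn ==> \<exists>u'\<in>Sn. invJ (u' \<circ> al ll) = 0 \<and> len n u' \<le> len n u \<and> mz (u' \<circ> al ll) = mz (u \<circ> al ll)"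
proof (induction "len n u" arbitrary: u rule: less_induct)
 case less
 let ?a = "al ll" and ?z = "u \<circ> al ll"
 note aW = al_in_W[OF ll_le]
 have uW: "u \<in> W n" using SnD(1)[OF less.prems] .
 have zW: "?z \<in> W n" using W_comp[OF uW aW] .
 show ?case
 proof (cases "\<exists>j\<in>J. ?z (int j + 1) < ?z (int j)")
  case True
  then obtain j where j: "j \<in> J" "?z (int j + 1) < ?z (int j)" by blast
  note jD = J_D[OF j(1)]
  define p q where "p = ?a (int j)" and "q = ?a (int j + 1)"
  have pq: "p < q" "p ~= 0" "q ~= 0" "0 < p \<longleftrightarrow> 0 < q" "\<bar>p\<bar> \<le> int n" "\<bar>q\<bar> \<le> int n"
   using jD ll_le by (auto simp: p_def q_def al_def split: if_splits)
  have lh: "lo j = int j" "hi j = int j + 1" using jD by (simp_all add: lo_def hi_def)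
  define u' where "u' = u \<circ> rfl p q"
  have "rfl p q \<circ> ?a = ?a \<circ> gen j"
   using rfl_conj[OF aW lo_hi(1-3), of j] unfolding gen_eq_rfl p_def q_def lh .
  then have z': "u' \<circ> ?a = ?z \<circ> gen j" unfolding u'_def by (simp add: comp_assoc)
  have "len n u' < len n u" unfolding u'_def using len_rfl_iff(1)[OF uW pq(1-3,5,6)] j(2) by (simp add: p_def q_def)
  moreover have "u' \<in> Sn"
  proof (rule SnI)
   show "u' \<in> W n" unfolding u'_def by (intro W_comp uW rfl_in_W) (use pq in auto)
   show "0 < u' i" if "1 \<le> i" for i
    unfolding u'_def o_apply SnD(2)[OF less.prems] using that pq by (auto simp: rfl_apply)
  qed
  moreover have "mz (u' \<circ> ?a) = mz ?z"
  proof -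
   have W': "?z \<circ> gen j \<in> W n" using W_comp[OF zW gen_in_W[OF jD(2)]] .
   have "(?z \<circ> gen j) (int j) < (?z \<circ> gen j) (int j + 1)"
    using j(2) jD by (simp add: gen_apply lo_def hi_def)
   from mz_step[OF W' j(1) this, unfolded comp_gen_gen] show ?thesis unfolding z' by (rule sym)
  qed
  ultimately show ?thesis using less.hyps[of u'] by fastforce
 next
  case False
  have asc: "?z (int j) < ?z (int j + 1)" if "j \<in> J" for j
  proof -
   have "?z (int j + 1) ~= ?z (int j)" unfolding W_inj[OF zW] by simp
   then show ?thesis using False that by force
  qed
  have "?z (int i) < ?z (int k)" if "(i, k) \<in> PP" for i k
   by (rule sorted_blocks[where R = "(<)" and z = ?z, OF asc _ that]) auto
  then have e: "{(i, k) \<in> PP. ?z (int k) < ?z (int i)} = {}" by fastforce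
  have "invJ ?z = 0" unfolding invJ_def e by simp
  then show ?thesis using less.prems by blast
 qed
qed

text \<open>For the longest representative the exponent of \<open>v\<close> is \<open>NN\<close>.
  Together with \<open>E (- int ll) (- ctm)\<close> this is, up to sign, division by
  \<open>omm T0 n\<close>.\<close>

lemma mz_tends:
 assumes "z \<in> W n"
 shows "\<exists>z'\<in>W n. mz z' = mz z \<and> (\<forall>P. valid P -->
  tends (E (- int ll) (- ctm) * mz z P) (sg * (if P = PT z' \<and> T0 = QT z' then 1 else 0)))"
proof -
 obtain z' where z': "z' \<in> W n" "invJ z' = NN" "mz z' = mz z" using climb[OF assms] by blast
 have "tends (E (- int ll) (- ctm) * mz z P) (sg * (if P = PT z' \<and> T0 = QT z' then 1 else 0))"
  if P: "valid P" for P
 proof (cases "shp P = shp T0")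
  case True
  have "of_int sg * (of_int sg :: 'g K) = 1" using arg_cong[OF sg_sg, of "of_int :: int => 'g K"] by simp
  then have s: "inverse (of_int sg :: 'g K) = of_int sg" by (metis inverse_unique)
  have "E (- int ll) (- ctm) * mz z P = of_int sg * (Rw z' f0 P / omm P n)"
   unfolding z'(3)[symmetric] omm_shape[OF P vT True] omm_T0
   by (simp add: mz_def z'(2) divide_inverse inverse_mult_distrib s E_inverse mult.assoc[symmetric] E_mult)
    (metis (no_types, lifting) \<open>of_int sg * of_int sg = 1\<close> mult.assoc mult.commute mult_1_left)
  moreover have "tends (of_int sg * (Rw z' f0 P / omm P n)) (sg * (if P = PT z' \<and> T0 = QT z' then 1 else 0))"
   by (intro lim_mult lim_of_int leading_coefficient'[OF z'(1) P vT])
  ultimately show ?thesis by simp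
 next
  case False
  have "Rw z' f0 P = 0" by (rule Rw_shape[OF z'(1) _ P, of "{shp P}"]) (use False in \<open>auto simp: dl_def\<close>)
  moreover have "\<not> (P = PT z' \<and> T0 = QT z')" using False PT_QT(5)[OF z'(1)] by auto
  ultimately show ?thesis unfolding z'(3)[symmetric] mz_def by auto
 qed
 then show ?thesis using z' by blast
qed

end

context asymptotic
begin

lemma fst_QT: assumes "w \<in> W n" "i \<in> {1..n}" shows "fst (QT w i) \<longleftrightarrow> 0 < w (int i)"
 using assms(2) by (simp add: QT_def mk_def Qmap_def rsQ_def)

lemma Asp_shape:
 assumes "Asp F" "\<And>P. valid P ==> shp P \<in> \<S> ==> X P = Y P" "valid P" "shp P \<in> \<S>"
 shows "F X P = F Y P"
proof -
 obtain h where h: "\<And>X P. F X P = (\<Sum>y\<in>W n. to_fract (h y) * Rw y X P)" using assms(1) unfolding spn_def by blast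
 have "Rw w X P = Rw w Y P" if w: "w \<in> W n" for w
 proof -
  have "Rw w (\<lambda>P. 1 * X P + (- 1) * Y P) P = 0"
   by (rule Rw_shape[OF w _ assms(3,4)]) (use assms(2) in simp)
  then show ?thesis using Rw_lin[OF w, of 1 X "- 1" Y] by simp
 qed
 then show ?thesis unfolding h by simp
qed

text \<open>Replace each \<open>Rw y\<close> by \<open>Rw (inv y)\<close> and apply
  \<open>Rw_transpose\<close> termwise.\<close>

lemma Asp_adjoint:
 assumes "Asp F"
 obtains F' where "Asp F'" "\<And>P Q. valid P ==> valid Q ==> F' (dl Q) P * Dg P = F (dl P) Q * Dg Q"
proof -
 obtain h where h: "\<And>X P. F X P = (\<Sum>y\<in>W n. to_fract (h y) * Rw y X P)" using assms unfolding spn_def by blast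
 let ?F = "\<lambda>X P. \<Sum>y\<in>W n. to_fract (h y) * Rw (inv y) X P"
 have "Asp ?F" by (rule spn_sum[OF finite_W, where F = "\<lambda>y. Rw (inv y)"]) (rule Asp_Rw[OF W_inv])
 moreover have "?F (dl Q) P * Dg P = F (dl P) Q * Dg Q" if "valid P" "valid Q" for P Q
  unfolding h sum_distrib_right mult.assoc
  using Rw_transpose[OF _ that(2,1)] by (intro sum.cong) auto
 ultimately show ?thesis using that by blast
qed

end

context ordered_tab
begin

definition MF :: "(int => int) => (tab => 'g K) => tab => 'g K" where
 "MF u X P = E (- int ll) (- ctm - int (invJ (u \<circ> al ll))) * Rw (u \<circ> al ll) X P"

abbreviation Mu :: "(int => int) => tab => 'g K" where "Mu u \<equiv> MF u f0"

lemma Mu_mz: "Mu u P = E (- int ll) (- ctm) * mz (u \<circ> al ll) P"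
 by (simp add: MF_def mz_def mult.assoc[symmetric] E_mult)

lemma Rw_g0: assumes "u \<in> Sn" shows "Rw u g0 P = E 0 (int (invJ (u \<circ> al ll))) * Mu u P"
proof -
 have "Rw u g0 = (\<lambda>P. E (- int ll) (- ctm) * Rw (u \<circ> al ll) f0 P)"
  unfolding g0_def Rw_scale[OF SnD(1)[OF assms]] Rw_Sn_al[OF assms ll_le] ..
 then show ?thesis by (simp add: MF_def mult.assoc[symmetric] E_mult)
qed

lemma Asp_MF: assumes "u \<in> Sn" shows "Asp (MF u)"
proof -
 have "u \<circ> al ll \<in> W n" by (rule W_comp[OF SnD(1)[OF assms] al_in_W[OF ll_le]])
 from spn_scale[OF Asp_Rw[OF this]] show ?thesis unfolding MF_def[abs_def] E_eq_to_fract .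
qed

text \<open>Shortest coset representatives with the factor \<open>al ll\<close> split off. The
  vectors \<open>Mu u\<close> belonging to them are in general linearly dependent.\<close>

definition II :: "(int => int) set" where "II = {u \<in> Sn. invJ (u \<circ> al ll) = 0}"

definition ls :: "(int => int) => (int => int) => bool" where
 "ls y u \<longleftrightarrow> y \<in> II \<and> u \<in> II \<and> len n y < len n u"

lemma finite_ls: "finite {y. ls y u}" and finite_II: "finite II"
proof -
 have "{y. ls y u} \<subseteq> W n" "II \<subseteq> W n" using SnD(1) by (auto simp: ls_def II_def)
 then show "finite {y. ls y u}" "finite II" using finite_subset finite_W by blast+
qed

text \<open>\<open>Cw u\<close> applied to the bar-invariant \<open>g0\<close> is bar-invariant. Its
  lower terms involve only elements of \<open>Sn\<close>, and \<open>descend\<close> rewrites them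
  by shorter members of \<open>II\<close>.\<close>

lemma Mu_lift:
 assumes u: "u \<in> II"
 shows "\<exists>h. kb (\<lambda>P. Mu u P + (\<Sum>y\<in>{y. ls y u}. to_fract (h y) * Mu y P)) =
   (\<lambda>P. Mu u P + (\<Sum>y\<in>{y. ls y u}. to_fract (h y) * Mu y P))"
proof -
 have uS: "u \<in> Sn" and u0: "invJ (u \<circ> al ll) = 0" using u by (auto simp: II_def)
 let ?B = "{y. bruhat_less n y u}" and ?M = "\<lambda>y (_ :: unit) P. Mu y P"
 have fin: "finite ?B" using bruhat_lessD(1) by (intro finite_subset[OF _ finite_W]) blast
 have "spn ?M {y. ls y u} (\<lambda>_ P. \<Sum>y\<in>?B. to_fract (klq u y) * Rw y g0 P)"
 proof (rule spn_sum[OF fin, where F = "\<lambda>y _. Rw y g0"])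
  fix y assume "y \<in> ?B"
  then have y: "y \<in> Sn" "len n y < len n u" using Sn_bruhat[OF _ uS] bruhat_lessD(3) by auto
  obtain y' where y': "y' \<in> Sn" "invJ (y' \<circ> al ll) = 0" "len n y' \<le> len n y" "mz (y' \<circ> al ll) = mz (y \<circ> al ll)"
   using descend[OF y(1)] by blast
  have "ls y' u" using y' y u by (simp add: ls_def II_def)
  then have "spn ?M {y. ls y u} (?M y')" by (intro spn_single[OF finite_ls]) simp
  note y'' = this
  have eq: "(\<lambda>_ :: unit. Rw y g0) = (\<lambda>_ P. to_fract (ex (zmul 0 b + zmul (int (invJ (y \<circ> al ll))) a)) * Mu y' P)"
   by (intro ext) (simp only: Rw_g0[OF y(1)] Mu_mz y'(4) E_eq_to_fract)
  show "spn ?M {y. ls y u} (\<lambda>_. Rw y g0)" unfolding eq by (rule spn_scale[OF y''])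
 qed
 then obtain h where h: "\<And>P. (\<Sum>y\<in>?B. to_fract (klq u y) * Rw y g0 P) = (\<Sum>y\<in>{y. ls y u}. to_fract (h y) * Mu y P)"
  unfolding spn_def by blast
 have "Cw u g0 = (\<lambda>P. Mu u P + (\<Sum>y\<in>{y. ls y u}. to_fract (h y) * Mu y P))"
  unfolding h[symmetric] by (rule ext) (simp add: Cw_def Rw_g0[OF uS] u0 E_0)
 moreover have "kb (Cw u g0) = Cw u g0"
 proof
  fix P
  have "kb (Cw u (kb g0)) P = Cw u g0 P" using klq(2)[OF SnD(1)[OF uS]] unfolding binv_def by blast
  then show "kb (Cw u g0) P = Cw u g0 P" unfolding kb_g0 .
 qed
 ultimately show ?thesis by (intro exI[of _ h]) simp
qed

lemma Mu_tends: assumes "u \<in> Sn" "valid P" shows "\<exists>c. tends (Mu u P) c"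
 unfolding Mu_mz using mz_tends[OF W_comp[OF SnD(1)[OF assms(1)] al_in_W[OF ll_le]]] assms(2) by blast

lemma bar_invariant_vector:
 assumes u: "u \<in> II"
 shows "\<exists>F. Asp F \<and> kb (F f0) = F f0 \<and> (\<forall>P c. valid P --> tends (Mu u P) c --> tends (F f0 P) c)"
proof -
 let ?B = "\<lambda>X :: tab => 'g K. kb X = X"
 have "\<exists>q. (\<forall>y. q y \<in> A_neg) \<and> ?B (\<lambda>P. Mu u P + (\<Sum>y\<in>{y. ls y u}. to_fract (q y) * Mu y P))"
 proof (rule kazhdan_lusztig_lift[OF finite_II _ _ _ _ u, where rk = "len n" and B = ?B])
  fix X Y :: "tab => 'g K" and s :: "'g gring" assume "kb X = X" "kb Y = Y" "A_bar s = s"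
  note XY = fun_cong[OF this(1), unfolded kb_def] fun_cong[OF this(2), unfolded kb_def] this(3)
  show "kb (\<lambda>P. X P + to_fract s * Y P) = (\<lambda>P. X P + to_fract s * Y P)"
   by (rule ext) (simp add: kb_def kbar_add kbar_mult XY)
 next
  fix w assume "w \<in> II"
  from Mu_lift[OF this] show "\<exists>h. ?B (\<lambda>P. Mu w P + (\<Sum>y\<in>{y. ls y w}. to_fract (h y) * Mu y P))" .
 qed (auto simp: ls_def)
 then obtain q where q: "\<And>y. q y \<in> A_neg"
  "?B (\<lambda>P. Mu u P + (\<Sum>y\<in>{y. ls y u}. to_fract (q y) * Mu y P))" by blast
 let ?F = "\<lambda>X P. MF u X P + (\<Sum>y\<in>{y. ls y u}. to_fract (q y) * MF y X P)"
 have S: "y \<in> Sn" if "y \<in> II" for y using that by (simp add: II_def)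
 have "Asp ?F"
  by (rule spn_add[OF Asp_MF[OF S[OF u]] spn_sum[OF finite_ls, where F = MF]]) (auto simp: ls_def intro: Asp_MF S)
 moreover have "tends (?F f0 P) c" if P: "valid P" "tends (Mu u P) c" for P c
 proof -
  have "\<forall>y\<in>{y. ls y u}. \<exists>c. tends (Mu y P) c" using Mu_tends[OF _ P(1)] by (auto simp: ls_def II_def)
  from bchoice[OF this] obtain d where d: "\<forall>y\<in>{y. ls y u}. tends (Mu y P) (d y)" ..
  have "tends (?F f0 P) (c + (\<Sum>y\<in>{y. ls y u}. 0 * d y))"
   using d q(1) by (intro lim_add lim_sum lim_mult P lim_to_fract) auto
  then show ?thesis by simp
 qed
 ultimately show ?thesis using q(2) by blast
qed

text \<open>By surjectivity of the correspondence some \<open>z\<close> has the tableaux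
  \<open>S\<close> and \<open>T0\<close>, and the signs recorded in \<open>T0\<close> show that
  \<open>z\<close> is \<open>u \<circ> al ll\<close> with \<open>u\<close> in \<open>Sn\<close>. The
  bar-invariant lift of the vector of its coset has the wanted limit.\<close>

lemma bar_invariant_vector_at:
 assumes S: "valid S" "shp S = shp T0"
 shows "\<exists>F. Asp F \<and> kb (F f0) = F f0 \<and> (\<forall>P. valid P --> tends (F f0 P) (if P = S then sg else 0))"
proof -
 let ?a = "al ll"
 have aW: "?a \<in> W n" using al_in_W[OF ll_le] .
 obtain z where z: "z \<in> W n" "PT z = S" "QT z = T0" using RS_surj[OF S(1) vT S(2)] .
 define u where "u = z \<circ> ?a"
 have ua: "u \<circ> ?a = z" unfolding u_def by (rule ext) (simp add: al_al)
 have u: "u \<in> Sn"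
 proof (rule SnI)
  show "u \<in> W n" unfolding u_def by (rule W_comp[OF z(1) aW])
  fix i assume i: "1 \<le> i" "i \<le> int n"
  define k where "k = nat \<bar>?a i\<bar>"
  have k: "k \<in> {1..n}" "i \<le> int ll \<longleftrightarrow> k \<le> ll" "?a i = (if i \<le> int ll then - int k else int k)"
   using i ll_le by (auto simp: k_def al_def)
  have "fst (T0 k) \<longleftrightarrow> 0 < z (int k)" using fst_QT[OF z(1) k(1)] z(3) by simp
  then have "0 < z (int k) \<longleftrightarrow> ll < k" using neg_iff[OF k(1)] by auto
  moreover have "z (int k) ~= 0" using W_eq_0_iff[OF z(1)] k by simp
  ultimately show "0 < u i" unfolding u_def o_apply k(3) using W_odd[OF z(1)] k(2) by auto
 qed
 obtain u' where u': "u' \<in> Sn" "invJ (u' \<circ> ?a) = 0" "mz (u' \<circ> ?a) = mz z"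
  using descend[OF u] unfolding ua by blast
 obtain z' where z': "\<And>P. valid P ==>
   tends (E (- int ll) (- ctm) * mz z P) (sg * (if P = PT z' \<and> T0 = QT z' then 1 else 0))"
  using mz_tends[OF z(1)] by blast
 \<comment> \<open>\<open>z'\<close> is the longest representative of the coset. If it had other
   tableaux, the normalised coset vector would tend to 0 at \<open>S\<close>. Dividing by the power
   of \<open>v\<close> by which \<open>z\<close> falls short of the longest representative keeps the
   limit 0, yet gives up to sign the normalised entry of \<open>z\<close> itself, whose limit is
   1.\<close>
 have "S = PT z' \<and> T0 = QT z'"
 proof (rule ccontr)
  assume "\<not> ?thesis"
  then have 0: "tends (E (- int ll) (- ctm) * mz z S) 0"
   using z'[OF S(1)] unfolding if_not_P[OF \<open>\<not> (S = PT z' \<and> T0 = QT z')\<close>] by simp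
  have "tends (E 0 (- int (NN - invJ z))) (if NN = invJ z then 1 else 0)"
   using tends_E0[of "- int (NN - invJ z)"] invJ_le[of z] by (auto simp: E_0)
  from lim_mult[OF this 0]
  have "tends (E 0 (- int (NN - invJ z)) * (E (- int ll) (- ctm) * mz z S)) 0" by simp
  moreover have "E 0 (- int (NN - invJ z)) * (E (- int ll) (- ctm) * mz z S) = E (- int ll) (- ctm - int NN) * Rw z f0 S"
   using invJ_le[of z] by (simp add: mz_def mult.assoc[symmetric] E_mult of_nat_diff)
    (simp only: diff_conv_add_uminus add.commute simp_thms)
  ultimately have "tends (E (- int ll) (- ctm - int NN) * Rw z f0 S) 0" by simp
  from lim_mult[OF lim_of_int[of sg] this]
  have 1: "tends (of_int sg * (E (- int ll) (- ctm - int NN) * Rw z f0 S)) 0" by simp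
  have ss: "of_int sg * (of_int sg :: 'g K) = 1" using arg_cong[OF sg_sg, of "of_int :: int => 'g K"] by simp
  have "omm S n * (of_int sg * (E (- int ll) (- ctm - int NN) * Rw z f0 S)) =
    (of_int sg * of_int sg) * (E (int ll) (ctm + int NN) * E (- int ll) (- ctm - int NN)) * Rw z f0 S"
   unfolding omm_shape[OF S(1) vT S(2)] omm_T0 by (simp only: ac_simps)
  then have "omm S n * (of_int sg * (E (- int ll) (- ctm - int NN) * Rw z f0 S)) = Rw z f0 S"
   unfolding ss E_mult by (simp add: E_0)
  then have "of_int sg * (E (- int ll) (- ctm - int NN) * Rw z f0 S) = Rw z f0 S / omm S n"
   by (simp add: field_simps)
  with 1 have "tends (Rw z f0 S / omm S n) 0" by simp
  moreover have "tends (Rw z f0 S / omm S n) 1" using leading_coefficient'[OF z(1) S(1) vT] z by simp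
  ultimately show False using lim_unique by fastforce
 qed
 then have "tends (Mu u' P) (if P = S then sg else 0)" if "valid P" for P
  using z'[OF that] unfolding Mu_mz u'(3) by (simp split: if_splits)
 moreover obtain F where "Asp F" "kb (F f0) = F f0" "\<And>P c. valid P ==> tends (Mu u' P) c ==> tends (F f0 P) c"
  using bar_invariant_vector[of u'] u' unfolding II_def by blast
 ultimately show ?thesis by blast
qed

subsection \<open>A primitive idempotent up to scaling\<close>

lemma WJ_D: assumes "y \<in> WJ" shows "y \<in> Sn" "y \<in> W n" "i \<in> {1..n} ==> ky (nat (y (int i))) = ky i"
 "i \<in> {1..n} ==> nat (y (int i)) \<in> {1..n}"
proof -
 show y: "y \<in> Sn" "y \<in> W n" using assms SnD by (auto simp: WJ_def)
 show "ky (nat (y (int i))) = ky i" if "i \<in> {1..n}" using assms that by (simp add: WJ_def)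
 show "nat (y (int i)) \<in> {1..n}" if "i \<in> {1..n}"
  using that SnD(2)[OF y(1), of "int i"] W_bound[OF y(2), of "int i"] by auto
qed

lemma WJ_id: "id \<in> WJ" by (simp add: WJ_def Sn_def)

lemma WJ_inv: assumes "y \<in> WJ" shows "inv y \<in> WJ"
proof -
 note y = WJ_D[OF assms]
 have "ky (nat (inv y (int i))) = ky i" if i: "i \<in> {1..n}" for i
 proof -
  have p: "0 < inv y (int i)" using SnD(2)[OF Sn_inv[OF y(1)]] i by simp
  then have k: "nat (inv y (int i)) \<in> {1..n}" using W_bound[OF W_inv[OF y(2)], of "int i"] i by auto
  from y(3)[OF this] show ?thesis using p W_inv_inverses(4)[OF y(2)] by simp
 qed
 then show ?thesis using Sn_inv[OF y(1)] by (simp add: WJ_def)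
qed

lemma finite_WJ: "finite WJ"
 using finite_subset[OF _ finite_W] WJ_D(2) by blast

lemma WJ_descent:
 assumes y: "y \<in> WJ" and j: "1 \<le> j" "j < n" and d: "inv y (int j + 1) < inv y (int j)" shows "j \<in> J"
proof -
 note iy = WJ_D[OF WJ_inv[OF y]]
 have jn: "j \<in> {1..n}" "Suc j \<in> {1..n}" using j by auto
 have "ky (nat (inv y (int (Suc j)))) \<le> ky (nat (inv y (int j)))"
  using d iy(4)[OF jn(1)] iy(4)[OF jn(2)] by (intro ky_mono) (auto simp: add.commute)
 then have "ky (Suc j) \<le> ky j" using iy(3)[OF jn(1)] iy(3)[OF jn(2)] by simp
 moreover have "ky j \<le> ky (Suc j)" using j by (intro ky_mono) auto
 ultimately show ?thesis using j by (simp add: J_def)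
qed

lemma WJ_induct [consumes 1, case_names id gen]:
 assumes y: "y \<in> WJ" and "Q id"
  and step: "\<And>j w. w \<in> WJ ==> j \<in> J ==> inv w (int j) < inv w (int j + 1) ==> Q w ==> Q (gen j \<circ> w)"
 shows "Q y"
proof -
 have "y \<in> WJ --> Q y" using WJ_D(1)[OF y]
 proof (induction y rule: Sn_left_induct)
  case (gen j w)
  show ?case
  proof
   assume W: "gen j \<circ> w \<in> WJ"
   have wW: "w \<in> W n" using SnD(1)[OF gen(1)] .
   have asc: "inv w (int j) < inv w (int j + 1)" using gen(2,4) by (simp add: lo_def hi_def)
   have "inv (gen j \<circ> w) = inv w \<circ> gen j" using W_inv_comp[OF gen_in_W[OF gen(3)] wW] by simp
   then have "inv (gen j \<circ> w) (int j + 1) < inv (gen j \<circ> w) (int j)"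
    using asc gen(2) by (simp add: gen_apply lo_def hi_def)
   then have j: "j \<in> J" using WJ_descent[OF W gen(2,3)] by blast
   have "gen j \<circ> (gen j \<circ> w) \<in> WJ" by (rule WJ_gen(1)[OF W j])
   then have w: "w \<in> WJ" by simp
   then show "Q (gen j \<circ> w)" using step[OF w j asc] gen(5) by blast
  qed
 qed (rule impI, rule assms(2))
 then show ?thesis using y by blast
qed

lemma WJ_len_left:
 assumes "w \<in> WJ" "j \<in> J" "inv w (int j) < inv w (int j + 1)"
 shows "len n (gen j \<circ> w) = Suc (len n w)" "Rw (gen j \<circ> w) X = Rop j (Rw w X)"
 using len_gen_left(1)[OF WJ_D(2)[OF assms(1)] J_D(2)[OF assms(2)]] Rw_left[OF WJ_D(2)[OF assms(1)] J_D(2)[OF assms(2)]]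
  assms(3) J_D(1)[OF assms(2)] by (simp_all add: lo_def hi_def)

lemma WJ_f0: assumes "y \<in> WJ" shows "Rw y f0 = (\<lambda>P. E 0 (int (len n y)) * f0 P)" "invJ (inv y) = len n y"
proof -
 have "Rw y f0 = (\<lambda>P. E 0 (int (len n y)) * f0 P) \<and> invJ (inv y) = len n y" using assms
 proof (induction y rule: WJ_induct)
  case id
  have e: "{(i, k) \<in> PP. id (int k) < id (int i)} = {}" by (auto simp: PP_def)
  show ?case unfolding Rw_id len_id inv_id invJ_def e by (simp add: E_0)
 next
  case (gen j w)
  note l = WJ_len_left[OF gen(1-3)]
  have "inv (gen j \<circ> w) = inv w \<circ> gen j"
   using W_inv_comp[OF gen_in_W[OF J_D(2)[OF gen(2)]] WJ_D(2)[OF gen(1)]] by simp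
  then have "invJ (inv (gen j \<circ> w)) = Suc (len n w)"
   using invJ_step[where z = "inv w", OF gen(2,3)] gen(4) by simp
  then have 1: "invJ (inv (gen j \<circ> w)) = len n (gen j \<circ> w)" unfolding l(1) .
  have "Rw (gen j \<circ> w) f0 = (\<lambda>P. E 0 (int (len n w)) * (v * f0 P))"
   unfolding l(2) conjunct1[OF gen(4)] scale_Rop Rop_f0[OF gen(2)] ..
  also have "\<dots> = (\<lambda>P. E 0 (int (len n (gen j \<circ> w))) * f0 P)"
   unfolding l(1) by (rule ext) (simp add: mult.assoc[symmetric] E_mult add.commute)
  finally show ?case using 1 by (rule conjI)
 qed
 then show "Rw y f0 = (\<lambda>P. E 0 (int (len n y)) * f0 P)" "invJ (inv y) = len n y" by auto
qed

lemma WJ_invJ: assumes "y \<in> WJ" shows "invJ y = len n y" "len n y \<le> NN"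
proof -
 show "invJ y = len n y"
  using WJ_f0(2)[OF WJ_inv[OF assms]] W_inv_inv[OF WJ_D(2)[OF assms]] len_inv[OF WJ_D(2)[OF assms]] by simp
 then show "len n y \<le> NN" using invJ_le[of y] by simp
qed

text \<open>The symmetriser of the Young subgroup: up to a power of \<open>v\<close>, the
  Kazhdan-Lusztig element of its longest element.\<close>

definition CJ :: "(tab => 'g K) => tab => 'g K" where
 "CJ X P = (\<Sum>y\<in>WJ. E 0 (int (len n y)) * Rw y X P)"

lemma Rop_CJ: assumes j: "j \<in> J" shows "Rop j (CJ X) P = v * CJ X P"
proof -
 note jD = J_D[OF j]
 let ?A = "{y \<in> WJ. inv y (int j) < inv y (int j + 1)}"
 have finA: "finite ?A" using finite_WJ by simp
 have inv: "inv (gen j \<circ> y) = inv y \<circ> gen j" if "y \<in> WJ" for y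
  using W_inv_comp[OF gen_in_W[OF jD(2)] WJ_D(2)[OF that]] by simp
 have gj: "gen j (int j) = int j + 1" "gen j (int j + 1) = int j" using jD by (simp_all add: gen_apply lo_def hi_def)
 have disj: "?A \<inter> (\<lambda>y. gen j \<circ> y) ` ?A = {}" using inv gj by auto
 have un: "WJ = ?A \<union> (\<lambda>y. gen j \<circ> y) ` ?A"
 proof (intro equalityI subsetI)
  fix y assume y: "y \<in> WJ"
  have "inv y (int j) ~= inv y (int j + 1)" using W_inj[OF W_inv[OF WJ_D(2)[OF y]]] by simp
  then consider "inv y (int j) < inv y (int j + 1)" | "inv y (int j + 1) < inv y (int j)" by linarith
  then show "y \<in> ?A \<union> (\<lambda>y. gen j \<circ> y) ` ?A"
  proof cases
   case 2
   then have "gen j \<circ> y \<in> ?A" using WJ_gen(1)[OF y j] inv[OF y] gj by simp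
   then have "gen j \<circ> (gen j \<circ> y) \<in> (\<lambda>y. gen j \<circ> y) ` ?A" by (rule imageI)
   then show ?thesis by simp
  qed (use y in simp)
 qed (use WJ_gen(1)[OF _ j] in auto)
 have inj: "inj_on (\<lambda>y. gen j \<circ> y) ?A"
  by (rule inj_on_inverseI[where g = "\<lambda>y. gen j \<circ> y"]) (rule comp_gen_gen(2))
 define Y where "Y y = Rw y X" for y
 have CJ: "CJ X = (\<lambda>P. \<Sum>y\<in>?A. E 0 (int (len n y)) * (Y y P + v * Rop j (Y y) P))"
 proof
  fix P
  have "CJ X P = (\<Sum>y\<in>?A. E 0 (int (len n y)) * Rw y X P) +
    (\<Sum>y\<in>(\<lambda>y. gen j \<circ> y) ` ?A. E 0 (int (len n y)) * Rw y X P)"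
   unfolding CJ_def by (subst un, rule sum.union_disjoint[OF finA finite_imageI[OF finA] disj])
  also have "(\<Sum>y\<in>(\<lambda>y. gen j \<circ> y) ` ?A. E 0 (int (len n y)) * Rw y X P) =
    (\<Sum>y\<in>?A. E 0 (int (len n y)) * (v * Rop j (Y y) P))"
  proof (rule sum.reindex_cong[OF inj refl])
   fix y assume "y \<in> ?A"
   then have y: "y \<in> WJ" "inv y (int j) < inv y (int j + 1)" by auto
   show "E 0 (int (len n (gen j \<circ> y))) * Rw (gen j \<circ> y) X P = E 0 (int (len n y)) * (v * Rop j (Y y) P)"
    unfolding WJ_len_left[OF y(1) j y(2)] Y_def by (simp add: mult.assoc[symmetric] E_mult add.commute)
  qed
  finally show "CJ X P = (\<Sum>y\<in>?A. E 0 (int (len n y)) * (Y y P + v * Rop j (Y y) P))"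
   by (simp add: Y_def sum.distrib distrib_left)
 qed
 have q: "Rop j (\<lambda>P. Y y P + v * Rop j (Y y) P) P = v * (Y y P + v * Rop j (Y y) P)" for y
 proof -
  have "Rop j (\<lambda>P. 1 * Y y P + v * Rop j (Y y) P) P = Rop j (Y y) P + v * Rop j (Rop j (Y y)) P"
   unfolding Rop_lin by simp
  also have "Rop j (Rop j (Y y)) P = (v - inverse v) * Rop j (Y y) P + Y y P"
   using Rop_quadratic[OF jD(2)] jD by (simp add: lw_def)
  finally show ?thesis by (simp add: algebra_simps v_inverse E_mult mult.assoc[symmetric] E_0)
 qed
 have "Rop j (CJ X) P = (\<Sum>y\<in>?A. E 0 (int (len n y)) * Rop j (\<lambda>P. Y y P + v * Rop j (Y y) P) P)"
  unfolding CJ by (rule Rop_sum[OF jD(2) finA])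
 also have "\<dots> = v * CJ X P" unfolding q CJ sum_distrib_left by (simp add: ac_simps)
 finally show ?thesis .
qed

text \<open>The factor of \<open>i\<close> vanishes on fillings with \<open>i\<close> in the box
  \<open>(True, 0, 0)\<close>. If some entry of \<open>1..l\<close> lies in the first component, an
  entry of \<open>1..l\<close> occupies that box; so only fillings with \<open>1..l\<close> in the
  second component survive.\<close>

primrec uu :: "nat => (tab => 'g K) => tab => 'g K" where
 "uu 0 X = X"
| "uu (Suc l) X = (\<lambda>P. tmul (Suc l) (uu l X) P + E (- 1) 0 * uu l X P)"

lemma uu_valid: "valid P ==> uu l X P = (\<Prod>i\<in>{1..l}. x (P i) + E (- 1) 0) * X P"
 by (induction l) (simp_all add: tmul_def atLeastAtMostSuc_conv algebra_simps)

lemma Asp_tmul: "1 \<le> k ==> k \<le> n ==> Asp (tmul k)"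
proof (induction k rule: nat_induct_at_least)
 case base
 then show ?case using Asp_Rop[OF Asp_id, of 0] n_pos unfolding tmul_1[symmetric] by simp
next
 case (Suc k)
 have "Asp (Rop k)" using Asp_Rop[OF Asp_id, of k] Suc by simp
 from Asp_Rop[OF Asp_comp[OF _ this], of "tmul k" k] Suc
 have "Asp (\<lambda>X. Rop k (tmul k (Rop k X)))" by simp
 then show ?case using tmul_Suc[of k] Suc by simp
qed

lemma Asp_uu: "l \<le> n ==> Asp (uu l)"
proof (induction l)
 case 0
 have "uu 0 = (\<lambda>X. X)" by (rule ext) simp
 then show ?case using Asp_id by simp
next
 case (Suc l)
 have "Asp (\<lambda>X. tmul (Suc l) (uu l X))" by (rule Asp_comp[OF Asp_tmul]) (use Suc in auto)
 from spn_add[OF this spn_scale[of _ _ "uu l", of _ _ "ex (zmul (- 1) b + zmul 0 a)"]] Suc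
 show ?case by (simp add: E_eq_to_fract)
qed

lemma Asp_CJ: "Asp CJ"
 unfolding CJ_def[abs_def] E_eq_to_fract
 by (rule spn_sum[OF finite_WJ, where F = Rw]) (rule Asp_Rw[OF WJ_D(2)])

definition C0 :: "(tab => 'g K) => tab => 'g K" where
 "C0 X P = E 0 (- ctm - int NN) * uu ll (CJ X) P"

lemma Asp_C0: "Asp C0"
 using spn_scale[OF Asp_comp[OF Asp_uu[OF ll_le] Asp_CJ]] unfolding C0_def[abs_def] E_eq_to_fract by blast

definition PiJ :: "'g K" where "PiJ = (\<Sum>y\<in>WJ. E 0 (2 * int (len n y)))"

text \<open>The scalar by which \<open>C0\<close> acts on \<open>f0\<close> inside the block of
  \<open>T0\<close>. It need not be bar-invariant, whence the sum with its conjugate in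
  \<open>pi0_tends\<close>.\<close>

definition pi0 :: "'g K" where
 "pi0 = E 0 (- ctm - int NN) * (\<Prod>i\<in>{1..ll}. x (T0 i) + E (- 1) 0) * PiJ"

text \<open>The row at \<open>T0\<close> is computed by transposition: on the column
  \<open>f0\<close> every \<open>Rw (inv y)\<close> is the scalar
  \<open>E 0 (int (len n y))\<close>.\<close>

lemma C0_T0: assumes V: "valid V" shows "C0 (dl V) T0 = (if V = T0 then pi0 else 0)"
proof -
 have "CJ (dl V) T0 * Dg T0 = (\<Sum>y\<in>WJ. E 0 (int (len n y)) * (Rw (inv y) f0 V * Dg V))"
  unfolding CJ_def sum_distrib_right mult.assoc using Rw_transpose[OF WJ_D(2) vT V] by (intro sum.cong) auto
 also have "\<dots> = (\<Sum>y\<in>WJ. E 0 (2 * int (len n y)) * (f0 V * Dg V))"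
  using WJ_f0(1)[OF WJ_inv] len_inv[OF WJ_D(2)]
  by (intro sum.cong) (simp_all add: mult.assoc[symmetric] E_mult)
 also have "\<dots> = PiJ * f0 V * Dg V" by (simp add: PiJ_def sum_distrib_right mult.assoc)
 finally have "CJ (dl V) T0 = (if V = T0 then PiJ else 0)" by (auto simp: dl_def)
 then show ?thesis unfolding C0_def pi0_def uu_valid[OF vT] by simp
qed

lemma factor_tends: assumes "i \<in> {1..ll}" shows "tends (1 + E (- 2) (- 2 * ct (T0 i))) 1"
proof -
 have i: "i \<in> {1..n}" using assms ll_le by auto
 obtain e r c where B: "T0 i = (e, r, c)" by (cases "T0 i")
 have "\<not> e" using neg_iff[OF i] assms B by simp
 then have "- 2 * ct (T0 i) \<le> - (- 2) * (int n - 1)" using valid_hook[OF vT i B] B by (simp add: ct_def)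
 then have "tends (E (- 2) (- 2 * ct (T0 i))) 0" by (intro tends_E) auto
 from lim_add[OF lim_1 this] show ?thesis by simp
qed

text \<open>After normalisation \<open>pi0\<close> and its conjugate tend, with the same sign
  \<open>sg\<close>, to the numbers of elements of the Young subgroup of length \<open>NN\<close>
  and of length 0. The second number is positive, so nothing cancels.\<close>

lemma pi0_tends: "\<exists>c>0. tends ((pi0 + kbar pi0) / omm T0 n) (sg * c)"
proof -
 let ?F = "\<Prod>i\<in>{1..ll}. 1 + E (- 2) (- 2 * ct (T0 i))"
 have F: "tends ?F 1" using lim_prod[of "{1..ll}" _ "\<lambda>_. 1", OF factor_tends] by simp
 have xT: "x (T0 i) = E 1 (2 * ct (T0 i))" if "i \<in> {1..ll}" for i
  using that neg_iff[of i] ll_le by (simp add: x_def)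
 have p1: "(\<Prod>i\<in>{1..ll}. x (T0 i) + E (- 1) 0) = E (int ll) (2 * ctm) * ?F"
 proof -
  have "(\<Prod>i\<in>{1..ll}. x (T0 i) + E (- 1) 0) = (\<Prod>i\<in>{1..ll}. x (T0 i) * (1 + E (- 2) (- 2 * ct (T0 i))))"
   by (intro prod.cong) (auto simp: xT distrib_left E_mult)
  then show ?thesis unfolding prod.distrib prod_x .
 qed
 have p2: "kbar (\<Prod>i\<in>{1..ll}. x (T0 i) + E (- 1) 0) = E (int ll) 0 * ?F"
 proof -
  have "kbar (\<Prod>i\<in>{1..ll}. x (T0 i) + E (- 1) 0) = (\<Prod>i\<in>{1..ll}. E 1 0 * (1 + E (- 2) (- 2 * ct (T0 i))))"
   unfolding kbar_prod by (intro prod.cong) (auto simp: xT kbar_add distrib_left E_mult add.commute)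
  also have "\<dots> = E (int ll) 0 * ?F" unfolding prod.distrib using E_prod[of "\<lambda>_. 1" "\<lambda>_. 0" "{1..ll}"] by simp
  finally show ?thesis .
 qed
 define c where "c = int (card {y\<in>WJ. len n y = NN})"
 define c' where "c' = int (card {y\<in>WJ. len n y = 0})"
 have sums: "tends (\<Sum>y\<in>WJ. E 0 (g y)) (int (card {y\<in>WJ. g y = 0}))" if "\<And>y. y \<in> WJ ==> g y \<le> 0" for g
 proof -
  have "tends (\<Sum>y\<in>WJ. E 0 (g y)) (\<Sum>y\<in>WJ. if g y = 0 then 1 else 0)"
   using that tends_E0 by (intro lim_sum) (force simp: E_0)
  then show ?thesis using finite_WJ by (simp add: sum.If_cases Int_def)
 qed
 have q1: "tends (E 0 (- 2 * int NN) * PiJ) c"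
 proof -
  have "E 0 (- 2 * int NN) * PiJ = (\<Sum>y\<in>WJ. E 0 (2 * int (len n y) - 2 * int NN))"
   unfolding PiJ_def sum_distrib_left by (simp add: E_mult)
  moreover have "{y\<in>WJ. 2 * int (len n y) - 2 * int NN = 0} = {y\<in>WJ. len n y = NN}" by auto
  ultimately show ?thesis using sums[of "\<lambda>y. 2 * int (len n y) - 2 * int NN"] WJ_invJ(2) unfolding c_def by simp
 qed
 have q2: "tends (kbar PiJ) c'"
 proof -
  have "kbar PiJ = (\<Sum>y\<in>WJ. E 0 (- 2 * int (len n y)))" unfolding PiJ_def kbar_sum by simp
  then show ?thesis using sums[of "\<lambda>y. - 2 * int (len n y)"] unfolding c'_def by simp
 qed
 have "id \<in> {y\<in>WJ. len n y = 0}" using WJ_id len_id by blast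
 then have "card {y\<in>WJ. len n y = 0} > 0" using finite_WJ by (subst card_gt_0_iff) auto
 then have c': "0 < c'" unfolding c'_def by simp
 have t: "tends ((pi0 + kbar pi0) * E (- int ll) (- ctm - int NN)) (1 * c + 1 * c')"
 proof -
  have "pi0 * E (- int ll) (- ctm - int NN) = ?F * (E 0 (- 2 * int NN) * PiJ)"
  proof -
   have "pi0 * E (- int ll) (- ctm - int NN) =
    (E 0 (- ctm - int NN) * E (int ll) (2 * ctm) * E (- int ll) (- ctm - int NN)) * ?F * PiJ"
    unfolding pi0_def p1 by (simp only: ac_simps)
   then show ?thesis unfolding E_mult by (simp add: ac_simps)
  qed
  moreover have "kbar pi0 * E (- int ll) (- ctm - int NN) = ?F * kbar PiJ"
  proof -
   have "kbar pi0 * E (- int ll) (- ctm - int NN) =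
    (E 0 (ctm + int NN) * E (int ll) 0 * E (- int ll) (- ctm - int NN)) * ?F * kbar PiJ"
    unfolding pi0_def kbar_mult p2 by (simp add: ac_simps)
   then show ?thesis unfolding E_mult by (simp add: E_0)
  qed
  ultimately show ?thesis unfolding distrib_right using lim_add[OF lim_mult[OF F q1] lim_mult[OF F q2]] by simp
 qed
 have "(pi0 + kbar pi0) / omm T0 n = of_int sg * ((pi0 + kbar pi0) * E (- int ll) (- ctm - int NN))"
 proof -
  have ss: "of_int sg * (of_int sg :: 'g K) = 1" using arg_cong[OF sg_sg, of "of_int :: int => 'g K"] by simp
  have "omm T0 n * (of_int sg * ((pi0 + kbar pi0) * E (- int ll) (- ctm - int NN))) =
    (of_int sg * of_int sg) * (E (int ll) (ctm + int NN) * E (- int ll) (- ctm - int NN)) * (pi0 + kbar pi0)"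
   unfolding omm_T0 by (simp only: ac_simps)
  then have "omm T0 n * (of_int sg * ((pi0 + kbar pi0) * E (- int ll) (- ctm - int NN))) = pi0 + kbar pi0"
   unfolding ss E_mult by (simp add: E_0)
  then show ?thesis by (simp add: divide_eq_eq ac_simps)
 qed
 then have "tends ((pi0 + kbar pi0) / omm T0 n) (sg * (c + c'))" using lim_mult[OF lim_of_int[of sg] t] by simp
 moreover have "0 < c + c'" using c' by (simp add: c_def)
 ultimately show ?thesis by blast
qed

end

section \<open>The Kazhdan--Lusztig basis and the order of shapes\<close>

context asymptotic
begin

text \<open>Chosen so that entry by entry it grows together with \<open>alpha\<close> and, in
  addition, equal values force equal block keys, see \<open>termwise\<close>.\<close>

definition rkb :: "box => int" where
 "rkb B = (case B of (e, r, c) => if e then - int c else int n - int r)"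

definition rk :: "tab => int" where "rk P = (\<Sum>i\<in>{1..n}. rkb (P i))"

definition aS :: "tab => 'g" where "aS P = (\<Sum>i\<in>{1..n}. alpha (P i))"

definition higher :: "tab => tab => bool" where
 "higher P Q \<longleftrightarrow> aS Q \<le> aS P \<and> rk Q < rk P"

lemma sum_shape: assumes "valid P" shows "(\<Sum>i\<in>{1..n}. g (P i)) = sum g (shp P)"
 using assms unfolding shp_def valid_def by (simp add: sum.reindex)

lemma higher_shape:
 assumes "valid P" "valid Q" "shp P = shp Q" shows "rk P = rk Q" "aS P = aS Q"
 unfolding rk_def aS_def sum_shape[OF assms(1)] sum_shape[OF assms(2)] assms(3) by (rule refl)+

lemma higher_trans: "higher P Q ==> higher Q R ==> higher P R"
 by (auto simp: higher_def)

lemma zmul_mono: "k \<le> l ==> zmul k a \<le> zmul l a"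
 using zmul_pos_iff[OF a_pos, of "l - k"] zmul_diff[of l k a] by (cases "k = l") (auto simp: less_imp_le)

text \<open>How consecutive boxes are related in a vector on which the corresponding generator acts by
 \<open>v\<close>, after sorting.\<close>

definition Rb :: "box => box => bool" where
 "Rb B B' \<longleftrightarrow> (fst B = fst B' \<and> ct B < ct B') \<or> (fst B \<and> \<not> fst B')"

text \<open>The content, with the whole first component shifted below the second. It is the order by
  which \<open>support_higher\<close> sorts a filling inside blocks.\<close>

definition key3 :: "box => int" where
 "key3 B = (case B of (e, r, c) => if e then int r - int c - 3 * int n else int c - int r)"

end

section \<open>The support of eigenvectors of the Young subgroup\<close>

context ordered_tab
begin

lemma J_dd: "j \<in> J ==> dd (T0 (Suc j)) = Suc (dd (T0 j))"
 using J_adj[of j] J_D[of j] by (cases "T0 j"; cases "T0 (Suc j)") (auto simp: dd_def pre_def ct_def split: if_splits)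

text \<open>If \<open>j\<close> and \<open>j + 1\<close> are adjacent, the diagonal entry must be
  \<open>v\<close>, which fixes the contents. Otherwise the swapped filling lies in the support too:
  a diagonal entry \<open>v\<close> would give \<open>qf\<close> = 0, although here
  \<open>qf\<close> tends to 1.\<close>

lemma symmetric_support:
 assumes Y: "Rop j Y U = v * Y U" and U: "valid U" "Y U ~= 0" and j: "j \<in> J"
 shows "(fst (U j) = fst (U (Suc j)) \<and> ct (U (Suc j)) = ct (U j) + 1) \<or>
  (U j \<notin> pre (U (Suc j)) \<and> valid (sw j U) \<and> Y (sw j U) ~= 0)"
proof -
 note jD = J_D[OF j]
 have jn: "j \<in> {1..n}" "Suc j \<in> {1..n}" using jD by auto
 have eq: "phi (U j) (U (Suc j)) * Y U + theta (U j) (U (Suc j)) * Y (sw j U) = v * Y U"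
  using Y U jD by (simp add: Rop_def)
 show ?thesis
 proof (cases "U j \<in> pre (U (Suc j))")
  case True
  then have "phi (U j) (U (Suc j)) = v" using eq theta_adj[OF True] U by simp
  moreover have "fst (U j) = fst (U (Suc j))" "ct (U (Suc j)) = ct (U j) + 1 \<or> ct (U (Suc j)) = ct (U j) - 1"
   using pre_ct[OF True] by auto
  moreover have "v ~= - inverse v" using E_neq_minus_E[of 0 1 0 "- 1"] by (simp add: E_inverse)
  ultimately show ?thesis using phi_adj(2)[of "U j" "U (Suc j)"] by metis
 next
  case False
  have "Y (sw j U) ~= 0"
  proof
   assume "Y (sw j U) = 0"
   then have 1: "phi (U j) (U (Suc j)) = v" using eq U by simp
   have "phi (U (Suc j)) (U j) = - inverse v"
    using phi_sum[OF valid_x_neq[OF U(1) jn]] 1 by (simp add: eq_neg_iff_add_eq_0 algebra_simps)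
   then have "qf (U j) (U (Suc j)) = 0" unfolding qf_def 1 by (simp add: E_neq_0)
   moreover have "tends (qf (U j) (U (Suc j))) 1"
    by (rule tends_qf[OF U(1) jn]) (use valid_consecutive[OF U(1)] False jD in force)
   ultimately show False using lim_1_neq_0 by fastforce
  qed
  then show ?thesis using valid_sw[OF U(1) jD(1,2) False] False by blast
 qed
qed

lemma blocks_Rb:
 assumes "\<And>j. j \<in> J ==> Rb (U j) (U (Suc j))" "(k, i) \<in> PP" shows "Rb (U k) (U i)"
proof -
 have "Rb ((\<lambda>t. U (nat t)) (int k)) ((\<lambda>t. U (nat t)) (int i))"
 proof (rule sorted_blocks[where R = Rb and z = "\<lambda>t. U (nat t)", OF _ _ assms(2)])
  show "Rb (U (nat (int j))) (U (nat (int j + 1)))" if "j \<in> J" for j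
   using assms(1)[OF that] by (simp add: nat_add_distrib)
 qed (auto simp: Rb_def)
 then show ?thesis by simp
qed

context
 fixes U assumes U: "valid U" and RJ: "\<And>j. j \<in> J ==> Rb (U j) (U (Suc j))"
  and neg: "\<And>i. i \<in> {1..ll} ==> \<not> fst (U i)"
begin

text \<open>Along a block contents increase strictly, so each step moves to a larger column, or a
  larger row in the first component. In \<open>T0\<close> the position grows by exactly one.\<close>

lemma dd_bound: "i \<in> {1..n} ==> fst (U i) = fst (T0 i) ==> dd (T0 i) \<le> dd (U i)"
proof (induction i)
 case (Suc i)
 show ?case
 proof (cases "i \<in> J")
  case True
  note jD = J_D[OF True]
  have "fst (U i) = fst (U (Suc i))"
  proof (cases "fst (T0 (Suc i))")
   case True
   then show ?thesis using RJ[OF \<open>i \<in> J\<close>] Suc.prems(2) by (auto simp: Rb_def)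
  next
   case False
   then have "Suc i \<le> ll" using neg_iff[OF Suc.prems(1)] by simp
   then show ?thesis using neg[of i] neg[of "Suc i"] jD by simp
  qed
  then have e: "fst (U i) = fst (U (Suc i))" "ct (U i) < ct (U (Suc i))" using RJ[OF True] by (auto simp: Rb_def)
  obtain e r c r' c' where B: "U i = (e, r, c)" "U (Suc i) = (e, r', c')"
   using e(1) by (cases "U i"; cases "U (Suc i)") auto
  have "dd (U i) < dd (U (Suc i))"
   using consecutive_position(1)[OF U jD(1,2) B] e(2) B by (auto simp: dd_def ct_def split: if_splits)
  moreover have "dd (T0 i) \<le> dd (U i)"
   using Suc e(1) J_adj(2)[OF True] jD by auto
  ultimately show ?thesis using J_dd[OF True] by simp
 next
  case False
  have e: "{k \<in> {1..<Suc i}. ky k = ky (Suc i)} = {}"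
  proof (rule equals0I)
   fix k assume k: "k \<in> {k \<in> {1..<Suc i}. ky k = ky (Suc i)}"
   have "ky k \<le> ky i" "ky i \<le> ky (Suc i)" by (rule ky_mono; use k Suc.prems in auto)+
   then have "i \<in> J" using k Suc.prems by (auto simp: J_def)
   then show False using False by simp
  qed
  then show ?thesis unfolding dd_count[OF Suc.prems(1)] e by simp
 qed
qed simp

text \<open>The bound for the other coordinate. The preceding box in that direction holds an earlier
  entry, and this entry belongs to a strictly smaller block of \<open>T0\<close>, because inside a
  block contents would have to increase.\<close>

lemma key_bound: "i \<in> {1..n} ==> fst (U i) = fst (T0 i) ==> key2 (U i) \<le> ky i"
proof (induction i rule: less_induct)
 case (less i)
 obtain e r c where B: "U i = (e, r, c)" by (cases "U i")
 define d where "d = (if e then c else r)"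
 show ?case
 proof (cases "d = 0")
  case True
  then show ?thesis using ky_neg[OF less.prems(1)] less.prems(2) B by (auto simp: d_def key2_def split: if_splits)
 next
  case False
  define B' where "B' = (if e then (e, r, c - 1) else (e, r - 1, c))"
  have "\<exists>k\<in>{1..i}. U k = B'"
   using valid_NW[OF U less.prems(1) B, of r "c - 1"] valid_NW[OF U less.prems(1) B, of "r - 1" c] by (auto simp: B'_def)
  then obtain k where k: "k \<in> {1..i}" "U k = B'" by blast
  have "k ~= i" using k(2) B False by (auto simp: B'_def d_def split: if_splits)
  then have ki: "k < i" "k \<in> {1..n}" using k less.prems by auto
  have fk: "fst (U k) = e" using k(2) by (simp add: B'_def)
  have "fst (T0 k) = e"
  proof (cases e)
   case True
   then have "\<not> k \<le> ll" using neg[of k] fk ki by auto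
   then show ?thesis using neg_iff[OF ki(2)] True by simp
  next
   case False
   then have "i \<le> ll" using neg_iff[OF less.prems(1)] less.prems(2) B by simp
   then show ?thesis using neg_iff[OF ki(2)] ki False by simp
  qed
  then have IH: "key2 (U k) \<le> ky k" using less.IH[OF ki] fk by simp
  have "ky k ~= ky i"
  proof
   assume "ky k = ky i"
   then have "(k, i) \<in> PP" using ki less.prems by (auto simp: PP_def)
   from blocks_Rb[of U, OF RJ this] have "ct (U k) < ct (U i)" using fk B by (auto simp: Rb_def)
   then show False using k(2) B False by (auto simp: B'_def d_def ct_def split: if_splits)
  qed
  moreover have "ky k \<le> ky i" using ky_mono[of k i] ki less.prems by auto
  moreover have "key2 (U i) = Suc (key2 (U k))" using k(2) B False by (auto simp: B'_def d_def key2_def split: if_splits)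
  ultimately show ?thesis using IH by simp
 qed
qed

text \<open>The \<open>r'\<close> boxes above that of \<open>i\<close> in \<open>U\<close> hold
  earlier entries outside the block of \<open>i\<close>, while \<open>r\<close> earlier entries lie
  in that block.\<close>

lemma mixed_bound:
 assumes i: "i \<in> {1..n}" and B: "T0 i = (True, r, c)" "U i = (False, r', c')" shows "r' + r < n"
proof -
 let ?A = "{k \<in> {1..<i}. ky k = ky i}"
 have sub: "(\<lambda>q. (False, q, c')) ` {..<r'} \<subseteq> U ` ({1..<i} - ?A)"
 proof
  fix B' assume "B' \<in> (\<lambda>q. (False, q, c')) ` {..<r'}"
  then obtain q where q: "q < r'" "B' = (False, q, c')" by blast
  obtain k where k: "k \<in> {1..i}" "U k = (False, q, c')" using valid_NW[OF U i B(2), of q c'] q by auto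
  have "k ~= i" using k(2) B(2) q by auto
  then have ki: "k \<in> {1..<i}" using k by auto
  have "ky k ~= ky i"
  proof
   assume "ky k = ky i"
   then have "(k, i) \<in> PP" using ki i by (auto simp: PP_def)
   from blocks_Rb[of U, OF RJ this] show False using k(2) B(2) q by (auto simp: Rb_def ct_def)
  qed
  then show "B' \<in> U ` ({1..<i} - ?A)" using ki k(2) q by (intro image_eqI[of _ _ k]) auto
 qed
 have "r' = card ((\<lambda>q. (False, q, c')) ` {..<r'})" by (subst card_image) (auto simp: inj_on_def)
 also have "\<dots> \<le> card (U ` ({1..<i} - ?A))" by (rule card_mono[OF _ sub]) simp
 also have "\<dots> \<le> card ({1..<i} - ?A)" by (rule card_image_le) simp
 also have "\<dots> = card {1..<i} - card ?A" by (rule card_Diff_subset) auto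
 also have "card ?A = r" using dd_count[OF i] B by (simp add: dd_def)
 finally have 1: "r' \<le> i - 1 - r" by simp
 have "card ?A \<le> card {1..<i}" by (rule card_mono) auto
 then have "r \<le> i - 1" using dd_count[OF i] B by (simp add: dd_def)
 then show ?thesis using 1 i by auto
qed

text \<open>Shapes are compared entry by entry. When \<open>i\<close> passes from the first to the
  second component, \<open>mixed_bound\<close> and the hypothesis on \<open>b\<close> cover the
  loss; the opposite passage is excluded by \<open>neg\<close>.\<close>

lemma termwise:
 assumes i: "i \<in> {1..n}"
 shows "alpha (T0 i) \<le> alpha (U i)" "rkb (T0 i) \<le> rkb (U i)" "rkb (T0 i) = rkb (U i) ==> key2 (U i) = ky i"
proof -
 obtain e r c where B: "T0 i = (e, r, c)" by (cases "T0 i")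
 obtain e' r' c' where B': "U i = (e', r', c')" by (cases "U i")
 have "alpha (T0 i) \<le> alpha (U i) \<and> rkb (T0 i) \<le> rkb (U i) \<and> (rkb (T0 i) = rkb (U i) --> key2 (U i) = ky i)"
 proof (cases "e' = e")
  case True
  have 1: "dd (T0 i) \<le> dd (U i)" "key2 (U i) \<le> ky i" using dd_bound[OF i] key_bound[OF i] B B' True by auto
  show ?thesis
  proof (cases e)
   case True
   then have "r \<le> r'" "c' \<le> c" using 1 B B' \<open>e' = e\<close> by (auto simp: dd_def key2_def)
   then show ?thesis using B B' True \<open>e' = e\<close> zmul_mono[of "int r" "int r'"] by (auto simp: alpha_def rkb_def key2_def)
  next
   case False
   then have "c \<le> c'" "r' \<le> r" using 1 B B' \<open>e' = e\<close> by (auto simp: dd_def key2_def)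
   then show ?thesis using B B' False \<open>e' = e\<close> zmul_mono[of "2 * int c - int r" "2 * int c' - int r'"]
    by (auto simp: alpha_def rkb_def key2_def)
  qed
 next
  case False
  have e: "e" "\<not> e'"
  proof -
   have "i \<le> ll ==> \<not> e \<and> \<not> e'" using neg[of i] neg_iff[OF i] i B B' by auto
   moreover have "\<not> i \<le> ll ==> e" using neg_iff[OF i] B by auto
   ultimately show "e" "\<not> e'" using False by auto
  qed
  have rr: "r' + r < n" by (rule mixed_bound[OF i, of r c r' c']) (use B B' e in auto)
  have "zmul (int r + int r' - 2 * int c') a \<le> zmul (int n - 1) a" by (rule zmul_mono) (use rr in linarith)
  then have "zmul (int r + int r' - 2 * int c') a < b" using b_large by (rule le_less_trans)
  then have "zmul (2 * int c' - int r') a + zmul (int r + int r' - 2 * int c') a \<le> zmul (2 * int c' - int r') a + b"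
   by (intro add_left_mono less_imp_le)
  then have "zmul (int r) a \<le> b + zmul (2 * int c' - int r') a"
   unfolding zmul_add[symmetric] by (simp add: add.commute)
  then show ?thesis using B B' e rr by (simp add: alpha_def rkb_def)
 qed
 then show "alpha (T0 i) \<le> alpha (U i)" "rkb (T0 i) \<le> rkb (U i)" "rkb (T0 i) = rkb (U i) ==> key2 (U i) = ky i"
  by blast+
qed

text \<open>If \<open>rk\<close> does not increase, all block keys agree with those of
  \<open>T0\<close>. Then \<open>U\<close> is ordered as well, and \<open>dd_count\<close> gives
  equal positions.\<close>

lemma sorted_higher: "U = T0 \<or> higher U T0"
proof (cases "rk T0 < rk U")
 case True
 then show ?thesis unfolding higher_def aS_def by (intro disjI2 conjI sum_mono termwise) auto
next
 case False
 have eq: "rkb (T0 i) = rkb (U i)" if i: "i \<in> {1..n}" for i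
 proof (rule ccontr)
  assume "rkb (T0 i) ~= rkb (U i)"
  then have "rkb (T0 i) < rkb (U i)" using termwise(2)[OF i] by simp
  then have "rk T0 < rk U" unfolding rk_def using termwise(2) i by (intro sum_strict_mono_ex1) auto
  then show False using False by simp
 qed
 have key: "key2 (U i) = ky i" if "i \<in> {1..n}" for i using termwise(3)[OF that eq[OF that]] .
 have "ordered U" using U T0 key unfolding ordered_def by auto
 then interpret U: ordered_tab n a b U by unfold_locales
 have "U i = T0 i" for i
 proof (cases "i \<in> {1..n}")
  case True
  have "dd (U i) = card {k \<in> {1..<i}. key2 (U k) = key2 (U i)}" using U.dd_count[OF True] .
  also have "{k \<in> {1..<i}. key2 (U k) = key2 (U i)} = {k \<in> {1..<i}. ky k = ky i}" using key True by auto
  also have "card \<dots> = dd (T0 i)" using dd_count[OF True] ..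
  finally have d: "dd (U i) = dd (T0 i)" .
  have "fst (U i) = fst (T0 i)" using U.ky_neg[OF True] ky_neg[OF True] key[OF True] by auto
  then show ?thesis using d key[OF True] by (cases "U i"; cases "T0 i") (auto simp: dd_def key2_def split: if_splits)
 next
  case False
  then show ?thesis using U vT unfolding valid_def by auto
 qed
 then show ?thesis by blast
qed

end

text \<open>Swapping inside blocks where \<open>key3\<close> decreases stays in the support and in
  the shape and raises the weighted sum of keys, so it ends at a sorted filling. Such a swap never
  leads to \<open>T0\<close>, since its source would not be standard.\<close>

lemma support_higher:
 assumes Y: "\<And>j P. j \<in> J ==> Rop j Y P = v * Y P"
 shows "valid U ==> Y U ~= 0 ==> (\<And>i. i \<in> {1..ll} ==> \<not> fst (U i)) ==> U = T0 \<or> higher U T0"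
proof (induction "nat (Max ((\<lambda>Q. \<Sum>i\<in>{1..n}. int i * key3 (Q i)) ` {Q. valid Q}) - (\<Sum>i\<in>{1..n}. int i * key3 (U i)))"
  arbitrary: U rule: less_induct)
 case less
 note U = less.prems(1,2) and neg = less.prems(3)
 let ?\<phi> = "\<lambda>Q. \<Sum>i\<in>{1..n}. int i * key3 (Q i)"
 show ?case
 proof (cases "\<exists>j\<in>J. U j \<notin> pre (U (Suc j)) \<and> valid (sw j U) \<and> Y (sw j U) ~= 0 \<and> key3 (U (Suc j)) < key3 (U j)")
  case True
  then obtain j where j: "j \<in> J" "U j \<notin> pre (U (Suc j))" "valid (sw j U)" "Y (sw j U) ~= 0" "key3 (U (Suc j)) < key3 (U j)"
   by blast
  note jD = J_D[OF j(1)]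
  have "?\<phi> U < ?\<phi> (sw j U)" unfolding weighted_sw[OF jD(1,2)] using j(5) by simp
  moreover have "?\<phi> (sw j U) \<le> Max (?\<phi> ` {Q. valid Q})"
   using j(3) by (intro Max_ge finite_imageI finite_valid) blast
  ultimately have m: "nat (Max (?\<phi> ` {Q. valid Q}) - ?\<phi> (sw j U)) < nat (Max (?\<phi> ` {Q. valid Q}) - ?\<phi> U)" by linarith
  have "\<not> fst (sw j U i)" if "i \<in> {1..ll}" for i
   using neg[of j] neg[of "Suc j"] neg[of i] that jD by (auto simp: sw_apply)
  from less.hyps[OF m j(3,4) this] consider "sw j U = T0" | "higher (sw j U) T0" by blast
  then show ?thesis
  proof cases
   case 1
   then have "U (Suc j) = T0 j" "U j = T0 (Suc j)" by (auto simp: sw_apply)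
   then have "U (Suc j) \<in> pre (U j)" using J_adj(1)[OF j(1)] by simp
   moreover have "pre (U j) \<subseteq> U ` {1..<j}" using U(1) jD unfolding valid_def by auto
   ultimately obtain k where "k \<in> {1..<j}" "U (Suc j) = U k" by blast
   then show ?thesis using valid_inj[OF U(1), of "Suc j" k] jD by auto
  next
   case 2
   then show ?thesis using higher_shape[OF j(3) U(1) shp_sw[OF jD(1,2)]] by (simp add: higher_def)
  qed
 next
  case False
  have "Rb (U j) (U (Suc j))" if j: "j \<in> J" for j
  proof -
   note jD = J_D[OF j]
   have jn: "j \<in> {1..n}" "Suc j \<in> {1..n}" using jD by auto
   obtain e r c e' r' c' where B: "U j = (e, r, c)" "U (Suc j) = (e', r', c')" by (cases "U j"; cases "U (Suc j)")
   have h: "r + c < n" "r' + c' < n" using valid_hook[OF U(1) jn(1) B(1)] valid_hook[OF U(1) jn(2) B(2)] by auto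
   from symmetric_support[OF Y[OF j] U j] show ?thesis
   proof
    assume "U j \<notin> pre (U (Suc j)) \<and> valid (sw j U) \<and> Y (sw j U) ~= 0"
    then have "key3 (U j) \<le> key3 (U (Suc j))" using False j by force
    moreover have "\<not> (fst (U j) = fst (U (Suc j)) \<and> ct (U j) = ct (U (Suc j)))"
     using valid_x_neq[OF U(1) jn] unfolding x_eq_iff by simp
    ultimately show ?thesis using B h by (auto simp: Rb_def key3_def ct_def split: if_splits)
   qed (auto simp: Rb_def)
  qed
  then show ?thesis using sorted_higher[OF U(1) _ neg] by blast
 qed
qed

lemma C0_support: assumes U: "valid U" and nz: "C0 X U ~= 0" shows "U = T0 \<or> higher U T0"
proof -
 have 1: "(\<Prod>i\<in>{1..ll}. x (U i) + E (- 1) 0) ~= 0" "CJ X U ~= 0" using nz U by (auto simp: C0_def uu_valid)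
 have "\<not> fst (U i)" if i: "i \<in> {1..ll}" for i
 proof
  assume f: "fst (U i)"
  obtain r c where B: "U i = (True, r, c)" using f by (cases "U i") auto
  have "i \<in> {1..n}" using i ll_le by auto
  from valid_NW[OF U this B, of 0 0] obtain k where k: "k \<in> {1..i}" "U k = (True, 0, 0)" by auto
  then have "x (U k) + E (- 1) 0 = 0" "k \<in> {1..ll}" using i by (auto simp: x_def ct_def)
  then show False using 1(1) by auto
 qed
 then show ?thesis using support_higher[of "CJ X" U] Rop_CJ U 1(2) by blast
qed

text \<open>In the block of \<open>T0\<close> the image is spanned by \<open>f0\<close> by
  \<open>C0_support\<close>, and the coefficient is the row computed in \<open>C0_T0\<close>. So
  \<open>C0\<close> is there a multiple of a primitive idempotent.\<close>

lemma C0_block: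
 assumes U: "valid U" "shp U = shp T0" shows "C0 X U = pi0 * X T0 * f0 U"
proof (cases "U = T0")
 case True
 have "C0 X T0 = C0 (\<lambda>P. \<Sum>V\<in>{V. valid V}. X V * dl V P) T0"
  using finite_valid by (intro Asp_shape[OF Asp_C0, of UNIV])
   (auto simp: dl_def sum.delta if_distrib[of "\<lambda>c. _ * c"] vT cong: if_cong)
 also have "\<dots> = (\<Sum>V\<in>{V. valid V}. X V * C0 (dl V) T0)" by (rule Asp_lin(2)[OF Asp_C0 finite_valid])
 also have "\<dots> = (\<Sum>V\<in>{V. valid V}. if V = T0 then X V * pi0 else 0)"
  by (rule sum.cong) (auto simp: C0_T0)
 finally show ?thesis using True finite_valid vT by (simp add: sum.delta dl_def)
next
 case False
 have "\<not> higher U T0" using higher_shape[OF U(1) vT U(2)] by (simp add: higher_def)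
 then show ?thesis using C0_support[OF U(1)] False by (auto simp: dl_def)
qed

text \<open>\<open>C0\<close> is placed between an operator taking \<open>f0\<close> to a
  bar-invariant vector near \<open>S\<close> and the adjoint of one doing so for \<open>S'\<close>;
  the bar conjugate is added. On the block this is a rank one matrix with scalar
  \<open>pi0 + kbar pi0\<close>, and the factors \<open>Dg\<close> have limit 1.\<close>

lemma ideal_element:
 assumes S: "valid S" "shp S = shp T0" and S': "valid S'" "shp S' = shp T0"
 shows "\<exists>B k. Asp B \<and> binv B \<and> k ~= 0 \<and>
  (\<forall>X U. valid U --> shp U ~= shp T0 --> \<not> higher U T0 --> B X U = 0) \<and>
  (\<forall>U V. valid U --> valid V --> shp U = shp T0 -->
    tends (B (dl V) U / omm U n) (if U = S \<and> V = S' then k else 0))"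
proof -
 obtain F where F: "Asp F" "kb (F f0) = F f0" "\<And>P. valid P ==> tends (F f0 P) (if P = S then sg else 0)"
  using bar_invariant_vector_at[OF S] by blast
 obtain F' where F': "Asp F'" "kb (F' f0) = F' f0" "\<And>P. valid P ==> tends (F' f0 P) (if P = S' then sg else 0)"
  using bar_invariant_vector_at[OF S'] by blast
 obtain G where G: "Asp G" "\<And>P Q. valid P ==> valid Q ==> G (dl Q) P * Dg P = F' (dl P) Q * Dg Q"
  using Asp_adjoint[OF F'(1)] by blast
 note Fb = fun_cong[OF F(2), unfolded kb_def] and F'b = fun_cong[OF F'(2), unfolded kb_def]
 define D where "D X = F (C0 (G X))" for X
 define B where "B X P = D X P + kb (D (kb X)) P" for X P
 have AD: "Asp D" unfolding D_def[abs_def] by (rule Asp_comp[OF F(1) Asp_comp[OF Asp_C0 G(1)]])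
 have 1: "Asp B" unfolding B_def[abs_def] by (rule spn_add[OF AD Asp_kb[OF AD]])
 have 2: "binv B" unfolding binv_def B_def kb_def by (simp add: kbar_add add.commute)
 have D0: "D X U = 0" if U: "valid U" "shp U ~= shp T0" "\<not> higher U T0" for X U
 proof -
  have "D X U = F (\<lambda>P. 0 * f0 P + 0 * f0 P) U"
   unfolding D_def
  proof (rule Asp_shape[OF F(1) _ U(1), of "{shp U}"])
   fix P assume P: "valid P" "shp P \<in> {shp U}"
   then have "\<not> higher P T0" "P ~= T0" using higher_shape[OF P(1) U(1)] U by (auto simp: higher_def)
   then show "C0 (G X) P = 0 * f0 P + 0 * f0 P" using C0_support[OF P(1)] by auto
  qed simp
  also have "\<dots> = 0" unfolding Asp_lin(1)[OF F(1)] by simp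
  finally show ?thesis .
 qed
 have 3: "B X U = 0" if "valid U" "shp U ~= shp T0" "\<not> higher U T0" for X U
  using D0[OF that] by (simp add: B_def kb_def)
 have D1: "D X U = pi0 * G X T0 * F f0 U" if U: "valid U" "shp U = shp T0" for X U
 proof -
  have "D X U = F (\<lambda>P. (pi0 * G X T0) * f0 P + 0 * f0 P) U"
   unfolding D_def by (rule Asp_shape[OF F(1) _ U(1), of "{shp T0}"]) (use U in \<open>auto simp: C0_block\<close>)
  then show ?thesis unfolding Asp_lin(1)[OF F(1)] by simp
 qed
 have GV: "G (dl V) T0 = F' f0 V * Dg V * inverse (Dg T0)" if "valid V" for V
  using G(2)[OF vT that] Dg_neq_0[of T0] by (simp add: field_simps)
 obtain c where c: "c > 0" "tends ((pi0 + kbar pi0) / omm T0 n) (sg * c)" using pi0_tends by blast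
 let ?k = "(sg * c) * sg * (sg * 1 * 1)"
 have 4: "tends (B (dl V) U / omm U n) (if U = S \<and> V = S' then ?k else 0)"
  if U: "valid U" "shp U = shp T0" and V: "valid V" for U V
 proof -
  have "kb (dl V) = dl V" by (rule ext) (simp add: kb_def dl_def)
  then have "B (dl V) U = (pi0 + kbar pi0) * F f0 U * (F' f0 V * Dg V * inverse (Dg T0))"
   unfolding B_def D1[OF U] GV[OF V] by (simp add: kb_def D1[OF U] GV[OF V] kbar_mult kbar_inverse kbar_Dg Fb F'b algebra_simps)
  then have "B (dl V) U / omm U n = ((pi0 + kbar pi0) / omm T0 n) * F f0 U * (F' f0 V * Dg V * inverse (Dg T0))"
   unfolding omm_shape[OF U(1) vT U(2)] by simp
  moreover have "tends (((pi0 + kbar pi0) / omm T0 n) * F f0 U * (F' f0 V * Dg V * inverse (Dg T0)))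
   ((sg * c) * (if U = S then sg else 0) * ((if V = S' then sg else 0) * 1 * 1))"
   by (intro lim_mult c(2) F(3) F'(3) U V tends_Dg lim_inverse_1 vT)
  ultimately show ?thesis by (auto split: if_splits)
 qed
 have "sg ~= 0" using sg_sg by auto
 then have 5: "?k ~= 0" using c(1) by simp
 show ?thesis by (intro exI[of _ B] exI[of _ ?k] conjI allI impI 1 2 3 4 5)
qed

end

context asymptotic
begin

text \<open>Induction from the highest shapes downwards. The element of \<open>ideal_element\<close>
  for \<open>(PT z, QT z)\<close> is expanded in the basis \<open>Cw\<close>. At a filling that is
  not higher, the terms of higher \<open>w\<close> vanish by induction, and the other coefficients
  are bar-invariant with limit \<open>k\<close> at \<open>z\<close> and 0 elsewhere. There the
  element is \<open>k\<close> times \<open>Cw z\<close>, so \<open>Cw z\<close> vanishes where it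
  does.\<close>

lemma Cw_support:
 "z \<in> W n ==> valid U ==> Cw z X U ~= 0 ==> shp U = shp (PT z) \<or> higher U (PT z)"
proof (induction "nat (Max (rk ` {Q. valid Q}) - rk (PT z))" arbitrary: z U X rule: less_induct)
 case less
 note z = less.prems(1)
 obtain T where T: "ordered T" "shp T = shp (PT z)" using ordered_exists[OF PT_QT(1)[OF z]] by blast
 interpret ordered_tab n a b T by unfold_locales (rule T(1))
 have hT: "rk T = rk (PT z)" "aS T = aS (PT z)" using higher_shape[OF vT PT_QT(1)[OF z] T(2)] by auto
 have hi: "higher P (PT z) \<longleftrightarrow> higher P T" for P by (simp add: higher_def hT)
 obtain B k where B: "Asp B" "binv B" "k ~= 0"
  "\<And>X U. valid U ==> shp U ~= shp T ==> \<not> higher U T ==> B X U = 0"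
  "\<And>U V. valid U ==> valid V ==> shp U = shp T ==>
    tends (B (dl V) U / omm U n) (if U = PT z \<and> V = QT z then k else 0)"
  using ideal_element[OF PT_QT(1)[OF z] T(2)[symmetric] PT_QT(2)[OF z] trans[OF PT_QT(5)[OF z, symmetric] T(2)[symmetric]]]
  by blast
 obtain h where h: "\<And>X P. B X P = (\<Sum>w\<in>W n. to_fract (h w) * Cw w X P)" using Asp_expand[OF B(1)] by blast
 let ?Z = "{w\<in>W n. \<not> higher (PT w) T}"
 have B': "B X U = (\<Sum>w\<in>?Z. to_fract (h w) * Cw w X U)" if U: "valid U" "\<not> higher U T" for X U
  unfolding h
 proof (rule sum.mono_neutral_right[OF finite_W])
  show "\<forall>w\<in>W n - ?Z. to_fract (h w) * Cw w X U = 0"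
  proof
   fix w assume w: "w \<in> W n - ?Z"
   then have wW: "w \<in> W n" and hw: "higher (PT w) T" by auto
   have "rk (PT w) \<le> Max (rk ` {Q. valid Q})"
    using PT_QT(1)[OF wW] by (intro Max_ge finite_imageI finite_valid) blast
   moreover have "rk (PT z) < rk (PT w)" using hw hT by (simp add: higher_def)
   ultimately have m: "nat (Max (rk ` {Q. valid Q}) - rk (PT w)) < nat (Max (rk ` {Q. valid Q}) - rk (PT z))" by linarith
   have "Cw w X U = 0"
   proof (rule ccontr)
    assume "Cw w X U ~= 0"
    from less.hyps[OF m wW U(1) this] show False
    proof
     assume "shp U = shp (PT w)"
     then show False using higher_shape[OF U(1) PT_QT(1)[OF wW]] hw U(2) by (simp add: higher_def)
    next
     assume "higher U (PT w)"
     then show False using higher_trans hw U(2) by blast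
    qed
   qed
   then show "to_fract (h w) * Cw w X U = 0" by simp
  qed
 qed auto
 have hw: "h w = of_int (if w = z then k else 0)" if w: "w \<in> ?Z" for w
 proof -
  have "tends (eps 0 * to_fract (h w)) (if w = z then k else 0)"
  proof (rule leading_terms[OF leads_Cw _ _ w])
   fix w assume w: "w \<in> ?Z"
   then have wW: "w \<in> W n" and nh: "\<not> higher (PT w) T" by auto
   note PQ = PT_QT(1,2)[OF wW]
   have e: "(PT w = PT z \<and> QT w = QT z) = (w = z)" using RS_inj[OF wW z] by auto
   have "tends (B (dl (QT w)) (PT w) / omm (PT w) n) (if w = z then k else 0)"
   proof (cases "shp (PT w) = shp T")
    case True
    from B(5)[OF PQ this] show ?thesis unfolding e .
   next
    case False
    then have "w ~= z" using T(2) by auto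
    then show ?thesis using B(4)[OF PQ(1) False nh] by simp
   qed
   then show "tends (eps 0 * (\<Sum>y\<in>?Z. to_fract (h y) * Cw y (dl (QT w)) (PT w)) / omm (PT w) n) (if w = z then k else 0)"
    unfolding B'[OF PQ(1) nh] by simp
  qed auto
  then have "tends (to_fract (h w)) (if w = z then k else 0)" by simp
  then show ?thesis using bar_invariant_limit[OF binv_coefficients[OF B(2) h]] w by blast
 qed
 show ?case
 proof (rule ccontr)
  assume n: "\<not> ?case"
  then have nh: "\<not> higher U T" "shp U ~= shp T" using hi T(2) by auto
  have zZ: "z \<in> ?Z" using z hT by (simp add: higher_def)
  have "0 = B X U" using B(4)[OF less.prems(2) nh(2,1)] by simp
  also have "\<dots> = (\<Sum>w\<in>?Z. if w = z then of_int k * Cw z X U else 0)"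
   unfolding B'[OF less.prems(2) nh(1)] using hw by (intro sum.cong) auto
  also have "\<dots> = of_int k * Cw z X U" using zZ finite_W by (simp add: sum.delta)
  finally have "of_int k * Cw z X U = 0" by simp
  moreover have "tends (of_int k :: 'g K) k" by simp
  ultimately show False using less.prems(3) lim_1_neq_0[OF _ B(3)] by (metis mult_eq_0_iff)
 qed
qed

end

section \<open>The \<open>a\<close>-function\<close>

context asymptotic
begin

definition sgn' :: "tab => int" where "sgn' P = (\<Prod>i\<in>{1..n}. if fst (P i) then 1 else (- 1) ^ fst (snd (P i)))"

lemma omm_eps: "omm P n = of_int (sgn' P) * eps (aS P)"
 unfolding omm_def om_eq aS_def sgn'_def eps_sum prod.distrib
 by (simp only: of_int_prod if_distrib[of of_int] of_int_1 of_int_power of_int_minus)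

lemma sgn'_sgn': "sgn' P * sgn' P = 1"
 unfolding sgn'_def prod.distrib[symmetric] by (rule prod.neutral) (auto simp flip: power_mult_distrib)

lemma aS_nonneg: assumes "valid P" shows "0 \<le> aS P"
 unfolding aS_def
proof (rule sum_nonneg)
 fix i assume i: "i \<in> {1..n}"
 obtain e r c where B: "P i = (e, r, c)" by (cases "P i")
 have "zmul (int r - 2 * int c) a \<le> zmul (int n - 1) a"
  using valid_hook[OF assms i B] by (intro zmul_mono) simp
 then have "zmul (int r - 2 * int c) a \<le> b" using b_large by simp
 moreover have "zmul (int r - 2 * int c) a = - zmul (2 * int c - int r) a" unfolding zmul_uminus[symmetric] by simp
 moreover have "0 \<le> zmul (int r) a" using zmul_mono[of 0 "int r"] by simp
 ultimately show "0 \<le> alpha (P i)" using B by (simp add: alpha_def minus_le_iff add.commute neg_le_iff_le)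
  (metis add.commute add.right_inverse add_le_cancel_left)
qed

text \<open>In the limit this is a product of two matrix units. Each factor is normalised by
  \<open>omm P n\<close>, and one of the two normalisations is, up to sign,
  \<open>eps (aS P)\<close>.\<close>

lemma product_tends:
 assumes u: "u \<in> W n" and y: "y \<in> W n" and P: "valid P" and Q: "valid Q" and PQ: "shp P = shp Q"
 shows "tends (eps (- aS P) * (Cw u (Cw y (dl Q)) P / omm P n))
  (sgn' P * (if P = PT u \<and> Q = QT y \<and> QT u = PT y then 1 else 0))"
proof -
 let ?V = "{R. valid R}" and ?V' = "{R. valid R \<and> shp R = shp P}"
 have finV': "finite ?V'" by (rule finite_subset[OF _ finite_valid]) auto
 have "Cw u (Cw y (dl Q)) P = Cw u (\<lambda>P. \<Sum>R\<in>?V. Cw y (dl Q) R * dl R P) P"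
  using finite_valid by (intro Asp_shape[OF Asp_Cw[OF u], of UNIV])
   (auto simp: dl_def sum.delta if_distrib[of "\<lambda>c. _ * c"] P cong: if_cong)
 also have "\<dots> = (\<Sum>R\<in>?V. Cw y (dl Q) R * Cw u (dl R) P)" by (rule Asp_lin(2)[OF Asp_Cw[OF u] finite_valid])
 also have "\<dots> = (\<Sum>R\<in>?V'. Cw y (dl Q) R * Cw u (dl R) P)"
 proof (rule sum.mono_neutral_right[OF finite_valid])
  show "\<forall>R\<in>?V - ?V'. Cw y (dl Q) R * Cw u (dl R) P = 0"
  proof
   fix R assume R: "R \<in> ?V - ?V'"
   have "Cw y (dl Q) R = Cw y (\<lambda>P. 0 * dl Q P + 0 * dl Q P) R"
    by (rule Asp_shape[OF Asp_Cw[OF y], of "{shp R}"]) (use R PQ in \<open>auto simp: dl_def\<close>)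
   then have "Cw y (dl Q) R = 0" unfolding Asp_lin(1)[OF Asp_Cw[OF y]] by simp
   then show "Cw y (dl Q) R * Cw u (dl R) P = 0" by simp
  qed
 qed auto
 finally have e: "Cw u (Cw y (dl Q)) P = (\<Sum>R\<in>?V'. Cw y (dl Q) R * Cw u (dl R) P)" .
 have ss: "of_int (sgn' P) * of_int (sgn' P) = (1 :: 'g K)"
  using arg_cong[OF sgn'_sgn'[of P], of "of_int :: int => 'g K"] by simp
 have "eps (- aS P) = of_int (sgn' P) / omm P n"
  unfolding omm_eps eps_minus using ss by (simp add: divide_inverse) (metis divide_inverse eps_neq_0 inverse_unique mult.commute mult.left_commute mult_1_right)
 then have "eps (- aS P) * (Cw u (Cw y (dl Q)) P / omm P n) =
   of_int (sgn' P) * (\<Sum>R\<in>?V'. (Cw y (dl Q) R / omm P n) * (Cw u (dl R) P / omm P n))"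
  unfolding e by (simp add: sum_divide_distrib sum_distrib_left)
 also have "\<dots> = of_int (sgn' P) * (\<Sum>R\<in>?V'. (Cw y (dl Q) R / omm R n) * (Cw u (dl R) P / omm P n))"
 proof -
  have "omm R n = omm P n" if "R \<in> ?V'" for R
  proof -
   have "\<And>R. valid R ==> omm R n = prod om (shp R)"
    unfolding omm_def shp_def valid_def by (simp add: prod.reindex)
   then show ?thesis using that P by simp
  qed
  then show ?thesis by simp
 qed
 finally have e2: "eps (- aS P) * (Cw u (Cw y (dl Q)) P / omm P n) =
  of_int (sgn' P) * (\<Sum>R\<in>?V'. (Cw y (dl Q) R / omm R n) * (Cw u (dl R) P / omm P n))" .
 let ?d = "\<lambda>R. (if R = PT y \<and> Q = QT y then 1 else 0) * (if P = PT u \<and> R = QT u then 1 else (0 :: int))"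
 have t: "tends (eps (- aS P) * (Cw u (Cw y (dl Q)) P / omm P n)) (sgn' P * (\<Sum>R\<in>?V'. ?d R))"
  unfolding e2 using leads_Cw u y P Q unfolding leads_def by (intro lim_mult lim_sum lim_of_int) auto
 have "(\<Sum>R\<in>?V'. ?d R) = (\<Sum>R\<in>?V'. if R = PT y then (if P = PT u \<and> Q = QT y \<and> QT u = PT y then 1 else 0) else 0)"
  by (rule sum.cong) auto
 also have "\<dots> = (if P = PT u \<and> Q = QT y \<and> QT u = PT y then 1 else 0)"
  using finV' PT_QT[OF u] by (auto simp: sum.delta)
 finally show ?thesis using t by simp
qed

end

section \<open>Structure constants of the Kazhdan-Lusztig basis and the a-function\<close>

context hecke_B
begin

definition block :: "(int => int) => (int => int) set" where
 "block z = {w \<in> W n. shp (PT w) = shp (PT z)}"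

lemma block_W: "block z \<subseteq> W n" by (auto simp: block_def)

lemma block_self: "z \<in> W n ==> z \<in> block z" by (simp add: block_def)

text \<open>By \<open>Cw_support\<close>, rows in the block of \<open>z\<close> see only those
  \<open>Cw v\<close> whose shape is that of \<open>z\<close> or lies below it. The lower shapes are
  moved to the right-hand side, to be treated by induction.\<close>

lemma block_sum:
 assumes u: "u \<in> W n" and y: "y \<in> W n" and z: "z \<in> W n" and w: "w \<in> block z"
 shows "(\<Sum>v\<in>block z. to_fract (h_coeff n L u y v) * Cw v X (PT w)) = Cw u (Cw y X) (PT w) -
  (\<Sum>v\<in>{v \<in> W n. higher (PT z) (PT v)}. to_fract (h_coeff n L u y v) * Cw v X (PT w))"
proof -
 let ?t = "\<lambda>v. to_fract (h_coeff n L u y v) * Cw v X (PT w)" and ?H = "{v \<in> W n. higher (PT z) (PT v)}"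
 have wW: "w \<in> W n" and sw: "shp (PT w) = shp (PT z)" using w by (auto simp: block_def)
 have vw: "valid (PT w)" using PT_QT(1)[OF wW] .
 have hr: "higher (PT z) P \<longleftrightarrow> higher (PT w) P" if "valid (PT z)" for P
  using higher_shape[OF vw that sw] by (simp add: higher_def)
 show ?thesis
 proof (cases "valid (PT z)")
  case vz: True
  have disj: "block z \<inter> ?H = {}"
  proof (rule equals0I)
   fix v assume v: "v \<in> block z \<inter> ?H"
   then have "valid (PT v)" "shp (PT v) = shp (PT z)" using PT_QT(1) by (auto simp: block_def)
   from higher_shape[OF this(1) vz this(2)] show False using v by (simp add: higher_def)
  qed
  have "Cw u (Cw y X) (PT w) = (\<Sum>v\<in>W n. ?t v)" by (rule h_coeff(1)[OF u y])
  also have "\<dots> = (\<Sum>v\<in>block z \<union> ?H. ?t v)"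
  proof (rule sum.mono_neutral_right[OF finite_W])
   show "\<forall>v\<in>W n - (block z \<union> ?H). ?t v = 0"
   proof
    fix v assume v: "v \<in> W n - (block z \<union> ?H)"
    have "Cw v X (PT w) = 0"
    proof (rule ccontr)
     assume "Cw v X (PT w) ~= 0"
     from Cw_support[OF _ vw this] have "shp (PT w) = shp (PT v) \<or> higher (PT w) (PT v)" using v by blast
     then show False using v sw hr[OF vz] by (auto simp: block_def)
    qed
    then show "?t v = 0" by simp
   qed
  qed (auto simp: block_def)
  also have "\<dots> = (\<Sum>v\<in>block z. ?t v) + (\<Sum>v\<in>?H. ?t v)"
   by (rule sum.union_disjoint[OF _ _ disj]) (use finite_W in \<open>auto simp: block_def\<close>)
  finally show ?thesis by simp
 qed (use PT_QT(1)[OF z] in blast)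
qed

text \<open>Induction from the lowest shapes upwards. \<open>Cw u\<close> vanishes on the rows in
  the block of \<open>z\<close>, hence so does the part of the expansion coming from this block, and
  \<open>leading_terms\<close> leaves no coefficient.\<close>

lemma h_coeff_vanish:
 assumes u: "u \<in> W n" and y: "y \<in> W n"
 shows "z \<in> W n ==> shp (PT z) ~= shp (PT u) ==> \<not> higher (PT z) (PT u) ==> h_coeff n L u y z = 0"
proof (induction "nat (rk (PT z) - Min (rk ` {Q. valid Q}))" arbitrary: z rule: less_induct)
 case less
 note z = less.prems(1)
 have vz: "valid (PT z)" using PT_QT(1)[OF z] .
 let ?H = "{v \<in> W n. higher (PT z) (PT v)}"
 have hv: "h_coeff n L u y v = 0" if v: "v \<in> ?H" for v
 proof (rule less.hyps)
  have vW: "v \<in> W n" and hi: "higher (PT z) (PT v)" using v by auto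
  have vv: "valid (PT v)" using PT_QT(1)[OF vW] .
  have "Min (rk ` {Q. valid Q}) \<le> rk (PT v)" using vv by (intro Min_le finite_imageI finite_valid) blast
  then show "nat (rk (PT v) - Min (rk ` {Q. valid Q})) < nat (rk (PT z) - Min (rk ` {Q. valid Q}))"
   using hi by (simp add: higher_def)
  show "v \<in> W n" by fact
  show "shp (PT v) ~= shp (PT u)"
   using higher_shape[OF vv PT_QT(1)[OF u]] hi less.prems(3) by (auto simp: higher_def)
  show "\<not> higher (PT v) (PT u)" using higher_trans hi less.prems(3) by blast
 qed
 have zero: "(\<Sum>v\<in>block z. to_fract (h_coeff n L u y v) * Cw v X (PT w)) = 0" if w: "w \<in> block z" for w X
 proof -
  have wW: "w \<in> W n" and sw: "shp (PT w) = shp (PT z)" using w by (auto simp: block_def)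
  have vw: "valid (PT w)" using PT_QT(1)[OF wW] .
  have "Cw u (Cw y X) (PT w) = 0"
  proof (rule ccontr)
   assume "Cw u (Cw y X) (PT w) ~= 0"
   from Cw_support[OF u vw this] show False
    using less.prems(2,3) sw higher_shape[OF vw vz sw] by (auto simp: higher_def)
  qed
  moreover have "(\<Sum>v\<in>?H. to_fract (h_coeff n L u y v) * Cw v X (PT w)) = 0" using hv by (intro sum.neutral) simp
  ultimately show ?thesis unfolding block_sum[OF u y z w] by simp
 qed
 show ?case
 proof (rule ccontr)
  assume "h_coeff n L u y z ~= 0"
  then obtain \<gamma> where g: "coef (h_coeff n L u y z) \<gamma> ~= 0"
   by (metis lookup_not_eq_zero_eq_in_keys keys_eq_empty equals0I)
  have "tends (eps (- \<gamma>) * to_fract (h_coeff n L u y z)) 0"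
   by (rule leading_terms[OF leads_Cw block_W _ block_self[OF z], where k = "\<lambda>_. 0"]) (simp add: zero)
  then have "tends (to_fract (ex (- \<gamma>) * h_coeff n L u y z)) 0" by (simp add: eps_def)
  from to_fract_eq_lim[OF this] have "coef (ex (- \<gamma>) * h_coeff n L u y z) 0 = 0" by (simp add: A_neg_coef)
  then show False using g by (simp add: coef_ex_mult)
 qed
qed

text \<open>Coefficients of lower shapes are bounded by induction by their own exponent, which is at
  most that of \<open>z\<close>. So they do not destroy the limits in the block of
  \<open>z\<close>.\<close>

lemma h_coeff_bound:
 assumes u: "u \<in> W n" and y: "y \<in> W n"
 shows "z \<in> W n ==> \<exists>c. tends (eps (- aS (PT z)) * to_fract (h_coeff n L u y z)) c"
proof (induction "nat (rk (PT z) - Min (rk ` {Q. valid Q}))" arbitrary: z rule: less_induct)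
 case less
 note z = less.prems
 have vz: "valid (PT z)" using PT_QT(1)[OF z] .
 let ?H = "{v \<in> W n. higher (PT z) (PT v)}" and ?\<alpha> = "aS (PT z)"
 have hv: "\<exists>c. tends (eps (- ?\<alpha>) * to_fract (h_coeff n L u y v)) c" if v: "v \<in> ?H" for v
 proof -
  have vW: "v \<in> W n" and hi: "higher (PT z) (PT v)" using v by auto
  have "Min (rk ` {Q. valid Q}) \<le> rk (PT v)"
   using PT_QT(1)[OF vW] by (intro Min_le finite_imageI finite_valid) blast
  then have "nat (rk (PT v) - Min (rk ` {Q. valid Q})) < nat (rk (PT z) - Min (rk ` {Q. valid Q}))"
   using hi by (simp add: higher_def)
  from less.hyps[OF this vW] obtain c where c: "tends (eps (- aS (PT v)) * to_fract (h_coeff n L u y v)) c" by blast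
  have "aS (PT v) - ?\<alpha> \<le> 0" using hi by (simp add: higher_def)
  from lim_mult[OF lim_eps_le[OF this] c] have
   "tends ((eps (aS (PT v) - ?\<alpha>) * eps (- aS (PT v))) * to_fract (h_coeff n L u y v))
    ((if aS (PT v) - ?\<alpha> = 0 then 1 else 0) * c)" by (simp only: mult.assoc)
  moreover have "eps (aS (PT v) - ?\<alpha>) * eps (- aS (PT v)) = eps (- ?\<alpha>)" unfolding eps_add[symmetric] by simp
  ultimately show ?thesis by auto
 qed
 have "\<forall>w\<in>block z. \<exists>c. tends (eps (- ?\<alpha>) *
   (\<Sum>v\<in>block z. to_fract (h_coeff n L u y v) * Cw v (dl (QT w)) (PT w)) / omm (PT w) n) c"
 proof
  fix w assume w: "w \<in> block z"
  have wW: "w \<in> W n" and sw: "shp (PT w) = shp (PT z)" using w by (auto simp: block_def)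
  note PQ = PT_QT(1,2,5)[OF wW]
  have "\<forall>v\<in>?H. \<exists>c. tends ((eps (- ?\<alpha>) * to_fract (h_coeff n L u y v)) * (Cw v (dl (QT w)) (PT w) / omm (PT w) n)) c"
  proof
   fix v assume v: "v \<in> ?H"
   then have vW: "v \<in> W n" by simp
   obtain c where "tends (eps (- ?\<alpha>) * to_fract (h_coeff n L u y v)) c" using hv[OF v] ..
   from lim_mult[OF this leadsD[OF leads_Cw vW wW]]
   show "\<exists>c. tends ((eps (- ?\<alpha>) * to_fract (h_coeff n L u y v)) * (Cw v (dl (QT w)) (PT w) / omm (PT w) n)) c" ..
  qed
  from bchoice[OF this] obtain d where
   d: "\<forall>v\<in>?H. tends ((eps (- ?\<alpha>) * to_fract (h_coeff n L u y v)) * (Cw v (dl (QT w)) (PT w) / omm (PT w) n)) (d v)" ..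
  have "tends (eps (- aS (PT w)) * (Cw u (Cw y (dl (QT w))) (PT w) / omm (PT w) n) -
    (\<Sum>v\<in>?H. (eps (- ?\<alpha>) * to_fract (h_coeff n L u y v)) * (Cw v (dl (QT w)) (PT w) / omm (PT w) n)))
   (sgn' (PT w) * (if PT w = PT u \<and> QT w = QT y \<and> QT u = PT y then 1 else 0) - (\<Sum>v\<in>?H. d v))"
   by (intro lim_diff lim_sum product_tends[OF u y PQ]) (use d in blast)
  then show "\<exists>c. tends (eps (- ?\<alpha>) *
   (\<Sum>v\<in>block z. to_fract (h_coeff n L u y v) * Cw v (dl (QT w)) (PT w)) / omm (PT w) n) c"
   unfolding block_sum[OF u y z w] higher_shape(2)[OF PQ(1) vz sw]
   by (intro exI) (simp add: right_diff_distrib diff_divide_distrib sum_distrib_left sum_divide_distrib mult.assoc)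
 qed
 from bchoice[OF this] obtain k where k: "\<forall>w\<in>block z. tends (eps (- ?\<alpha>) *
   (\<Sum>v\<in>block z. to_fract (h_coeff n L u y v) * Cw v (dl (QT w)) (PT w)) / omm (PT w) n) (k w)" ..
 have "tends (eps (- ?\<alpha>) * to_fract (h_coeff n L u y z)) (k z)"
  by (rule leading_terms[OF leads_Cw block_W _ block_self[OF z], where k = k]) (rule k[rule_format])
 then show ?case by blast
qed

text \<open>\<open>u\<close> is chosen with both tableaux equal to \<open>PT z\<close>, so that its
  matrix unit is a left identity for that of \<open>z\<close>. Lower shapes contribute nothing by
  \<open>h_coeff_vanish\<close>.\<close>

lemma h_coeff_leading:
 assumes z: "z \<in> W n" obtains u where "u \<in> W n" "tends (eps (- aS (PT z)) * to_fract (h_coeff n L u z z)) (sgn' (PT z))"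
proof -
 note vz = PT_QT(1)[OF z]
 obtain u where u: "u \<in> W n" "PT u = PT z" "QT u = PT z" using RS_surj[OF vz vz] by blast
 have "tends (eps (- aS (PT z)) * to_fract (h_coeff n L u z z))
   (sgn' (PT z) * (if PT z = PT u \<and> QT z = QT z \<and> QT u = PT z then 1 else 0))"
 proof (rule leading_terms[OF leads_Cw block_W _ block_self[OF z],
   where h = "h_coeff n L u z" and k = "\<lambda>w. sgn' (PT w) * (if PT w = PT u \<and> QT w = QT z \<and> QT u = PT z then 1 else 0)"])
  fix w assume w: "w \<in> block z"
  have wW: "w \<in> W n" and sw: "shp (PT w) = shp (PT z)" using w by (auto simp: block_def)
  note PQ = PT_QT(1,2,5)[OF wW]
  have "(\<Sum>v\<in>{v \<in> W n. higher (PT z) (PT v)}. to_fract (h_coeff n L u z v) * Cw v (dl (QT w)) (PT w)) = 0"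
  proof (rule sum.neutral, rule ballI)
   fix v assume v: "v \<in> {v \<in> W n. higher (PT z) (PT v)}"
   then have vW: "v \<in> W n" and hi: "higher (PT z) (PT v)" by auto
   have "h_coeff n L u z v = 0"
   proof (rule h_coeff_vanish[OF u(1) z vW])
    show "shp (PT v) ~= shp (PT u)"
     using higher_shape[OF PT_QT(1)[OF vW] vz] hi u(2) by (auto simp: higher_def)
    show "\<not> higher (PT v) (PT u)" using hi u(2) by (auto simp: higher_def)
   qed
   then show "to_fract (h_coeff n L u z v) * Cw v (dl (QT w)) (PT w) = 0" by simp
  qed
  then have e: "(\<Sum>v\<in>block z. to_fract (h_coeff n L u z v) * Cw v (dl (QT w)) (PT w)) = Cw u (Cw z (dl (QT w))) (PT w)"
   unfolding block_sum[OF u(1) z z w] by simp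
  show "tends (eps (- aS (PT z)) * (\<Sum>v\<in>block z. to_fract (h_coeff n L u z v) * Cw v (dl (QT w)) (PT w)) / omm (PT w) n)
   (sgn' (PT w) * (if PT w = PT u \<and> QT w = QT z \<and> QT u = PT z then 1 else 0))"
   unfolding e using product_tends[OF u(1) z PQ] higher_shape(2)[OF PQ(1) vz sw] by simp
 qed
 then show ?thesis using that u by simp
qed

theorem a_fun_shape: assumes z: "z \<in> W n" shows "a_fun n L z = aS (PT z)"
 unfolding a_fun_def
proof (rule Least_equality)
 let ?\<alpha> = "aS (PT z)"
 have "ex ?\<alpha> * h_coeff n L u y z \<in> A_nonneg" if u: "u \<in> W n" and y: "y \<in> W n" for u y
 proof -
  obtain c where "tends (to_fract (ex (- ?\<alpha>) * h_coeff n L u y z)) c"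
   using h_coeff_bound[OF u y z] by (auto simp: eps_def)
  from to_fract_eq_lim[OF this] have 0: "coef (ex (- ?\<alpha>) * h_coeff n L u y z) \<gamma> = 0" if "0 < \<gamma>" for \<gamma>
   using that by (simp add: A_neg_coef lookup_minus coef_of_int)
  have "coef (ex ?\<alpha> * h_coeff n L u y z) \<gamma> = 0" if "\<gamma> < 0" for \<gamma>
  proof -
   \<comment> \<open>Bar invariance of the structure constants turns the upper bound on exponents
     into the lower bound asked for by \<open>a_fun\<close>.\<close>
   have "coef (ex ?\<alpha> * h_coeff n L u y z) \<gamma> = coef (A_bar (h_coeff n L u y z)) (\<gamma> - ?\<alpha>)"
    unfolding h_coeff(2)[OF u y z] coef_ex_mult ..
   also have "\<dots> = coef (ex (- ?\<alpha>) * h_coeff n L u y z) (- \<gamma>)"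
    unfolding coef_A_bar coef_ex_mult by (simp add: algebra_simps)
   also have "\<dots> = 0" using 0[of "- \<gamma>"] that by simp
   finally show ?thesis .
  qed
  then show ?thesis by (simp add: A_nonneg_coef)
 qed
 then show "0 \<le> ?\<alpha> \<and> (\<forall>u\<in>W n. \<forall>y\<in>W n. ex ?\<alpha> * h_coeff n L u y z \<in> A_nonneg)"
  using aS_nonneg[OF PT_QT(1)[OF z]] by blast
next
 fix \<gamma> assume g: "0 \<le> \<gamma> \<and> (\<forall>u\<in>W n. \<forall>y\<in>W n. ex \<gamma> * h_coeff n L u y z \<in> A_nonneg)"
 let ?\<alpha> = "aS (PT z)"
 obtain u where u: "u \<in> W n" "tends (eps (- ?\<alpha>) * to_fract (h_coeff n L u z z)) (sgn' (PT z))"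
  using h_coeff_leading[OF z] .
 from u(2) have "tends (to_fract (ex (- ?\<alpha>) * h_coeff n L u z z)) (sgn' (PT z))" by (simp add: eps_def)
 from to_fract_eq_lim[OF this] have "coef (ex (- ?\<alpha>) * h_coeff n L u z z) 0 = sgn' (PT z)"
  by (simp add: A_neg_coef lookup_minus coef_of_int)
 moreover have "sgn' (PT z) ~= 0" using sgn'_sgn'[of "PT z"] by auto
 ultimately have "coef (h_coeff n L u z z) ?\<alpha> ~= 0" by (simp add: coef_ex_mult)
 then have "coef (A_bar (h_coeff n L u z z)) (- ?\<alpha>) ~= 0" by (simp add: coef_A_bar)
 then have "coef (ex \<gamma> * h_coeff n L u z z) (\<gamma> - ?\<alpha>) ~= 0"
  unfolding h_coeff(2)[OF u(1) z z] coef_ex_mult by simp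
 moreover have "ex \<gamma> * h_coeff n L u z z \<in> A_nonneg" using g u(1) z by blast
 ultimately show "?\<alpha> \<le> \<gamma>" unfolding A_nonneg_coef by (metis diff_less_0_iff_less not_le)
qed

end

section \<open>Tableaux as lists of rows\<close>

lemma row_insert_cases:
 assumes "sorted_wrt (<) row" "x \<notin> set row"
 shows "(\<forall>z\<in>set row. z < x) \<and> row_insert x row = (row @ [x], None) \<or>
  (\<exists>row' y. row_insert x row = (row', Some y) \<and> y \<in> set row \<and> x < y \<and> (\<forall>z\<in>set row. x < z --> y \<le> z) \<and>
    set row' = insert x (set row - {y}) \<and> sorted_wrt (<) row')"
 using assms
proof (induction row)
 case (Cons u row)
 show ?case
 proof (cases "x < u")
  case True
  have "u \<notin> set row" using Cons.prems(1) by auto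
  then show ?thesis using True Cons.prems by (intro disjI2 exI[of _ "x # row"] exI[of _ u]) auto
 next
  case False
  then have xu: "u < x" using Cons.prems(2) by auto
  have "sorted_wrt (<) row" "x \<notin> set row" using Cons.prems by auto
  from Cons.IH[OF this] show ?thesis
  proof
   assume "(\<forall>z\<in>set row. z < x) \<and> row_insert x row = (row @ [x], None)"
   then show ?thesis using False xu by auto
  next
   assume "\<exists>row' y. row_insert x row = (row', Some y) \<and> y \<in> set row \<and> x < y \<and> (\<forall>z\<in>set row. x < z --> y \<le> z) \<and>
    set row' = insert x (set row - {y}) \<and> sorted_wrt (<) row'"
   then obtain row' y where r: "row_insert x row = (row', Some y)" "y \<in> set row" "x < y"
    "\<forall>z\<in>set row. x < z --> y \<le> z" "set row' = insert x (set row - {y})" "sorted_wrt (<) row'" by blast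
   then show ?thesis using False xu Cons.prems
    by (intro disjI2 exI[of _ "u # row'"] exI[of _ y]) auto
  qed
 qed
qed simp

text \<open>Relates a list tableau, placed from row \<open>r\<close> of component \<open>e\<close>
  on, to a row map. The offset \<open>r\<close> follows the recursion of \<open>rs_insert\<close>
  into the lower rows.\<close>

definition rows_of :: "bool => nat => tableau => rmap => bool" where
 "rows_of e r A f \<longleftrightarrow> (\<forall>i y. f y = Some (e, r + i) \<longleftrightarrow> i < length A \<and> int y \<in> set (A ! i)) \<and>
   (\<forall>row\<in>set A. sorted_wrt (<) row \<and> (\<forall>z\<in>set row. 0 \<le> z))"

lemma rows_of_Nil: "rows_of e r [] f \<longleftrightarrow> (\<forall>i y. f y ~= Some (e, r + i))"
 by (simp add: rows_of_def)

lemma rows_of_Cons: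
 "rows_of e r (row # A) f \<longleftrightarrow> (\<forall>y. f y = Some (e, r) \<longleftrightarrow> int y \<in> set row) \<and> sorted_wrt (<) row \<and>
   (\<forall>z\<in>set row. 0 \<le> z) \<and> rows_of e (Suc r) A f"
proof -
 have "(\<forall>i. Q i) \<longleftrightarrow> Q 0 \<and> (\<forall>i. Q (Suc i))" for Q :: "nat => bool" using not0_implies_Suc by metis
 note all = this[of "\<lambda>i. \<forall>y. (f y = Some (e, r + i)) = (i < length (row # A) \<and> int y \<in> set ((row # A) ! i))"]
 show ?thesis unfolding rows_of_def all by auto
qed

lemma Ins_keep:
 "Ins e r k f F R ==> k < z ==> e' ~= e \<or> r' < r ==> F z = Some (e', r') \<longleftrightarrow> f z = Some (e', r')"
proof (induction arbitrary: r' rule: Ins.induct)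
 case (step k y f r F R)
 consider "z < y" | "z = y" | "y < z" by linarith
 then show ?case
 proof cases
  case 2
  then show ?thesis using step.hyps(2) Ins_label[OF step.hyps(5)] step.prems by auto
 next
  case 3
  have "e' ~= e \<or> r' < Suc r" using step.prems by auto
  from step.IH[OF 3 this] show ?thesis .
 qed (use step in auto)
qed simp

text \<open>The list recursion follows the steps of \<open>Ins\<close>: in both, the bumped entry is
  the smallest entry of the row that exceeds the inserted one.\<close>

lemma rs_insert_Ins:
 "Ins e r k f F R ==> (\<And>i y. y < k ==> F y = Some (e, r + i) \<longleftrightarrow> f y = Some (e, r + i)) ==>
  (\<And>i. f k ~= Some (e, r + i)) ==> rows_of e r A f ==> rows_of e r (fst (rs_insert (int k) l A B)) F"
proof (induction arbitrary: A B rule: Ins.induct)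
 case (base k f r F)
 have F0: "F y = Some (e, r) \<longleftrightarrow> y = k \<or> f y = Some (e, r)" for y
  using base.hyps base.prems(1)[of y 0] by (cases y k rule: linorder_cases) auto
 have FS: "F y = Some (e, r + Suc i) \<longleftrightarrow> f y = Some (e, r + Suc i)" for y i
  using base.hyps base.prems(1)[of y "Suc i"] base.prems(2)[of "Suc i"] by (cases y k rule: linorder_cases) auto
 have rest: "rows_of e (Suc r) A' F \<longleftrightarrow> rows_of e (Suc r) A' f" for A'
  unfolding rows_of_def using FS by simp
 show ?case
 proof (cases A)
  case Nil
  then have "\<And>i y. f y ~= Some (e, r + i)" using base.prems(3) by (simp add: rows_of_Nil)
  from this[of _ 0] this[of _ "Suc _"] have nf: "\<And>y. f y ~= Some (e, r)" "rows_of e (Suc r) [] f"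
   by (simp_all add: rows_of_Nil)
  then have "rows_of e (Suc r) [] F" unfolding rest by blast
  then show ?thesis using Nil nf(1) by (simp add: rows_of_Cons F0)
 next
  case (Cons row A')
  then have row: "\<And>y. f y = Some (e, r) \<longleftrightarrow> int y \<in> set row" "sorted_wrt (<) row" "\<forall>z\<in>set row. 0 \<le> z"
   "rows_of e (Suc r) A' f" using base.prems(3) by (simp_all add: rows_of_Cons)
  have k: "int k \<notin> set row" using row(1)[of k] base.prems(2)[of 0] by simp
  have lt: "z < int k" if z: "z \<in> set row" for z
  proof -
   have "f (nat z) = Some (e, r)" using row(1)[of "nat z"] row(3) z by simp
   then have "\<not> k < nat z" using base.hyps(1) by blast
   moreover have "z ~= int k" using k z by blast
   ultimately show ?thesis using row(3) z by force
  qed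
  then have "row_insert (int k) row = (row @ [int k], None)" using row_insert_cases[OF row(2) k] by force
  then show ?thesis using Cons row lt by (auto simp: rows_of_Cons F0 rest sorted_wrt_append)
 qed
next
 case (step k y f r F R)
 have fy: "f y = Some (e, r)" using step.hyps(2) .
 obtain row A' where A: "A = row # A'" using step.prems(3) fy by (cases A) (auto simp: rows_of_Nil dest: spec[of _ 0])
 then have row: "\<And>y. f y = Some (e, r) \<longleftrightarrow> int y \<in> set row" "sorted_wrt (<) row" "\<forall>z\<in>set row. 0 \<le> z"
  "rows_of e (Suc r) A' f" using step.prems(3) by (simp_all add: rows_of_Cons)
 have k: "int k \<notin> set row" using row(1)[of k] step.prems(2)[of 0] by simp
 have yr: "int y \<in> set row" using row(1) fy by blast
 then obtain row' y' where r: "row_insert (int k) row = (row', Some y')" "y' \<in> set row" "int k < y'"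
  "\<forall>z\<in>set row. int k < z --> y' \<le> z" "set row' = insert (int k) (set row - {y'})" "sorted_wrt (<) row'"
  using row_insert_cases[OF row(2) k] step.hyps(1) by force
 have y': "y' = int y"
 proof (rule ccontr)
  assume ne: "y' ~= int y"
  have "y' \<le> int y" using r(4) yr step.hyps(1) by simp
  then have "k < nat y'" "nat y' < y" using ne r(3) by auto
  then have "f (nat y') ~= Some (e, r)" using step.hyps(4) by blast
  then show False using row(1)[of "nat y'"] row(3) r(2) by simp
 qed
 have IH: "rows_of e (Suc r) (fst (rs_insert (int y) l A' (tl B))) F"
 proof (rule step.IH[OF _ _ row(4)])
  fix i z assume z: "z < y"
  consider "z < k" | "z = k" | "k < z" by linarith
  then show "F z = Some (e, Suc r + i) \<longleftrightarrow> f z = Some (e, Suc r + i)"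
  proof cases
   case 1 then show ?thesis using step.prems(1)[of z "Suc i"] by simp
  next
   case 2 then show ?thesis using step.hyps(3) step.prems(2)[of "Suc i"] by simp
  next
   case 3 then show ?thesis using step.hyps(4)[OF 3 z] by simp
  qed
 next
  show "f y ~= Some (e, Suc r + i)" for i using fy by simp
 qed
 have F0: "F z = Some (e, r) \<longleftrightarrow> int z \<in> set row'" for z
 proof -
  consider "z < k" | "z = k" | "k < z" "z < y" | "z = y" | "y < z" by linarith
  then show ?thesis
  proof cases
   case 1 then show ?thesis using step.prems(1)[of z 0] row(1)[of z] r(5) y' step.hyps(1) by auto
  next
   case 2 then show ?thesis using step.hyps(3) r(5) by simp
  next
   case 3 then show ?thesis using step.hyps(4)[OF 3] row(1)[of z] r(5) by auto
  next
   case 4 then show ?thesis using Ins_label[OF step.hyps(5)] r(5) y' step.hyps(1) by auto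
  next
   case 5
   then show ?thesis using Ins_keep[OF step.hyps(5) 5, of e r] row(1)[of z] r(5) y' step.hyps(1) by auto
  qed
 qed
 have pos: "\<forall>z\<in>set row'. 0 \<le> z" using r(5) row(3) by auto
 obtain A'' B'' where ins: "rs_insert (int y) l A' (tl B) = (A'', B'')" by fastforce
 have "fst (rs_insert (int k) l A B) = row' # A''" using A r(1) y' ins by simp
 then show ?case using IH ins F0 r(6) pos by (simp add: rows_of_Cons)
qed

definition part_word :: "bool => (int => int) => nat => (int \<times> int) list" where
 "part_word e w m = map (\<lambda>i. (i, \<bar>w i\<bar>)) (filter (\<lambda>i. (0 < w i) = e) [1..int m])"

text \<open>A letter of the other sign leaves component \<open>e\<close> unchanged, so one run of
  \<open>rsP\<close> simulates both list insertions.\<close>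

lemma rs_rows:
 assumes "good_word w m" shows "rows_of e 0 (fst (rs (part_word e w m))) (rsP w m)"
 using assms
proof (induction m)
 case 0
 then show ?case by (simp add: part_word_def rs_def rows_of_Nil)
next
 case (Suc m)
 let ?k = "au w (Suc m)" and ?e = "0 < w (int (Suc m))"
 have gw: "good_word w m" "?k \<notin> au w ` {1..m}" using Suc.prems good_word_Suc by blast+
 note IH = Suc.IH[OF gw(1)]
 note I = rsP_Ins[OF Suc.prems]
 have fk: "rsP w m ?k = None" using rsP_main[OF gw(1)] gw(2) by blast
 have snoc: "[1..int (Suc m)] = [1..int m] @ [int (Suc m)]"
  using upto_rec2[of 1 "int (Suc m)"] by simp
 show ?case
 proof (cases "?e = e")
  case True
  have pw: "part_word e w (Suc m) = part_word e w m @ [(int (Suc m), int ?k)]"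
   unfolding part_word_def snoc using True by simp
  obtain A B where AB: "rs (part_word e w m) = (A, B)" by fastforce
  have "rs (part_word e w (Suc m)) = rs_insert (int ?k) (int (Suc m)) A B"
   unfolding pw using AB by (simp add: rs_def)
  moreover have "rows_of e 0 (fst (rs_insert (int ?k) (int (Suc m)) A B)) (rsP w (Suc m))"
   by (rule rs_insert_Ins[OF I(1)[unfolded True]]) (use I(2) fk IH AB in \<open>auto simp del: rsP.simps\<close>)
  ultimately show ?thesis by simp
 next
  case False
  have pw: "part_word e w (Suc m) = part_word e w m"
   unfolding part_word_def snoc using False by simp
  have "rsP w (Suc m) z = Some (e, i) \<longleftrightarrow> rsP w m z = Some (e, i)" for z i
  proof (cases z ?k rule: linorder_cases)
   case less then show ?thesis using I(2) by simp
  next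
   case equal
   then show ?thesis using fk Ins_label[OF I(1)] False by auto
  next
   case greater
   then show ?thesis using Ins_keep[OF I(1) greater, of e i] False by blast
  qed
  then show ?thesis using IH unfolding pw rows_of_def by (simp del: rsP.simps)
 qed
qed

context asymptotic
begin

lemma cnt_rows:
 assumes w: "w \<in> W n" and A: "rows_of e 0 A (rsP w n)"
 shows "cnt (rsP w n) (e, r) n = (if r < length A then length (A ! r) else 0)"
proof -
 have mem: "rsP w n y = Some (e, i) \<longleftrightarrow> i < length A \<and> int y \<in> set (A ! i)" for i y
  using A by (simp add: rows_of_def)
 have "{y \<in> {1..n}. rsP w n y = Some (e, r)} = {y. rsP w n y = Some (e, r)}"
 proof -
  have "y \<in> {1..n}" if "rsP w n y = Some (e, r)" for y using rsP_W(1)[OF w, of y] that by simp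
  then show ?thesis by auto
 qed
 also have "\<dots> = (if r < length A then nat ` set (A ! r) else {})"
 proof (cases "r < length A")
  case True
  then have pos: "\<forall>z\<in>set (A ! r). 0 \<le> z" using A nth_mem[OF True] unfolding rows_of_def by blast
  have "rsP w n y = Some (e, r) \<longleftrightarrow> int y \<in> set (A ! r)" for y using mem True by simp
  then show ?thesis using True pos by (auto simp: image_iff) (metis nat_int)
 next
  case False
  then show ?thesis using mem by simp
 qed
 finally have e: "cnt (rsP w n) (e, r) n = card (if r < length A then nat ` set (A ! r) else {})" by (simp add: cnt_def)
 show ?thesis
 proof (cases "r < length A")
  case True
  then have row: "sorted_wrt (<) (A ! r)" "\<forall>z\<in>set (A ! r). 0 \<le> z" using A nth_mem[OF True] unfolding rows_of_def by blast+
  have "inj_on nat (set (A ! r))" using row(2) by (intro inj_onI) (metis eq_nat_nat_iff)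
  then have "card (nat ` set (A ! r)) = length (A ! r)"
   using row(1) by (simp add: card_image distinct_card strict_sorted_iff)
  then show ?thesis using e True by simp
 qed (use e in simp)
qed

lemma shp_PT:
 assumes w: "w \<in> W n" and P: "fst (gen_RS n w) = (A1, A2)"
 shows "shp (PT w) = {(e, r, c). c < (if e then if r < length A1 then length (A1 ! r) else 0
   else if r < length A2 then length (A2 ! r) else 0)}"
proof -
 have gw: "good_word w n" using W_good[OF w order_refl] .
 have 1: "map (\<lambda>i. (i, w i)) (filter (\<lambda>i. w i > 0) [1..int n]) = part_word True w n"
  unfolding part_word_def by (rule map_cong) auto
 have 2: "map (\<lambda>j. (j, \<bar>w j\<bar>)) (filter (\<lambda>j. w j < 0) [1..int n]) = part_word False w n"
  unfolding part_word_def using W_eq_0_iff[OF w]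
  by (intro map_cong filter_cong refl) (auto simp: not_less le_less)
 have A: "A1 = fst (rs (part_word True w n))" "A2 = fst (rs (part_word False w n))"
  using P unfolding gen_RS_def 1 2 by (auto simp: Let_def split: prod.splits)
 have r: "rows_of True 0 A1 (rsP w n)" "rows_of False 0 A2 (rsP w n)"
  unfolding A by (rule rs_rows[OF gw])+
 have "cnt (rsP w n) (e, r) n = (if e then if r < length A1 then length (A1 ! r) else 0
   else if r < length A2 then length (A2 ! r) else 0)" for e r
  using cnt_rows[OF w r(1), of r] cnt_rows[OF w r(2), of r] by (cases e) simp_all
 then show ?thesis unfolding shp_eq[OF PT_QT(1)[OF w]] PT_QT(3)[OF w] by simp
qed

section \<open>The exponent of a shape in terms of the two partitions\<close>

lemma zmul_sum: "(\<Sum>i\<in>S. zmul (f i) y) = zmul (\<Sum>i\<in>S. f i) y"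
 by (induction S rule: infinite_finite_induct) (simp_all add: zmul_add)

lemma alpha_sum:
 assumes S: "S = {(e, r, c). c < (if e then if r < length l1 then l1 ! r else 0 else if r < length l2 then l2 ! r else 0)}"
 shows "sum alpha S = zmul (int (sum_list l2)) b +
  zmul (int (n_stat l1) + 2 * int (n_stat (conjugate l2)) - int (n_stat l2)) a"
proof -
 let ?D = "\<lambda>l. SIGMA r:{..<length l}. {..<l ! r}"
 have fin: "finite (?D l)" for l :: "nat list" by (rule finite_SigmaI) auto
 have S': "S = (\<lambda>(r, c). (True, r, c)) ` ?D l1 \<union> (\<lambda>(r, c). (False, r, c)) ` ?D l2"
  unfolding S by (auto split: if_splits simp: image_iff)
 have "sum alpha S = sum alpha ((\<lambda>(r, c). (True, r, c)) ` ?D l1) + sum alpha ((\<lambda>(r, c). (False, r, c)) ` ?D l2)"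
  unfolding S' by (rule sum.union_disjoint) (use fin in auto)
 also have "sum alpha ((\<lambda>(r, c). (True, r, c)) ` ?D l1) = (\<Sum>(r, c)\<in>?D l1. zmul (int r) a)"
  by (subst sum.reindex) (auto simp: inj_on_def alpha_def intro!: sum.cong)
 also have "\<dots> = zmul (int (n_stat l1)) a"
  unfolding case_prod_unfold zmul_sum n_stat_def
  by (subst sum.Sigma[symmetric, where g = "\<lambda>r c. int r", simplified case_prod_unfold]) (auto simp: mult.commute)
 also have "sum alpha ((\<lambda>(r, c). (False, r, c)) ` ?D l2) = (\<Sum>(r, c)\<in>?D l2. zmul 1 b + zmul (2 * int c - int r) a)"
  by (subst sum.reindex) (auto simp: inj_on_def alpha_def intro!: sum.cong)
 also have "\<dots> = zmul (\<Sum>(r, c)\<in>?D l2. 1) b + zmul (\<Sum>(r, c)\<in>?D l2. 2 * int c - int r) a"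
  unfolding case_prod_unfold sum.distrib zmul_sum ..
 also have "(\<Sum>(r, c)\<in>?D l2. 1) = int (sum_list l2)"
  by (subst sum.Sigma[symmetric]) (auto simp: sum_list_sum_nth atLeast0LessThan)
 also have "(\<Sum>(r, c)\<in>?D l2. 2 * int c - int r) = 2 * int (n_stat (conjugate l2)) - int (n_stat l2)"
 proof -
  let ?m = "foldr max l2 0"
  have le: "l2 ! r \<le> ?m" if "r < length l2" for r
  proof -
   have "k \<le> foldr max l 0" if "k \<in> set l" for k and l :: "nat list" using that by (induction l) auto
   then show ?thesis using that by simp
  qed
  \<comment> \<open>Double counting: the length of column \<open>j\<close> is the number of rows
    longer than \<open>j\<close>, so this statistic adds up the column indices of all boxes.\<close>
  have "n_stat (conjugate l2) = (\<Sum>j<?m. \<Sum>r<length l2. if j < l2 ! r then j else 0)"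
   unfolding n_stat_def conjugate_def
   by (auto simp: length_filter_conv_card sum.If_cases Int_def mult.commute conj_commute intro!: sum.cong)
  also have "\<dots> = (\<Sum>r<length l2. \<Sum>j<?m. if j < l2 ! r then j else 0)" by (rule sum.swap)
  also have "\<dots> = (\<Sum>r<length l2. \<Sum>j<l2 ! r. j)"
  proof (rule sum.cong[OF refl])
   fix r assume "r \<in> {..<length l2}"
   then show "(\<Sum>j<?m. if j < l2 ! r then j else 0) = (\<Sum>j<l2 ! r. j)"
    using le[of r] by (intro sum.mono_neutral_cong_right) auto
  qed
  finally have c: "int (n_stat (conjugate l2)) = (\<Sum>r<length l2. \<Sum>j<l2 ! r. int j)" by simp
  have "(\<Sum>(r, c)\<in>?D l2. 2 * int c - int r) = (\<Sum>r<length l2. \<Sum>c<l2 ! r. 2 * int c - int r)"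
   by (subst sum.Sigma) auto
  also have "\<dots> = 2 * int (n_stat (conjugate l2)) - int (n_stat l2)"
   unfolding c by (simp add: n_stat_def sum_subtractf sum_distrib_left mult.commute)
  finally show ?thesis .
 qed
 finally show ?thesis by (simp add: zmul_add[symmetric] algebra_simps)
qed

end

theorem theorem1p2:
  fixes n :: nat
    and a b :: "'g::linordered_ab_group_add"
    and L :: "(int \<Rightarrow> int) \<Rightarrow> 'g"
    and w :: "int \<Rightarrow> int"
    and lam1 lam2 :: "nat list"
    and P Q :: bitableau
  assumes "n \<ge> 2"
    and "b > zmul (int n - 1) a" and "zmul (int n - 1) a > 0"
    and "weight_function n L"
    and "L t_gen = b" and "\<forall>i\<in>{1..n - 1}. L (s_gen i) = a"
    and "w \<in> W n"
    and "is_partition lam1" and "is_partition lam2"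
    and "sum_list lam1 + sum_list lam2 = n"
    and "gen_RS n w = (P, Q)"
    and "standard_bitableau n P" and "bishape P = (lam1, lam2)"
    and "standard_bitableau n Q" and "bishape Q = (lam1, lam2)"
  shows "a_fun n L w =
    zmul (int (sum_list lam2)) b +
    zmul (int (n_stat lam1) + 2 * int (n_stat (conjugate lam2)) - int (n_stat lam2)) a"
proof -
 have a: "0 < a"
 proof (rule ccontr)
  assume "\<not> 0 < a"
  then have "(\<Sum>i<nat (int n - 1). a) \<le> (\<Sum>i<nat (int n - 1). 0)" by (intro sum_mono) simp
  then have "zmul (int n - 1) a \<le> 0" using assms(1) by (simp add: zmul_def)
  then show False using assms(3) by simp
 qed
 interpret hecke_B n a b L
 proof unfold_locales
  show "0 < n" using assms(1) by simp
  show "0 < a" by fact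
  show "zmul (int n - 1) a < b" by fact
  show "L (gen j) = (if j = 0 then b else a)" if "j < n" for j
   using that assms(5,6) by (auto simp: gen_def)
 qed
 obtain A1 A2 where A: "P = (A1, A2)" by (cases P)
 have l: "lam1 = map length A1" "lam2 = map length A2" using assms(13) A by (auto simp: bishape_def shape_def)
 have "shp (PT w) = {(e, r, c). c < (if e then if r < length A1 then length (A1 ! r) else 0
   else if r < length A2 then length (A2 ! r) else 0)}"
  using shp_PT[OF assms(7), of A1 A2] assms(11) A by simp
 also have "\<dots> = {(e, r, c). c < (if e then if r < length lam1 then lam1 ! r else 0
   else if r < length lam2 then lam2 ! r else 0)}"
  unfolding l by (auto split: if_splits)
 finally have "sum alpha (shp (PT w)) = zmul (int (sum_list lam2)) b +
  zmul (int (n_stat lam1) + 2 * int (n_stat (conjugate lam2)) - int (n_stat lam2)) a"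
  by (rule alpha_sum)
 then show ?thesis unfolding a_fun_shape[OF assms(7)] aS_def sum_shape[OF PT_QT(1)[OF assms(7)]] .
qed

end
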